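(* Let $\lambda(t)$ be an analytic (possibly multivalued) function of $t$ which is not identically equal to $0$, $1$ or $t$, and let $A(\lambda)\subset\mathbb{C}^4$ be the set of all $\alpha=(\alpha_0,\alpha_1,\alpha_2,\alpha_3)\in\mathbb{C}^4$ such that $\lambda(t)$ is a solution of the equation $\mathbf{PVI}_\alpha$. Then $A(\lambda)$ contains at least two distinct elements if and only if $\lambda(t)$ is an algebraic function defined by a relation $P(\lambda(t),t)\equiv 0$ with $P$ one of the polynomials in the following list; moreover, in that case $A(\lambda)$ is the set of parameters written next to $P$. Series 1 (here $a_0,b_0\in\mathbb{C}\setminus\{0\}$, $a_0\neq b_0$, are fixed constants and $s$ runs over $\mathbb{C}$): 1A: $P=a_0\lambda^2-b_0t$, $\ \alpha=(sa_0,sb_0,\frac18,\frac18)$; 1B: $P=a_0(\lambda-1)^2+b_0(t-1)$, $\ \alpha=(sa_0,\frac18,sb_0,\frac18)$; 1C: $P=a_0(\lambda-t)^2-b_0t(t-1)$, $\ \alpha=(sa_0,\frac18,\frac18,sb_0)$; 1D: $P=-a_0t(\lambda-1)^2+b_0(t-1)\lambda^2$, $\ \alpha=(\frac18,sa_0,sb_0,\frac18)$; 1E: $P=a_0(\lambda-t)^2+b_0(t-1)\lambda^2$, $\ \alpha=(\frac18,sa_0,\frac18,sb_0)$; 1F: $P=a_0(\lambda-t)^2-b_0t(\lambda-1)^2$, $\ \alpha=(\frac18,\frac18,sa_0,sb_0)$. Series 2 ($a,b$ run over $\mathbb{C}$): 2A: $P=\lambda^2-t$, $\ \alpha=(a,a,b,b)$;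 2B: $P=\lambda^2-2\lambda+t$, $\ \alpha=(a,b,a,b)$; 2C: $P=\lambda^2-2\lambda t+t$, $\ \alpha=(b,a,a,b)$. Series 3 ($a$ runs over $\mathbb{C}$): 3A: $P=\lambda^4-6\lambda^2t+4\lambda t+4\lambda t^2-3t^2$, $\ \alpha=(a,9a,a,a)$; 3B: $P=3\lambda^4-4\lambda^3-4\lambda^3t+6\lambda^2t-t^2$, $\ \alpha=(9a,a,a,a)$; 3C: $P=\lambda^4-4\lambda^3+6t\lambda^2-4t^2\lambda+t^2$, $\ \alpha=(a,a,9a,a)$; 3D: $P=\lambda^4-4t\lambda^3+6t\lambda^2-4t\lambda+t^2$, $\ \alpha=(a,a,a,9a)$. Series 4 ($a$ runs over $\mathbb{C}$): 4A: $P=\lambda^4-2t\lambda^3-2\lambda^3+6t\lambda^2-2t^2\lambda-2t\lambda+t^3-t^2+t$, $\ \alpha=(a,\frac18,a,a)$; 4B: $P=\lambda^4-2t\lambda^3+2t^2\lambda-t^3$, $\ \alpha=(a,a,\frac18,a)$; 4C: $P=\lambda^4(t^2-t+1)-2\lambda^3t(t+1)+6t^2\lambda^2-2\lambda t^2(t+1)+t^3$, $\ \alpha=(\frac18,a,a,a)$; 4D: $P=\lambda^4-2\lambda^3+2t\lambda-t$, $\ \alpha=(a,a,a,\frac18)$. Series 5 ($a$ runs over $\mathbb{C}$): 5A: $P=-2\lambda^3+3t\lambda^2+3\lambda^2-6t\lambda+t^2+t$, $\ \alpha=(4a,\frac1{18},a,a)$; 5B: $P=\lambda^3-3\lambda^2+3t\lambda-2t^2+t$,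 $\ \alpha=(a,\frac1{18},4a,a)$; 5C: $P=\lambda^3-3t\lambda^2+3t\lambda+t^2-2t$, $\ \alpha=(a,\frac1{18},a,4a)$; 5D: $P=2\lambda^3-3t\lambda^2+t^2$, $\ \alpha=(4a,a,\frac1{18},a)$; 5E: $P=\lambda^3-3t\lambda+2t^2$, $\ \alpha=(a,4a,\frac1{18},a)$; 5F: $P=\lambda^3-3t\lambda^2+3t\lambda-t^2$, $\ \alpha=(a,a,\frac1{18},4a)$; 5G: $P=\lambda^3(2-t)-3t\lambda^2+3t^2\lambda-t^2$, $\ \alpha=(\frac1{18},a,4a,a)$; 5H: $P=\lambda^3(t+1)-6t\lambda^2+3t(t+1)\lambda-2t^2$, $\ \alpha=(\frac1{18},4a,a,a)$; 5I: $P=(1-2t)\lambda^3+3t\lambda^2-3t\lambda+t^2$, $\ \alpha=(\frac1{18},a,a,4a)$; 5J: $P=\lambda^3-3\lambda^2+3t\lambda-t$, $\ \alpha=(a,a,4a,\frac1{18})$; 5K: $P=\lambda^3-3t\lambda+2t$, $\ \alpha=(a,4a,a,\frac1{18})$; 5L: $P=2\lambda^3-3\lambda^2+t$, $\ \alpha=(4a,a,a,\frac1{18})$.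
   Context: For $\alpha=(\alpha_0,\alpha_1,\alpha_2,\alpha_3)\in\mathbb{C}^4$, $\mathbf{PVI}_\alpha$ denotes the Painlevé VI equation $$\frac{d^2\lambda}{dt^2}=\frac12\Big(\frac1\lambda+\frac1{\lambda-1}+\frac1{\lambda-t}\Big)\Big(\frac{d\lambda}{dt}\Big)^2-\Big(\frac1t+\frac1{t-1}+\frac1{\lambda-t}\Big)\frac{d\lambda}{dt}+\frac{\lambda(\lambda-1)(\lambda-t)}{t^2(t-1)^2}\Big[\alpha_0-\alpha_1\frac{t}{\lambda^2}+\alpha_2\frac{t-1}{(\lambda-1)^2}+\Big(\frac12-\alpha_3\Big)\frac{t(t-1)}{(\lambda-t)^2}\Big].$$ The functions $0,1,t$ are by convention not considered as solutions. The set $A(\lambda)$ is always an affine subspace of $\mathbb{C}^4$ (if nonempty); when it contains at least two points, the set of equations $\mathbf{PVI}_\alpha$, $\alpha\in A(\lambda)$, is called a family of Painlevé VI equations having a common solution. Each polynomial $P$ in the list is used to define an algebraic function $\lambda(t)$ (any of its branches).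
   Formalization: The formal theorem also assumes that λ is none of c, ct, 1+c(t−1), nor given by (λ−1)t=cλ(t−1), c constant; such λ (other than 0, 1, t) solve a line of PVI equations but are not in the list, e.g. λ≡c solves PVI for all α=(s,sc²,s(c−1)²,1/2). *)

theory Defs
  imports "HOL-Analysis.Analysis"
begin

(* Multivalued analytic functions in the sense of Weierstrass (Ahlfors: "global analytic
   function"): a nonempty collection of function elements (f, U), any two of which are joined by a
   chain of direct analytic continuations inside the collection. The collection need not be
   closed under continuation, so a single branch {(f, U)} is an instance. *)

type_synonym function_element = "(complex \<Rightarrow> complex) \<times> complex set"

definition is_function_element :: "function_element \<Rightarrow> bool" where
  "is_function_element =
    (\<lambda>(f, U). open U \<and> connected U \<and> U \<noteq> {} \<and> f holomorphic_on U)"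

definition direct_continuation :: "function_element \<Rightarrow> function_element \<Rightarrow> bool" where
  "direct_continuation = (\<lambda>(f, U) (g, V). U \<inter> V \<noteq> {} \<and> (\<forall>t \<in> U \<inter> V. f t = g t))"

definition analytic_function :: "function_element set \<Rightarrow> bool" where
  "analytic_function F \<longleftrightarrow>
     F \<noteq> {} \<and> (\<forall>d \<in> F. is_function_element d) \<and>
     (\<forall>d \<in> F. \<forall>e \<in> F. (d, e) \<in> {(x, y). x \<in> F \<and> y \<in> F \<and> direct_continuation x y}\<^sup>*)"

definition satisfies_relation ::
  "(complex \<Rightarrow> complex \<Rightarrow> complex) \<Rightarrow> function_element set \<Rightarrow> bool" where
  "satisfies_relation P F \<longleftrightarrow> (\<forall>(f, U) \<in> F. \<forall>t \<in> U. P (f t) t = 0)"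

definition identically :: "function_element set \<Rightarrow> (complex \<Rightarrow> complex) \<Rightarrow> bool" where
  "identically F g \<longleftrightarrow> (\<forall>(f, U) \<in> F. \<forall>t \<in> U. f t = g t)"

type_synonym parameters = "complex \<times> complex \<times> complex \<times> complex"

(* PVI_rhs alpha t x p: right-hand side of the Painleve VI equation with lambda = x and
   d lambda / d t = p. *)
definition PVI_rhs :: "parameters \<Rightarrow> complex \<Rightarrow> complex \<Rightarrow> complex \<Rightarrow> complex" where
  "PVI_rhs = (\<lambda>(\<alpha>0, \<alpha>1, \<alpha>2, \<alpha>3) t x p.
     1 / 2 * (1 / x + 1 / (x - 1) + 1 / (x - t)) * p\<^sup>2
     - (1 / t + 1 / (t - 1) + 1 / (x - t)) * p
     + x * (x - 1) * (x - t) / (t\<^sup>2 * (t - 1)\<^sup>2) *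
       (\<alpha>0 - \<alpha>1 * (t / x\<^sup>2) + \<alpha>2 * ((t - 1) / (x - 1)\<^sup>2)
         + (1 / 2 - \<alpha>3) * (t * (t - 1) / (x - t)\<^sup>2)))"

(* The equation is required wherever no denominator in it vanishes. As the functions 0, 1, t are
   not solutions by convention, the omitted points are isolated in the domain of each element. *)
definition PVI_solution :: "parameters \<Rightarrow> function_element set \<Rightarrow> bool" where
  "PVI_solution \<alpha> F \<longleftrightarrow>
     \<not> identically F (\<lambda>t. 0) \<and> \<not> identically F (\<lambda>t. 1) \<and> \<not> identically F (\<lambda>t. t) \<and>
     (\<forall>(f, U) \<in> F. \<forall>t \<in> U. t \<noteq> 0 \<and> t \<noteq> 1 \<and> f t \<noteq> 0 \<and> f t \<noteq> 1 \<and> f t \<noteq> t \<longrightarrow>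
        deriv (deriv f) t = PVI_rhs \<alpha> t (f t) (deriv f t))"

definition PVI_parameters :: "function_element set \<Rightarrow> parameters set" where
  "PVI_parameters F = {\<alpha>. PVI_solution \<alpha> F}"

(* PVI_family P S: the polynomial P(lambda, t), given as a function of x = lambda and t, occurs in
   the classification with the set S of parameters. *)
inductive PVI_family :: "(complex \<Rightarrow> complex \<Rightarrow> complex) \<Rightarrow> parameters set \<Rightarrow> bool" where
  f1A: "a0 \<noteq> 0 \<Longrightarrow> b0 \<noteq> 0 \<Longrightarrow> a0 \<noteq> b0 \<Longrightarrow>
    PVI_family (\<lambda>x t. a0 * x^2 - b0 * t) {(s * a0, s * b0, 1/8, 1/8) | s. True}"
| f1B: "a0 \<noteq> 0 \<Longrightarrow> b0 \<noteq> 0 \<Longrightarrow> a0 \<noteq> b0 \<Longrightarrow>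
    PVI_family (\<lambda>x t. a0 * (x - 1)^2 + b0 * (t - 1)) {(s * a0, 1/8, s * b0, 1/8) | s. True}"
| f1C: "a0 \<noteq> 0 \<Longrightarrow> b0 \<noteq> 0 \<Longrightarrow> a0 \<noteq> b0 \<Longrightarrow>
    PVI_family (\<lambda>x t. a0 * (x - t)^2 - b0 * t * (t - 1)) {(s * a0, 1/8, 1/8, s * b0) | s. True}"
| f1D: "a0 \<noteq> 0 \<Longrightarrow> b0 \<noteq> 0 \<Longrightarrow> a0 \<noteq> b0 \<Longrightarrow>
    PVI_family (\<lambda>x t. - a0 * t * (x - 1)^2 + b0 * (t - 1) * x^2)
      {(1/8, s * a0, s * b0, 1/8) | s. True}"
| f1E: "a0 \<noteq> 0 \<Longrightarrow> b0 \<noteq> 0 \<Longrightarrow> a0 \<noteq> b0 \<Longrightarrow>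
    PVI_family (\<lambda>x t. a0 * (x - t)^2 + b0 * (t - 1) * x^2) {(1/8, s * a0, 1/8, s * b0) | s. True}"
| f1F: "a0 \<noteq> 0 \<Longrightarrow> b0 \<noteq> 0 \<Longrightarrow> a0 \<noteq> b0 \<Longrightarrow>
    PVI_family (\<lambda>x t. a0 * (x - t)^2 - b0 * t * (x - 1)^2) {(1/8, 1/8, s * a0, s * b0) | s. True}"

| f2A: "PVI_family (\<lambda>x t. x^2 - t) {(a, a, b, b) | a b. True}"
| f2B: "PVI_family (\<lambda>x t. x^2 - 2 * x + t) {(a, b, a, b) | a b. True}"
| f2C: "PVI_family (\<lambda>x t. x^2 - 2 * x * t + t) {(b, a, a, b) | a b. True}"

| f3A: "PVI_family (\<lambda>x t. x^4 - 6 * x^2 * t + 4 * x * t + 4 * x * t^2 - 3 * t^2)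
    {(a, 9 * a, a, a) | a. True}"
| f3B: "PVI_family (\<lambda>x t. 3 * x^4 - 4 * x^3 - 4 * x^3 * t + 6 * x^2 * t - t^2)
    {(9 * a, a, a, a) | a. True}"
| f3C: "PVI_family (\<lambda>x t. x^4 - 4 * x^3 + 6 * t * x^2 - 4 * t^2 * x + t^2)
    {(a, a, 9 * a, a) | a. True}"
| f3D: "PVI_family (\<lambda>x t. x^4 - 4 * t * x^3 + 6 * t * x^2 - 4 * t * x + t^2)
    {(a, a, a, 9 * a) | a. True}"

| f4A: "PVI_family (\<lambda>x t. x^4 - 2 * t * x^3 - 2 * x^3 + 6 * t * x^2 - 2 * t^2 * x - 2 * t * x
      + t^3 - t^2 + t)
    {(a, 1/8, a, a) | a. True}"
| f4B: "PVI_family (\<lambda>x t. x^4 - 2 * t * x^3 + 2 * t^2 * x - t^3) {(a, a, 1/8, a) | a. True}"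
| f4C: "PVI_family (\<lambda>x t. x^4 * (t^2 - t + 1) - 2 * x^3 * t * (t + 1) + 6 * t^2 * x^2
      - 2 * x * t^2 * (t + 1) + t^3)
    {(1/8, a, a, a) | a. True}"
| f4D: "PVI_family (\<lambda>x t. x^4 - 2 * x^3 + 2 * t * x - t) {(a, a, a, 1/8) | a. True}"

| f5A: "PVI_family (\<lambda>x t. - 2 * x^3 + 3 * t * x^2 + 3 * x^2 - 6 * t * x + t^2 + t)
    {(4 * a, 1/18, a, a) | a. True}"
| f5B: "PVI_family (\<lambda>x t. x^3 - 3 * x^2 + 3 * t * x - 2 * t^2 + t) {(a, 1/18, 4 * a, a) | a. True}"
| f5C: "PVI_family (\<lambda>x t. x^3 - 3 * t * x^2 + 3 * t * x + t^2 - 2 * t)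
    {(a, 1/18, a, 4 * a) | a. True}"
| f5D: "PVI_family (\<lambda>x t. 2 * x^3 - 3 * t * x^2 + t^2) {(4 * a, a, 1/18, a) | a. True}"
| f5E: "PVI_family (\<lambda>x t. x^3 - 3 * t * x + 2 * t^2) {(a, 4 * a, 1/18, a) | a. True}"
| f5F: "PVI_family (\<lambda>x t. x^3 - 3 * t * x^2 + 3 * t * x - t^2) {(a, a, 1/18, 4 * a) | a. True}"
| f5G: "PVI_family (\<lambda>x t. x^3 * (2 - t) - 3 * t * x^2 + 3 * t^2 * x - t^2)
    {(1/18, a, 4 * a, a) | a. True}"
| f5H: "PVI_family (\<lambda>x t. x^3 * (t + 1) - 6 * t * x^2 + 3 * t * (t + 1) * x - 2 * t^2)
    {(1/18, 4 * a, a, a) | a. True}"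
| f5I: "PVI_family (\<lambda>x t. (1 - 2 * t) * x^3 + 3 * t * x^2 - 3 * t * x + t^2)
    {(1/18, a, a, 4 * a) | a. True}"
| f5J: "PVI_family (\<lambda>x t. x^3 - 3 * x^2 + 3 * t * x - t) {(a, a, 4 * a, 1/18) | a. True}"
| f5K: "PVI_family (\<lambda>x t. x^3 - 3 * t * x + 2 * t) {(a, 4 * a, a, 1/18) | a. True}"
| f5L: "PVI_family (\<lambda>x t. 2 * x^3 - 3 * x^2 + t) {(4 * a, a, a, 1/18) | a. True}"

(* Four one-parameter families of rational functions, permuted by the symmetries of Painleve VI.
   Apart from 0, 1 and t, each of them solves a line of Painleve VI equations (lemma
   degenerate_solutions), but none of them satisfies a relation in PVI_family. *)
definition degenerate :: "function_element set \<Rightarrow> bool" where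
  "degenerate F \<longleftrightarrow> (\<exists>c.
     satisfies_relation (\<lambda>x t. x - c) F \<or>
     satisfies_relation (\<lambda>x t. x - c * t) F \<or>
     satisfies_relation (\<lambda>x t. (x - 1) - c * (t - 1)) F \<or>
     satisfies_relation (\<lambda>x t. (x - 1) * t - c * x * (t - 1)) F)"

lemma deriv2_eqI:
  assumes "open U" "t \<in> U" "\<And>u. u \<in> U \<Longrightarrow> f u = g u"
    and g: "\<And>u. u \<in> U \<Longrightarrow> (g has_field_derivative g' u) (at u)"
    and g': "\<And>u. u \<in> U \<Longrightarrow> (g' has_field_derivative g'' u) (at u)"
  shows "deriv f t = g' t" and "deriv (deriv f) t = g'' t"
proof -
  have d: "deriv f u = g' u" if "u \<in> U" for u
  proof -
    have "(f has_field_derivative g' u) (at u)"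
      by (rule has_field_derivative_transform_within_open[OF g[OF that] assms(1) that])
         (simp add: assms(3))
    then show ?thesis by (rule DERIV_imp_deriv)
  qed
  then show "deriv f t = g' t" using assms(2) .
  have "(deriv f has_field_derivative g'' t) (at t)"
    by (rule has_field_derivative_transform_within_open[OF g'[OF assms(2)] assms(1,2)])
       (simp add: d)
  then show "deriv (deriv f) t = g'' t" by (rule DERIV_imp_deriv)
qed

lemma degenerate_solutions:
  assumes F: "analytic_function F"
    and nt: "\<not> identically F (\<lambda>t. 0)" "\<not> identically F (\<lambda>t. 1)" "\<not> identically F (\<lambda>t. t)"
  shows "satisfies_relation (\<lambda>x t. x - c) F \<Longrightarrow>
      (s, s * c\<^sup>2, s * (c - 1)\<^sup>2, 1/2) \<in> PVI_parameters F"
    and "satisfies_relation (\<lambda>x t. x - c * t) F \<Longrightarrow>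
      (s, s * c\<^sup>2, 1/2, s * (c - 1)\<^sup>2) \<in> PVI_parameters F"
    and "satisfies_relation (\<lambda>x t. (x - 1) - c * (t - 1)) F \<Longrightarrow>
      (s, 1/2, s * c\<^sup>2, s * (c - 1)\<^sup>2) \<in> PVI_parameters F"
    and "satisfies_relation (\<lambda>x t. (x - 1) * t - c * x * (t - 1)) F \<Longrightarrow>
      (1/2, s, s * c\<^sup>2, s * (c - 1)\<^sup>2) \<in> PVI_parameters F"
proof -
  have op: "open U" if "(f, U) \<in> F" for f U
    using F that by (auto simp: analytic_function_def is_function_element_def)
  have I: "\<alpha> \<in> PVI_parameters F"
    if "\<And>f U t. (f, U) \<in> F \<Longrightarrow> t \<in> U \<Longrightarrow> t \<noteq> 0 \<Longrightarrow> t \<noteq> 1 \<Longrightarrow> f t \<noteq> 0 \<Longrightarrow> f t \<noteq> 1 \<Longrightarrow> f t \<noteq> t \<Longrightarrow>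
      deriv (deriv f) t = PVI_rhs \<alpha> t (f t) (deriv f t)" for \<alpha>
    using that nt by (auto simp: PVI_parameters_def PVI_solution_def)
  have R: "P (f t) t = 0" if "satisfies_relation P F" "(f, U) \<in> F" "t \<in> U" for P f U t
    using that by (auto simp: satisfies_relation_def)
  show "(s, s * c\<^sup>2, s * (c - 1)\<^sup>2, 1/2) \<in> PVI_parameters F"
    if r: "satisfies_relation (\<lambda>x t. x - c) F"
  proof (rule I)
    fix f U t
    assume e: "(f, U) \<in> F" "t \<in> U" and g: "t \<noteq> 0" "t \<noteq> 1" "f t \<noteq> 0" "f t \<noteq> 1" "f t \<noteq> t"
    have v: "f u = c" if "u \<in> U" for u using R[OF r e(1) that] by simp
    have d: "deriv f t = 0" "deriv (deriv f) t = 0"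
      using deriv2_eqI[of U t f "\<lambda>_. c" "\<lambda>_. 0" "\<lambda>_. 0"] op[OF e(1)] e(2) v by auto
    have "s - s * c\<^sup>2 * (t / c\<^sup>2) + s * (c - 1)\<^sup>2 * ((t - 1) / (c - 1)\<^sup>2) = 0"
      using g v[OF e(2)] by (simp add: divide_simps) (simp add: algebra_simps)
    then show "deriv (deriv f) t =
        PVI_rhs (s, s * c\<^sup>2, s * (c - 1)\<^sup>2, 1/2) t (f t) (deriv f t)"
      unfolding d v[OF e(2)] PVI_rhs_def by simp
  qed
  show "(s, s * c\<^sup>2, 1/2, s * (c - 1)\<^sup>2) \<in> PVI_parameters F"
    if r: "satisfies_relation (\<lambda>x t. x - c * t) F"
  proof (rule I)
    fix f U t
    assume e: "(f, U) \<in> F" "t \<in> U" and g: "t \<noteq> 0" "t \<noteq> 1" "f t \<noteq> 0" "f t \<noteq> 1" "f t \<noteq> t"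
    have v: "f u = c * u" if "u \<in> U" for u using R[OF r e(1) that] by simp
    have d: "deriv f t = c" "deriv (deriv f) t = 0"
      using deriv2_eqI[of U t f "\<lambda>u. c * u" "\<lambda>_. c" "\<lambda>_. 0"] op[OF e(1)] e(2) v
      by (auto intro!: derivative_eq_intros)
    define y where "y = c * t - 1"
    define z where "z = c - 1"
    have nz: "c \<noteq> 0" "y \<noteq> 0" "z \<noteq> 0" "t - 1 \<noteq> 0"
      using g v[OF e(2)] by (auto simp: y_def z_def)
    have eq: "c * t - t = z * t" by (simp add: z_def algebra_simps)
    have B: "s - s * c\<^sup>2 * (t / (c * t)\<^sup>2) + 1 / 2 * ((t - 1) / y\<^sup>2)
        + (1 / 2 - s * z\<^sup>2) * (t * (t - 1) / (z * t)\<^sup>2) =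
        (t - 1) / 2 * (1 / y\<^sup>2 + 1 / (z\<^sup>2 * t))"
      using nz g by (simp add: power2_eq_square field_simps)
    have yz: "y = (z + 1) * t - 1" "c = z + 1" by (auto simp: y_def z_def)
    have "1 / 2 * (1 / (c * t) + 1 / y + 1 / (z * t)) * c\<^sup>2
        - (1 / t + 1 / (t - 1) + 1 / (z * t)) * c
        + (c * t) * y * (z * t) / (t\<^sup>2 * (t - 1)\<^sup>2) * ((t - 1) / 2 * (1 / y\<^sup>2 + 1 / (z\<^sup>2 * t))) = 0"
      using nz g(1,2) by (simp add: divide_simps) (simp add: y_def z_def, algebra)
    then show "deriv (deriv f) t =
        PVI_rhs (s, s * c\<^sup>2, 1/2, s * (c - 1)\<^sup>2) t (f t) (deriv f t)"
      unfolding d v[OF e(2)] PVI_rhs_def prod.case eq y_def[symmetric] z_def[symmetric] B by simp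
  qed
  show "(s, 1/2, s * c\<^sup>2, s * (c - 1)\<^sup>2) \<in> PVI_parameters F"
    if r: "satisfies_relation (\<lambda>x t. (x - 1) - c * (t - 1)) F"
  proof (rule I)
    fix f U t
    assume e: "(f, U) \<in> F" "t \<in> U" and g: "t \<noteq> 0" "t \<noteq> 1" "f t \<noteq> 0" "f t \<noteq> 1" "f t \<noteq> t"
    have v: "f u = c * (u - 1) + 1" if "u \<in> U" for u
      using R[OF r e(1) that] by (simp add: algebra_simps)
    have d: "deriv f t = c" "deriv (deriv f) t = 0"
      by (rule deriv2_eqI[of U t f "\<lambda>u. c * (u - 1) + 1" "\<lambda>_. c" "\<lambda>_. 0"],
          use op e v in \<open>auto intro!: derivative_eq_intros\<close>)+
    define w where "w = t - 1"
    define y where "y = c * w + 1"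
    define z where "z = c - 1"
    have nz: "c \<noteq> 0" "y \<noteq> 0" "z \<noteq> 0" "w \<noteq> 0"
      using g v[OF e(2)] by (auto simp: y_def z_def w_def)
    have eq: "f t = y" "y - 1 = c * w" "y - t = z * w"
      using v[OF e(2)] by (auto simp: y_def z_def w_def algebra_simps)
    have B: "s - 1 / 2 * (t / y\<^sup>2) + s * c\<^sup>2 * (w / (c * w)\<^sup>2)
        + (1 / 2 - s * z\<^sup>2) * (t * w / (z * w)\<^sup>2) =
        t / 2 * (1 / (z\<^sup>2 * w) - 1 / y\<^sup>2)"
      using nz g(1) by (simp add: divide_simps) (simp add: y_def z_def w_def, algebra)
    have "1 / 2 * (1 / y + 1 / (c * w) + 1 / (z * w)) * c\<^sup>2
        - (1 / t + 1 / w + 1 / (z * w)) * c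
        + y * (c * w) * (z * w) / (t\<^sup>2 * w\<^sup>2) * (t / 2 * (1 / (z\<^sup>2 * w) - 1 / y\<^sup>2)) = 0"
      using nz g(1) by (simp add: divide_simps) (simp add: y_def z_def w_def, algebra)
    then show "deriv (deriv f) t =
        PVI_rhs (s, 1/2, s * c\<^sup>2, s * (c - 1)\<^sup>2) t (f t) (deriv f t)"
      unfolding d PVI_rhs_def prod.case eq w_def[symmetric] z_def[symmetric] B by simp
  qed
  show "(1/2, s, s * c\<^sup>2, s * (c - 1)\<^sup>2) \<in> PVI_parameters F"
    if r: "satisfies_relation (\<lambda>x t. (x - 1) * t - c * x * (t - 1)) F"
  proof (rule I)
    fix f U t
    assume e: "(f, U) \<in> F" "t \<in> U" and g: "t \<noteq> 0" "t \<noteq> 1" "f t \<noteq> 0" "f t \<noteq> 1" "f t \<noteq> t"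
    have v: "f u = u / (u - c * (u - 1)) \<and> u - c * (u - 1) \<noteq> 0" if "u \<in> U - {0}" for u
    proof -
      have "f u * (u - c * (u - 1)) = u"
        using R[OF r e(1), of u] that by (simp add: algebra_simps)
      then show ?thesis using that by (auto simp: eq_divide_eq)
    qed
    have t: "t \<in> U - {0}" "open (U - {0})" using e g op by auto
    have dd: "((\<lambda>u. u - c * (u - 1)) has_field_derivative 1 - c) (at u)" for u
      by (auto intro!: derivative_eq_intros)
    have d1: "((\<lambda>u. u / (u - c * (u - 1))) has_field_derivative c / (u - c * (u - 1))\<^sup>2) (at u)"
      if "u \<in> U - {0}" for u
    proof -
      have "(1 * (u - c * (u - 1)) - u * (1 - c)) / ((u - c * (u - 1)) * (u - c * (u - 1))) =
          c / (u - c * (u - 1))\<^sup>2"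
        by (simp add: power2_eq_square algebra_simps)
      then show ?thesis
        using DERIV_divide[OF DERIV_ident dd, of u] v[OF that] by auto
    qed
    have d2: "((\<lambda>u. c / (u - c * (u - 1))\<^sup>2) has_field_derivative
        2 * c * (c - 1) / (u - c * (u - 1)) ^ 3) (at u)" if "u \<in> U - {0}" for u
    proof -
      define D where "D = u - c * (u - 1)"
      have D: "D \<noteq> 0" using v[OF that] by (simp add: D_def)
      have A: "(0 * D\<^sup>2 - c * (2 * D * (1 - c))) / (D\<^sup>2 * D\<^sup>2) = 2 * c * (c - 1) / D ^ 3"
        using D by (simp add: divide_simps) algebra
      have B: "((\<lambda>u. (u - c * (u - 1))\<^sup>2) has_field_derivative 2 * D * (1 - c)) (at u)"
        unfolding D_def by (rule derivative_eq_intros dd refl | simp)+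
      have "((\<lambda>u. c / (u - c * (u - 1))\<^sup>2) has_field_derivative
          (0 * D\<^sup>2 - c * (2 * D * (1 - c))) / (D\<^sup>2 * D\<^sup>2)) (at u)"
        by (rule DERIV_divide[OF DERIV_const B, folded D_def]) (simp add: D)
      then show ?thesis unfolding A unfolding D_def .
    qed
    have d: "deriv f t = c / (t - c * (t - 1))\<^sup>2"
        "deriv (deriv f) t = 2 * c * (c - 1) / (t - c * (t - 1)) ^ 3"
      by (rule deriv2_eqI[OF t(2,1) _ d1 d2]; use v in blast)+
    define w where "w = t - 1"
    define y where "y = t - c * w"
    define z where "z = c - 1"
    have y: "f t = t / y" "y \<noteq> 0" using v[OF t(1)] by (auto simp: y_def w_def)
    have eq: "t / y - 1 = c * w / y" "t / y - t = t * z * w / y"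
      using y(2) by (auto simp: y_def z_def w_def field_simps)
    have nz: "c \<noteq> 0" "z \<noteq> 0" "w \<noteq> 0" using g y eq by auto
    have rel: "c = z + 1" "t = w + 1" "y = 1 - z * w"
      by (auto simp: y_def z_def w_def algebra_simps)
    have "s * (t / (t / y)\<^sup>2) = s * y\<^sup>2 / t"
        "s * c\<^sup>2 * (w / (c * w / y)\<^sup>2) = s * y\<^sup>2 / w"
        "(1 / 2 - s * z\<^sup>2) * (t * w / (t * z * w / y)\<^sup>2) =
          y\<^sup>2 / (2 * z\<^sup>2 * t * w) - s * y\<^sup>2 / (t * w)"
      using nz y(2) g(1) by (simp_all add: field_simps power2_eq_square)
    moreover have "s * y\<^sup>2 / w = s * y\<^sup>2 / t + s * y\<^sup>2 / (t * w)"
      using nz(3) g(1) by (simp add: divide_simps) (simp add: rel(2) algebra_simps)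
    ultimately have B: "1 / 2 - s * (t / (t / y)\<^sup>2) + s * c\<^sup>2 * (w / (c * w / y)\<^sup>2)
        + (1 / 2 - s * z\<^sup>2) * (t * w / (t * z * w / y)\<^sup>2) =
        1 / 2 + y\<^sup>2 / (2 * z\<^sup>2 * t * w)" by simp
    have "1 / 2 * (1 / (t / y) + 1 / (c * w / y) + 1 / (t * z * w / y)) * (c / y\<^sup>2)\<^sup>2
        - (1 / t + 1 / w + 1 / (t * z * w / y)) * (c / y\<^sup>2)
        + t / y * (c * w / y) * (t * z * w / y) / (t\<^sup>2 * w\<^sup>2) *
          (1 / 2 + y\<^sup>2 / (2 * z\<^sup>2 * t * w)) = 2 * c * z / y ^ 3" (is "?L = ?R")
    proof -
      have "?L * (2 * t * z * w * y ^ 3) = c * (c * z * w + t * z + c)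
          - 2 * c * y * (z * w + z * t + y) + c * z\<^sup>2 * t * w + c * y\<^sup>2"
        using nz y(2) g(1) by (simp add: divide_simps) algebra
      also have "\<dots> = ?R * (2 * t * z * w * y ^ 3)"
        using y(2) by simp (simp add: rel, algebra)
      finally show ?thesis
        by (rule mult_right_cancel[THEN iffD1, rotated]) (use nz y(2) g(1) in simp)
    qed
    then show "deriv (deriv f) t =
        PVI_rhs (1/2, s, s * c\<^sup>2, s * (c - 1)\<^sup>2) t (f t) (deriv f t)"
      unfolding d PVI_rhs_def prod.case y(1) w_def[symmetric] y_def[symmetric] eq
        z_def[symmetric] B by simp
  qed
qed

end

theory Submission
  imports Defs "HOL-Complex_Analysis.Complex_Analysis" "HOL-Computational_Algebra.Fundamental_Theorem_Algebra"
begin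

text \<open>
If two equations with parameters \<open>\<alpha> \<noteq> \<beta>\<close> share a solution, then subtracting their right-hand sides
shows that the solution lies on the algebraic curve
\<open>g0 - g1 t / x^2 + g2 (t - 1) / (x - 1)^2 - g3 t (t - 1) / (x - t)^2 = 0\<close> with \<open>g = \<beta> - \<alpha>\<close>
(\<open>PVI_rhs_diff\<close>, \<open>solves_difference\<close>). So a common solution is algebraic, and the problem is to
decide which branches of which of these curves solve a Painleve VI equation.

The decisive local fact is \<open>no_critical_point\<close>: along a parametrized solution \<open>s \<mapsto> (x(s), t(s))\<close> the
equation reads \<open>x' t'' = h t'\<close> with \<open>h\<close> holomorphic as long as \<open>x, t\<close> avoid the denominators. If
\<open>t'\<close> vanished at a point where \<open>x' \<noteq> 0\<close>, then \<open>t'\<close> would vanish identically by uniqueness for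
linear equations. Hence a component that carries a solution is unramified over the \<open>t\<close>-line at all its
smooth points that avoid the denominators.

This excludes almost all \<open>g\<close>. The curve can be singular only if suitable square roots \<open>h\<close> of the
\<open>g\<close> satisfy \<open>h0 + h1 + h2 + h3 = 0\<close> (\<open>singular_point_square_relation\<close>, \<open>square_relation\<close>).

\<^item> If all \<open>g\<close> are nonzero and there are no such square roots, the points that carry a solution form a
finite covering of the plane without \<open>0\<close> and \<open>1\<close> (\<open>solution_points_covering\<close>). The functions
\<open>1 / (x R_x)\<close> and \<open>1 / ((x - 1) R_x)\<close>, with \<open>R\<close> the left-hand side above, are holomorphic on this
covering because it is unramified, and an asymptotic analysis of \<open>R_x\<close> shows that they are bounded
near \<open>0, 1, \<infinity>\<close>. By Liouville both are constant, so \<open>x\<close> is constant (\<open>smooth_curve_constant\<close>): the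
solution is degenerate.

\<^item> If all \<open>g\<close> are nonzero and there are such square roots, the equation splits into a quadratic and a
quartic factor, both rational curves. On a rational curve \<open>no_critical_point\<close> becomes a statement
on the zeros of one explicit polynomial (\<open>no_critical_parameter\<close>), which leaves the relations \<open>f2A\<close>
to \<open>f2C\<close> from the quadratic factor (\<open>quadratic_branch\<close>) and the relations \<open>f3A\<close> to \<open>f3D\<close> from the
quartic one (\<open>conic_branch\<close>).

\<^item> If exactly one \<open>g\<close> vanishes, \<open>t\<close> is a rational function of \<open>x\<close>, or becomes one after a symmetry,
and the same argument leaves \<open>f4A\<close> to \<open>f4D\<close> and \<open>f5A\<close> to \<open>f5L\<close> (\<open>one_zero_branch\<close>).

\<^item> If two \<open>g\<close> vanish, the equation of the curve is \<open>f1A\<close> to \<open>f1F\<close>, or \<open>f2A\<close> to \<open>f2C\<close> when the two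
others are equal.

The group generated by \<open>(x, t) \<mapsto> (1/x, 1/t), (1 - x, 1 - t), (x/t, 1/t)\<close> permutes the four
parameters (\<open>solves_flip\<close>). It reduces each case above to a normal form.

Conversely, one representative of each orbit of listed families is checked by substituting a
rational parametrization (\<open>solution_parameters\<close>): one parameter solves the equation, and another one
solves it exactly when the difference vanishes identically on the curve, which is a finite set
of linear equations. The symmetries carry this to all families (\<open>PVI_family_correct\<close>). Finally, the identity
theorem propagates relations between germs along analytic continuations (\<open>relation_propagates\<close>).
\<close>

section \<open>Two tools from complex analysis\<close>

text \<open>
The inverse function theorem for \<open>(x, t) \<mapsto> (F x t, t)\<close> over the reals. Its derivative is
complex linear, hence so is the derivative of the local solution, which is therefore holomorphic.
\<close>
lemma holomorphic_implicit_function: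
  fixes F Fx Ft :: "complex \<Rightarrow> complex \<Rightarrow> complex"
  assumes W: "open W" "(x0, t0) \<in> W"
    and der: "\<And>x t. (x, t) \<in> W \<Longrightarrow>
      ((\<lambda>z. F (fst z) (snd z)) has_derivative (\<lambda>z. Fx x t * fst z + Ft x t * snd z)) (at (x, t))"
    and contx: "continuous_on W (\<lambda>z. Fx (fst z) (snd z))"
    and contt: "continuous_on W (\<lambda>z. Ft (fst z) (snd z))"
    and zero: "F x0 t0 = 0" and nz: "Fx x0 t0 \<noteq> 0"
  obtains r \<rho> g where "r > 0" "\<rho> > 0" "ball x0 r \<times> ball t0 \<rho> \<subseteq> W" "g holomorphic_on ball t0 \<rho>"
    "\<And>t. t \<in> ball t0 \<rho> \<Longrightarrow> g t \<in> ball x0 r"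
    "\<And>x t. x \<in> ball x0 r \<Longrightarrow> t \<in> ball t0 \<rho> \<Longrightarrow> F x t = 0 \<longleftrightarrow> x = g t"
proof -
  define U where "U = W \<inter> ((\<lambda>z. Fx (fst z) (snd z)) -` (- {0}))"
  have openU: "open U"
    unfolding U_def by (rule continuous_open_preimage[OF contx W(1)]) auto
  have U0: "(x0, t0) \<in> U" using W nz by (auto simp: U_def)
  define G where "G z = (F (fst z) (snd z), snd z)" for z
  define L where "L z w = (Fx (fst z) (snd z) * fst w + Ft (fst z) (snd z) * snd w, snd w)"
    for z w :: "complex \<times> complex"
  have blL: "bounded_linear (L z)" for z
    unfolding L_def
    by (intro bounded_linear_Pair bounded_linear_add bounded_linear_mult_right[THEN bounded_linear_compose]
        bounded_linear_fst bounded_linear_snd)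
  have apL: "blinfun_apply (Blinfun (L z)) = L z" for z
    by (rule bounded_linear_Blinfun_apply[OF blL])
  have derG: "(G has_derivative blinfun_apply (Blinfun (L z))) (at z)" if "z \<in> U" for z
  proof -
    obtain x t where z: "z = (x, t)" by (cases z)
    have "(x, t) \<in> W" using that z by (auto simp: U_def)
    from der[OF this] show ?thesis
      unfolding apL G_def L_def z fst_conv snd_conv
      by (intro has_derivative_Pair has_derivative_snd has_derivative_ident)
  qed
  have contL: "continuous_on U (\<lambda>z. Blinfun (L z))"
  proof (rule continuous_on_blinfun_componentwise)
    fix i :: "complex \<times> complex"
    have "U \<subseteq> W" by (auto simp: U_def)
    then show "continuous_on U (\<lambda>z. blinfun_apply (Blinfun (L z)) i)"
      unfolding apL L_def
      by (intro continuous_intros continuous_on_subset[OF contx] continuous_on_subset[OF contt])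
  qed
  define K where "K w = ((fst w - Ft x0 t0 * snd w) / Fx x0 t0, snd w)" for w :: "complex \<times> complex"
  have blK: "bounded_linear K"
    unfolding K_def divide_inverse
    by (intro bounded_linear_Pair bounded_linear_sub bounded_linear_mult_right[THEN bounded_linear_compose]
        bounded_linear_mult_left[THEN bounded_linear_compose] bounded_linear_fst bounded_linear_snd)
  have inv: "Blinfun K o\<^sub>L Blinfun (L (x0, t0)) = id_blinfun"
    by (rule blinfun_eqI)
       (use nz in \<open>auto simp: bounded_linear_Blinfun_apply[OF blK] apL K_def L_def\<close>)
  obtain U' V h h' where h: "open U'" "U' \<subseteq> U" "(x0, t0) \<in> U'" "open V" "G (x0, t0) \<in> V"
      "homeomorphism U' V G h" "\<And>y. y \<in> V \<Longrightarrow> (h has_derivative h' y) (at y)"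
    using inverse_function_theorem[OF openU derG contL U0 inv] by metis
  have hG: "h (G z) = z" if "z \<in> U'" for z using h(6) that by (auto simp: homeomorphism_def)
  have Gh: "G (h y) = y" "h y \<in> U'" if "y \<in> V" for y using h(6) that by (auto simp: homeomorphism_def)
  obtain A B where AB: "open A" "open B" "x0 \<in> A" "t0 \<in> B" "A \<times> B \<subseteq> U'"
    using open_prod_elim[OF h(1,3)] by (metis mem_Sigma_iff)
  obtain r where r: "r > 0" "ball x0 r \<subseteq> A" using AB openE by blast
  define g where "g t = fst (h (0, t))" for t
  have G0: "G (x0, t0) = (0, t0)" by (simp add: G_def zero)
  have h0: "h (0, t0) = (x0, t0)" using hG[OF h(3)] G0 by simp
  define S where "S = {t \<in> B. (0, t) \<in> V \<and> g t \<in> ball x0 r}"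
  have derg: "(g has_derivative (\<lambda>k. fst (h' (0, t) (0, k)))) (at t)" if "(0, t) \<in> V" for t
  proof -
    have "((\<lambda>t. (0, t)) has_derivative (\<lambda>k. (0::complex, k))) (at t)"
      by (auto intro!: derivative_eq_intros)
    from has_derivative_compose[OF this h(7)[OF that]]
    have "((\<lambda>t. h (0, t)) has_derivative (\<lambda>k. h' (0, t) (0, k))) (at t)" .
    from has_derivative_fst[OF this] show ?thesis unfolding g_def .
  qed
  have opV: "open {t. (0, t) \<in> V}"
  proof -
    have "{t. (0, t) \<in> V} = (\<lambda>t. (0::complex, t)) -` V" by auto
    then show ?thesis using h(4) by (simp add: open_vimage continuous_on_Pair)
  qed
  have contg: "continuous_on {t. (0, t) \<in> V} g"
    by (intro continuous_at_imp_continuous_on ballI has_derivative_continuous[OF derg]) simp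
  have "open (B \<inter> ({t. (0, t) \<in> V} \<inter> g -` ball x0 r))"
    by (intro open_Int AB continuous_open_preimage[OF contg opV]) simp
  then have openS: "open S" by (rule back_subst[where P = "open"]) (auto simp: S_def)
  have "t0 \<in> S" using AB h(5) r by (auto simp: S_def G0 g_def h0)
  then obtain \<rho> where \<rho>: "\<rho> > 0" "ball t0 \<rho> \<subseteq> S" using openS openE by blast
  have hg: "h (0, t) = (g t, t)" "F (g t) t = 0" if "(0, t) \<in> V" for t
    using Gh(1)[OF that] by (auto simp: G_def g_def prod_eq_iff)
  have iff: "F x t = 0 \<longleftrightarrow> x = g t" if "x \<in> ball x0 r" "t \<in> ball t0 \<rho>" for x t
  proof
    have t: "t \<in> S" using that \<rho> by auto
    have z: "(x, t) \<in> U'" using that r AB t by (auto simp: S_def)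
    show "x = g t" if "F x t = 0"
      using hG[OF z] that by (simp add: G_def g_def)
    show "F x t = 0" if "x = g t" using hg t that by (auto simp: S_def)
  qed
  have hol: "g holomorphic_on ball t0 \<rho>"
  proof (rule holomorphic_onI)
    fix t assume "t \<in> ball t0 \<rho>"
    then have t: "t \<in> S" using \<rho> by auto
    then have V: "(0, t) \<in> V" by (simp add: S_def)
    have "(g t, t) \<in> U" using Gh(2)[OF V] hg[OF V] h(2) by auto
    then have W': "(g t, t) \<in> W" and nz': "Fx (g t) t \<noteq> 0" by (auto simp: U_def)
    define D where "D = (\<lambda>k. fst (h' (0, t) (0, k)))"
    have dg: "(g has_derivative D) (at t)" unfolding D_def by (rule derg[OF V])
    have "((\<lambda>t. (g t, t)) has_derivative (\<lambda>k. (D k, k))) (at t)"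
      by (intro has_derivative_Pair dg has_derivative_ident)
    from has_derivative_compose[OF this der[OF W']]
    have 1: "((\<lambda>t. F (g t) t) has_derivative (\<lambda>k. Fx (g t) t * D k + Ft (g t) t * k)) (at t)" by simp
    have 2: "((\<lambda>t. F (g t) t) has_derivative (\<lambda>k. 0)) (at t)"
      by (rule has_derivative_transform_within_open[OF has_derivative_const[of 0] openS t])
         (use hg(2) in \<open>auto simp: S_def\<close>)
    have "Fx (g t) t * D k + Ft (g t) t * k = 0" for k
      using has_derivative_unique[OF 1 2] by (metis)
    then have "D k = (- Ft (g t) t / Fx (g t) t) * k" for k
      using nz' by (simp add: field_simps add_eq_0_iff)
    then have "D = (*) (- Ft (g t) t / Fx (g t) t)" by auto
    then show "g field_differentiable at t within ball t0 \<rho>"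
      using dg unfolding field_differentiable_def has_field_derivative_def
      by (metis has_derivative_at_withinI)
  qed
  show thesis
  proof (rule that[OF r(1) \<rho>(1) _ hol])
    show "ball x0 r \<times> ball t0 \<rho> \<subseteq> W"
    proof -
      have "ball x0 r \<times> ball t0 \<rho> \<subseteq> A \<times> B" using r \<rho> by (auto simp: S_def)
      also have "\<dots> \<subseteq> W" using AB h(2) by (auto simp: U_def)
      finally show ?thesis .
    qed
    show "g t \<in> ball x0 r" if "t \<in> ball t0 \<rho>" for t using \<rho> that by (auto simp: S_def)
  qed (rule iff)
qed

text \<open>
The integrating factor \<open>exp (- H)\<close>, with \<open>H\<close> a primitive of \<open>h\<close>, makes \<open>y exp (- H)\<close> constant.
\<close>
lemma linear_ode_zero:
  assumes "y holomorphic_on ball s0 r" "h holomorphic_on ball s0 r" "r > 0"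
    and ode: "\<And>s. s \<in> ball s0 r \<Longrightarrow> deriv y s = h s * y s"
    and "y s0 = 0" "s \<in> ball s0 r"
  shows "y s = 0"
proof -
  obtain H where H: "\<And>s. s \<in> ball s0 r \<Longrightarrow> (H has_field_derivative h s) (at s)"
    using holomorphic_convex_primitive'[OF convex_ball open_ball assms(2)]
        by (auto simp: at_within_open[OF _ open_ball])
  have d: "((\<lambda>s. y s * exp (- H s)) has_field_derivative 0) (at s)" if "s \<in> ball s0 r" for s
  proof -
    have "(y has_field_derivative h s * y s) (at s)"
      using holomorphic_derivI[OF assms(1) open_ball that] ode[OF that] by simp
    note [derivative_intros] = this H[OF that]
    show ?thesis by (auto intro!: derivative_eq_intros)
  qed
  have "\<exists>c. \<forall>s\<in>ball s0 r. y s * exp (- H s) = c"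
    by (rule has_field_derivative_zero_constant[OF convex_ball]) (rule has_field_derivative_at_within[OF d])
  then obtain c where c: "\<forall>s\<in>ball s0 r. y s * exp (- H s) = c" ..
  have "c = 0" using bspec[OF c, of s0] assms(3,5) by simp
  then show ?thesis using bspec[OF c assms(6)] by simp
qed

section \<open>Painleve VI along a parametrized curve\<close>

text \<open>
The conditions on the values keep \<open>f\<close> away from every denominator of the equation.
\<close>
definition germ :: "(complex \<Rightarrow> complex) \<Rightarrow> complex set \<Rightarrow> bool" where
  "germ f U \<longleftrightarrow> open U \<and> connected U \<and> U \<noteq> {} \<and> f holomorphic_on U \<and>
    (\<forall>t\<in>U. t \<noteq> 0 \<and> t \<noteq> 1 \<and> f t \<noteq> 0 \<and> f t \<noteq> 1 \<and> f t \<noteq> t)"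

definition solves :: "parameters \<Rightarrow> (complex \<Rightarrow> complex) \<Rightarrow> complex set \<Rightarrow> bool" where
  "solves \<alpha> f U \<longleftrightarrow> (\<forall>t\<in>U. deriv (deriv f) t = PVI_rhs \<alpha> t (f t) (deriv f t))"

definition PVI_a :: "complex \<Rightarrow> complex \<Rightarrow> complex" where
  "PVI_a t x = 1 / 2 * (1 / x + 1 / (x - 1) + 1 / (x - t))"

definition PVI_b :: "complex \<Rightarrow> complex \<Rightarrow> complex" where
  "PVI_b t x = - (1 / t + 1 / (t - 1) + 1 / (x - t))"

text \<open>
\<open>PVI_a\<close> and \<open>PVI_b\<close> are the coefficients of the right-hand side as a quadratic polynomial in the
derivative; the parameters enter only through its constant term.
\<close>
lemma PVI_rhs_quadratic:
  "PVI_rhs \<alpha> t x p = PVI_a t x * p\<^sup>2 + PVI_b t x * p + PVI_rhs \<alpha> t x 0"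
  by (cases \<alpha>) (simp add: PVI_rhs_def PVI_a_def PVI_b_def algebra_simps)

lemma holomorphic_PVI_coeff:
  assumes "\<tau> holomorphic_on D" "\<xi> holomorphic_on D"
    and "\<And>s. s \<in> D \<Longrightarrow> \<tau> s \<noteq> 0 \<and> \<tau> s \<noteq> 1 \<and> \<xi> s \<noteq> 0 \<and> \<xi> s \<noteq> 1 \<and> \<xi> s \<noteq> \<tau> s"
  shows "(\<lambda>s. PVI_a (\<tau> s) (\<xi> s)) holomorphic_on D" "(\<lambda>s. PVI_b (\<tau> s) (\<xi> s)) holomorphic_on D"
    "(\<lambda>s. PVI_rhs \<alpha> (\<tau> s) (\<xi> s) 0) holomorphic_on D"
  using assms unfolding PVI_a_def PVI_b_def PVI_rhs_def
  by (cases \<alpha>; auto intro!: holomorphic_intros)+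

text \<open>
Here \<open>\<sigma>\<close> inverts \<open>\<tau>\<close>, so \<open>t1 (\<sigma> t) * deriv \<sigma> t = 1\<close>, and the equation for \<open>f = \<xi> \<circ> \<sigma>\<close> is multiplied by
\<open>(t1 (\<sigma> t))^3\<close>. The resulting equation still makes sense at zeros of \<open>t1\<close>, which is what
\<open>no_critical_point\<close> exploits.
\<close>
lemma parametrized_equation:
  assumes V: "open V" and t: "t \<in> V" and \<sigma>: "\<sigma> holomorphic_on V"
    and par: "\<And>u. u \<in> V \<Longrightarrow> \<tau> (\<sigma> u) = u" "\<And>u. u \<in> V \<Longrightarrow> \<xi> (\<sigma> u) = f u"
    and d\<tau>: "\<And>u. u \<in> V \<Longrightarrow> (\<tau> has_field_derivative t1 (\<sigma> u)) (at (\<sigma> u))"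
      "\<And>u. u \<in> V \<Longrightarrow> (t1 has_field_derivative t2 (\<sigma> u)) (at (\<sigma> u))"
    and d\<xi>: "\<And>u. u \<in> V \<Longrightarrow> (\<xi> has_field_derivative x1 (\<sigma> u)) (at (\<sigma> u))"
      "\<And>u. u \<in> V \<Longrightarrow> (x1 has_field_derivative x2 (\<sigma> u)) (at (\<sigma> u))"
  shows "t1 (\<sigma> t) \<noteq> 0"
    and "deriv (deriv f) t = PVI_rhs \<alpha> t (f t) (deriv f t) \<longleftrightarrow>
      x2 (\<sigma> t) * t1 (\<sigma> t) - x1 (\<sigma> t) * t2 (\<sigma> t) = PVI_a t (f t) * (x1 (\<sigma> t))\<^sup>2 * t1 (\<sigma> t)
        + PVI_b t (f t) * x1 (\<sigma> t) * (t1 (\<sigma> t))\<^sup>2 + PVI_rhs \<alpha> t (f t) 0 * t1 (\<sigma> t) ^ 3"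
proof -
  define q where "q = deriv \<sigma>"
  have dq: "(\<sigma> has_field_derivative q u) (at u)" "(q has_field_derivative deriv q u) (at u)" if "u \<in> V" for u
    using holomorphic_derivI[OF \<sigma> V that]
      holomorphic_derivI[OF holomorphic_deriv[OF \<sigma> V] V that] by (auto simp: q_def)
  have ch: "((\<lambda>t. \<phi> (\<sigma> t)) has_field_derivative \<phi>' * q u) (at u)"
    if "u \<in> V" "(\<phi> has_field_derivative \<phi>') (at (\<sigma> u))" for \<phi> \<phi>' u
    using DERIV_chain2[OF that(2) dq(1)[OF that(1)]] .
  have d1: "t1 (\<sigma> u) * q u = 1" if "u \<in> V" for u
  proof -
    have "((\<lambda>t. \<tau> (\<sigma> t)) has_field_derivative 1) (at u)"
      by (rule has_field_derivative_transform_within_open[OF DERIV_ident V that]) (simp add: par)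
    with ch[OF that d\<tau>(1)[OF that]] show ?thesis by (rule DERIV_unique)
  qed
  have d2: "t2 (\<sigma> t) * (q t)\<^sup>2 + t1 (\<sigma> t) * deriv q t = 0"
  proof -
    have "((\<lambda>t. t1 (\<sigma> t) * q t) has_field_derivative 0) (at t)"
      by (rule has_field_derivative_transform_within_open[OF DERIV_const[of 1] V t]) (simp add: d1)
    moreover have "((\<lambda>t. t1 (\<sigma> t) * q t) has_field_derivative
        t2 (\<sigma> t) * q t * q t + deriv q t * t1 (\<sigma> t)) (at t)"
      by (rule DERIV_mult[OF ch[OF t d\<tau>(2)[OF t]] dq(2)[OF t]])
    ultimately have "t2 (\<sigma> t) * q t * q t + deriv q t * t1 (\<sigma> t) = 0"
      by (rule DERIV_unique[symmetric])
    then show ?thesis by (simp add: power2_eq_square algebra_simps)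
  qed
  have A: "((\<lambda>t. \<xi> (\<sigma> t)) has_field_derivative x1 (\<sigma> u) * q u) (at u)" if "u \<in> V" for u
    by (rule ch[OF that d\<xi>(1)[OF that]])
  have B: "((\<lambda>t. x1 (\<sigma> t) * q t) has_field_derivative
      x2 (\<sigma> u) * q u * q u + deriv q u * x1 (\<sigma> u)) (at u)" if "u \<in> V" for u
    by (rule DERIV_mult[OF ch[OF that d\<xi>(2)[OF that]] dq(2)[OF that]])
  from deriv2_eqI[OF V t _ A B, of f] par(2)
  have f1: "deriv f t = x1 (\<sigma> t) * q t" "deriv (deriv f) t = x2 (\<sigma> t) * (q t)\<^sup>2 + x1 (\<sigma> t) * deriv q t"
    by (auto simp: power2_eq_square algebra_simps)
  have q0: "q t \<noteq> 0" using d1[OF t] by auto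
  show "t1 (\<sigma> t) \<noteq> 0" using d1[OF t] by auto
  define T1 T2 X1 X2 Q a b c where defs: "T1 = t1 (\<sigma> t)" "T2 = t2 (\<sigma> t)" "X1 = x1 (\<sigma> t)" "X2 = x2 (\<sigma> t)" "Q = q t"
    "a = PVI_a t (f t)" "b = PVI_b t (f t)" "c = PVI_rhs \<alpha> t (f t) 0"
  have T1: "T1 * Q = 1" using d1[OF t] by (simp add: defs)
  have qq: "deriv q t = - (T2 * Q ^ 3)"
  proof -
    have "deriv q t = (T1 * Q) * deriv q t" using T1 by simp
    also have "\<dots> = Q * (T2 * Q\<^sup>2 + T1 * deriv q t) - T2 * Q ^ 3" by algebra
    also have "T2 * Q\<^sup>2 + T1 * deriv q t = 0" using d2 by (simp add: defs)
    finally show ?thesis by simp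
  qed
  have "X2 * Q\<^sup>2 + X1 * deriv q t - (a * (X1 * Q)\<^sup>2 + b * (X1 * Q) + c) =
      (X2 * T1 - X1 * T2 - (a * X1\<^sup>2 * T1 + b * X1 * T1\<^sup>2 + c * T1 ^ 3)) * Q ^ 3"
    unfolding qq using T1 by algebra
  then have "X2 * Q\<^sup>2 + X1 * deriv q t = a * (X1 * Q)\<^sup>2 + b * (X1 * Q) + c \<longleftrightarrow>
      X2 * T1 - X1 * T2 = a * X1\<^sup>2 * T1 + b * X1 * T1\<^sup>2 + c * T1 ^ 3"
    using q0 unfolding defs(5) by (metis eq_iff_diff_eq_0 mult_eq_0_iff power_not_zero)
  then show "deriv (deriv f) t = PVI_rhs \<alpha> t (f t) (deriv f t) \<longleftrightarrow>
      x2 (\<sigma> t) * t1 (\<sigma> t) - x1 (\<sigma> t) * t2 (\<sigma> t) = PVI_a t (f t) * (x1 (\<sigma> t))\<^sup>2 * t1 (\<sigma> t)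
        + PVI_b t (f t) * x1 (\<sigma> t) * (t1 (\<sigma> t))\<^sup>2 + PVI_rhs \<alpha> t (f t) 0 * t1 (\<sigma> t) ^ 3"
    unfolding f1 PVI_rhs_quadratic[of \<alpha> t "f t" "x1 (\<sigma> t) * q t"] defs .
qed

text \<open>
The equation in terms of the parameter extends from the image of \<open>V\<close> to all of \<open>D\<close> by the identity
theorem. Every term of it except \<open>\<xi>' \<tau>''\<close> contains the factor \<open>\<tau>'\<close>. Where \<open>\<xi>' \<noteq> 0\<close> it is therefore a
linear homogeneous equation for \<open>\<tau>'\<close>, and a zero of \<open>\<tau>'\<close> would make \<open>\<tau>\<close> constant.
\<close>
lemma no_critical_point:
  assumes D: "open D" "connected D" and hol: "\<tau> holomorphic_on D" "\<xi> holomorphic_on D"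
    and reg: "\<And>s. s \<in> D \<Longrightarrow> \<tau> s \<noteq> 0 \<and> \<tau> s \<noteq> 1 \<and> \<xi> s \<noteq> 0 \<and> \<xi> s \<noteq> 1 \<and> \<xi> s \<noteq> \<tau> s"
    and V: "open V" "V \<noteq> {}" and \<sigma>: "\<sigma> holomorphic_on V" "\<And>t. t \<in> V \<Longrightarrow> \<sigma> t \<in> D"
    and par: "\<And>t. t \<in> V \<Longrightarrow> \<tau> (\<sigma> t) = t" "\<And>t. t \<in> V \<Longrightarrow> \<xi> (\<sigma> t) = f t"
    and sol: "solves \<alpha> f V"
    and s0: "s0 \<in> D" "deriv \<xi> s0 \<noteq> 0"
  shows "deriv \<tau> s0 \<noteq> 0"
proof
  assume crit: "deriv \<tau> s0 = 0"
  define a b c where abc: "a = (\<lambda>s. PVI_a (\<tau> s) (\<xi> s))" "b = (\<lambda>s. PVI_b (\<tau> s) (\<xi> s))"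
    "c = (\<lambda>s. PVI_rhs \<alpha> (\<tau> s) (\<xi> s) 0)"
  have holabc: "a holomorphic_on D" "b holomorphic_on D" "c holomorphic_on D"
    unfolding abc by (rule holomorphic_PVI_coeff[OF hol reg]; assumption)+
  define t1 t2 x1 x2 where ders: "t1 = deriv \<tau>" "t2 = deriv (deriv \<tau>)" "x1 = deriv \<xi>" "x2 = deriv (deriv \<xi>)"
  have holders: "t1 holomorphic_on D" "t2 holomorphic_on D" "x1 holomorphic_on D" "x2 holomorphic_on D"
    unfolding ders by (intro holomorphic_deriv hol D)+
  (* The equation in terms of the parameter s, cleared of the denominator (t')^3. *)
  define E where "E s = x2 s * t1 s - x1 s * t2 s - a s * (x1 s)\<^sup>2 * t1 s - b s * x1 s * (t1 s)\<^sup>2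
      - c s * t1 s ^ 3" for s
  have holE: "E holomorphic_on D"
    unfolding E_def by (intro holomorphic_intros holders holabc)
  have dD: "(\<tau> has_field_derivative t1 s) (at s)" "(t1 has_field_derivative t2 s) (at s)"
    "(\<xi> has_field_derivative x1 s) (at s)" "(x1 has_field_derivative x2 s) (at s)" if "s \<in> D" for s
    using holomorphic_derivI[OF hol(1) D(1) that] holomorphic_derivI[OF hol(2) D(1) that]
      holomorphic_derivI[OF holders(1) D(1) that] holomorphic_derivI[OF holders(3) D(1) that]
    by (auto simp: ders)
  note eqn = parametrized_equation[OF V(1) _ \<sigma>(1) par dD(1)[OF \<sigma>(2)] dD(2)[OF \<sigma>(2)] dD(3)[OF \<sigma>(2)] dD(4)[OF \<sigma>(2)]]
  have E0: "E (\<sigma> t) = 0" if "t \<in> V" for t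
  proof -
    have "deriv (deriv f) t = PVI_rhs \<alpha> t (f t) (deriv f t)" using sol that by (simp add: solves_def)
    then have "x2 (\<sigma> t) * t1 (\<sigma> t) - x1 (\<sigma> t) * t2 (\<sigma> t) = PVI_a t (f t) * (x1 (\<sigma> t))\<^sup>2 * t1 (\<sigma> t)
        + PVI_b t (f t) * x1 (\<sigma> t) * (t1 (\<sigma> t))\<^sup>2 + PVI_rhs \<alpha> t (f t) 0 * t1 (\<sigma> t) ^ 3"
      by (subst (asm) eqn(2)[where \<alpha> = \<alpha>]) (use that in auto)
    then show ?thesis unfolding E_def abc par[OF that] by (simp add: algebra_simps)
  qed
  have inj: "inj_on \<sigma> V" by (metis inj_onI par(1))
  have op: "open (\<sigma> ` V)" by (rule open_mapping_thm3[OF \<sigma>(1) V(1) inj])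
  have E00: "E s = 0" if "s \<in> D" for s
    by (rule analytic_continuation_open[OF op D(1) _ D(2) _ holE, of "\<lambda>_. 0"])
       (use V \<sigma> E0 that in auto)
  have "open (D \<inter> x1 -` (- {0}))"
    by (intro continuous_open_preimage holomorphic_on_imp_continuous_on holders D) auto
  then obtain r where r: "r > 0" "ball s0 r \<subseteq> D \<inter> x1 -` (- {0})"
    using s0 ders openE[of "D \<inter> x1 -` (- {0})" s0] by auto
  (* The equation solved for the second derivative of the first component, divided by its first derivative. *)
  define h where "h s = (x2 s - a s * (x1 s)\<^sup>2 - b s * x1 s * t1 s - c s * (t1 s)\<^sup>2) / x1 s" for s
  have sub: "ball s0 r \<subseteq> D" using r by auto
  have holh: "h holomorphic_on ball s0 r"
    unfolding h_def by (intro holomorphic_intros holders[THEN holomorphic_on_subset]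
        holabc[THEN holomorphic_on_subset] sub) (use r in auto)
  have "t1 s = 0" if "s \<in> ball s0 r" for s
  proof (rule linear_ode_zero[OF holomorphic_on_subset[OF holders(1) sub] holh r(1) _ _ that])
    show "t1 s0 = 0" using crit by (simp add: ders)
    fix s assume s: "s \<in> ball s0 r"
    then have x1: "x1 s \<noteq> 0" "s \<in> D" using r by auto
    have "x1 s * t2 s = t1 s * (x2 s - a s * (x1 s)\<^sup>2 - b s * x1 s * t1 s - c s * (t1 s)\<^sup>2)"
      using E00[OF x1(2)] unfolding E_def by algebra
    then show "deriv t1 s = h s * t1 s"
      using x1 unfolding h_def by (simp add: ders field_simps)
  qed
  then have z: "t1 s = 0" if "s \<in> D" for s
    using analytic_continuation_open[OF open_ball D(1) _ D(2) sub holders(1), of "\<lambda>_. 0"] r that by auto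
  obtain t where "t \<in> V" using V by auto
  then show False using eqn(1)[of t] z[OF \<sigma>(2)[of t]] by simp
qed

section \<open>The difference of two Painleve VI equations\<close>

text \<open>
The bracket in the equation is affine in the parameters. This is its linear part, which vanishes
along a common solution of two equations whose parameters differ by the argument.
\<close>
fun PVI_difference :: "parameters \<Rightarrow> complex \<Rightarrow> complex \<Rightarrow> complex" where
  "PVI_difference (g0, g1, g2, g3) x t =
     g0 - g1 * (t / x\<^sup>2) + g2 * ((t - 1) / (x - 1)\<^sup>2) - g3 * (t * (t - 1) / (x - t)\<^sup>2)"

lemma PVI_rhs_diff:
  "PVI_rhs \<alpha> t x p - PVI_rhs \<beta> t x p =
    x * (x - 1) * (x - t) / (t\<^sup>2 * (t - 1)\<^sup>2) * PVI_difference (\<alpha> - \<beta>) x t"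
proof -
  obtain a0 a1 a2 a3 b0 b1 b2 b3 where ab: "\<alpha> = (a0, a1, a2, a3)" "\<beta> = (b0, b1, b2, b3)"
    by (metis prod_cases4)
  define K A B C where "K = x * (x - 1) * (x - t) / (t\<^sup>2 * (t - 1)\<^sup>2)"
    "A = t / x\<^sup>2" "B = (t - 1) / (x - 1)\<^sup>2" "C = t * (t - 1) / (x - t)\<^sup>2"
  show ?thesis
    unfolding ab PVI_rhs_def diff_Pair PVI_difference.simps prod.case K_A_B_C_def[symmetric]
    by (simp add: algebra_simps)
qed

lemma solves_difference:
  assumes "germ f U" "solves \<alpha> f U"
  shows "solves \<beta> f U \<longleftrightarrow> (\<forall>t\<in>U. PVI_difference (\<beta> - \<alpha>) (f t) t = 0)"
proof -
  have "deriv (deriv f) t = PVI_rhs \<beta> t (f t) (deriv f t) \<longleftrightarrow> PVI_difference (\<beta> - \<alpha>) (f t) t = 0"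
    if "t \<in> U" for t
  proof -
    have nz: "f t * (f t - 1) * (f t - t) / (t\<^sup>2 * (t - 1)\<^sup>2) \<noteq> 0"
      using assms(1) that by (auto simp: germ_def)
    have "deriv (deriv f) t = PVI_rhs \<alpha> t (f t) (deriv f t)"
      using assms(2) that by (simp add: solves_def)
    then show ?thesis
      using PVI_rhs_diff[of \<beta> t "f t" "deriv f t" \<alpha>] nz
      by (metis eq_iff_diff_eq_0 mult_eq_0_iff)
  qed
  then show ?thesis by (simp add: solves_def)
qed

lemma deriv_germ:
  assumes "germ f U" "t \<in> U"
  shows "(f has_field_derivative deriv f t) (at t)"
    "(deriv f has_field_derivative deriv (deriv f) t) (at t)"
proof -
  have h: "f holomorphic_on U" "open U" using assms(1) by (auto simp: germ_def)
  show "(f has_field_derivative deriv f t) (at t)"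
    "(deriv f has_field_derivative deriv (deriv f) t) (at t)"
    using holomorphic_derivI[OF h assms(2)] holomorphic_derivI[OF holomorphic_deriv[OF h] h(2) assms(2)] by auto
qed

section \<open>The symmetries of Painleve VI\<close>

fun swap01 :: "parameters \<Rightarrow> parameters" where "swap01 (a, b, c, d) = (b, a, c, d)"
fun swap12 :: "parameters \<Rightarrow> parameters" where "swap12 (a, b, c, d) = (a, c, b, d)"
fun swap23 :: "parameters \<Rightarrow> parameters" where "swap23 (a, b, c, d) = (a, b, d, c)"

text \<open>
The flips come from the Moebius maps of the \<open>x\<close>-plane that permute \<open>\<infinity>, 0, 1\<close> and the moving point \<open>t\<close>,
followed by the normalization of \<open>t\<close>. The parameters belong to these four points in this order, so each
flip exchanges two neighbouring parameters.
\<close>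
definition flip01 :: "(complex \<Rightarrow> complex) \<Rightarrow> complex \<Rightarrow> complex" where "flip01 f t = 1 / f (1 / t)"
definition flip12 :: "(complex \<Rightarrow> complex) \<Rightarrow> complex \<Rightarrow> complex" where "flip12 f t = 1 - f (1 - t)"
definition flip23 :: "(complex \<Rightarrow> complex) \<Rightarrow> complex \<Rightarrow> complex" where "flip23 f t = t * f (1 / t)"

definition dom_inverse :: "complex set \<Rightarrow> complex set" where "dom_inverse U = (\<lambda>t. 1 / t) ` U"
definition dom_reflect :: "complex set \<Rightarrow> complex set" where "dom_reflect U = (\<lambda>t. 1 - t) ` U"

lemma dom_simps:
  "t \<in> dom_inverse U \<longleftrightarrow> 1 / t \<in> U" "t \<in> dom_reflect U \<longleftrightarrow> 1 - t \<in> U"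
  by (auto simp: dom_inverse_def dom_reflect_def image_iff intro: bexI[of _ "1/t"] bexI[of _ "1-t"])

lemma dom_open:
  assumes "germ f U"
  shows "open (dom_inverse U)" "connected (dom_inverse U)" "dom_inverse U \<noteq> {}"
    "open (dom_reflect U)" "connected (dom_reflect U)" "dom_reflect U \<noteq> {}"
proof -
  have U: "open U" "connected U" "U \<noteq> {}" "0 \<notin> U" using assms by (auto simp: germ_def)
  have h: "(\<lambda>t. 1 / t) holomorphic_on U" "(\<lambda>t. 1 - t) holomorphic_on U"
    using U by (auto intro!: holomorphic_intros)
  have inj: "inj_on (\<lambda>t. 1 / t) U" "inj_on (\<lambda>t. 1 - t) U" by (auto simp: inj_on_def)
  show "open (dom_inverse U)" "open (dom_reflect U)"
    unfolding dom_inverse_def dom_reflect_def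
    using open_mapping_thm3[OF h(1) U(1) inj(1)] open_mapping_thm3[OF h(2) U(1) inj(2)] by auto
  show "connected (dom_inverse U)" "connected (dom_reflect U)"
    unfolding dom_inverse_def dom_reflect_def
    using h[THEN holomorphic_on_imp_continuous_on] U(2) by (auto intro: connected_continuous_image)
  show "dom_inverse U \<noteq> {}" "dom_reflect U \<noteq> {}" using U(3) by (auto simp: dom_inverse_def dom_reflect_def)
qed

lemma hol_inverse_arg:
  assumes "germ f U" shows "(\<lambda>t. f (1 / t)) holomorphic_on dom_inverse U"
    and "(\<lambda>t. f (1 - t)) holomorphic_on dom_reflect U"
proof -
  have f: "f holomorphic_on U" and z: "0 \<notin> dom_inverse U" using assms by (auto simp: germ_def dom_simps)
  show "(\<lambda>t. f (1 / t)) holomorphic_on dom_inverse U"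
    by (rule holomorphic_on_compose_gen[OF _ f, unfolded o_def])
       (use z in \<open>auto intro!: holomorphic_intros simp: dom_simps\<close>)
  show "(\<lambda>t. f (1 - t)) holomorphic_on dom_reflect U"
    by (rule holomorphic_on_compose_gen[OF _ f, unfolded o_def])
       (auto intro!: holomorphic_intros simp: dom_simps)
qed

lemma germ_flip:
  assumes "germ f U"
  shows "germ (flip01 f) (dom_inverse U)" "germ (flip12 f) (dom_reflect U)" "germ (flip23 f) (dom_inverse U)"
proof -
  note h = hol_inverse_arg[OF assms]
  have nz: "t \<noteq> 0" "t \<noteq> 1" "f t \<noteq> 0" "f t \<noteq> 1" "f t \<noteq> t" if "t \<in> U" for t using assms that by (auto simp: germ_def)
  have i: "t \<noteq> 0" "t \<noteq> 1" "f (1/t) \<noteq> 0" "f (1/t) \<noteq> 1" "f (1/t) \<noteq> 1/t" if "t \<in> dom_inverse U" for t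
    using nz[of "1/t"] that by (auto simp: dom_simps)
  have r: "t \<noteq> 0" "t \<noteq> 1" "f (1-t) \<noteq> 0" "f (1-t) \<noteq> 1" "f (1-t) \<noteq> 1-t" if "t \<in> dom_reflect U" for t
    using nz[of "1-t"] that by (auto simp: dom_simps)
  have e: "1 / x = t \<longleftrightarrow> x = 1 / t" if "x \<noteq> 0" "t \<noteq> 0" for x t :: complex
    using that by (auto simp: field_simps)
  show "germ (flip01 f) (dom_inverse U)"
    unfolding germ_def flip01_def using dom_open[OF assms] i e
    by (auto intro!: holomorphic_intros h)
  have e: "t * x = 1 \<longleftrightarrow> x = 1 / t" "t * x = t \<longleftrightarrow> x = 1" if "t \<noteq> 0" for x t :: complex
    using that by (auto simp: field_simps)
  show "germ (flip23 f) (dom_inverse U)"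
    unfolding germ_def flip23_def using dom_open[OF assms] i e
    by (auto intro!: holomorphic_intros h)
  have e: "1 - x = t \<longleftrightarrow> x = 1 - t" for x t :: complex by (auto simp: field_simps)
  show "germ (flip12 f) (dom_reflect U)"
    unfolding germ_def flip12_def using dom_open[OF assms] r e
    by (auto intro!: holomorphic_intros h)
qed

lemma solves_cong:
  assumes "open U" "\<And>t. t \<in> U \<Longrightarrow> f t = g t"
  shows "solves \<alpha> f U \<longleftrightarrow> solves \<alpha> g U"
proof -
  have "deriv f t = deriv g t" "deriv (deriv f) t = deriv (deriv g) t" if "t \<in> U" for t
  proof -
    have e: "eventually (\<lambda>u. u \<in> U) (nhds t)" using assms(1) that by (rule eventually_nhds_in_open)
    have "eventually (\<lambda>u. deriv f u = deriv g u) (nhds t)"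
      using eventually_nhds_in_open[OF assms(1) that]
    proof eventually_elim
      case (elim u)
      show ?case by (rule deriv_cong_ev[OF _ refl])
        (use eventually_nhds_in_open[OF assms(1) elim] assms(2) in \<open>auto elim: eventually_mono\<close>)
    qed
    then show "deriv (deriv f) t = deriv (deriv g) t" "deriv f t = deriv g t"
      by (auto intro: deriv_cong_ev dest: eventually_nhds_x_imp_x)
  qed
  then show ?thesis using assms(2) by (simp add: solves_def)
qed

lemma flip_flip:
  assumes "germ f U"
  shows "dom_inverse (dom_inverse U) = U" "dom_reflect (dom_reflect U) = U"
    "t \<in> U \<Longrightarrow> flip01 (flip01 f) t = f t" "t \<in> U \<Longrightarrow> flip12 (flip12 f) t = f t"
    "t \<in> U \<Longrightarrow> flip23 (flip23 f) t = f t"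
  using assms by (auto simp: dom_simps flip01_def flip12_def flip23_def germ_def)

lemma deriv_flip:
  assumes "germ f U" and u: "u \<in> U"
  defines "p \<equiv> deriv f u" and "p2 \<equiv> deriv (deriv f) u" and "x \<equiv> f u"
  shows "deriv (flip12 f) (1 - u) = p" "deriv (deriv (flip12 f)) (1 - u) = - p2"
    "deriv (flip01 f) (1 / u) = u\<^sup>2 / x\<^sup>2 * p"
    "deriv (deriv (flip01 f)) (1 / u) = - (u ^ 4 / x\<^sup>2) * p2 - 2 * u ^ 3 / x\<^sup>2 * p + 2 * u ^ 4 / x ^ 3 * p\<^sup>2"
    "deriv (flip23 f) (1 / u) = x - u * p" "deriv (deriv (flip23 f)) (1 / u) = u ^ 3 * p2"
proof -
  have nz: "t \<noteq> 0" "f t \<noteq> 0" if "t \<in> U" for t using assms that by (auto simp: germ_def)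
  note d = deriv_germ[OF assms(1)]
  have inv: "((\<lambda>t. 1 / t) has_field_derivative - 1 / v\<^sup>2) (at v)" if "v \<noteq> 0" for v :: complex
    using that by (auto intro!: derivative_eq_intros simp: power2_eq_square)
  have ref: "((\<lambda>t. 1 - t) has_field_derivative - 1) (at v)" for v :: complex
    by (auto intro!: derivative_eq_intros)
  note op = dom_open[OF assms(1)]
  have r1: "(flip12 f has_field_derivative deriv f (1 - v)) (at v)" if "v \<in> dom_reflect U" for v
    unfolding flip12_def using DERIV_diff[OF DERIV_const[of 1] DERIV_chain2[OF d(1) ref, of v]] that
        by (simp add: dom_simps)
  have r2: "((\<lambda>v. deriv f (1 - v)) has_field_derivative - deriv (deriv f) (1 - v)) (at v)"
      if "v \<in> dom_reflect U" for v
    using DERIV_chain2[OF d(2) ref, of v] that by (simp add: dom_simps)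
  have "1 - u \<in> dom_reflect U" using u by (simp add: dom_simps)
  from deriv2_eqI[OF op(4) this refl r1 r2]
  show "deriv (flip12 f) (1 - u) = p" "deriv (deriv (flip12 f)) (1 - u) = - p2"
    by (simp_all add: p_def p2_def)
  have u': "1 / u \<in> dom_inverse U" using u by (simp add: dom_simps)
  have fi: "((\<lambda>v. f (1 / v)) has_field_derivative deriv f (1 / v) * (- 1 / v\<^sup>2)) (at v)"
    "((\<lambda>v. deriv f (1 / v)) has_field_derivative deriv (deriv f) (1 / v) * (- 1 / v\<^sup>2)) (at v)"
    "v \<noteq> 0" "f (1 / v) \<noteq> 0"
    if "v \<in> dom_inverse U" for v
    using that nz[of "1 / v"] DERIV_chain2[OF d(1) inv, of v] DERIV_chain2[OF d(2) inv, of v]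
    by (auto simp: dom_simps)
  have s1: "(flip23 f has_field_derivative f (1 / v) - deriv f (1 / v) / v) (at v)" if "v \<in> dom_inverse U" for v
    unfolding flip23_def
    by (rule derivative_eq_intros fi(1,2)[OF that] refl)+
       (use fi[OF that] in \<open>simp add: field_simps power2_eq_square\<close>)
  have s2: "((\<lambda>v. f (1 / v) - deriv f (1 / v) / v) has_field_derivative deriv (deriv f) (1 / v) / v ^ 3) (at v)"
    if "v \<in> dom_inverse U" for v
    using DERIV_diff[OF fi(1)[OF that] DERIV_divide[OF fi(2)[OF that] DERIV_ident fi(3)[OF that]]] fi(3)[OF that]
    by (simp add: field_simps power2_eq_square power3_eq_cube)
  from deriv2_eqI[OF op(1) u' refl s1 s2]
  show "deriv (flip23 f) (1 / u) = x - u * p" "deriv (deriv (flip23 f)) (1 / u) = u ^ 3 * p2"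
    using nz[OF u] by (simp_all add: p_def p2_def x_def power_divide)
  have q1: "(flip01 f has_field_derivative deriv f (1 / v) / (v\<^sup>2 * (f (1 / v))\<^sup>2)) (at v)"
      if "v \<in> dom_inverse U" for v
    unfolding flip01_def
    by (rule derivative_eq_intros fi(1,2)[OF that] refl)+
       (use fi[OF that] in \<open>simp_all add: field_simps power2_eq_square\<close>)
  have q2: "((\<lambda>v. deriv f (1 / v) / (v\<^sup>2 * (f (1 / v))\<^sup>2)) has_field_derivative
      - deriv (deriv f) (1 / v) / (v ^ 4 * (f (1 / v))\<^sup>2) - 2 * deriv f (1 / v) / (v ^ 3 * (f (1 / v))\<^sup>2)
      + 2 * (deriv f (1 / v))\<^sup>2 / (v ^ 4 * (f (1 / v)) ^ 3)) (at v)" if "v \<in> dom_inverse U" for v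
    by (rule derivative_eq_intros fi(1,2)[OF that] refl)+
       (use fi[OF that] in \<open>simp_all add: field_simps power2_eq_square power3_eq_cube power4_eq_xxxx\<close>)
  from deriv2_eqI[OF op(1) u' refl q1 q2]
  show "deriv (flip01 f) (1 / u) = u\<^sup>2 / x\<^sup>2 * p"
    "deriv (deriv (flip01 f)) (1 / u) = - (u ^ 4 / x\<^sup>2) * p2 - 2 * u ^ 3 / x\<^sup>2 * p + 2 * u ^ 4 / x ^ 3 * p\<^sup>2"
    using nz[OF u] by (simp_all add: p_def p2_def x_def power_divide field_simps)
qed

lemma PVI_rhs_reflect:
  "PVI_rhs (swap12 \<alpha>) (1 - t) (1 - x) p = - PVI_rhs \<alpha> t x p"
proof -
  obtain a0 a1 a2 a3 where a: "\<alpha> = (a0, a1, a2, a3)" by (metis prod_cases4)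
  define y z w where "y = x - 1" "z = x - t" "w = t - 1"
  have e: "1 - x = - y" "1 - t = - w" "- y - 1 = - x" "- y - - w = - z" "- w - 1 = - t"
    by (auto simp: y_z_w_def)
  show ?thesis
    unfolding a swap12.simps PVI_rhs_def prod.case e y_z_w_def[symmetric] by (simp add: algebra_simps)
qed

lemma PVI_rhs_inverse:
  assumes nz: "t \<noteq> 0" "t \<noteq> 1" "x \<noteq> 0" "x \<noteq> 1" "x \<noteq> t"
  shows "PVI_rhs (swap01 \<alpha>) (1 / t) (1 / x) (t\<^sup>2 / x\<^sup>2 * p) =
    - (t ^ 4 / x\<^sup>2) * PVI_rhs \<alpha> t x p - 2 * t ^ 3 / x\<^sup>2 * p + 2 * t ^ 4 / x ^ 3 * p\<^sup>2"
proof -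
  obtain a0 a1 a2 a3 where a: "\<alpha> = (a0, a1, a2, a3)" by (metis prod_cases4)
  define y z w where "y = x - 1" "z = x - t" "w = t - 1"
  have e: "1 / x - 1 = - y / x" "1 / x - 1 / t = - z / (x * t)" "1 / t - 1 = - w / t"
    using nz by (auto simp: y_z_w_def field_simps)
  have nz': "y \<noteq> 0" "z \<noteq> 0" "w \<noteq> 0" using nz by (auto simp: y_z_w_def)
  have xt: "x = y + 1" "t = w + 1" "z = y - w" by (auto simp: y_z_w_def)
  have A: "1 / 2 * (x - x / y - x * t / z) * (t\<^sup>2 / x\<^sup>2)\<^sup>2 =
      - (t ^ 4 / x\<^sup>2) * (1 / 2 * (1 / x + 1 / y + 1 / z)) + 2 * t ^ 4 / x ^ 3"
    using nz nz' by (simp add: field_simps) (simp add: xt, algebra)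
  have B: "- (t - t / w - x * t / z) * (t\<^sup>2 / x\<^sup>2) = (t ^ 4 / x\<^sup>2) * (1 / t + 1 / w + 1 / z) - 2 * t ^ 3 / x\<^sup>2"
    using nz nz' by (simp add: field_simps) (simp add: xt, algebra)
  have K: "1 / x * (- y / x) * (- z / (x * t)) / ((1 / t)\<^sup>2 * (- w / t)\<^sup>2)
      = (t ^ 4 / x\<^sup>2) * (x * y * z / (t\<^sup>2 * w\<^sup>2)) * (t / x\<^sup>2)"
    using nz nz' by (simp add: field_simps) algebra
  have C: "(t / x\<^sup>2) * (a1 - a0 * ((1 / t) / (1 / x)\<^sup>2) + a2 * ((- w / t) / (- y / x)\<^sup>2)
         + (1 / 2 - a3) * ((1 / t) * (- w / t) / (- z / (x * t))\<^sup>2)) =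
      - (a0 - a1 * (t / x\<^sup>2) + a2 * (w / y\<^sup>2) + (1 / 2 - a3) * (t * w / z\<^sup>2))"
    using nz nz' by (simp add: field_simps power2_eq_square)
  have C': "1 / x * (- y / x) * (- z / (x * t)) / ((1 / t)\<^sup>2 * (- w / t)\<^sup>2) *
      (a1 - a0 * ((1 / t) / (1 / x)\<^sup>2) + a2 * ((- w / t) / (- y / x)\<^sup>2)
         + (1 / 2 - a3) * ((1 / t) * (- w / t) / (- z / (x * t))\<^sup>2)) =
      - (t ^ 4 / x\<^sup>2) * (x * y * z / (t\<^sup>2 * w\<^sup>2) * (a0 - a1 * (t / x\<^sup>2) + a2 * (w / y\<^sup>2) + (1 / 2
          - a3) * (t * w / z\<^sup>2)))"
    unfolding K by (subst mult.assoc, subst C) (simp only: mult_minus_left mult_minus_right mult.assoc)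
  have D: "1 / 2 * (1 / (1 / x) + 1 / (- y / x) + 1 / (- z / (x * t))) * (t\<^sup>2 / x\<^sup>2 * p)\<^sup>2 =
      (1 / 2 * (x - x / y - x * t / z) * (t\<^sup>2 / x\<^sup>2)\<^sup>2) * p\<^sup>2"
    by (simp add: power_mult_distrib power_divide)
  have E0: "1 / (1 / t) + 1 / (- w / t) + 1 / (- z / (x * t)) = t - t / w - x * t / z" by simp
  have E: "(1 / (1 / t) + 1 / (- w / t) + 1 / (- z / (x * t))) * (t\<^sup>2 / x\<^sup>2 * p) =
      - (- (t - t / w - x * t / z) * (t\<^sup>2 / x\<^sup>2)) * p"
    unfolding E0 by (simp only: mult_minus_left minus_minus mult.assoc)
  show ?thesis
    unfolding a swap01.simps PVI_rhs_def prod.case e C' D E A B y_z_w_def[symmetric]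
    by (simp add: algebra_simps add_divide_distrib diff_divide_distrib)
qed

lemma PVI_rhs_scale:
  assumes nz: "t \<noteq> 0" "t \<noteq> 1" "x \<noteq> 0" "x \<noteq> 1" "x \<noteq> t"
  shows "PVI_rhs (swap23 \<alpha>) (1 / t) (x / t) (x - t * p) = t ^ 3 * PVI_rhs \<alpha> t x p"
proof -
  obtain a0 a1 a2 a3 where a: "\<alpha> = (a0, a1, a2, a3)" by (metis prod_cases4)
  define y z w where "y = x - 1" "z = x - t" "w = t - 1"
  have e: "x / t - 1 = z / t" "x / t - 1 / t = y / t" "1 / t - 1 = - w / t"
    using nz by (auto simp: y_z_w_def field_simps)
  have nz': "y \<noteq> 0" "z \<noteq> 0" "w \<noteq> 0" using nz by (auto simp: y_z_w_def)
  have xt: "x = y + 1" "t = w + 1" "z = y - w" by (auto simp: y_z_w_def)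
  define A where "A = 1 / 2 * (1 / x + 1 / y + 1 / z)"
  define B where "B = 1 / t + 1 / w + 1 / z"
  define K where "K = x * y * z / (t\<^sup>2 * w\<^sup>2)"
  have A: "1 / 2 * (1 / (x / t) + 1 / (z / t) + 1 / (y / t)) = t * A"
    using nz nz' by (simp add: A_def algebra_simps)
  have K: "x / t * (z / t) * (y / t) / ((1 / t)\<^sup>2 * (- w / t)\<^sup>2) = t ^ 3 * K"
    using nz nz' unfolding K_def by (simp add: field_simps power2_eq_square power3_eq_cube)
  have B: "1 / (1 / t) + 1 / (- w / t) + 1 / (y / t) = t - t / w + t / y"
    using nz nz' by simp
  have P1: "- 2 * A * x * t\<^sup>2 + t * (t - t / w + t / y) = - (t ^ 3 * B)"
    unfolding A_def B_def using nz nz' by (simp add: field_simps) (simp add: xt, algebra)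
  have P0: "t * A * x\<^sup>2 - (t - t / w + t / y) * x + t ^ 3 * K * (- (1 / 2) * (w / y\<^sup>2)) * 0
      + t ^ 3 * K * (- w / (2 * y\<^sup>2)) = t ^ 3 * K * (1 / 2 * (t * w / z\<^sup>2))"
    unfolding A_def K_def using nz nz' by (simp add: field_simps) (simp add: xt, algebra)
  have C: "a0 - a1 * (1 / t / (x / t)\<^sup>2) + a3 * (- w / t / (z / t)\<^sup>2) + (1 / 2 - a2) * (1 / t * (- w / t) / (y / t)\<^sup>2)
     = (a0 - a1 * (t / x\<^sup>2) + a2 * (w / y\<^sup>2) - a3 * (t * w / z\<^sup>2)) - w / (2 * y\<^sup>2)"
    using nz nz' by (simp add: field_simps power2_eq_square)
  show ?thesis
    unfolding a swap23.simps PVI_rhs_def prod.case e A B K C y_z_w_def[symmetric]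
      A_def[symmetric] B_def[symmetric] K_def[symmetric]
    using P1 P0 by algebra
qed

text \<open>
The two derivatives of a flipped germ (\<open>deriv_flip\<close>) are substituted into the transformation laws of
the right-hand side.
\<close>
lemma solves_flip:
  assumes "germ f U" "solves \<alpha> f U"
  shows "solves (swap01 \<alpha>) (flip01 f) (dom_inverse U)"
    "solves (swap12 \<alpha>) (flip12 f) (dom_reflect U)"
    "solves (swap23 \<alpha>) (flip23 f) (dom_inverse U)"
proof -
  have nz: "u \<noteq> 0" "u \<noteq> 1" "f u \<noteq> 0" "f u \<noteq> 1" "f u \<noteq> u" if "u \<in> U" for u
    using assms(1) that by (auto simp: germ_def)
  have s: "deriv (deriv f) u = PVI_rhs \<alpha> u (f u) (deriv f u)" if "u \<in> U" for u
    using assms(2) that by (simp add: solves_def)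
  note d = deriv_flip[OF assms(1)]
  show "solves (swap01 \<alpha>) (flip01 f) (dom_inverse U)"
    using PVI_rhs_inverse[OF nz] d s by (auto simp: solves_def dom_inverse_def flip01_def)
  show "solves (swap12 \<alpha>) (flip12 f) (dom_reflect U)"
    using PVI_rhs_reflect d s by (auto simp: solves_def dom_reflect_def flip12_def)
  show "solves (swap23 \<alpha>) (flip23 f) (dom_inverse U)"
    using PVI_rhs_scale[OF nz] d s by (auto simp: solves_def dom_inverse_def flip23_def)
qed

lemma solves_flip_iff:
  assumes "germ f U"
  shows "solves (swap01 \<alpha>) (flip01 f) (dom_inverse U) \<longleftrightarrow> solves \<alpha> f U"
    "solves (swap12 \<alpha>) (flip12 f) (dom_reflect U) \<longleftrightarrow> solves \<alpha> f U"
    "solves (swap23 \<alpha>) (flip23 f) (dom_inverse U) \<longleftrightarrow> solves \<alpha> f U"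
proof -
  have o: "open U" using assms by (auto simp: germ_def)
  obtain a b c d where \<alpha>: "\<alpha> = (a, b, c, d)" by (metis prod_cases4)
  note g = germ_flip[OF assms] and ff = flip_flip[OF assms]
  note c = solves_cong[OF o ff(3)] solves_cong[OF o ff(4)] solves_cong[OF o ff(5)]
  show "solves (swap01 \<alpha>) (flip01 f) (dom_inverse U) \<longleftrightarrow> solves \<alpha> f U"
    using solves_flip(1)[OF g(1), where \<alpha> =
        "swap01 \<alpha>"] solves_flip(1)[OF assms, where \<alpha> = \<alpha>] c(1)[where \<alpha> = \<alpha>] ff(1) by (auto simp: \<alpha>)
  show "solves (swap12 \<alpha>) (flip12 f) (dom_reflect U) \<longleftrightarrow> solves \<alpha> f U"
    using solves_flip(2)[OF g(2), where \<alpha> =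
        "swap12 \<alpha>"] solves_flip(2)[OF assms, where \<alpha> = \<alpha>] c(2)[where \<alpha> = \<alpha>] ff(2) by (auto simp: \<alpha>)
  show "solves (swap23 \<alpha>) (flip23 f) (dom_inverse U) \<longleftrightarrow> solves \<alpha> f U"
    using solves_flip(3)[OF g(3), where \<alpha> =
        "swap23 \<alpha>"] solves_flip(3)[OF assms, where \<alpha> = \<alpha>] c(3)[where \<alpha> = \<alpha>] ff(1) by (auto simp: \<alpha>)
qed

section \<open>The curve of common solutions\<close>

fun PVI_difference_dx :: "parameters \<Rightarrow> complex \<Rightarrow> complex \<Rightarrow> complex" where
  "PVI_difference_dx (g0, g1, g2, g3) x t =
     2 * g1 * t / x ^ 3 - 2 * g2 * (t - 1) / (x - 1) ^ 3 + 2 * g3 * (t * (t - 1)) / (x - t) ^ 3"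

fun PVI_difference_dt :: "parameters \<Rightarrow> complex \<Rightarrow> complex \<Rightarrow> complex" where
  "PVI_difference_dt (g0, g1, g2, g3) x t =
     - g1 / x\<^sup>2 + g2 / (x - 1)\<^sup>2 - g3 * ((2 * t - 1) / (x - t)\<^sup>2 + 2 * (t * (t - 1)) / (x - t) ^ 3)"

text \<open>
Pairs are written \<open>(x, t)\<close>, the value first and the argument second.
\<close>
definition regular_points :: "(complex \<times> complex) set" where
  "regular_points = {z. snd z \<noteq> 0 \<and> snd z \<noteq> 1 \<and> fst z \<noteq> 0 \<and> fst z \<noteq> 1 \<and> fst z \<noteq> snd z}"

lemma open_regular_points: "open regular_points"
  unfolding regular_points_def
  by (intro open_Collect_conj open_Collect_neq continuous_intros)

lemma has_derivative_quotient_square: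
  fixes n d :: "complex \<times> complex \<Rightarrow> complex"
  assumes "(n has_derivative n') (at z)" "(d has_derivative d') (at z)" "d z \<noteq> 0"
  shows "((\<lambda>w. n w / (d w)\<^sup>2) has_derivative (\<lambda>h. n' h / (d z)\<^sup>2 - 2 * n z / d z ^ 3 * d' h)) (at z)"
proof -
  have "((\<lambda>w. n w / (d w)\<^sup>2) has_derivative
      (\<lambda>h. (n' h * (d z)\<^sup>2 - n z * (of_nat 2 * d' h * d z ^ (2 - 1))) / ((d z)\<^sup>2 * (d z)\<^sup>2))) (at z)"
    by (rule has_derivative_divide'[OF assms(1) has_derivative_power[OF assms(2)]]) (use assms(3) in simp)
  then show ?thesis
    by (rule has_derivative_eq_rhs)
       (use assms(3) in \<open>auto simp: fun_eq_iff field_simps power2_eq_square power3_eq_cube\<close>)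
qed

lemma has_derivative_PVI_difference:
  assumes "(x, t) \<in> regular_points"
  shows "((\<lambda>z. PVI_difference g (fst z) (snd z)) has_derivative
    (\<lambda>z. PVI_difference_dx g x t * fst z + PVI_difference_dt g x t * snd z)) (at (x, t))"
proof -
  obtain g0 g1 g2 g3 where g: "g = (g0, g1, g2, g3)" by (metis prod_cases4)
  have nz: "x \<noteq> 0" "x - 1 \<noteq> 0" "x - t \<noteq> 0" using assms by (auto simp: regular_points_def)
  let ?z = "(x, t)"
  have f: "(fst has_derivative fst) (at ?z)" and s: "(snd has_derivative snd) (at ?z)"
    by (simp_all add: bounded_linear_imp_has_derivative bounded_linear_fst bounded_linear_snd)
  have f1: "((\<lambda>z. fst z - 1) has_derivative fst) (at ?z)"
    and s1: "((\<lambda>z. snd z - 1) has_derivative snd) (at ?z)"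
    using has_derivative_diff[OF f has_derivative_const[of 1]] has_derivative_diff[OF s has_derivative_const[of 1]]
    by simp_all
  have n3: "((\<lambda>z. snd z * (snd z - 1)) has_derivative (\<lambda>h. (2 * t - 1) * snd h)) (at ?z)"
    by (rule has_derivative_eq_rhs[OF has_derivative_mult[OF s s1]]) (auto simp: algebra_simps fun_eq_iff)
  have f3: "((\<lambda>z. fst z - snd z) has_derivative (\<lambda>h. fst h - snd h)) (at ?z)"
    by (rule has_derivative_diff[OF f s])
  note q = has_derivative_quotient_square[OF s f] has_derivative_quotient_square[OF s1 f1]
    has_derivative_quotient_square[OF n3 f3]
  show ?thesis
    unfolding g PVI_difference.simps PVI_difference_dx.simps PVI_difference_dt.simps
    by (rule has_derivative_eq_rhs, rule has_derivative_diff, rule has_derivative_add,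
        rule has_derivative_diff, rule has_derivative_const,
        (rule has_derivative_mult_right, rule q, use nz in simp)+)
       (simp add: fun_eq_iff algebra_simps add_divide_distrib diff_divide_distrib)
qed

lemma continuous_PVI_difference_partials:
  "continuous_on regular_points (\<lambda>z. PVI_difference_dx g (fst z) (snd z))"
  "continuous_on regular_points (\<lambda>z. PVI_difference_dt g (fst z) (snd z))"
  by (cases g; auto intro!: continuous_intros simp: regular_points_def)+

text \<open>
At a critical point of the difference, the three equations are linear in \<open>a1 = g1 t / x^3\<close>,
\<open>a2 = g2 (t - 1) / (x - 1)^3\<close> and \<open>a3 = g3 t (t - 1) / (x - t)^3\<close>. Solving them gives
\<open>A = x^2 / t\<close>, \<open>B = (x - 1)^2 / (t - 1)\<close> and \<open>C = (x - t)^2 / (t (t - 1))\<close>, which satisfy \<open>A - B + C = 1\<close>.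
\<close>
lemma singular_point_square_relation:
  assumes "(x, t) \<in> regular_points" "PVI_difference (g0, g1, g2, g3) x t = 0"
    "PVI_difference_dx (g0, g1, g2, g3) x t = 0" "PVI_difference_dt (g0, g1, g2, g3) x t = 0"
  shows "\<exists>A B C. A - B + C = 1 \<and> g1 = g0 * A\<^sup>2 \<and> g2 = g0 * B\<^sup>2 \<and> g3 = g0 * C\<^sup>2"
proof -
  define y z w where "y = x - 1" "z = x - t" "w = t - 1"
  have nz: "x \<noteq> 0" "y \<noteq> 0" "z \<noteq> 0" "t \<noteq> 0" "w \<noteq> 0"
    using assms(1) by (auto simp: regular_points_def y_z_w_def)
  define a1 a2 a3 where "a1 = g1 * t / x ^ 3" "a2 = g2 * w / y ^ 3" "a3 = g3 * (t * w) / z ^ 3"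
  note ds = y_z_w_def a1_a2_a3_def
  have g: "g1 = a1 * x ^ 3 / t" "g2 = a2 * y ^ 3 / w" "g3 = a3 * z ^ 3 / (t * w)"
    using nz by (auto simp: a1_a2_a3_def field_simps)
  have e1: "g0 - a1 * x + a2 * y - a3 * z = 0"
    using assms(2) nz unfolding PVI_difference.simps y_z_w_def[symmetric] a1_a2_a3_def
    by (simp add: field_simps power2_eq_square power3_eq_cube)
  have e2: "a1 - a2 + a3 = 0"
  proof -
    have "2 * (a1 - a2 + a3) = 0"
      using assms(3) unfolding PVI_difference_dx.simps y_z_w_def[symmetric] a1_a2_a3_def
      by (simp add: algebra_simps)
    then show ?thesis by (metis mult_eq_0_iff zero_neq_numeral)
  qed
  have e3: "- a1 * x * w + a2 * y * t - a3 * ((2 * t - 1) * z + 2 * (t * w)) = 0"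
  proof -
    have 0: "- g1 / x\<^sup>2 + g2 / y\<^sup>2 - g3 * ((2 * t - 1) / z\<^sup>2 + 2 * (t * w) / z ^ 3) = 0"
      using assms(4) by (simp only: PVI_difference_dt.simps y_z_w_def)
    have "g1 / x\<^sup>2 * (t * w) = a1 * x * w" "g2 / y\<^sup>2 * (t * w) = a2 * y * t"
      "g3 * ((2 * t - 1) / z\<^sup>2 + 2 * (t * w) / z ^ 3) * (t * w) = a3 * ((2 * t - 1) * z + 2 * (t * w))"
      unfolding g using nz by (simp_all add: field_simps power2_eq_square power3_eq_cube)
    then have "- a1 * x * w + a2 * y * t - a3 * ((2 * t - 1) * z + 2 * (t * w)) =
        (- g1 / x\<^sup>2 + g2 / y\<^sup>2 - g3 * ((2 * t - 1) / z\<^sup>2 + 2 * (t * w) / z ^ 3)) * (t * w)"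
      by (simp add: algebra_simps)
    then show ?thesis unfolding 0 by simp
  qed
  have a2: "a2 = g0 + t * a3" and a1: "a1 = g0 + w * a3"
    using e1 e2 unfolding y_z_w_def by algebra+
  have a3: "a3 * (t * w) = g0 * z"
    using e3 unfolding a1 a2 unfolding y_z_w_def by algebra
  have a3': "a3 = g0 * z / (t * w)" using a3 nz by (simp add: field_simps)
  have a2': "a2 = g0 * y / w" unfolding a2 a3' using nz by (simp add: field_simps) (simp add: y_z_w_def algebra_simps)
  have a1': "a1 = g0 * x / t" unfolding a1 a3' using nz by (simp add: field_simps) (simp add: y_z_w_def algebra_simps)
  show ?thesis
  proof (intro exI conjI)
    show "x\<^sup>2 / t - y\<^sup>2 / w + z\<^sup>2 / (t * w) = 1"
      using nz by (simp add: divide_simps) (simp add: y_z_w_def, algebra)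
    show "g1 = g0 * (x\<^sup>2 / t)\<^sup>2" "g2 = g0 * (y\<^sup>2 / w)\<^sup>2" "g3 = g0 * (z\<^sup>2 / (t * w))\<^sup>2"
      unfolding g a1' a2' a3' using nz by (simp_all add: field_simps power2_eq_square power3_eq_cube)
  qed
qed

text \<open>
On a smooth curve this set is open and closed and unramified over the \<open>t\<close>-plane (\<open>solution_points_local\<close>);
it is the covering space to which the theorem of Liouville is applied.
\<close>
definition solution_points :: "parameters \<Rightarrow> parameters \<Rightarrow> (complex \<times> complex) set" where
  "solution_points \<alpha> g = {(x, t). \<exists>f V. germ f V \<and> t \<in> V \<and> f t = x \<and> solves \<alpha> f V \<and>
     (\<forall>u\<in>V. PVI_difference g (f u) u = 0)}"

lemma solution_points_regular:
  "(x, t) \<in> solution_points \<alpha> g \<Longrightarrow> (x, t) \<in> regular_points \<and> PVI_difference g x t = 0"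
  by (auto simp: solution_points_def regular_points_def germ_def)

lemma solves_extend:
  assumes g: "germ f U" and V: "open V" "V \<subseteq> U" "V \<noteq> {}" and "solves \<alpha> f V"
  shows "solves \<alpha> f U"
proof -
  have U: "open U" "connected U" "f holomorphic_on U" using g by (auto simp: germ_def)
  note d1 = holomorphic_deriv[OF U(3,1)]
  have c: "(\<lambda>s. PVI_a s (f s)) holomorphic_on U" "(\<lambda>s. PVI_b s (f s)) holomorphic_on U"
    "(\<lambda>s. PVI_rhs \<alpha> s (f s) 0) holomorphic_on U"
    using holomorphic_PVI_coeff[OF holomorphic_on_ident U(3)] g by (auto simp: germ_def)
  have hol: "(\<lambda>t. PVI_rhs \<alpha> t (f t) (deriv f t)) holomorphic_on U"
    unfolding PVI_rhs_quadratic[of \<alpha> _ _ "deriv f _"] by (intro holomorphic_intros c d1)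
  have "deriv (deriv f) t = PVI_rhs \<alpha> t (f t) (deriv f t)" if "t \<in> U" for t
    by (rule analytic_continuation_open[OF V(1) U(1) V(3) U(2) V(2) holomorphic_deriv[OF d1 U(1)] hol _ that])
       (use assms(5) in \<open>simp add: solves_def\<close>)
  then show ?thesis by (simp add: solves_def)
qed

text \<open>
Near a point with \<open>R_x \<noteq> 0\<close> the curve is the graph of one function \<open>G\<close>, and by the identity theorem \<open>G\<close>
solves the equation either near all points of the graph or near none. Near a point with \<open>R_x = 0\<close>
smoothness makes the curve a graph \<open>t = T(x)\<close> with \<open>T' = 0\<close> at the point, and \<open>no_critical_point\<close>
forbids solutions on it. So the solution points are open and closed on the curve and consist of
unramified points.
\<close>
lemma solution_points_local:
  assumes reg: "(x0, t0) \<in> regular_points" and zero: "PVI_difference g x0 t0 = 0"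
    and smooth: "PVI_difference_dx g x0 t0 = 0 \<Longrightarrow> PVI_difference_dt g x0 t0 \<noteq> 0"
  shows "\<exists>r>0. \<exists>\<rho>>0. \<exists>G. G holomorphic_on ball t0 \<rho> \<and> (\<forall>t\<in>ball t0 \<rho>. G t \<in> ball x0 r) \<and>
    (if (x0, t0) \<in> solution_points \<alpha> g
     then PVI_difference_dx g x0 t0 \<noteq> 0 \<and> G t0 = x0 \<and>
       (\<forall>t\<in>ball t0 \<rho>. \<forall>x\<in>ball x0 r. (x, t) \<in> solution_points \<alpha> g \<longleftrightarrow> x = G t)
     else \<forall>t\<in>ball t0 \<rho>. \<forall>x\<in>ball x0 r. (x, t) \<notin> solution_points \<alpha> g)"
proof (cases "PVI_difference_dx g x0 t0 = 0")
  case False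
  obtain r \<rho> G where G: "r > 0" "\<rho> > 0" "ball x0 r \<times> ball t0 \<rho> \<subseteq> regular_points" "G holomorphic_on ball t0 \<rho>"
    "\<And>t. t \<in> ball t0 \<rho> \<Longrightarrow> G t \<in> ball x0 r"
    "\<And>x t. x \<in> ball x0 r \<Longrightarrow> t \<in> ball t0 \<rho> \<Longrightarrow> PVI_difference g x t = 0 \<longleftrightarrow> x = G t"
    using holomorphic_implicit_function[OF open_regular_points reg has_derivative_PVI_difference
        continuous_PVI_difference_partials zero False] by blast
  have germG: "germ G (ball t0 \<rho>)"
  proof -
    have "(G t, t) \<in> regular_points" if "t \<in> ball t0 \<rho>" for t using G(3,5) that by blast
    then show ?thesis using G(2,4) unfolding germ_def regular_points_def by auto
  qed
  have G0: "G t0 = x0" using G(6)[of x0 t0] zero G(1,2) by simp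
  have all: "(G t, t) \<in> solution_points \<alpha> g"
    if S: "(x1, t1) \<in> solution_points \<alpha> g" "x1 \<in> ball x0 r" "t1 \<in> ball t0 \<rho>" and t: "t \<in> ball t0 \<rho>" for x1 t1 t
  proof -
    obtain f V where f: "germ f V" "t1 \<in> V" "f t1 = x1" "solves \<alpha> f V" "\<forall>u\<in>V. PVI_difference g (f u) u = 0"
      using S(1) by (auto simp: solution_points_def)
    define W where "W = (V \<inter> f -` ball x0 r) \<inter> ball t0 \<rho>"
    have W: "open W"
      unfolding W_def using f(1)
      by (intro open_Int continuous_open_preimage holomorphic_on_imp_continuous_on) (auto simp: germ_def)
    have "t1 \<in> W" using S f by (auto simp: W_def)
    have eq: "f u = G u" if "u \<in> W" for u
      using G(6)[of "f u" u] f(5) that by (auto simp: W_def)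
    have "solves \<alpha> f W" using f(4) by (auto simp: solves_def W_def)
    then have "solves \<alpha> G W" using solves_cong[OF W eq] by simp
    then have "solves \<alpha> G (ball t0 \<rho>)"
      by (intro solves_extend[OF germG W]) (use \<open>t1 \<in> W\<close> in \<open>auto simp: W_def\<close>)
    then show ?thesis
      unfolding solution_points_def using germG t G(5,6) by blast
  qed
  have iff: "(x, t) \<in> solution_points \<alpha> g \<Longrightarrow> x = G t" if "x \<in> ball x0 r" "t \<in> ball t0 \<rho>" for x t
    using G(6)[OF that] solution_points_regular by blast
  have "x0 \<in> ball x0 r" "t0 \<in> ball t0 \<rho>" using G(1,2) by auto
  then have "if (x0, t0) \<in> solution_points \<alpha> g
     then PVI_difference_dx g x0 t0 \<noteq> 0 \<and> G t0 = x0 \<and>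
       (\<forall>t\<in>ball t0 \<rho>. \<forall>x\<in>ball x0 r. (x, t) \<in> solution_points \<alpha> g \<longleftrightarrow> x = G t)
     else \<forall>t\<in>ball t0 \<rho>. \<forall>x\<in>ball x0 r. (x, t) \<notin> solution_points \<alpha> g"
    using False G0 all iff by (smt (verit))
  then show ?thesis using G by blast
next
  case True
  note dt = smooth[OF True]
  define W where "W = {z. (snd z, fst z) \<in> regular_points}"
  have swap: "continuous_on UNIV (\<lambda>z. (snd z, fst z) :: complex \<times> complex)"
    by (intro continuous_intros)
  have W: "open W" "(t0, x0) \<in> W"
    using open_vimage[OF open_regular_points swap] reg by (auto simp: W_def vimage_def)
  have der: "((\<lambda>z. PVI_difference g (snd z) (fst z)) has_derivative
      (\<lambda>z. PVI_difference_dt g x t * fst z + PVI_difference_dx g x t * snd z)) (at (t, x))"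
    if "(t, x) \<in> W" for t x
  proof -
    have s: "((\<lambda>z. (snd z, fst z)) has_derivative (\<lambda>z. (snd z, fst z))) (at (t, x))"
      by (intro has_derivative_Pair has_derivative_snd has_derivative_fst has_derivative_ident)
    have "(x, t) \<in> regular_points" using that by (simp add: W_def)
    from has_derivative_PVI_difference[OF this, of g]
    have "((\<lambda>z. PVI_difference g (fst z) (snd z)) has_derivative
      (\<lambda>z. PVI_difference_dx g x t * fst z + PVI_difference_dt g x t * snd z)) (at (snd (t, x), fst (t, x)))" by simp
    from has_derivative_compose[OF s this] show ?thesis by (simp add: add.commute)
  qed
  have cW: "continuous_on W (\<lambda>z. (snd z, fst z) :: complex \<times> complex)" "(\<lambda>z. (snd z, fst z)) ` W \<subseteq> regular_points"
    by (auto intro!: continuous_intros simp: W_def)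
  have cont: "continuous_on W (\<lambda>z. PVI_difference_dt g (snd z) (fst z))"
     "continuous_on W (\<lambda>z. PVI_difference_dx g (snd z) (fst z))"
    using continuous_on_compose2[OF continuous_PVI_difference_partials(2) cW, of g]
      continuous_on_compose2[OF continuous_PVI_difference_partials(1) cW, of g] by simp_all
  obtain \<rho> r T where T: "\<rho> > 0" "r > 0" "ball t0 \<rho> \<times> ball x0 r \<subseteq> W" "T holomorphic_on ball x0 r"
    "\<And>x. x \<in> ball x0 r \<Longrightarrow> T x \<in> ball t0 \<rho>"
    "\<And>t x. t \<in> ball t0 \<rho> \<Longrightarrow> x \<in> ball x0 r \<Longrightarrow> PVI_difference g x t = 0 \<longleftrightarrow> t = T x"
    using holomorphic_implicit_function[of W t0 x0 "\<lambda>t x. PVI_difference g x t"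
        "\<lambda>t x. PVI_difference_dt g x t" "\<lambda>t x. PVI_difference_dx g x t", OF W der cont zero dt] by blast
  have regT: "T x \<noteq> 0 \<and> T x \<noteq> 1 \<and> x \<noteq> 0 \<and> x \<noteq> 1 \<and> x \<noteq> T x" if "x \<in> ball x0 r" for x
    using T(3,5) that unfolding W_def regular_points_def by fastforce
  have T0: "T x0 = t0" using T(6)[of t0 x0] T(1,2) zero by simp
  have T'0: "deriv T x0 = 0"
  proof -
    have x0: "x0 \<in> ball x0 r" using T by simp
    have dT: "(T has_derivative (*) (deriv T x0)) (at x0)"
      using holomorphic_derivI[OF T(4) open_ball x0] by (simp add: has_field_derivative_def)
    have p: "((\<lambda>x. (x, T x)) has_derivative (\<lambda>h. (h, deriv T x0 * h))) (at x0)"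
      by (intro has_derivative_Pair has_derivative_ident dT)
    have "((\<lambda>z. PVI_difference g (fst z) (snd z)) has_derivative
      (\<lambda>z. PVI_difference_dx g x0 t0 * fst z + PVI_difference_dt g x0 t0 * snd z)) (at (x0, T x0))"
      using has_derivative_PVI_difference[OF reg] T0 by simp
    from has_derivative_compose[OF p this]
    have 1: "((\<lambda>x. PVI_difference g x (T x)) has_derivative (\<lambda>h. PVI_difference_dt g x0 t0 * (deriv T x0 * h)))
        (at x0)"
      by (simp add: True)
    have 2: "((\<lambda>x. PVI_difference g x (T x)) has_derivative (\<lambda>h. 0)) (at x0)"
      by (rule has_derivative_transform_within_open[OF has_derivative_const[of 0] open_ball x0])
         (use T(5,6) in force)
    show ?thesis using has_derivative_unique[OF 1 2] dt by (metis mult.right_neutral mult_eq_0_iff)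
  qed
  have none: "(x1, t1) \<notin> solution_points \<alpha> g" if S: "x1 \<in> ball x0 r" "t1 \<in> ball t0 \<rho>" for x1 t1
  proof
    assume "(x1, t1) \<in> solution_points \<alpha> g"
    then obtain f V where f: "germ f V" "t1 \<in> V" "f t1 = x1" "solves \<alpha> f V" "\<forall>u\<in>V. PVI_difference g (f u) u = 0"
      by (auto simp: solution_points_def)
    define W where "W = (V \<inter> f -` ball x0 r) \<inter> ball t0 \<rho>"
    have W: "open W"
      unfolding W_def using f(1)
      by (intro open_Int continuous_open_preimage holomorphic_on_imp_continuous_on) (auto simp: germ_def)
    have ne: "W \<noteq> {}" using S f by (auto simp: W_def)
    have "deriv T x0 \<noteq> 0"
    proof (rule no_critical_point[OF open_ball connected_ball T(4) holomorphic_on_ident regT W ne])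
      show "f holomorphic_on W" using f(1) by (auto simp: germ_def W_def intro: holomorphic_on_subset)
      show "T (f t) = t" if "t \<in> W" for t using T(6)[of t "f t"] f(5) that by (auto simp: W_def)
      show "solves \<alpha> f W" using f(4) by (auto simp: solves_def W_def)
    qed (use T in \<open>auto simp: W_def\<close>)
    with T'0 show False by simp
  qed
  then have "(x0, t0) \<notin> solution_points \<alpha> g" using T(1,2) by simp
  then show ?thesis using none T(1,2)
    by (intro exI[of _ r] conjI exI[of _ \<rho>] exI[of _ "\<lambda>_. x0"]) auto
qed

section \<open>The covering formed by the solutions on a smooth curve\<close>

text \<open>
For \<open>x\<close> large compared with \<open>t\<close> the terms with denominators are of order \<open>(1 + \<bar>t\<bar>)^2 / \<bar>x\<bar>^2\<close> and cannot cancel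
\<open>g0\<close>. In particular no point of the curve escapes to infinity over a bounded set of \<open>t\<close>.
\<close>
lemma curve_bounded:
  assumes reg: "(x, t) \<in> regular_points" and zero: "PVI_difference (g0, g1, g2, g3) x t = 0" and "g0 \<noteq> 0"
  shows "norm x \<le> (2 + (norm g1 + 4 * norm g2 + 4 * norm g3) / norm g0) * (1 + norm t)"
proof (rule ccontr)
  define k where "k = (norm g1 + 4 * norm g2 + 4 * norm g3) / norm g0"
  define T where "T = 1 + norm t"
  assume "\<not> ?thesis"
  then have x: "norm x > (2 + k) * T" by (simp add: k_def T_def)
  have k: "k \<ge> 0" "k * norm g0 = norm g1 + 4 * norm g2 + 4 * norm g3" using assms(3) by (auto simp: k_def)
  have T: "T \<ge> 1" "norm t \<le> T" "norm (t - 1) \<le> T"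
    using norm_triangle_ineq4[of t 1] by (simp_all add: T_def)
  have T3: "norm (t * (t - 1)) \<le> T\<^sup>2"
    unfolding norm_mult power2_eq_square by (rule mult_mono) (use T in auto)
  have "k * T \<ge> 0" by (rule mult_nonneg_nonneg) (use k T in auto)
  then have x2: "norm x > 2 * T" using x by (simp add: distrib_right)
  have x0: "norm x > 0" using x2 T by linarith
  have b1: "norm (x - 1) \<ge> norm x / 2" "norm (x - t) \<ge> norm x / 2"
    using x2 T norm_triangle_ineq2[of x 1] norm_triangle_ineq2[of x t] by auto
  have sq: "(norm (x - 1))\<^sup>2 \<ge> (norm x)\<^sup>2 / 4" "(norm (x - t))\<^sup>2 \<ge> (norm x)\<^sup>2 / 4"
    using power_mono[OF b1(1), of 2] power_mono[OF b1(2), of 2] by (auto simp: power_divide)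
  have T2: "T \<le> T\<^sup>2" using T by (simp add: power2_eq_square)
  have q: "norm (a * (b / c\<^sup>2)) \<le> norm a * T\<^sup>2 * (m / (norm x)\<^sup>2)"
    if "norm b \<le> T\<^sup>2" "(norm c)\<^sup>2 \<ge> (norm x)\<^sup>2 / m" "m > 0" for a b c :: complex and m :: real
  proof -
    have "norm b / (norm c)\<^sup>2 \<le> T\<^sup>2 / ((norm x)\<^sup>2 / m)"
      using that x0 by (intro frac_le) auto
    then have "norm a * (norm b / (norm c)\<^sup>2) \<le> norm a * (T\<^sup>2 / ((norm x)\<^sup>2 / m))"
      by (intro mult_left_mono) auto
    then show ?thesis by (simp add: norm_mult norm_divide norm_power)
  qed
  have "norm g0 = norm (g1 * (t / x\<^sup>2) - g2 * ((t - 1) / (x - 1)\<^sup>2) + g3 * (t * (t - 1) / (x - t)\<^sup>2))"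
    using zero by (auto simp: algebra_simps intro!: arg_cong[where f = norm])
  also have "\<dots> \<le> norm (g1 * (t / x\<^sup>2)) + norm (g2 * ((t - 1) / (x - 1)\<^sup>2)) + norm (g3 * (t * (t - 1) / (x - t)\<^sup>2))"
    by (rule order.trans[OF norm_triangle_ineq add_right_mono[OF norm_triangle_ineq4]])
  also have "\<dots> \<le> norm g1 * T\<^sup>2 * (1 / (norm x)\<^sup>2) + norm g2 * T\<^sup>2 * (4 / (norm x)\<^sup>2)
      + norm g3 * T\<^sup>2 * (4 / (norm x)\<^sup>2)"
    by (intro add_mono q) (use T T2 T3 sq in auto)
  also have "\<dots> = k * norm g0 * T\<^sup>2 / (norm x)\<^sup>2"
    unfolding k(2) by (simp add: field_simps add_divide_distrib)
  finally have "norm g0 * (norm x)\<^sup>2 \<le> k * norm g0 * T\<^sup>2" using x0 by (simp add: field_simps)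
  then have "(norm x)\<^sup>2 \<le> k * T\<^sup>2" using assms(3) by (simp add: mult.commute mult.left_commute)
  moreover have "(norm x)\<^sup>2 > ((2 + k) * T)\<^sup>2" using x k T by (intro power_strict_mono) auto
  moreover have "((2 + k) * T)\<^sup>2 \<ge> k * T\<^sup>2"
  proof -
    have "k \<le> (2 + k)\<^sup>2" using k by (simp add: power2_eq_square algebra_simps)
    then show ?thesis by (simp add: power_mult_distrib mult_right_mono)
  qed
  ultimately show False by linarith
qed

text \<open>
\<open>PVI_difference\<close> multiplied by \<open>x^2 (x - 1)^2 (x - t)^2\<close>, as a polynomial in \<open>x\<close> for fixed \<open>t\<close>.
\<close>
fun curve_poly :: "parameters \<Rightarrow> complex \<Rightarrow> complex poly" where
  "curve_poly (g0, g1, g2, g3) t =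
     smult g0 ([:0, 1:]\<^sup>2 * [:-1, 1:]\<^sup>2 * [:-t, 1:]\<^sup>2) - smult (g1 * t) ([:-1, 1:]\<^sup>2 * [:-t, 1:]\<^sup>2)
     + smult (g2 * (t - 1)) ([:0, 1:]\<^sup>2 * [:-t, 1:]\<^sup>2) - smult (g3 * (t * (t - 1))) ([:0, 1:]\<^sup>2 * [:-1, 1:]\<^sup>2)"

lemma poly_curve_poly:
  "poly (curve_poly (g0, g1, g2, g3) t) x = g0 * (x\<^sup>2 * (x - 1)\<^sup>2 * (x - t)\<^sup>2) - g1 * t * ((x - 1)\<^sup>2 * (x - t)\<^sup>2)
    + g2 * (t - 1) * (x\<^sup>2 * (x - t)\<^sup>2) - g3 * (t * (t - 1)) * (x\<^sup>2 * (x - 1)\<^sup>2)"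
  by (simp add: algebra_simps)

fun all_nonzero :: "parameters \<Rightarrow> bool" where
  "all_nonzero (g0, g1, g2, g3) \<longleftrightarrow> g0 \<noteq> 0 \<and> g1 \<noteq> 0 \<and> g2 \<noteq> 0 \<and> g3 \<noteq> 0"

text \<open>
If no coefficient vanishes, clearing denominators adds no points: at \<open>x = 0, 1, t\<close> a single term of
\<open>curve_poly\<close> survives, and it is nonzero.
\<close>
lemma curve_poly_zero_iff:
  assumes "all_nonzero g" "t \<noteq> 0" "t \<noteq> 1"
  shows "poly (curve_poly g t) x = 0 \<longleftrightarrow> (x, t) \<in> regular_points \<and> PVI_difference g x t = 0"
proof -
  obtain g0 g1 g2 g3 where g: "g = (g0, g1, g2, g3)" by (metis prod_cases4)
  have nz: "g1 \<noteq> 0" "g2 \<noteq> 0" "g3 \<noteq> 0" using assms by (auto simp: g)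
  have reg: "x \<noteq> 0 \<and> x \<noteq> 1 \<and> x \<noteq> t" if "poly (curve_poly g t) x = 0"
    using that nz assms(2,3) unfolding g poly_curve_poly by auto
  have "poly (curve_poly g t) x = PVI_difference g x t * (x\<^sup>2 * (x - 1)\<^sup>2 * (x - t)\<^sup>2)"
    if "x \<noteq> 0" "x \<noteq> 1" "x \<noteq> t"
  proof -
    define y z where "y = x - 1" "z = x - t"
    have "y \<noteq> 0" "z \<noteq> 0" using that by (auto simp: y_z_def)
    then show ?thesis unfolding g poly_curve_poly PVI_difference.simps y_z_def[symmetric]
      using that(1) by (simp add: field_simps)
  qed
  then show ?thesis using reg assms(2,3) by (auto simp: regular_points_def)
qed

lemma curve_fibre_finite:
  assumes "all_nonzero g" "t \<noteq> 0" "t \<noteq> 1"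
  shows "finite {x. poly (curve_poly g t) x = 0}" "card {x. poly (curve_poly g t) x = 0} \<le> 6"
proof -
  obtain g0 g1 g2 g3 where g: "g = (g0, g1, g2, g3)" by (metis prod_cases4)
  have "poly (curve_poly g t) 0 \<noteq> 0"
    using assms unfolding g poly_curve_poly by auto
  then have nz: "curve_poly g t \<noteq> 0" by auto
  have "degree (curve_poly g t) \<le> 6"
    unfolding g curve_poly.simps
    by (intro degree_diff_le degree_add_le order.trans[OF degree_smult_le])
       (simp_all add: degree_mult_eq degree_power_eq)
  then show "finite {x. poly (curve_poly g t) x = 0}" "card {x. poly (curve_poly g t) x = 0} \<le> 6"
    using poly_roots_finite[OF nz] card_poly_roots_bound[OF nz] by auto
qed

lemma solution_points_fibre:
  assumes "all_nonzero g" "t \<noteq> 0" "t \<noteq> 1"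
  shows "finite {x. (x, t) \<in> solution_points \<alpha> g}" "card {x. (x, t) \<in> solution_points \<alpha> g} \<le> 6"
proof -
  have sub: "{x. (x, t) \<in> solution_points \<alpha> g} \<subseteq> {x. poly (curve_poly g t) x = 0}"
    using solution_points_regular curve_poly_zero_iff[OF assms] by blast
  show "finite {x. (x, t) \<in> solution_points \<alpha> g}"
    using finite_subset[OF sub curve_fibre_finite(1)[OF assms]] .
  show "card {x. (x, t) \<in> solution_points \<alpha> g} \<le> 6"
    using card_mono[OF curve_fibre_finite(1)[OF assms] sub] curve_fibre_finite(2)[OF assms] by linarith
qed

text \<open>
Roots depend continuously on \<open>t\<close>. The roots over a compact neighbourhood of \<open>t0\<close> lie in a compact
set by \<open>curve_bounded\<close>; those outside the given discs form a compact set whose projection misses \<open>t0\<close>.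
\<close>
lemma curve_fibre_continuous:
  assumes g: "all_nonzero g" and t0: "t0 \<noteq> 0" "t0 \<noteq> 1"
    and r: "\<And>x. poly (curve_poly g t0) x = 0 \<Longrightarrow> r x > 0"
  shows "\<exists>\<rho>>0. \<forall>t\<in>ball t0 \<rho>. t \<noteq> 0 \<and> t \<noteq> 1 \<and> (\<forall>x. poly (curve_poly g t) x = 0 \<longrightarrow>
    (\<exists>x0. poly (curve_poly g t0) x0 = 0 \<and> x \<in> ball x0 (r x0)))"
proof -
  obtain g0 g1 g2 g3 where gg: "g = (g0, g1, g2, g3)" by (metis prod_cases4)
  have g0: "g0 \<noteq> 0" using g by (simp add: gg)
  define \<delta> where "\<delta> = min (norm t0) (norm (t0 - 1)) / 2"
  have \<delta>: "\<delta> > 0" using t0 by (simp add: \<delta>_def)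
  have av: "t \<noteq> 0 \<and> t \<noteq> 1" if "t \<in> cball t0 \<delta>" for t
    using that t0 by (auto simp: \<delta>_def dist_norm)
  define M where "M = (2 + (norm g1 + 4 * norm g2 + 4 * norm g3) / norm g0) * (1 + (norm t0 + \<delta>))"
  define Nb where "Nb = (\<Union>x\<in>{x. poly (curve_poly g t0) x = 0}. ball x (r x))"
  define F where "F = (\<lambda>z. poly (curve_poly g (snd z)) (fst z))"
  define K where "K = (cball 0 M \<times> cball t0 \<delta>) \<inter> F -` {0} \<inter> ((- Nb) \<times> UNIV)"
  have contF: "continuous_on UNIV F"
    unfolding F_def gg poly_curve_poly by (intro continuous_intros)
  have "closed (F -` {0})"
    using continuous_closed_preimage[OF contF closed_UNIV, of "{0}"] by simp
  moreover have "open Nb" unfolding Nb_def by auto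
  ultimately have "compact K"
    unfolding K_def by (intro compact_Int_closed compact_Times compact_cball closed_Times closed_Compl) auto
  then have "compact (snd ` K)" by (intro compact_continuous_image continuous_intros)
  then have "open (- (snd ` K))" by (simp add: compact_imp_closed open_Compl)
  moreover have "t0 \<notin> snd ` K"
    using r by (force simp: K_def F_def Nb_def)
  ultimately obtain \<rho> where \<rho>: "\<rho> > 0" "ball t0 \<rho> \<subseteq> - (snd ` K)" using openE by blast
  show ?thesis
  proof (intro exI[of _ "min \<rho> \<delta>"] conjI ballI)
    show "min \<rho> \<delta> > 0" using \<rho> \<delta> by simp
    fix t assume t: "t \<in> ball t0 (min \<rho> \<delta>)"
    then have tc: "t \<in> cball t0 \<delta>" by auto
    from av[OF this] show "t \<noteq> 0" "t \<noteq> 1" by auto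
    show "\<forall>x. poly (curve_poly g t) x = 0 \<longrightarrow> (\<exists>x0. poly (curve_poly g t0) x0 = 0 \<and> x \<in> ball x0 (r x0))"
    proof (intro allI impI)
      fix x assume x: "poly (curve_poly g t) x = 0"
      have "norm x \<le> (2 + (norm g1 + 4 * norm g2 + 4 * norm g3) / norm g0) * (1 + norm t)"
        using curve_bounded[of x t g0 g1 g2 g3] x curve_poly_zero_iff[OF g, of t x] av[OF tc] g0 by (simp add: gg)
      also have "\<dots> \<le> M"
      proof -
        have "norm t \<le> norm t0 + \<delta>" using tc norm_triangle_sub[of t t0] by (auto simp: dist_norm norm_minus_commute)
        then show ?thesis unfolding M_def by (intro mult_left_mono) auto
      qed
      finally have "norm x \<le> M" .
      moreover have "t \<notin> snd ` K" using t \<rho> by auto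
      then have "(x, t) \<notin> K" by force
      ultimately have "x \<in> Nb" using x tc by (auto simp: K_def F_def)
      then show "\<exists>x0. poly (curve_poly g t0) x0 = 0 \<and> x \<in> ball x0 (r x0)" by (auto simp: Nb_def)
    qed
  qed
qed

text \<open>
The local sheets of \<open>solution_points_local\<close> at the finitely many points over \<open>t0\<close> exhaust the fibre over
a nearby \<open>t\<close> by \<open>curve_fibre_continuous\<close>, and sheets through different points stay apart.
\<close>
lemma solution_points_covering:
  fixes \<alpha> g :: parameters
  assumes g: "all_nonzero g" and t0: "t0 \<noteq> 0" "t0 \<noteq> 1"
    and smooth: "\<And>x t. (x, t) \<in> regular_points \<Longrightarrow> PVI_difference g x t = 0 \<Longrightarrow>
      PVI_difference_dx g x t = 0 \<Longrightarrow> PVI_difference_dt g x t \<noteq> 0"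
  defines "Z \<equiv> \<lambda>t. {x. (x, t) \<in> solution_points \<alpha> g}"
  shows "\<exists>\<rho>>0. \<exists>G. (\<forall>x\<in>Z t0. G x holomorphic_on ball t0 \<rho>) \<and>
    (\<forall>t\<in>ball t0 \<rho>. Z t = (\<lambda>x. G x t) ` Z t0 \<and> inj_on (\<lambda>x. G x t) (Z t0))"
proof -
  define X where "X = {x. poly (curve_poly g t0) x = 0}"
  have finX: "finite X" unfolding X_def by (rule curve_fibre_finite[OF g t0])
  define P where "P x r \<rho> G \<longleftrightarrow> r > 0 \<and> \<rho> > 0 \<and> G holomorphic_on ball t0 \<rho> \<and> (\<forall>t\<in>ball t0 \<rho>. G t \<in> ball x r) \<and>
    (if (x, t0) \<in> solution_points \<alpha> g
     then PVI_difference_dx g x t0 \<noteq> 0 \<and> G t0 = x \<and>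
       (\<forall>t\<in>ball t0 \<rho>. \<forall>x'\<in>ball x r. (x', t) \<in> solution_points \<alpha> g \<longleftrightarrow> x' = G t)
     else \<forall>t\<in>ball t0 \<rho>. \<forall>x'\<in>ball x r. (x', t) \<notin> solution_points \<alpha> g)" for x r \<rho> G
  have "\<exists>r \<rho> G. P x r \<rho> G" if "x \<in> X" for x
  proof -
    have reg: "(x, t0) \<in> regular_points" "PVI_difference g x t0 = 0"
      using that curve_poly_zero_iff[OF g t0] by (auto simp: X_def)
    show ?thesis unfolding P_def using solution_points_local[OF reg smooth[OF reg], of \<alpha>] by blast
  qed
  then obtain r \<rho> G where P: "\<And>x. x \<in> X \<Longrightarrow> P x (r x) (\<rho> x) (G x)" by metis
  have pos: "r x > 0" "\<rho> x > 0" and holG: "G x holomorphic_on ball t0 (\<rho> x)"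
    and Gin: "\<forall>t\<in>ball t0 (\<rho> x). G x t \<in> ball x (r x)" if "x \<in> X" for x
    using P[OF that] unfolding P_def by blast+
  have G0: "G x t0 = x" and Giff: "\<forall>t\<in>ball t0 (\<rho> x). \<forall>x'\<in>ball x (r x). (x', t) \<in> solution_points \<alpha> g \<longleftrightarrow> x' = G x t"
    if "x \<in> X" "(x, t0) \<in> solution_points \<alpha> g" for x
    using P[OF that(1)] unfolding P_def if_P[OF that(2)] by blast+
  have Gnone: "\<forall>t\<in>ball t0 (\<rho> x). \<forall>x'\<in>ball x (r x). (x', t) \<notin> solution_points \<alpha> g"
    if "x \<in> X" "(x, t0) \<notin> solution_points \<alpha> g" for x
    using P[OF that(1)] unfolding P_def if_not_P[OF that(2)] by blast
  obtain \<rho>0 where \<rho>0: "\<rho>0 > 0" "\<And>t. t \<in> ball t0 \<rho>0 \<Longrightarrow> t \<noteq> 0 \<and> t \<noteq> 1 \<and> (\<forall>x. poly (curve_poly g t) x = 0 \<longrightarrow>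
      (\<exists>x0\<in>X. x \<in> ball x0 (r x0)))"
  proof -
    have "r x > 0" if "poly (curve_poly g t0) x = 0" for x using pos(1)[of x] that by (simp add: X_def)
    from curve_fibre_continuous[where r = r, OF g t0 this] obtain \<rho>0 where h: "\<rho>0 > 0"
      "\<forall>t\<in>ball t0 \<rho>0. t \<noteq> 0 \<and> t \<noteq> 1 \<and> (\<forall>x. poly (curve_poly g t) x = 0 \<longrightarrow>
        (\<exists>x0. poly (curve_poly g t0) x0 = 0 \<and> x \<in> ball x0 (r x0)))" by auto
    show thesis
    proof (rule that[OF h(1)])
      fix t assume "t \<in> ball t0 \<rho>0"
      from bspec[OF h(2) this] show "t \<noteq> 0 \<and> t \<noteq> 1 \<and> (\<forall>x. poly (curve_poly g t) x = 0 \<longrightarrow>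
          (\<exists>x0\<in>X. x \<in> ball x0 (r x0)))"
        by (simp add: X_def)
    qed
  qed
  have ZX: "Z t0 \<subseteq> X"
    using solution_points_regular[of _ t0 \<alpha> g] curve_poly_zero_iff[OF g t0] unfolding Z_def X_def by blast
  have finZ: "finite (Z t0)" using finite_subset[OF ZX finX] .
  have "\<forall>\<^sub>F t in at t0. \<forall>x\<in>Z t0. \<forall>y\<in>Z t0. x \<noteq> y \<longrightarrow> G x t \<noteq> G y t"
  proof (intro eventually_ball_finite finZ ballI)
    fix x y assume xy: "x \<in> Z t0" "y \<in> Z t0"
    have lim: "(G x \<longlongrightarrow> x) (at t0)" if "x \<in> Z t0" for x
    proof -
      have "x \<in> X" using that ZX by auto
      then have h: "G x holomorphic_on ball t0 (\<rho> x)" "G x t0 = x" "t0 \<in> ball t0 (\<rho> x)"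
        using that holG G0 pos by (simp_all add: Z_def)
      have "isCont (G x) t0"
        using holomorphic_on_imp_continuous_on[OF h(1)] h(3) by (simp add: continuous_on_eq_continuous_at)
      then show ?thesis using h(2) by (simp add: isCont_def)
    qed
    show "\<forall>\<^sub>F t in at t0. x \<noteq> y \<longrightarrow> G x t \<noteq> G y t"
    proof (cases "x = y")
      case False
      then have "\<forall>\<^sub>F t in at t0. G x t - G y t \<noteq> 0"
        by (intro tendsto_imp_eventually_ne[OF tendsto_diff[OF lim lim]] xy) auto
      then show ?thesis by eventually_elim auto
    qed simp
  qed
  then obtain d where d: "d > 0" "\<And>t x y. t \<noteq> t0 \<Longrightarrow> dist t t0 < d \<Longrightarrow> x \<in> Z t0 \<Longrightarrow> y \<in> Z t0 \<Longrightarrow> x \<noteq> y \<Longrightarrow> G x t \<noteq> G y t"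
    unfolding eventually_at by blast
  (* Small enough for all sheets, for the localisation of the fibre and for the separation of the sheets. *)
  define \<rho>' where "\<rho>' = Min (insert d (insert \<rho>0 (\<rho> ` X)))"
  have \<rho>': "\<rho>' > 0" "\<rho>' \<le> d" "\<rho>' \<le> \<rho>0" "\<And>x. x \<in> X \<Longrightarrow> \<rho>' \<le> \<rho> x"
  proof -
    have fin: "finite (insert d (insert \<rho>0 (\<rho> ` X)))" using finX by simp
    show "\<rho>' > 0" unfolding \<rho>'_def Min_gr_iff[OF fin insert_not_empty] using d(1) \<rho>0(1) pos(2) by auto
    show "\<rho>' \<le> d" "\<rho>' \<le> \<rho>0" "\<And>x. x \<in> X \<Longrightarrow> \<rho>' \<le> \<rho> x"
      unfolding \<rho>'_def by (rule Min_le[OF fin]; simp)+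
  qed
  have G0': "G x t0 = x" if "x \<in> Z t0" for x using G0[of x] that ZX by (auto simp: Z_def)
  show ?thesis
  proof (intro exI[of _ \<rho>'] exI[of _ G] conjI ballI)
    show "G x holomorphic_on ball t0 \<rho>'" if "x \<in> Z t0" for x
    proof -
      have "x \<in> X" using that ZX by blast
      from holomorphic_on_subset[OF holG[OF this] subset_ball[OF \<rho>'(4)[OF this]]] show ?thesis .
    qed
    fix t assume t: "t \<in> ball t0 \<rho>'"
    show "inj_on (\<lambda>x. G x t) (Z t0)"
    proof (cases "t = t0")
      case True then show ?thesis using G0' by (auto simp: inj_on_def)
    next
      case False
      have "dist t t0 < d" using t \<rho>'(2) by (auto simp: dist_commute)
      then show ?thesis using d(2)[OF False] by (auto simp: inj_on_def)
    qed
    have tr: "t \<in> ball t0 (\<rho> x)" if "x \<in> X" for x using t \<rho>'(4)[OF that] by auto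
    have t': "t \<in> ball t0 \<rho>0" using t \<rho>'(3) by auto
    show "Z t = (\<lambda>x. G x t) ` Z t0"
    proof (intro equalityI subsetI)
      fix x assume x: "x \<in> Z t"
      then have "poly (curve_poly g t) x = 0"
        using solution_points_regular[of x t \<alpha> g] curve_poly_zero_iff[OF g, of t x] \<rho>0(2)[OF t'] unfolding Z_def
            by blast
      then obtain x0 where x0: "x0 \<in> X" "x \<in> ball x0 (r x0)" using \<rho>0(2)[OF t'] by auto
      show "x \<in> (\<lambda>x. G x t) ` Z t0"
      proof (cases "x0 \<in> Z t0")
        case True
        then have "x = G x0 t"
          using Giff[OF x0(1)] tr[OF x0(1)] x0(2) x unfolding Z_def by blast
        then show ?thesis using True by blast
      next
        case False
        then show ?thesis using Gnone[OF x0(1)] tr[OF x0(1)] x0(2) x unfolding Z_def by blast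
      qed
    next
      fix x assume "x \<in> (\<lambda>x. G x t) ` Z t0"
      then obtain x0 where x0: "x0 \<in> Z t0" "x = G x0 t" by auto
      then have "x0 \<in> X" using ZX by auto
      then show "x \<in> Z t" using Giff[OF \<open>x0 \<in> X\<close>] Gin[OF \<open>x0 \<in> X\<close>] tr[OF \<open>x0 \<in> X\<close>] x0 unfolding Z_def by blast
    qed
  qed (use \<rho>' in auto)
qed

text \<open>
A holomorphic function on a finite covering takes the same values on every fibre if it is bounded near
\<open>0, 1, \<infinity>\<close>: the product of \<open>w - \<psi>\<close> over the fibre is a single-valued bounded holomorphic function of
\<open>t\<close> off \<open>0, 1\<close>, hence constant by Riemann and Liouville. It vanishes at \<open>t\<close> exactly if \<open>w\<close> is a value over \<open>t\<close>.
\<close>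
lemma bounded_on_covering_values:
  fixes Z :: "complex \<Rightarrow> complex set" and \<psi> :: "complex \<Rightarrow> complex \<Rightarrow> complex"
  assumes loc: "\<And>t0. t0 \<noteq> 0 \<Longrightarrow> t0 \<noteq> 1 \<Longrightarrow> \<exists>\<rho>>0. \<exists>G. (\<forall>x\<in>Z t0. (\<lambda>t. \<psi> (G x t) t) holomorphic_on ball t0 \<rho>) \<and>
      (\<forall>t\<in>ball t0 \<rho>. Z t = (\<lambda>x. G x t) ` Z t0 \<and> inj_on (\<lambda>x. G x t) (Z t0))"
    and fin: "\<And>t. t \<noteq> 0 \<Longrightarrow> t \<noteq> 1 \<Longrightarrow> finite (Z t) \<and> card (Z t) \<le> N"
    and bdd: "\<And>F. F \<in> {at 0, at 1, at_infinity} \<Longrightarrow> \<forall>\<^sub>F t in F. \<forall>x\<in>Z t. norm (\<psi> x t) \<le> B"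
    and t1: "t1 \<noteq> 0" "t1 \<noteq> 1" and t2: "t2 \<noteq> 0" "t2 \<noteq> 1" and w: "w \<in> (\<lambda>x. \<psi> x t1) ` Z t1"
  shows "w \<in> (\<lambda>x. \<psi> x t2) ` Z t2"
proof -
  define p where "p t = (\<Prod>x\<in>Z t. w - \<psi> x t)" for t
  have hol: "p holomorphic_on (UNIV - {0, 1})"
  proof (rule holomorphic_onI)
    fix t0 :: complex assume "t0 \<in> UNIV - {0, 1}"
    then have "t0 \<noteq> 0" "t0 \<noteq> 1" by auto
    from loc[OF this] obtain \<rho> G where G: "\<rho> > 0" "\<And>x. x \<in> Z t0 \<Longrightarrow> (\<lambda>t. \<psi> (G x t) t) holomorphic_on ball t0 \<rho>"
      "\<And>t. t \<in> ball t0 \<rho> \<Longrightarrow> Z t = (\<lambda>x. G x t) ` Z t0 \<and> inj_on (\<lambda>x. G x t) (Z t0)"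
      by blast
    have eq: "p t = (\<Prod>x\<in>Z t0. w - \<psi> (G x t) t)" if "t \<in> ball t0 \<rho>" for t
      unfolding p_def using G(3)[OF that] by (simp add: prod.reindex)
    have "(\<lambda>t. \<Prod>x\<in>Z t0. w - \<psi> (G x t) t) holomorphic_on ball t0 \<rho>"
      by (intro holomorphic_intros G(2))
    then have "p holomorphic_on ball t0 \<rho>" by (rule holomorphic_transform) (use eq in simp)
    then show "p field_differentiable at t0 within UNIV - {0, 1}"
      using G(1) by (meson centre_in_ball field_differentiable_at_within holomorphic_on_imp_differentiable_at
          open_ball)
  qed
  define b where "b = (1 + norm w + \<bar>B\<bar>) ^ N"
  have bd: "norm (p t) \<le> b" if "\<forall>x\<in>Z t. norm (\<psi> x t) \<le> B" "t \<noteq> 0" "t \<noteq> 1" for t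
  proof -
    have "norm (p t) = (\<Prod>x\<in>Z t. norm (w - \<psi> x t))" unfolding p_def by (rule prod_norm[symmetric])
    also have "\<dots> \<le> (\<Prod>x\<in>Z t. 1 + norm w + \<bar>B\<bar>)"
    proof (intro prod_mono conjI norm_ge_zero)
      fix x assume "x \<in> Z t"
      then show "norm (w - \<psi> x t) \<le> 1 + norm w + \<bar>B\<bar>"
        using that(1) norm_triangle_ineq4[of w "\<psi> x t"] by fastforce
    qed
    also have "\<dots> = (1 + norm w + \<bar>B\<bar>) ^ card (Z t)" by simp
    also have "\<dots> \<le> b" unfolding b_def by (intro power_increasing) (use fin[OF that(2,3)] in auto)
    finally show ?thesis .
  qed
  have n1: "\<forall>\<^sub>F t in at z. t \<noteq> (0::complex) \<and> t \<noteq> 1" for z :: complex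
    by (intro eventually_conj eventually_neq_at_within)
  have ev: "\<forall>\<^sub>F t in at z. norm (p t) \<le> b" if "z \<in> {0, 1}" for z
    by (rule eventually_mono[OF eventually_conj[OF bdd[of "at z"] n1[of z]]]) (use that bd in auto)
  have big: "p \<in> O[at z](\<lambda>_. 1)" if "z \<in> {0, 1}" for z
    using ev[OF that] by (intro bigoI[of _ b]) simp
  obtain q where q: "q holomorphic_on UNIV" "\<And>t. t \<in> UNIV - {0, 1} \<Longrightarrow> q t = p t"
    using removable_singularities[of "{0, 1}" UNIV p] hol big by auto
  have n2: "\<forall>\<^sub>F t in at_infinity. t \<noteq> (0::complex) \<and> t \<noteq> 1"
    unfolding eventually_at_infinity by (rule exI[of _ 2]) auto
  have "\<forall>\<^sub>F t in at_infinity. norm (q t) \<le> b"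
    by (rule eventually_mono[OF eventually_conj[OF bdd[of at_infinity] n2]]) (auto simp: q(2) intro!: bd)
  then obtain R where R: "\<And>t. norm t \<ge> R \<Longrightarrow> norm (q t) \<le> b" unfolding eventually_at_infinity by auto
  have "bounded (q ` cball 0 R)"
    by (intro compact_imp_bounded compact_continuous_image holomorphic_on_imp_continuous_on compact_cball
        holomorphic_on_subset[OF q(1)]) auto
  then obtain b' where "\<forall>t\<in>cball 0 R. norm (q t) \<le> b'" unfolding bounded_iff by blast
  then have "norm (q t) \<le> max b b'" for t using R[of t] by (cases "norm t \<ge> R") (auto simp: le_max_iff_disj not_le)
  then have "bounded (range q)" unfolding bounded_iff by blast
  then obtain c where c: "\<And>t. q t = c" using Liouville_theorem[OF q(1)] by (auto simp: constant_on_def)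
  have "p t1 = 0" unfolding p_def using w fin[OF t1] by (auto simp: prod_zero_iff)
  then have "p t2 = 0" using c q(2) t1 t2 by (metis Diff_iff UNIV_I empty_iff insert_iff)
  then show ?thesis unfolding p_def using fin[OF t2] by (auto simp: prod_zero_iff)
qed

section \<open>Smooth curves carry only constant solutions\<close>

lemma tendsto_zero_of_cube:
  fixes f :: "nat \<Rightarrow> complex"
  assumes "(\<lambda>n. f n ^ 3) \<longlonglongrightarrow> 0"
  shows "f \<longlonglongrightarrow> 0"
proof (rule tendsto_norm_zero_cancel)
  have "(\<lambda>n. norm (f n) ^ 3) \<longlonglongrightarrow> 0" using tendsto_norm_zero[OF assms] by (simp add: norm_power)
  then show "(\<lambda>n. norm (f n)) \<longlonglongrightarrow> 0" by simp
qed

text \<open>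
Along points of the curve with \<open>t \<rightarrow> 0\<close> and \<open>x \<rightarrow> c\<close>, suppose that one of \<open>x R_x\<close>, \<open>(x - 1) R_x\<close>, \<open>(x - t) R_x\<close>
tends to \<open>0\<close>. The equation of the curve excludes \<open>c = 1\<close>, and for other \<open>c \<noteq> 0\<close> the limit \<open>2 g2 / (c - 1)^3\<close> of
\<open>R_x\<close> is nonzero. For \<open>c = 0\<close> the smallness forces \<open>w = t^2 / (x - t)^3 \<rightarrow> e\<close> with \<open>e\<close> a nonzero multiple
of \<open>g0 - g2\<close>; hence \<open>t / (x - t) \<rightarrow> 0\<close>, and the equation of the curve yields \<open>g1 = g3\<close> at leading order
and \<open>g0 + 2 g1 e - g2 = 0\<close> at the next one. Together with \<open>g0 - g2 = g1 e\<close> this contradicts \<open>g0 \<noteq> g2\<close>.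
\<close>
lemma curve_near_zero_sequence:
  fixes X T :: "nat \<Rightarrow> complex" and g0 g1 g2 g3 :: complex
  defines "D \<equiv> \<lambda>n. PVI_difference_dx (g0, g1, g2, g3) (X n) (T n)"
  assumes nz: "g0 \<noteq> 0" "g1 \<noteq> 0" "g2 \<noteq> 0" "g3 \<noteq> 0" "g0 \<noteq> g2"
    and reg: "\<And>n. (X n, T n) \<in> regular_points"
    and zero: "\<And>n. PVI_difference (g0, g1, g2, g3) (X n) (T n) = 0"
    and T: "T \<longlonglongrightarrow> 0" and X: "X \<longlonglongrightarrow> c"
    and small: "(\<lambda>n. X n * D n) \<longlonglongrightarrow> 0 \<or> (\<lambda>n. (X n - 1) * D n) \<longlonglongrightarrow> 0 \<or> (\<lambda>n. (X n - T n) * D n) \<longlonglongrightarrow> 0"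
  shows False
proof -
  have ne: "T n \<noteq> 0" "X n \<noteq> 0" "X n - 1 \<noteq> 0" "X n - T n \<noteq> 0" for n
    using reg[of n] by (auto simp: regular_points_def)
  have R: "g0 - g1 * (T n / (X n)\<^sup>2) + g2 * ((T n - 1) / (X n - 1)\<^sup>2) - g3 * (T n * (T n - 1) / (X n - T n)\<^sup>2)
      = 0" for n
    using zero[of n] by simp
  have D: "D n = 2 * g1 * T n / X n ^ 3 - 2 * g2 * (T n - 1) / (X n - 1) ^ 3 + 2 * g3 * (T n * (T n - 1)) / (X n
      - T n) ^ 3" for n
    by (simp add: D_def)
  have half: "a * (2 * b) / 2 = a * b" for a b :: complex by simp
  have Dh: "D n = 2 * (g1 * T n / X n ^ 3 - g2 * (T n - 1) / (X n - 1) ^ 3 + g3 * (T n * (T n - 1)) / (X n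
      - T n) ^ 3)" for n
    by (simp add: D right_diff_distrib distrib_left mult.assoc)
  show False
  proof (cases "c = 0")
    case False
    have "c \<noteq> 1"
    proof
      assume c: "c = 1"
      have id: "g2 * (T n - 1) = (X n - 1)\<^sup>2 * (- g0 + g1 * (T n / (X n)\<^sup>2) + g3 * (T n * (T n - 1) / (X n
          - T n)\<^sup>2))" for n
      proof -
        have "g2 * ((T n - 1) / (X n - 1)\<^sup>2) = - g0 + g1 * (T n / (X n)\<^sup>2) + g3 * (T n * (T n - 1) / (X n - T n)\<^sup>2)"
          using R[of n] by (simp add: algebra_simps)
        from this[symmetric] show ?thesis using ne[of n] by simp
      qed
      have "(\<lambda>n. (X n - 1)\<^sup>2 * (- g0 + g1 * (T n / (X n)\<^sup>2) + g3 * (T n * (T n - 1) / (X n - T n)\<^sup>2))) \<longlonglongrightarrow> 0"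
        by (rule tendsto_eq_intros X T refl | simp add: c)+
      then have "(\<lambda>n. g2 * (T n - 1)) \<longlonglongrightarrow> 0" unfolding id .
      moreover have "(\<lambda>n. g2 * (T n - 1)) \<longlonglongrightarrow> - g2"
        by (rule tendsto_eq_intros T refl | simp)+
      ultimately have "0 = - g2" by (rule LIMSEQ_unique)
      then show False using nz(3) by simp
    qed
    have "D \<longlonglongrightarrow> 2 * g2 / (c - 1) ^ 3"
      unfolding D[abs_def] by (rule tendsto_eq_intros X T refl | use False \<open>c \<noteq> 1\<close> in simp)+
    note lims = tendsto_mult[OF X this] tendsto_mult[OF tendsto_diff[OF X tendsto_const[of 1]] this]
      tendsto_mult[OF tendsto_diff[OF X T] this]
    have "2 * g2 / (c - 1) ^ 3 \<noteq> 0" "c - 1 \<noteq> 0" "c - 0 \<noteq> 0" using nz(3) False \<open>c \<noteq> 1\<close> by auto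
    then have nz': "c * (2 * g2 / (c - 1) ^ 3) \<noteq> 0" "(c - 1) * (2 * g2 / (c - 1) ^ 3) \<noteq> 0"
        "(c - 0) * (2 * g2 / (c - 1) ^ 3) \<noteq> 0"
      using False by simp_all
    from small show False
      by (elim disjE) (use nz' LIMSEQ_unique[OF lims(1)] LIMSEQ_unique[OF lims(2)] LIMSEQ_unique[OF lims(3)] in
          blast)+
  next
    case True
    (* The distinguished scale: on it t and (x - t)^(3/2) are comparable. *)
    define w where "w n = (T n)\<^sup>2 / (X n - T n) ^ 3" for n
    have X1: "(\<lambda>n. X n - 1) \<longlonglongrightarrow> - 1" using X True by (auto intro!: tendsto_eq_intros)
    have "\<exists>e. w \<longlonglongrightarrow> e \<and> (g0 - g2 = g3 * e \<or> g0 - g2 = g1 * e)"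
    proof -
      have XD: ?thesis if s: "(\<lambda>n. X n * D n) \<longlonglongrightarrow> 0"
      proof -
        have id: "g3 * w n * (T n - 1) = X n * D n / 2 - g0 + g2 * ((T n - 1) / (X n - 1) ^ 3)" for n
        proof -
          define y z where "y = X n - 1" "z = X n - T n"
          have yz: "y \<noteq> 0" "z \<noteq> 0" "X n \<noteq> 0" using ne[of n] by (auto simp: y_z_def)
          have "X n * D n / 2 = X n * (g1 * T n / X n ^ 3 - g2 * (T n - 1) / y ^ 3 + g3 * (T n * (T n - 1)) / z ^ 3)"
            unfolding Dh y_z_def by (rule half)
          also have "\<dots> = g1 * (T n / (X n)\<^sup>2) - g2 * ((T n - 1) / y\<^sup>2) - g2 * ((T n - 1) / y ^ 3)
              + g3 * (T n * (T n - 1) / z\<^sup>2) + g3 * (T n)\<^sup>2 * (T n - 1) / z ^ 3"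
            using yz by (simp add: field_simps) (simp add: y_z_def, algebra)
          finally have L: "X n * D n / 2 = g1 * (T n / (X n)\<^sup>2) - g2 * ((T n - 1) / y\<^sup>2) - g2 * ((T n - 1) / y ^ 3)
              + g3 * (T n * (T n - 1) / z\<^sup>2) + g3 * (T n)\<^sup>2 * (T n - 1) / z ^ 3" .
          have "u = L - g0 + r" if "L = p - q - r + s + u" "g0 - p + q - s = 0" for L p q r s u :: complex
            using that by algebra
          from this[OF L R[of n, folded y_z_def]] show ?thesis unfolding w_def y_z_def[symmetric] by simp
        qed
        have "(\<lambda>n. (X n * D n / 2 - g0 + g2 * ((T n - 1) / (X n - 1) ^ 3)) / (g3 * (T n - 1))) \<longlonglongrightarrow> (g0 - g2) / g3"
          by (rule tendsto_eq_intros s T X1 refl | use nz in \<open>simp add: field_simps\<close>)+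
        moreover have "(X n * D n / 2 - g0 + g2 * ((T n - 1) / (X n - 1) ^ 3)) / (g3 * (T n - 1)) = w n" for n
          unfolding id[symmetric] using nz reg[of n] by (simp add: regular_points_def)
        ultimately show ?thesis using nz by (intro exI[of _ "(g0 - g2) / g3"]) auto
      qed
      from small show ?thesis
      proof (elim disjE)
        assume s: "(\<lambda>n. (X n - 1) * D n) \<longlonglongrightarrow> 0"
        (* The factor x - 1 tends to -1, so this case is implied by the previous one. *)
        have "(\<lambda>n. X n * (((X n - 1) * D n) / (X n - 1))) \<longlonglongrightarrow> 0 * (0 / (- 1))"
          by (intro tendsto_intros s X1 X[unfolded True]) simp
        then have "(\<lambda>n. X n * D n) \<longlonglongrightarrow> 0" using ne(3) by simp
        then show ?thesis by (rule XD)
      next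
        assume s: "(\<lambda>n. (X n - T n) * D n) \<longlonglongrightarrow> 0"
        define v where "v n = (T n)\<^sup>2 / X n ^ 3" for n
        have id: "g1 * v n = g0 + g2 * ((T n - 1)\<^sup>2 / (X n - 1) ^ 3) - (X n - T n) * D n / 2" for n
        proof -
          define y z where "y = X n - 1" "z = X n - T n"
          have yz: "y \<noteq> 0" "z \<noteq> 0" "X n \<noteq> 0" using ne[of n] by (auto simp: y_z_def)
          have "z * D n / 2 = z * (g1 * T n / X n ^ 3 - g2 * (T n - 1) / y ^ 3 + g3 * (T n * (T n - 1)) / z ^ 3)"
            unfolding Dh y_z_def by (rule half)
          also have "\<dots> = g1 * (T n / (X n)\<^sup>2) - g1 * ((T n)\<^sup>2 / X n ^ 3) - g2 * ((T n - 1) / y\<^sup>2) + g2 * ((T n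
              - 1)\<^sup>2 / y ^ 3)
              + g3 * (T n * (T n - 1) / z\<^sup>2)"
            using yz by (simp add: field_simps) (simp add: y_z_def, algebra)
          finally have L: "z * D n / 2
              = g1 * (T n / (X n)\<^sup>2) - g1 * ((T n)\<^sup>2 / X n ^ 3) - g2 * ((T n - 1) / y\<^sup>2) + g2 * ((T n - 1)\<^sup>2 / y ^ 3)
              + g3 * (T n * (T n - 1) / z\<^sup>2)" .
          have "v = g0 + r - L" if "L = p - v - q + r + s" "g0 - p + q - s = 0" for L p q r s v :: complex
            using that by algebra
          from this[OF L R[of n, folded y_z_def]] show ?thesis unfolding v_def y_z_def[symmetric] .
        qed
        have "(\<lambda>n. (g0 + g2 * ((T n - 1)\<^sup>2 / (X n - 1) ^ 3) - (X n - T n) * D n / 2) / g1) \<longlonglongrightarrow> (g0 - g2) / g1"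
          by (rule tendsto_eq_intros s T X1 refl | use nz in \<open>simp add: field_simps\<close>)+
        then have v: "v \<longlonglongrightarrow> (g0 - g2) / g1" unfolding id[symmetric] using nz by simp
        have "(\<lambda>n. (T n / X n) ^ 3) \<longlonglongrightarrow> 0"
        proof -
          have "(\<lambda>n. T n * v n) \<longlonglongrightarrow> 0" using tendsto_mult[OF T v] by simp
          moreover have "T n * v n = (T n / X n) ^ 3" for n
            using ne[of n] by (simp add: v_def field_simps power2_eq_square power3_eq_cube)
          ultimately show ?thesis by simp
        qed
        then have k: "(\<lambda>n. T n / X n) \<longlonglongrightarrow> 0" by (rule tendsto_zero_of_cube)
        have "(\<lambda>n. v n * (1 / (1 - T n / X n)) ^ 3) \<longlonglongrightarrow> (g0 - g2) / g1"
          by (rule tendsto_eq_intros v k refl | simp)+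
        moreover have "v n * (1 / (1 - T n / X n)) ^ 3 = w n" for n
        proof -
          have "1 - T n / X n = (X n - T n) / X n" using ne[of n] by (simp add: field_simps)
          then show ?thesis unfolding v_def w_def using ne[of n] by (simp add: field_simps)
        qed
        ultimately show ?thesis using nz by (intro exI[of _ "(g0 - g2) / g1"]) auto
      qed (rule XD)
    qed
    then obtain e where e: "w \<longlonglongrightarrow> e" "g0 - g2 = g3 * e \<or> g0 - g2 = g1 * e" by blast
    have e0: "e \<noteq> 0" using e(2) nz by auto
    define k where "k n = T n / (X n - T n)" for n
    have "(\<lambda>n. k n ^ 3) \<longlonglongrightarrow> 0"
    proof -
      have "(\<lambda>n. T n * w n) \<longlonglongrightarrow> 0" using tendsto_mult[OF T e(1)] by simp
      moreover have "T n * w n = k n ^ 3" for n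
        using ne[of n] by (simp add: w_def k_def field_simps power2_eq_square power3_eq_cube)
      ultimately show ?thesis by simp
    qed
    then have k: "k \<longlonglongrightarrow> 0" by (rule tendsto_zero_of_cube)
    define m where "m n = 1 + k n" for n
    have m: "m \<longlonglongrightarrow> 1" unfolding m_def using tendsto_add[OF tendsto_const[of 1] k] by simp
    have mX: "X n = m n * (X n - T n)" for n using ne[of n] by (simp add: m_def k_def field_simps)
    (* The equation of the curve multiplied by k / w = (x - t)^2 / t. *)
    have eq: "g1 = g3"
    proof -
      have id: "g0 * (k n / w n) - g1 * (1 / (m n)\<^sup>2) + g2 * ((T n - 1) / (X n - 1)\<^sup>2) * (k n / w n) - g3 * (T n
          - 1) = 0" for n
      proof -
        define z where "z = X n - T n"
        have z: "z \<noteq> 0" "m n \<noteq> 0" "X n = m n * z" "T n \<noteq> 0" using ne[of n] mX[of n] by (auto simp: z_def)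
        have kw: "k n / w n = z\<^sup>2 / T n"
          unfolding k_def w_def z_def[symmetric] using z by (simp add: field_simps power2_eq_square power3_eq_cube)
        have "g1 * (T n / (X n)\<^sup>2) * (z\<^sup>2 / T n) = g1 * (1 / (m n)\<^sup>2)"
          unfolding z(3) using z by (simp add: field_simps)
        moreover have "g3 * (T n * (T n - 1) / z\<^sup>2) * (z\<^sup>2 / T n) = g3 * (T n - 1)" using z by simp
        moreover have "(g0 - g1 * (T n / (X n)\<^sup>2) + g2 * ((T n - 1) / (X n - 1)\<^sup>2) - g3 * (T n * (T n
            - 1) / z\<^sup>2)) * (z\<^sup>2 / T n) = 0"
          using R[of n] by (simp add: z_def)
        ultimately show ?thesis unfolding kw by (simp only: left_diff_distrib distrib_right)
      qed
      have "(\<lambda>n. g0 * (k n / w n) - g1 * (1 / (m n)\<^sup>2) + g2 * ((T n - 1) / (X n - 1)\<^sup>2) * (k n / w n)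
          - g3 * (T n - 1)) \<longlonglongrightarrow> g3 - g1"
        by (rule tendsto_eq_intros k m e(1) T X1 refl | use e0 in simp)+
      then have "(\<lambda>n. 0) \<longlonglongrightarrow> g3 - g1" unfolding id .
      from LIMSEQ_unique[OF tendsto_const this] show ?thesis by simp
    qed
    (* Since g1 = g3, the two singular terms cancel at leading order; this is what remains. *)
    have id: "g0 - g1 * (w n * (1 / m n) * (X n - 2 + k n / m n)) + g2 * ((T n - 1) / (X n - 1)\<^sup>2) = 0" for n
    proof -
      define z where "z = X n - T n"
      have z: "z \<noteq> 0" "m n \<noteq> 0" "X n \<noteq> 0" "T n \<noteq> 0" using ne[of n] mX[of n] by (auto simp: z_def)
      have mz: "m n = X n / z" using mX[of n] z by (simp add: z_def field_simps)
      have "w n * (1 / m n) * (X n - 2 + k n / m n) = T n / (X n)\<^sup>2 + T n * (T n - 1) / z\<^sup>2"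
        unfolding w_def k_def mz z_def[symmetric]
        using z by (simp add: divide_simps) (use z_def in algebra)
      then show ?thesis using R[of n] unfolding eq z_def[symmetric] by (simp add: algebra_simps)
    qed
    have "(\<lambda>n. g0 - g1 * (w n * (1 / m n) * (X n - 2 + k n / m n)) + g2 * ((T n - 1) / (X n - 1)\<^sup>2)) \<longlonglongrightarrow> g0
        + 2 * g1 * e - g2"
      by (rule tendsto_eq_intros k m e(1) T X[unfolded True] X1 refl | simp)+
    then have "(\<lambda>n. 0) \<longlonglongrightarrow> g0 + 2 * g1 * e - g2" unfolding id .
    from LIMSEQ_unique[OF tendsto_const this] have "g0 + 2 * g1 * e - g2 = 0" by simp
    moreover have "g0 - g2 = g1 * e" using e(2) eq by auto
    ultimately have "3 * (g0 - g2) = 0" by algebra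
    then show False using nz by simp
  qed
qed

text \<open>
The quantitative form of \<open>curve_near_zero_sequence\<close>; \<open>curve_bounded\<close> provides convergent subsequences.
\<close>
lemma curve_near_zero:
  assumes nz: "g0 \<noteq> 0" "g1 \<noteq> 0" "g2 \<noteq> 0" "g3 \<noteq> 0" "g0 \<noteq> g2" and c: "c \<in> {\<lambda>t. 0, \<lambda>t. 1, \<lambda>t. t}"
  shows "\<exists>\<epsilon>>0. \<exists>\<delta>>0. \<forall>t x. norm t < \<delta> \<and> (x, t) \<in> regular_points \<and> PVI_difference (g0, g1, g2, g3) x t = 0 \<longrightarrow>
    \<epsilon> \<le> norm ((x - c t) * PVI_difference_dx (g0, g1, g2, g3) x t)"
proof (rule ccontr)
  let ?g = "(g0, g1, g2, g3)"
  assume neg: "\<not> ?thesis"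
  have "\<exists>t x. norm t < 1 / real (Suc n) \<and> (x, t) \<in> regular_points \<and> PVI_difference ?g x t = 0 \<and>
      norm ((x - c t) * PVI_difference_dx ?g x t) < 1 / real (Suc n)" for n
  proof -
    have "1 / real (Suc n) > 0" by simp
    then show ?thesis using neg by (meson not_le)
  qed
  then obtain T X where TX: "\<And>n. norm (T n) < 1 / real (Suc n)" "\<And>n. (X n, T n) \<in> regular_points"
    "\<And>n. PVI_difference ?g (X n) (T n) = 0"
    "\<And>n. norm ((X n - c (T n)) * PVI_difference_dx ?g (X n) (T n)) < 1 / real (Suc n)" by metis
  have null: "f \<longlonglongrightarrow> 0" if "\<And>n. norm (f n) < 1 / real (Suc n)" for f :: "nat \<Rightarrow> complex"
    by (rule Lim_null_comparison[OF _ LIMSEQ_Suc[OF lim_1_over_n]])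
       (use that in \<open>auto intro: always_eventually less_imp_le\<close>)
  have T: "T \<longlonglongrightarrow> 0" by (rule null[OF TX(1)])
  have s: "(\<lambda>n. (X n - c (T n)) * PVI_difference_dx ?g (X n) (T n)) \<longlonglongrightarrow> 0" by (rule null[OF TX(4)])
  define M where "M = 2 + (norm g1 + 4 * norm g2 + 4 * norm g3) / norm g0"
  have "norm (X n) \<le> M * 2" for n
  proof -
    have "norm (X n) \<le> M * (1 + norm (T n))" unfolding M_def by (rule curve_bounded[OF TX(2,3) nz(1)])
    also have "\<dots> \<le> M * 2"
    proof (rule mult_left_mono)
      have "1 / real (Suc n) \<le> 1" by simp
      then show "1 + norm (T n) \<le> 2" using TX(1)[of n] by linarith
      show "0 \<le> M" by (simp add: M_def)
    qed
    finally show ?thesis .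
  qed
  then have "bounded (range X)" unfolding bounded_iff by blast
  then obtain l r where lr: "strict_mono r" "(X \<circ> r) \<longlonglongrightarrow> l"
    using bounded_imp_convergent_subsequence by blast
  note sub = LIMSEQ_subseq_LIMSEQ[OF _ lr(1)]
  have s': "(\<lambda>n. (X (r n) - c (T (r n))) * PVI_difference_dx ?g (X (r n)) (T (r n))) \<longlonglongrightarrow> 0"
    using sub[OF s] by (simp add: o_def)
  show False
  proof (rule curve_near_zero_sequence[of g0 g1 g2 g3 "X \<circ> r" "T \<circ> r" l])
    show "(\<lambda>n. (X \<circ> r) n * PVI_difference_dx ?g ((X \<circ> r) n) ((T \<circ> r) n)) \<longlonglongrightarrow> 0 \<or>
        (\<lambda>n. ((X \<circ> r) n - 1) * PVI_difference_dx ?g ((X \<circ> r) n) ((T \<circ> r) n)) \<longlonglongrightarrow> 0 \<or>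
        (\<lambda>n. ((X \<circ> r) n - (T \<circ> r) n) * PVI_difference_dx ?g ((X \<circ> r) n) ((T \<circ> r) n)) \<longlonglongrightarrow> 0"
      using s' c unfolding o_def by auto
  qed (use nz TX lr sub[OF T] in auto)
qed

lemma PVI_difference_reflect:
  "PVI_difference (swap12 g) (1 - x) (1 - t) = PVI_difference g x t"
  "PVI_difference_dx (swap12 g) (1 - x) (1 - t) = - PVI_difference_dx g x t"
proof -
  obtain g0 g1 g2 g3 where g: "g = (g0, g1, g2, g3)" by (metis prod_cases4)
  define y z w where "y = x - 1" "z = x - t" "w = t - 1"
  have e: "1 - x = - y" "1 - t = - w" "- y - 1 = - x" "- y - - w = - z" "- w - 1 = - t"
    by (auto simp: y_z_w_def)
  show "PVI_difference (swap12 g) (1 - x) (1 - t) = PVI_difference g x t"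
    "PVI_difference_dx (swap12 g) (1 - x) (1 - t) = - PVI_difference_dx g x t"
    unfolding g swap12.simps PVI_difference.simps PVI_difference_dx.simps e y_z_w_def[symmetric]
    by (simp_all add: algebra_simps)
qed

lemma PVI_difference_scale:
  assumes "t \<noteq> 0"
  shows "PVI_difference (swap23 g) (x / t) (1 / t) = PVI_difference g x t"
    "PVI_difference_dx (swap23 g) (x / t) (1 / t) = t * PVI_difference_dx g x t"
proof -
  obtain g0 g1 g2 g3 where g: "g = (g0, g1, g2, g3)" by (metis prod_cases4)
  define y z w where "y = x - 1" "z = x - t" "w = t - 1"
  have e: "x / t - 1 = z / t" "x / t - 1 / t = y / t" "1 / t - 1 = - w / t"
    using assms by (auto simp: y_z_w_def field_simps)
  show "PVI_difference (swap23 g) (x / t) (1 / t) = PVI_difference g x t"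
    "PVI_difference_dx (swap23 g) (x / t) (1 / t) = t * PVI_difference_dx g x t"
    unfolding g swap23.simps PVI_difference.simps PVI_difference_dx.simps e y_z_w_def[symmetric]
    using assms by (simp_all add: power_divide power2_eq_square power3_eq_cube algebra_simps)
qed

lemma PVI_difference_invert:
  assumes "t \<noteq> 0" "x \<noteq> 0" "x \<noteq> 1" "x \<noteq> t"
  shows "PVI_difference (swap01 g) (1 / x) (1 / t) = - (x\<^sup>2 / t) * PVI_difference g x t"
proof -
  obtain g0 g1 g2 g3 where g: "g = (g0, g1, g2, g3)" by (metis prod_cases4)
  define y z w where "y = x - 1" "z = x - t" "w = t - 1"
  have nz: "y \<noteq> 0" "z \<noteq> 0" using assms by (auto simp: y_z_w_def)
  have e: "1 / x - 1 = - y / x" "1 / x - 1 / t = - z / (x * t)" "1 / t - 1 = - w / t"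
    using assms by (auto simp: y_z_w_def field_simps)
  show ?thesis
    unfolding g swap01.simps PVI_difference.simps e y_z_w_def[symmetric]
    using assms nz by (simp add: field_simps power2_eq_square)
qed

lemma regular_points_flip:
  assumes "(x, t) \<in> regular_points"
  shows "(1 - x, 1 - t) \<in> regular_points" "(x / t, 1 / t) \<in> regular_points" "(1 / x, 1 / t) \<in> regular_points"
  using assms by (auto simp: regular_points_def field_simps)

text \<open>
The points \<open>1\<close> and \<open>\<infinity>\<close> are moved to \<open>0\<close> by the flips, which turn the hypothesis \<open>g0 \<noteq> g2\<close> into \<open>g0 \<noteq> g1\<close>
and \<open>g0 \<noteq> g3\<close>.
\<close>
lemma curve_dx_bounded_below:
  assumes nz: "g0 \<noteq> 0" "g1 \<noteq> 0" "g2 \<noteq> 0" "g3 \<noteq> 0" and dist: "g0 \<noteq> g1" "g0 \<noteq> g2" "g0 \<noteq> g3"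
    and F: "F \<in> {at 0, at 1, at_infinity}" and c: "c \<in> {0, 1 :: complex}"
  shows "\<exists>\<epsilon>>0. \<forall>\<^sub>F t in F. \<forall>x. (x, t) \<in> regular_points \<and> PVI_difference (g0, g1, g2, g3) x t = 0 \<longrightarrow>
    \<epsilon> \<le> norm ((x - c) * PVI_difference_dx (g0, g1, g2, g3) x t)"
proof -
  let ?g = "(g0, g1, g2, g3)"
  consider "F = at 0" | "F = at 1" | "F = at_infinity" using F by auto
  then show ?thesis
  proof cases
    case 1
    have "(\<lambda>t. c) \<in> {\<lambda>t. 0, \<lambda>t. 1, \<lambda>t. t}" using c by auto
    from curve_near_zero[OF nz dist(2) this] obtain \<epsilon> \<delta> where
      h: "\<epsilon> > 0" "\<delta> > 0" "\<And>t x. norm t < \<delta> \<Longrightarrow> (x, t) \<in> regular_points \<Longrightarrow> PVI_difference ?g x t = 0 \<Longrightarrow>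
        \<epsilon> \<le> norm ((x - c) * PVI_difference_dx ?g x t)" by blast
    show ?thesis unfolding 1 eventually_at
      by (rule exI[of _ \<epsilon>], intro conjI h(1) exI[of _ \<delta>] h(2)) (use h(3) in auto)
  next
    case 2
    have "(\<lambda>t. 1 - c) \<in> {\<lambda>t. 0, \<lambda>t. 1, \<lambda>t. t}" using c by auto
    from curve_near_zero[OF nz(1,3,2,4) dist(1) this] obtain \<epsilon> \<delta> where
      h: "\<epsilon> > 0" "\<delta> > 0" "\<And>t x. norm t < \<delta> \<Longrightarrow> (x, t) \<in> regular_points \<Longrightarrow> PVI_difference (swap12 ?g) x t = 0 \<Longrightarrow>
        \<epsilon> \<le> norm ((x - (1 - c)) * PVI_difference_dx (swap12 ?g) x t)" unfolding swap12.simps by blast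
    have "\<epsilon> \<le> norm ((x - c) * PVI_difference_dx ?g x t)"
      if "dist t 1 < \<delta>" "(x, t) \<in> regular_points" "PVI_difference ?g x t = 0" for x t
    proof -
      have e: "1 - x - (1 - c) = - (x - c)" by simp
      have "norm (1 - t) < \<delta>" using that(1) by (simp add: dist_norm norm_minus_commute)
      moreover have "PVI_difference (swap12 ?g) (1 - x) (1 - t) = 0"
        unfolding PVI_difference_reflect by (rule that(3))
      ultimately show ?thesis using h(3)[of "1 - t" "1 - x"] regular_points_flip(1)[OF that(2)]
        unfolding PVI_difference_reflect e norm_mult norm_minus_cancel by blast
    qed
    then show ?thesis unfolding 2 eventually_at using h(1,2) by blast
  next
    case 3
    (* The flip divides x by t, so the point c = 1 corresponds to c(t) = t near 0. *)
    have "(if c = 0 then (\<lambda>t. 0) else (\<lambda>t. t)) \<in> {\<lambda>t. 0, \<lambda>t. 1, \<lambda>t. t}" using c by auto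
    from curve_near_zero[OF nz(1,2,4,3) dist(3) this] obtain \<epsilon> \<delta> where
      h: "\<epsilon> > 0" "\<delta> > 0" "\<And>t x. norm t < \<delta> \<Longrightarrow> (x, t) \<in> regular_points \<Longrightarrow> PVI_difference (swap23 ?g) x t = 0 \<Longrightarrow>
        \<epsilon> \<le> norm ((x - (if c = 0 then (\<lambda>t. 0) else (\<lambda>t. t)) t) * PVI_difference_dx (swap23 ?g) x t)"
      unfolding swap23.simps by blast
    have "\<epsilon> \<le> norm ((x - c) * PVI_difference_dx ?g x t)"
      if "2 / \<delta> \<le> norm t" "(x, t) \<in> regular_points" "PVI_difference ?g x t = 0" for x t
    proof -
      have t: "t \<noteq> 0" using that(2) by (simp add: regular_points_def)
      have e: "(x / t - (if c = 0 then (\<lambda>t. 0) else (\<lambda>t. t)) (1 / t)) = (x - c) / t"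
        using c t by (auto simp: field_simps)
      have "norm (1 / t) < \<delta>"
        using that(1) h(2) t by (simp add: norm_divide field_simps)
      moreover have "PVI_difference (swap23 ?g) (x / t) (1 / t) = 0"
        unfolding PVI_difference_scale[OF t] by (rule that(3))
      moreover have "(x - c) / t * (t * PVI_difference_dx ?g x t) = (x - c) * PVI_difference_dx ?g x t"
        using t by simp
      ultimately show ?thesis using h(3)[of "1 / t" "x / t"] regular_points_flip(2)[OF that(2)]
        unfolding PVI_difference_scale[OF t] e by metis
    qed
    then show ?thesis unfolding 3 eventually_at_infinity using h(1) by blast
  qed
qed

text \<open>
The functions \<open>1 / (x R_x)\<close> and \<open>1 / ((x - 1) R_x)\<close> are holomorphic on the covering by solutions, since
\<open>R_x\<close> has no zero there, and bounded near the missing points. So they are constant along \<open>f\<close>,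
and the two constants determine \<open>x\<close>.
\<close>
lemma smooth_curve_constant:
  assumes nz: "g0 \<noteq> 0" "g1 \<noteq> 0" "g2 \<noteq> 0" "g3 \<noteq> 0" and dist: "g0 \<noteq> g1" "g0 \<noteq> g2" "g0 \<noteq> g3"
    and smooth: "\<nexists>A B C. A - B + C = 1 \<and> g1 = g0 * A\<^sup>2 \<and> g2 = g0 * B\<^sup>2 \<and> g3 = g0 * C\<^sup>2"
    and f: "germ f U" "solves \<alpha> f U" "\<And>t. t \<in> U \<Longrightarrow> PVI_difference (g0, g1, g2, g3) (f t) t = 0"
  shows "\<exists>c. \<forall>t\<in>U. f t = c"
proof -
  let ?g = "(g0, g1, g2, g3)"
  have g: "all_nonzero ?g" using nz by simp
  have sm: "PVI_difference_dt ?g x t \<noteq> 0"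
    if "(x, t) \<in> regular_points" "PVI_difference ?g x t = 0" "PVI_difference_dx ?g x t = 0" for x t
    using singular_point_square_relation[OF that] smooth by blast
  define Z where "Z t = {x. (x, t) \<in> solution_points \<alpha> ?g}" for t
  have dx: "PVI_difference_dx ?g x t \<noteq> 0" if "x \<in> Z t" for x t
  proof -
    have S: "(x, t) \<in> solution_points \<alpha> ?g" using that by (simp add: Z_def)
    note reg = solution_points_regular[OF S]
    show ?thesis
      using solution_points_local[OF conjunct1[OF reg] conjunct2[OF reg] sm[OF conjunct1[OF reg] conjunct2[OF
          reg]], of \<alpha>]
      unfolding if_P[OF S] by blast
  qed
  have fZ: "f t \<in> Z t" if "t \<in> U" for t
    using f that unfolding Z_def solution_points_def by blast
  have U: "open U" "connected U" "U \<noteq> {}" "f holomorphic_on U" and Ureg: "\<And>t. t \<in> U \<Longrightarrow> (f t, t) \<in> regular_points"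
    using f(1) by (auto simp: germ_def regular_points_def)
  (* Each psi is a function on the curve without poles: constant by Liouville. *)
  have const: "\<exists>k. \<forall>t\<in>U. 1 / ((f t - c) * PVI_difference_dx ?g (f t) t) = k" if c: "c \<in> {0, 1}" for c
  proof -
    define \<psi> where "\<psi> x t = 1 / ((x - c) * PVI_difference_dx ?g x t)" for x t
    define low where "low \<epsilon> F \<longleftrightarrow> \<epsilon> > 0 \<and> (\<forall>\<^sub>F t in F. \<forall>x. (x, t) \<in> regular_points \<and> PVI_difference ?g x t = 0 \<longrightarrow>
        \<epsilon> \<le> norm ((x - c) * PVI_difference_dx ?g x t))" for \<epsilon> F
    have "\<exists>\<epsilon>. low \<epsilon> F" if "F \<in> {at 0, at 1, at_infinity}" for F
      unfolding low_def by (rule curve_dx_bounded_below[OF nz dist that c])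
    then obtain \<epsilon> where low: "\<And>F. F \<in> {at 0, at 1, at_infinity} \<Longrightarrow> low (\<epsilon> F) F" by metis
    have \<epsilon>: "\<epsilon> F > 0" "\<forall>\<^sub>F t in F. \<forall>x. (x, t) \<in> regular_points \<and> PVI_difference ?g x t = 0 \<longrightarrow>
        \<epsilon> F \<le> norm ((x - c) * PVI_difference_dx ?g x t)" if "F \<in> {at 0, at 1, at_infinity}" for F
      using low[OF that] unfolding low_def by simp_all
    define B where "B = max (1 / \<epsilon> (at 0)) (max (1 / \<epsilon> (at 1)) (1 / \<epsilon> at_infinity))"
    have bdd: "\<forall>\<^sub>F t in F. \<forall>x\<in>Z t. norm (\<psi> x t) \<le> B" if F: "F \<in> {at 0, at 1, at_infinity}" for F
      using \<epsilon>(2)[OF F]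
    proof (rule eventually_mono)
      fix t
      assume h: "\<forall>x. (x, t) \<in> regular_points \<and> PVI_difference ?g x t = 0 \<longrightarrow>
        \<epsilon> F \<le> norm ((x - c) * PVI_difference_dx ?g x t)"
      show "\<forall>x\<in>Z t. norm (\<psi> x t) \<le> B"
      proof
        fix x assume "x \<in> Z t"
        then have "\<epsilon> F \<le> norm ((x - c) * PVI_difference_dx ?g x t)"
          using h solution_points_regular unfolding Z_def by blast
        then have "norm (\<psi> x t) \<le> 1 / \<epsilon> F"
          unfolding \<psi>_def norm_divide norm_one by (intro divide_left_mono mult_pos_pos) (use \<epsilon>(1)[OF F] in auto)
        also have "\<dots> \<le> B" using F by (auto simp: B_def)
        finally show "norm (\<psi> x t) \<le> B" .
      qed
    qed
    have loc: "\<exists>\<rho>>0. \<exists>G. (\<forall>x\<in>Z t0. (\<lambda>t. \<psi> (G x t) t) holomorphic_on ball t0 \<rho>) \<and>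
      (\<forall>t\<in>ball t0 \<rho>. Z t = (\<lambda>x. G x t) ` Z t0 \<and> inj_on (\<lambda>x. G x t) (Z t0))" if t0: "t0 \<noteq> 0" "t0 \<noteq> 1" for t0
    proof -
      obtain \<rho> G where G: "\<rho> > 0" "\<forall>x\<in>Z t0. G x holomorphic_on ball t0 \<rho>"
        "\<forall>t\<in>ball t0 \<rho>. Z t = (\<lambda>x. G x t) ` Z t0 \<and> inj_on (\<lambda>x. G x t) (Z t0)"
      proof -
        have "\<exists>\<rho>>0. \<exists>G. (\<forall>x\<in>Z t0. G x holomorphic_on ball t0 \<rho>) \<and>
            (\<forall>t\<in>ball t0 \<rho>. Z t = (\<lambda>x. G x t) ` Z t0 \<and> inj_on (\<lambda>x. G x t) (Z t0))"
          unfolding Z_def by (rule solution_points_covering[OF g t0]) (rule sm)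
        then show thesis by (elim exE conjE) (rule that; assumption)
      qed
      have "(\<lambda>t. \<psi> (G x t) t) holomorphic_on ball t0 \<rho>" if x: "x \<in> Z t0" for x
      proof -
        have GZ: "G x t \<in> Z t" if "t \<in> ball t0 \<rho>" for t using G(3) x that by blast
        have r: "G x t \<noteq> 0" "G x t - 1 \<noteq> 0" "G x t - t \<noteq> 0" "PVI_difference_dx ?g (G x t) t \<noteq> 0"
            if "t \<in> ball t0 \<rho>" for t
          using solution_points_regular[of "G x t" t \<alpha> ?g] GZ[OF that] dx[OF GZ[OF that]]
          unfolding Z_def regular_points_def by auto
        have h: "G x holomorphic_on ball t0 \<rho>" using G(2) x by blast
        have "(\<lambda>t. PVI_difference_dx ?g (G x t) t) holomorphic_on ball t0 \<rho>"
          unfolding PVI_difference_dx.simps by (intro holomorphic_intros h) (use r in auto)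
        then show ?thesis unfolding \<psi>_def
          by (intro holomorphic_intros h) (use r c in auto)
      qed
      then show ?thesis using G(1,3) by blast
    qed
    have fin: "finite (Z t) \<and> card (Z t) \<le> 6" if "t \<noteq> 0" "t \<noteq> 1" for t
      using solution_points_fibre[OF g that, of \<alpha>] unfolding Z_def by blast
    obtain t1 where t1: "t1 \<in> U" using U by auto
    have nU: "t \<noteq> 0" "t \<noteq> 1" if "t \<in> U" for t using f(1) that by (auto simp: germ_def)
    have in1: "\<psi> (f t) t \<in> (\<lambda>x. \<psi> x t1) ` Z t1" if "t \<in> U" for t
      using bounded_on_covering_values[OF loc fin bdd nU[OF that] nU[OF t1]] fZ[OF that] by blast
    have cont: "continuous_on U (\<lambda>t. \<psi> (f t) t)"
    proof -
      have r: "f t \<noteq> 0" "f t - 1 \<noteq> 0" "f t - t \<noteq> 0" "PVI_difference_dx ?g (f t) t \<noteq> 0" if "t \<in> U" for t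
        using Ureg[OF that] dx[OF fZ[OF that]] by (auto simp: regular_points_def)
      have h: "continuous_on U f" using U(4) by (rule holomorphic_on_imp_continuous_on)
      have "continuous_on U (\<lambda>t. PVI_difference_dx ?g (f t) t)"
        unfolding PVI_difference_dx.simps by (intro continuous_intros h) (use r in auto)
      then show ?thesis unfolding \<psi>_def by (intro continuous_intros h) (use r c in auto)
    qed
    have "finite ((\<lambda>t. \<psi> (f t) t) ` U)"
      by (rule finite_subset[of _ "(\<lambda>x. \<psi> x t1) ` Z t1"]) (use in1 fin nU[OF t1] in auto)
    from continuous_finite_range_constant[OF U(2) cont this]
    show ?thesis unfolding \<psi>_def constant_on_def by blast
  qed
  obtain k0 k1 where k: "\<And>t. t \<in> U \<Longrightarrow> 1 / (f t * PVI_difference_dx ?g (f t) t) = k0"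
    "\<And>t. t \<in> U \<Longrightarrow> 1 / ((f t - 1) * PVI_difference_dx ?g (f t) t) = k1"
    using const[of 0] const[of 1] by auto
  have "f t = - k1 / (k0 - k1)" if "t \<in> U" for t
  proof -
    define D where "D = PVI_difference_dx ?g (f t) t"
    have D: "D \<noteq> 0" "f t \<noteq> 0" "f t - 1 \<noteq> 0"
      using dx[OF fZ[OF that]] Ureg[OF that] by (auto simp: D_def regular_points_def)
    have e: "f t * D * k0 = 1" "(f t - 1) * D * k1 = 1"
      using k[OF that] D unfolding D_def[symmetric] by (auto simp: field_simps)
    then have "D * (f t * (k0 - k1) + k1) = 0" by algebra
    then have 1: "f t * (k0 - k1) = - k1" using D by (simp add: add_eq_0_iff2)
    have "k1 \<noteq> 0" using e by auto
    then have "k0 - k1 \<noteq> 0" using 1 by auto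
    then show ?thesis using 1 by (simp add: field_simps)
  qed
  then show ?thesis by blast
qed

section \<open>Rational curves have no regular critical points\<close>

lemma germ_product_zero:
  assumes f: "germ f U" and hol: "p holomorphic_on U" "q holomorphic_on U"
    and zero: "\<And>t. t \<in> U \<Longrightarrow> p t * q t = 0"
  shows "(\<forall>t\<in>U. p t = 0) \<or> (\<forall>t\<in>U. q t = 0)"
proof (rule disjCI)
  have U: "open U" "connected U" using f by (auto simp: germ_def)
  assume "\<not> (\<forall>t\<in>U. q t = 0)"
  then obtain t1 where t1: "t1 \<in> U" "q t1 \<noteq> 0" by blast
  define V where "V = U \<inter> q -` (- {0})"
  have V: "open V" "V \<noteq> {}" "V \<subseteq> U"
    unfolding V_def using t1
    by (auto intro!: continuous_open_preimage[OF holomorphic_on_imp_continuous_on[OF hol(2)] U(1)])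
  have "p t = 0" if "t \<in> V" for t using zero[of t] that by (auto simp: V_def)
  then show "\<forall>t\<in>U. p t = 0"
    using analytic_continuation_open[OF V(1) U(1) V(2) U(2) V(3) hol(1), of "\<lambda>_. 0"] by auto
qed

lemma poly_vanishing_on_image:
  assumes f: "germ f U" and \<sigma>: "\<sigma> holomorphic_on U" "\<nexists>c. \<forall>t\<in>U. \<sigma> t = c"
    and zero: "\<And>t. t \<in> U \<Longrightarrow> poly p (\<sigma> t) = 0"
  shows "p = 0"
proof (rule ccontr)
  assume "p \<noteq> 0"
  then have "finite (\<sigma> ` U)"
    using finite_subset[OF _ poly_roots_finite[of p]] zero by blast
  moreover have "connected U" using f by (simp add: germ_def)
  ultimately have "\<sigma> constant_on U"
    using continuous_finite_range_constant[OF _ holomorphic_on_imp_continuous_on[OF \<sigma>(1)]] by blast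
  then show False using \<sigma>(2) by (auto simp: constant_on_def)
qed

text \<open>
\<open>no_critical_point\<close> for the rational curve \<open>t = N / M\<close>, \<open>x = Q / P\<close>. Its domain is the plane without the
finitely many parameters at which a denominator of the equation vanishes, and it is connected.
\<close>
lemma no_critical_parameter:
  assumes f: "germ f U" "solves \<alpha> f U"
    and \<sigma>: "\<sigma> holomorphic_on U" "\<nexists>c. \<forall>t\<in>U. \<sigma> t = c"
    and par: "\<And>t. t \<in> U \<Longrightarrow> t * poly M (\<sigma> t) = poly N (\<sigma> t)"
      "\<And>t. t \<in> U \<Longrightarrow> f t * poly P (\<sigma> t) = poly Q (\<sigma> t)"
    and s0: "poly M s0 \<noteq> 0" "poly P s0 \<noteq> 0" "poly N s0 \<noteq> 0" "poly N s0 \<noteq> poly M s0"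
      "poly Q s0 \<noteq> 0" "poly Q s0 \<noteq> poly P s0" "poly Q s0 * poly M s0 \<noteq> poly N s0 * poly P s0"
    and immersed: "poly (pderiv Q) s0 * poly P s0 \<noteq> poly Q s0 * poly (pderiv P) s0"
  shows "poly (pderiv N) s0 * poly M s0 \<noteq> poly N s0 * poly (pderiv M) s0"
proof -
  have U: "open U" "connected U" "U \<noteq> {}" using f by (auto simp: germ_def)
  define B where "B = M * P * N * (N - M) * Q * (Q - P) * (Q * M - N * P)"
  have "poly B s0 \<noteq> 0" using s0 by (simp add: B_def)
  then have "B \<noteq> 0" by auto
  then have fin: "finite {s. poly B s = 0}" by (rule poly_roots_finite)
  define D where "D = - {s. poly B s = 0}"
  have D: "open D" unfolding D_def using fin by (simp add: open_Compl finite_imp_closed)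
  have "connected (UNIV - {s. poly B s = 0})"
    by (rule connected_open_delete_finite[OF open_UNIV connected_UNIV _ fin]) (simp add: DIM_complex)
  then have D': "connected D" by (simp add: D_def Compl_eq_Diff_UNIV)
  define \<tau> where "\<tau> s = poly N s / poly M s" for s
  define \<xi> where "\<xi> s = poly Q s / poly P s" for s
  have nz: "poly M s \<noteq> 0" "poly P s \<noteq> 0" "poly N s \<noteq> 0" "poly N s \<noteq> poly M s"
      "poly Q s \<noteq> 0" "poly Q s \<noteq> poly P s" "poly Q s * poly M s \<noteq> poly N s * poly P s" if "s \<in> D" for s
    using that by (auto simp: D_def B_def)
  have hol: "\<tau> holomorphic_on D" "\<xi> holomorphic_on D"
    unfolding \<tau>_def \<xi>_def using nz by (auto intro!: holomorphic_intros)
  have reg: "\<tau> s \<noteq> 0 \<and> \<tau> s \<noteq> 1 \<and> \<xi> s \<noteq> 0 \<and> \<xi> s \<noteq> 1 \<and> \<xi> s \<noteq> \<tau> s" if "s \<in> D" for s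
    using nz[OF that] by (auto simp: \<tau>_def \<xi>_def frac_eq_eq)
  define V where "V = U \<inter> (\<lambda>t. poly B (\<sigma> t)) -` (- {0})"
  have holB: "(\<lambda>t. poly B (\<sigma> t)) holomorphic_on U" by (intro holomorphic_intros \<sigma>)
  have V: "open V" unfolding V_def
    by (intro continuous_open_preimage holomorphic_on_imp_continuous_on holB U) auto
  have ne: "V \<noteq> {}"
  proof
    assume "V = {}"
    then have "poly B (\<sigma> t) = 0" if "t \<in> U" for t using that by (auto simp: V_def)
    from poly_vanishing_on_image[OF f(1) \<sigma> this] show False using \<open>B \<noteq> 0\<close> by simp
  qed
  have inD: "\<sigma> t \<in> D" if "t \<in> V" for t using that by (simp add: V_def D_def)
  have "deriv \<tau> s0 \<noteq> 0"
  proof (rule no_critical_point[OF D D' hol reg V ne])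
    show "\<sigma> holomorphic_on V" using \<sigma>(1) by (rule holomorphic_on_subset) (auto simp: V_def)
    show "\<sigma> t \<in> D" if "t \<in> V" for t by (rule inD[OF that])
    show "\<tau> (\<sigma> t) = t" "\<xi> (\<sigma> t) = f t" if "t \<in> V" for t
      using par[of t] nz[OF inD[OF that]] that by (auto simp: \<tau>_def \<xi>_def V_def field_simps)
    show "solves \<alpha> f V" using f(2) by (auto simp: solves_def V_def)
    show "s0 \<in> D" using \<open>poly B s0 \<noteq> 0\<close> by (simp add: D_def)
    have "(\<xi> has_field_derivative (poly (pderiv Q) s0 * poly P s0
        - poly Q s0 * poly (pderiv P) s0) / (poly P s0 * poly P s0)) (at s0)"
      unfolding \<xi>_def by (intro DERIV_divide poly_DERIV s0)
    then show "deriv \<xi> s0 \<noteq> 0" using immersed s0 by (simp add: DERIV_imp_deriv)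
  qed
  moreover have "(\<tau> has_field_derivative (poly (pderiv N) s0 * poly M s0
      - poly N s0 * poly (pderiv M) s0) / (poly M s0 * poly M s0)) (at s0)"
    unfolding \<tau>_def by (intro DERIV_divide poly_DERIV s0)
  ultimately show ?thesis by (auto simp: DERIV_imp_deriv)
qed

lemma no_critical_value:
  assumes f: "germ f U" "solves \<alpha> f U" and nc: "\<nexists>c. \<forall>t\<in>U. f t = c"
    and par: "\<And>t. t \<in> U \<Longrightarrow> t * poly M (f t) = poly N (f t)"
    and x0: "x0 \<noteq> 0" "x0 \<noteq> 1" "poly M x0 \<noteq> 0" "poly N x0 \<noteq> 0" "poly N x0 \<noteq> poly M x0" "poly N x0 \<noteq> x0 * poly M x0"
  shows "poly (pderiv N) x0 * poly M x0 \<noteq> poly N x0 * poly (pderiv M) x0"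
proof (rule no_critical_parameter[OF f _ nc par, where P = 1 and Q = "[:0, 1:]"])
  show "f holomorphic_on U" using f by (simp add: germ_def)
qed (use x0 in \<open>auto simp: pderiv_pCons\<close>)

text \<open>
The relation gives \<open>t = N(x) / M(x)\<close> with critical points the zeros of the quadratic \<open>E\<close>. A zero other
than \<open>0\<close> and \<open>1\<close> would be a regular critical point, so \<open>E\<close> is a multiple of \<open>x (x - 1)\<close>, or, if \<open>A = B\<close> and
its degree drops, of \<open>x\<close> or \<open>x - 1\<close>. These are the three relations of the conclusion.
\<close>
lemma quadratic_branch:
  assumes f: "germ f U" "solves \<alpha> f U" and nc: "\<nexists>c. \<forall>t\<in>U. f t = c"
    and nz: "A \<noteq> 0" "B \<noteq> 0" "1 - A + B \<noteq> 0"
    and rel: "\<And>t. t \<in> U \<Longrightarrow> (f t)\<^sup>2 - ((A - B) * t + 1 + B) * f t + A * t = 0"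
  shows "(\<forall>t\<in>U. (f t)\<^sup>2 - t = 0) \<or> (\<forall>t\<in>U. (f t)\<^sup>2 - 2 * f t + t = 0) \<or> (\<forall>t\<in>U. (f t)\<^sup>2 - 2 * f t * t + t = 0)"
proof -
  define M N where "M = [:-A, A - B:]" "N = [:0, - (1 + B), 1:]"
  have MN: "poly M x = (A - B) * x - A" "poly N x = x * (x - 1 - B)" "poly (pderiv M) x = A - B"
      "poly (pderiv N) x = 2 * x - 1 - B" for x
    by (simp_all add: M_N_def pderiv_pCons algebra_simps)
  have par: "t * poly M (f t) = poly N (f t)" if "t \<in> U" for t
    using rel[OF that] unfolding MN by algebra
  define E where "E x = (A - B) * x\<^sup>2 - 2 * A * x + A * (1 + B)" for x
  have bad: "x = 0 \<or> x = 1" if E: "E x = 0" for x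
  proof (rule ccontr)
    assume x: "\<not> (x = 0 \<or> x = 1)"
    have id: "poly (pderiv N) x * poly M x = poly N x * poly (pderiv M) x" using E unfolding E_def MN by algebra
    have N0: "poly N x \<noteq> 0" and M0: "poly M x \<noteq> 0"
    proof -
      show "poly N x \<noteq> 0"
      proof
        assume "poly N x = 0"
        then have "x - (1 + B) = 0" using x unfolding MN by (simp add: diff_diff_eq)
        then have xB: "x = 1 + B" by simp
        have "x * B * (1 - A + B) = 0" using E unfolding E_def using xB by algebra
        then show False using x nz by simp
      qed
      show "poly M x \<noteq> 0"
      proof
        assume "poly M x = 0"
        then have M0: "(A - B) * x - A = 0" unfolding MN .
        have "A * (1 + B - x) = E x - x * ((A - B) * x - A)" unfolding E_def by algebra
        then have x: "x = 1 + B" using E M0 nz by simp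
        have "B * (1 - A + B) = A - (A - B) * (1 + B)" by algebra
        then have "B * (1 - A + B) = 0" using M0 x by simp
        then show False using nz by simp
      qed
    qed
    have "poly N x \<noteq> poly M x"
    proof
      assume "poly N x = poly M x"
      then have "(x - 1) * (x - A) = 0" unfolding MN by algebra
      then have xA: "x = A" using x by auto
      have "A * (A - 1) * (1 - A + B) = 0" using E unfolding E_def using xA by algebra
      then show False using nz x xA by simp
    qed
    moreover have "poly N x \<noteq> x * poly M x"
    proof
      assume "poly N x = x * poly M x"
      then have "x * ((1 - A + B) * (x - 1)) = 0" unfolding MN by algebra
      then show False using x nz by simp
    qed
    ultimately show False
      using no_critical_value[OF f nc par _ _ M0 N0] x id by blast
  qed
  have E01: "E 0 = A * (1 + B)" "E 1 = B * (A - 1)" by (auto simp: E_def algebra_simps)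
  show ?thesis
  proof (cases "A = B")
    case True
    have "E ((1 + B) / 2) = 0" using True by (simp add: E_def)
    then have "(1 + B) / 2 = 0 \<or> (1 + B) / 2 = 1" by (rule bad)
    then have "1 + B = 0 \<or> 1 + B = 2" by (simp add: field_simps)
    then have "B = - 1 \<or> B = 1" by (metis add.commute add_diff_cancel_left' add_eq_0_iff one_add_one)
    then show ?thesis using rel True by (auto simp: algebra_simps)
  next
    case False
    (* A quarter of the discriminant of E, so that (A + r) / (A - B) and (A - r) / (A - B) are its two zeros. *)
    define r where "r = csqrt (A * B * (1 - A + B))"
    have r: "r\<^sup>2 = A * B * (1 - A + B)" "r \<noteq> 0" using nz by (auto simp: r_def)
    have root: "E x = 0" if "(A - B) * x = A + k" "k\<^sup>2 = r\<^sup>2" for x k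
    proof -
      have "(A - B) * E x = ((A - B) * x)\<^sup>2 - 2 * A * ((A - B) * x) + A * (1 + B) * (A - B)"
        unfolding E_def by algebra
      also have "\<dots> = k\<^sup>2 - r\<^sup>2" unfolding that(1) r(1) by algebra
      finally show ?thesis using that(2) False by simp
    qed
    have "E ((A + r) / (A - B)) = 0" "E ((A - r) / (A - B)) = 0"
      using root[of "(A + r) / (A - B)" r] root[of "(A - r) / (A - B)" "- r"] False by simp_all
    moreover have "(A + r) / (A - B) \<noteq> (A - r) / (A - B)" using False r(2) by (simp add: field_simps)
    ultimately have "E 0 = 0" "E 1 = 0" using bad by metis+
    then have "A = 1" "B = - 1" using nz unfolding E01 by (auto simp: add_eq_0_iff)
    then show ?thesis using rel by (auto simp: algebra_simps)
  qed
qed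

text \<open>
At \<open>0\<close> and \<open>1\<close> the cubic takes the values \<open>c - k\<close> and \<open>b - k\<close>. A root at one of the two points can be
divided out, and the cofactor has a root elsewhere unless \<open>b = c = k\<close>, when the cubic is \<open>3 k x (x - 1)\<close>.
\<close>
lemma cubic_root_not_0_1:
  fixes b c k :: complex
  assumes "b \<noteq> 0" "c \<noteq> 0" "k \<noteq> 0" "\<not> (b = c \<and> b = k)"
  shows "\<exists>x. x \<noteq> 0 \<and> x \<noteq> 1 \<and> b * x ^ 3 - c * (x - 1) ^ 3 - k = 0"
proof -
  have root: "\<exists>x. poly p x = 0" if "\<not> constant (poly p)" for p :: "complex poly"
    using Fundamental_Theorem_Algebra.fundamental_theorem_of_algebra[OF that] .
  have nconst: "\<not> constant (poly p)" if "degree p > 0" for p :: "complex poly"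
    using that constant_degree[of p] by simp
  define E where "E = (\<lambda>x. b * x ^ 3 - c * (x - 1) ^ 3 - k)"
  have expand: "E x = poly [:c - k, - 3 * c, 3 * c, b - c:] x" for x
    unfolding E_def by (simp, algebra)
  have "\<exists>x. x \<noteq> 0 \<and> x \<noteq> 1 \<and> E x = 0"
  proof (cases "c = k")
    case c: True
    then have bc: "b \<noteq> c" using assms by auto
    then have "degree [:- 3 * c, 3 * c, b - c:] > 0" by simp
    then obtain x where x: "poly [:- 3 * c, 3 * c, b - c:] x = 0" using root[OF nconst] by blast
    have "E x = x * poly [:- 3 * c, 3 * c, b - c:] x" unfolding expand c by (simp add: algebra_simps)
    moreover have "x \<noteq> 0" "x \<noteq> 1" using x assms bc by auto
    ultimately show ?thesis using x by auto
  next
    case c: False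
    show ?thesis
    proof (cases "b = k")
      case True
      then have bc: "b \<noteq> c" using c by auto
      then have "degree [:k - c, 2 * c + b, b - c:] > 0" by simp
      then obtain x where x: "poly [:k - c, 2 * c + b, b - c:] x = 0" using root[OF nconst] by blast
      have "E x = (x - 1) * poly [:k - c, 2 * c + b, b - c:] x" unfolding expand True by (simp add: algebra_simps)
      moreover have "x \<noteq> 0" using x c by auto
      moreover have "x \<noteq> 1"
      proof
        assume "x = 1"
        then have "3 * b = 0" using x True by (simp add: algebra_simps)
        then show False using assms by simp
      qed
      ultimately show ?thesis using x by auto
    next
      case False
      have "degree [:c - k, - 3 * c, 3 * c, b - c:] > 0" using assms by auto
      then obtain x where x: "poly [:c - k, - 3 * c, 3 * c, b - c:] x = 0" using root[OF nconst] by blast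
      then have "E x = 0" by (simp add: expand)
      moreover have "x \<noteq> 0" "x \<noteq> 1" using \<open>E x = 0\<close> c False by (auto simp: E_def)
      ultimately show ?thesis by auto
    qed
  qed
  then show ?thesis by (simp add: E_def)
qed

text \<open>
With \<open>g3 = 0\<close> the curve is \<open>t = N(x) / M(x)\<close>, and its critical points other than \<open>0\<close> and \<open>1\<close> are the roots of
\<open>g0 g2 x^3 - g0 g1 (x - 1)^3 - g1 g2\<close>. If the three coefficients are equal, there are none, and the curve
is the quartic \<open>f4D\<close>. Otherwise there is such a root, and it must be a common zero of \<open>N\<close> and \<open>M\<close>.
Then the fraction can be reduced by a linear factor, and the argument is repeated for the reduced fraction:
its critical point \<open>y\<close> is regular except for three values of \<open>x\<close>, which give \<open>f5J\<close>, \<open>f5K\<close> and \<open>f5L\<close>.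
\<close>
lemma one_zero_branch:
  assumes f: "germ f U" "solves \<alpha> f U" and nc: "\<nexists>c. \<forall>t\<in>U. f t = c"
    and nz: "g0 \<noteq> 0" "g1 \<noteq> 0" "g2 \<noteq> 0"
    and rel: "\<And>t. t \<in> U \<Longrightarrow> PVI_difference (g0, g1, g2, 0) (f t) t = 0"
  shows "(\<forall>t\<in>U. f t ^ 4 - 2 * f t ^ 3 + 2 * t * f t - t = 0) \<or>
    (\<forall>t\<in>U. f t ^ 3 - 3 * (f t)\<^sup>2 + 3 * t * f t - t = 0) \<or>
    (\<forall>t\<in>U. f t ^ 3 - 3 * t * f t + 2 * t = 0) \<or>
    (\<forall>t\<in>U. 2 * f t ^ 3 - 3 * (f t)\<^sup>2 + t = 0)"
proof -
  have reg: "t \<noteq> 0" "t \<noteq> 1" "f t \<noteq> 0" "f t \<noteq> 1" "f t \<noteq> t" if "t \<in> U" for t using f that by (auto simp: germ_def)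
  have holf: "f holomorphic_on U" using f by (simp add: germ_def)
  have eq: "t * (g1 * (f t - 1)\<^sup>2 - g2 * (f t)\<^sup>2) = (f t)\<^sup>2 * (g0 * (f t - 1)\<^sup>2 - g2)" if "t \<in> U" for t
  proof -
    define y where "y = f t - 1"
    have "y \<noteq> 0" "f t \<noteq> 0" using reg[OF that] by (auto simp: y_def)
    moreover have "g0 - g1 * (t / (f t)\<^sup>2) + g2 * ((t - 1) / y\<^sup>2) = 0" using rel[OF that] by (simp add: y_def)
    ultimately have "g0 * ((f t)\<^sup>2 * y\<^sup>2) - g1 * t * y\<^sup>2 + g2 * (t - 1) * (f t)\<^sup>2 = 0"
      by (simp add: field_simps)
    then show ?thesis unfolding y_def[symmetric] by algebra
  qed
  define M N where "M = [:g1, - 2 * g1, g1 - g2:]" "N = [:0, 0, g0 - g2, - 2 * g0, g0:]"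
  have MN: "poly M x = g1 * (x - 1)\<^sup>2 - g2 * x\<^sup>2" "poly N x = x\<^sup>2 * (g0 * (x - 1)\<^sup>2 - g2)"
    "poly (pderiv M) x = 2 * g1 * (x - 1) - 2 * g2 * x"
    "poly (pderiv N) x = 2 * x * (g0 * (x - 1)\<^sup>2 - g2) + x\<^sup>2 * (2 * g0 * (x - 1))" for x
    by (simp_all add: M_N_def pderiv_pCons, algebra+)
  have par: "t * poly M (f t) = poly N (f t)" if "t \<in> U" for t using eq[OF that] by (simp only: MN)
  show ?thesis
  proof (cases "g1 = g2 \<and> g0 = g1")
    case True
    have "f t ^ 4 - 2 * f t ^ 3 + 2 * t * f t - t = 0" if "t \<in> U" for t
    proof -
      have "g0 * (f t ^ 4 - 2 * f t ^ 3 + 2 * t * f t - t) = 0"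
        using eq[OF that] True by algebra
      then show ?thesis using nz by simp
    qed
    then show ?thesis by blast
  next
    case False
    then obtain x where x: "x \<noteq> 0" "x \<noteq> 1" "g0 * g2 * x ^ 3 - g0 * g1 * (x - 1) ^ 3 - g1 * g2 = 0"
      using cubic_root_not_0_1[of "g0 * g2" "g0 * g1" "g1 * g2"] nz by auto
    have NM: "g1 * poly N x = g0 * x ^ 3 * poly M x" "g2 * (poly N x - poly M x) = g0 * (x - 1) ^ 3 * poly M x"
      using x(3) unfolding MN by algebra+
    show ?thesis
    proof (cases "poly M x = 0")
      case M0: False
      have N0: "poly N x \<noteq> 0" using NM(1) M0 x nz by auto
      have NM0: "poly N x \<noteq> poly M x" using NM(2) M0 x nz by auto
      have xM: "poly N x \<noteq> x * poly M x"
      proof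
        assume h: "poly N x = x * poly M x"
        have "x * poly M x * (g0 * x\<^sup>2 - g1) = 0" "(x - 1) * poly M x * (g0 * (x - 1)\<^sup>2 - g2) = 0"
          using NM h by algebra+
        then have "g1 = g0 * x\<^sup>2" "g2 = g0 * (x - 1)\<^sup>2" using x M0 by auto
        then have "poly M x = 0" unfolding MN by algebra
        then show False using M0 by simp
      qed
      have "poly (pderiv N) x * poly M x = poly N x * poly (pderiv M) x"
        using x(3) unfolding MN by algebra
      then show ?thesis using no_critical_value[OF f nc par x(1,2) M0 N0 NM0 xM] by blast
    next
      case True
      then have N0: "poly N x = 0" using NM(1) nz by simp
      then have g2: "g2 = g0 * (x - 1)\<^sup>2" using x(1) unfolding MN by auto
      have "(x - 1)\<^sup>2 * (g1 - g0 * x\<^sup>2) = 0" using True unfolding MN g2 by algebra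
      then have g1: "g1 = g0 * x\<^sup>2" using x(2) by auto
      have prod: "(f t - x) * (t * ((2 * x - 1) * f t - x) - (f t)\<^sup>2 * (f t + x - 2)) = 0" if "t \<in> U" for t
      proof -
        have "g0 * ((f t - x) * (t * ((2 * x - 1) * f t - x) - (f t)\<^sup>2 * (f t + x - 2))) = 0"
          using eq[OF that] unfolding g1 g2 by algebra
        then show ?thesis using nz by simp
      qed
      have "(\<forall>t\<in>U. f t - x = 0) \<or> (\<forall>t\<in>U. t * ((2 * x - 1) * f t - x) - (f t)\<^sup>2 * (f t + x - 2) = 0)"
        by (rule germ_product_zero[OF f(1) _ _ prod]) (intro holomorphic_intros holf)+
      then have rel': "t * ((2 * x - 1) * f t - x) = (f t)\<^sup>2 * (f t + x - 2)" if "t \<in> U" for t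
        using nc that by auto
      define M' N' where "M' = [:- x, 2 * x - 1:]" "N' = [:0, 0, x - 2, 1:]"
      have MN': "poly M' y = (2 * x - 1) * y - x" "poly N' y = y\<^sup>2 * (y + x - 2)"
        "poly (pderiv M') y = 2 * x - 1" "poly (pderiv N') y = 2 * y * (y + x - 2) + y\<^sup>2" for y
        by (simp_all add: M'_N'_def pderiv_pCons, algebra+)
      have par': "t * poly M' (f t) = poly N' (f t)" if "t \<in> U" for t using rel'[OF that] by (simp only: MN')
      show ?thesis
      proof (cases "2 * x - 1 = 0")
        case True
        have "2 * f t ^ 3 - 3 * (f t)\<^sup>2 + t = 0" if "t \<in> U" for t
          using rel'[OF that] True by algebra
        then show ?thesis by blast
      next
        case x2: False
        (* The critical point, apart from 0 and 1, of the reduced fraction. *)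
        define y where "y = x * (2 - x) / (2 * x - 1)"
        have y: "(2 * x - 1) * y = x * (2 - x)" using x2 by (simp add: y_def)
        consider "x = 2" | "x = - 1" | "x \<noteq> 2" "x \<noteq> - 1" by blast
        then show ?thesis
        proof cases
          case 1
          have "f t ^ 3 - 3 * t * f t + 2 * t = 0" if "t \<in> U" for t using rel'[OF that] 1 by algebra
          then show ?thesis by blast
        next
          case 2
          have "f t ^ 3 - 3 * (f t)\<^sup>2 + 3 * t * f t - t = 0" if "t \<in> U" for t using rel'[OF that] 2 by algebra
          then show ?thesis by blast
        next
          case 3
          have x1: "x + 1 \<noteq> 0" using 3 by (simp add: add_eq_0_iff2)
          have f1: "(2 * x - 1) * (y - 1) = - (x - 1) * (x + 1)"
            and f2: "(2 * x - 1) * (y + x - 2) = (x - 2) * (x - 1)" and f3: "(2 * x - 1) * (y + x) = x * (x + 1)"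
            and f4: "(2 * x - 1) * (y - x) = - 3 * x * (x - 1)" using y by algebra+
          have n: "y \<noteq> 0" "y - 1 \<noteq> 0" "y + x - 2 \<noteq> 0" "y + x \<noteq> 0" "y - x \<noteq> 0"
            using y f1 f2 f3 f4 x 3 x1 by auto
          have "poly M' y \<noteq> 0" unfolding MN' y using x by (simp add: algebra_simps)
          moreover have "poly N' y \<noteq> 0" unfolding MN' using n by simp
          moreover have "poly N' y - poly M' y = (y - 1)\<^sup>2 * (y + x)" unfolding MN' by algebra
          then have "poly N' y \<noteq> poly M' y" using n by auto
          moreover have "poly N' y - y * poly M' y = y * (y - 1) * (y - x)" unfolding MN' by algebra
          then have "poly N' y \<noteq> y * poly M' y" using n by auto
          moreover have "poly (pderiv N') y * poly M' y = poly N' y * poly (pderiv M') y"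
            using y unfolding MN' by algebra
          ultimately show ?thesis using no_critical_value[OF f nc par', of y] n by auto
        qed
      qed
    qed
  qed
qed

section \<open>The quartic component of a singular curve\<close>

lemma cubic_all_roots_unit:
  fixes b3 :: complex
  assumes b3: "b3 \<noteq> 0" and unit: "\<And>s. b3 * s ^ 3 + b2 * s\<^sup>2 + b1 * s + b0 = 0 \<Longrightarrow> s = 1 \<or> s = - 1"
  shows "\<exists>r1\<in>{1, - 1}. \<exists>r2\<in>{1, - 1}. \<exists>r3\<in>{1, - 1}.
    b2 = - b3 * (r1 + r2 + r3) \<and> b1 = b3 * (r1 * r2 + r1 * r3 + r2 * r3) \<and> b0 = - b3 * (r1 * r2 * r3)"
proof -
  have "\<not> constant (poly [:b0, b1, b2, b3:])"
    using b3 constant_degree[of "[:b0, b1, b2, b3:]"] by simp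
  then obtain r1 where "poly [:b0, b1, b2, b3:] r1 = 0"
    using Fundamental_Theorem_Algebra.fundamental_theorem_of_algebra by blast
  then have r1: "b3 * r1 ^ 3 + b2 * r1\<^sup>2 + b1 * r1 + b0 = 0"
    by (simp add: algebra_simps power2_eq_square power3_eq_cube)
  define q1 q0 where "q1 = b2 + b3 * r1" "q0 = b1 + q1 * r1"
  define d where "d = csqrt (q1\<^sup>2 - 4 * b3 * q0)"
  have d: "d\<^sup>2 = q1\<^sup>2 - 4 * b3 * q0" by (simp add: d_def)
  define r2 r3 where "r2 = (- q1 + d) / (2 * b3)" "r3 = (- q1 - d) / (2 * b3)"
  have r23: "2 * b3 * r2 = - q1 + d" "2 * b3 * r3 = - q1 - d"
    unfolding r2_r3_def using b3 by simp_all
  have "2 * (b3 * (r2 + r3)) = 2 * (- q1)" using r23 by algebra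
  then have v: "b3 * (r2 + r3) = - q1" by (simp only: mult_cancel_left) simp
  have "4 * (b3 * (b3 * (r2 * r3))) = 4 * (b3 * q0)" using r23 d by algebra
  then have "b3 * (b3 * (r2 * r3)) = b3 * q0" by (simp only: mult_cancel_left) simp
  then have v': "b3 * (r2 * r3) = q0" using b3 by simp
  have e: "b2 = - b3 * (r1 + r2 + r3)" "b1 = b3 * (r1 * r2 + r1 * r3 + r2 * r3)" "b0 = - b3 * (r1 * r2 * r3)"
    using v v' r1 unfolding q1_q0_def by algebra+
  have "b3 * r2 ^ 3 + b2 * r2\<^sup>2 + b1 * r2 + b0 = 0" "b3 * r3 ^ 3 + b2 * r3\<^sup>2 + b1 * r3 + b0 = 0"
    unfolding e by algebra+
  then have "r1 \<in> {1, -1}" "r2 \<in> {1, -1}" "r3 \<in> {1, -1}" using unit r1 by auto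
  then show ?thesis using e by blast
qed

text \<open>
The quartic factor of the equation of the curve \<open>(g0, g0 A^2, g0 B^2, g0 C^2)\<close> when \<open>A - B + C = 1\<close>. In the
coordinates \<open>u = x / (x - 1)\<close> and \<open>v = x / (x - t)\<close> it is a conic (\<open>conic_equation\<close>).
\<close>
definition conic_poly :: "complex \<Rightarrow> complex \<Rightarrow> complex \<Rightarrow> complex \<Rightarrow> complex \<Rightarrow> complex" where
  "conic_poly A B C x t = (A - B) * x * (x - 1) * (x - t)\<^sup>2 + (A + C) * x * (x - 1)\<^sup>2 * (x - t)
     - A * (x - 1)\<^sup>2 * (x - t)\<^sup>2 + x\<^sup>2 * (1 - t) * (B * (x - t) + C * (x - 1))"

text \<open>
The hypothesis on the cubic \<open>E\<close> says that no zero of \<open>E\<close> is a regular critical parameter. A zero of the linear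
form \<open>1 + A + (B + C) s\<close> is a zero of \<open>E\<close> only if \<open>1 + A = 0\<close>, which leads to two of the triples. Otherwise all
roots of \<open>E\<close> are \<open>1\<close> or \<open>- 1\<close>; comparing coefficients gives the two other triples if \<open>B + C = 0\<close> and a
contradiction if \<open>B + C \<noteq> 0\<close>.
\<close>
lemma conic_critical_values:
  fixes A B C :: complex
  assumes A: "A = 1 + B - C" and nz: "A \<noteq> 0" "B \<noteq> 0" "C \<noteq> 0" and irr: "A \<noteq> 1" "C \<noteq> 1" "B \<noteq> - 1"
    and bad: "\<And>s. B * C * (B + C) * s ^ 3 + 3 * B * C * (1 + A) * s\<^sup>2 + 3 * A * (B + C) * s + A * (1 + A) = 0 \<Longrightarrow>
      s = 1 \<or> s = - 1 \<or> 1 + A + (B + C) * s = 0"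
  shows "(A, B, C) \<in> {(- 1, 1, 3), (- 1, - 3, - 1), (3, 1, - 1), (1 / 3, - 1 / 3, 1 / 3)}"
proof -
  define E where "E s = B * C * (B + C) * s ^ 3 + 3 * B * C * (1 + A) * s\<^sup>2 + 3 * A * (B + C) * s + A * (1 + A)" for s
  define S where "S = B + C"
  define a where "a = 1 + A"
  have \<delta>: "B - C \<noteq> 0" "C - 1 \<noteq> 0" "B + 1 \<noteq> 0" using irr A by (auto simp: add_eq_0_iff2)
  have den: "a = 0" if "E s = 0" "a + S * s = 0" for s
  proof -
    have "2 * a * (B - C)\<^sup>2 * (B + 1) * (C - 1) = S\<^sup>2 * E s"
      using that(2) unfolding E_def S_def a_def A by algebra
    then show ?thesis using that(1) \<delta> by simp
  qed
  have aS: "\<not> (a = 0 \<and> S = 0)" using \<delta> A unfolding a_def S_def by algebra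
  show ?thesis
  proof (cases "a = 0")
    case True
    then have S: "S \<noteq> 0" using aS by simp
    have A1: "A = - 1" and CB: "C = B + 2" using True A unfolding a_def by algebra+
    define r where "r = csqrt (3 / (B * C))"
    have r: "r\<^sup>2 * (B * C) = 3" "r \<noteq> 0" using nz by (auto simp: r_def)
    have "E r = (B + C) * r * (r\<^sup>2 * (B * C) - 3)" unfolding E_def A1 by algebra
    then have "E r = 0" using r(1) by simp
    then have "r = 1 \<or> r = - 1 \<or> S * r = 0" using bad[of r] True unfolding E_def a_def S_def by auto
    then have "r\<^sup>2 = 1" using S r by auto
    then have "(B - 1) * (B + 3) = 0" using r(1) CB by algebra
    then have "B = 1 \<or> B = - 3" by (auto simp: add_eq_0_iff2)
    then show ?thesis using A1 CB by auto
  next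
    case False
    then have unit: "s = 1 \<or> s = - 1" if "E s = 0" for s
      using bad[of s] den[of s] that unfolding E_def a_def S_def by auto
    show ?thesis
    proof (cases "S = 0")
      case True
      then have C: "C = - B" and A': "A = 1 + 2 * B" using A unfolding S_def by algebra+
      define r where "r = csqrt (A / (3 * B\<^sup>2))"
      have r: "r\<^sup>2 * (3 * B\<^sup>2) = A" using nz by (simp add: r_def)
      have "E r = (1 + A) * (A - r\<^sup>2 * (3 * B\<^sup>2))" unfolding E_def C by algebra
      then have "E r = 0" using r by simp
      from unit[OF this] have "r\<^sup>2 = 1" by auto
      then have "(3 * B + 1) * (B - 1) = 0" using r A' by algebra
      then have "3 * B = - 1 \<or> B = 1" unfolding mult_eq_0_iff eq_neg_iff_add_eq_0 by simp
      then have "B = 1 \<or> B = - 1 / 3" by (metis nonzero_mult_div_cancel_left zero_neq_numeral)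
      then show ?thesis using A' C by auto
    next
      case S: False
      have "B * C * S \<noteq> 0" using S nz by simp
      from cubic_all_roots_unit[OF this, of "3 * B * C * a" "3 * A * S" "A * a"] unit
      obtain r1 r2 r3 where r: "r1 \<in> {1, - 1}" "r2 \<in> {1, - 1}" "r3 \<in> {1, - 1}"
        "3 * B * C * a = - (B * C * S) * (r1 + r2 + r3)" "3 * A * S = B * C * S * (r1 * r2 + r1 * r3 + r2 * r3)"
        "A * a = - (B * C * S) * (r1 * r2 * r3)"
        unfolding E_def S_def a_def by blast
      have r': "3 * a = - S * (r1 + r2 + r3)" "3 * A = B * C * (r1 * r2 + r1 * r3 + r2 * r3)"
      proof -
        have "B * C * (3 * a) = B * C * (- S * (r1 + r2 + r3))" using r(4) by algebra
        then show "3 * a = - S * (r1 + r2 + r3)" using nz by (simp only: mult_cancel_left) auto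
        have "S * (3 * A) = S * (B * C * (r1 * r2 + r1 * r3 + r2 * r3))" using r(5) by algebra
        then show "3 * A = B * C * (r1 * r2 + r1 * r3 + r2 * r3)" using S by (simp only: mult_cancel_left) auto
      qed
      have mixed: False if "9 * (A * a) = B * C * S \<or> 9 * (A * a) = - (B * C * S)"
          "A * a = B * C * S \<or> A * a = - (B * C * S)"
      proof -
        have "A * a \<noteq> 0" using nz False by simp
        moreover have "8 * (A * a) = 0 \<or> 10 * (A * a) = 0" using that by algebra
        ultimately show False by simp
      qed
      have pm: False if "a = S \<or> a = - S"
      proof -
        have "(C - 1) * (B + 1) = 0" using that A unfolding a_def S_def by algebra
        then show False using \<delta> by simp
      qed
      have three: "p = q" if "3 * p = 3 * q" for p q :: complex using that by simp
      have "False"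
        using r(1-3)
      proof (elim insertE emptyE)
        assume "r1 = 1" "r2 = 1" "r3 = 1"
        then show False using r' three[of a "- S"] pm by auto
      next
        assume "r1 = - 1" "r2 = - 1" "r3 = - 1"
        then show False using r' three[of a S] pm by auto
      qed (rule mixed; use r(6) r' in algebra)+
      then show ?thesis ..
    qed
  qed
qed

lemma conic_equation:
  fixes x t A B C :: complex
  assumes reg: "x \<noteq> 1" "x \<noteq> t" and conic: "conic_poly A B C x t = 0"
  defines "u \<equiv> x / (x - 1)" and "v \<equiv> x / (x - t)"
  shows "(u - v) * (B * u + C * v) + (A - B) * u + (A + C) * v - A = 0"
proof -
  define y z where "y = x - 1" "z = x - t"
  have yz: "y \<noteq> 0" "z \<noteq> 0" using reg by (auto simp: y_z_def)
  have ux: "u * y = x" and vx: "v * z = x" using yz by (simp_all add: u_def v_def y_z_def)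
  have "(y * z)\<^sup>2 * ((u - v) * (B * u + C * v) + (A - B) * u + (A + C) * v - A) =
      ((u * y) * z - (v * z) * y) * (B * ((u * y) * z) + C * ((v * z) * y)) +
      (A - B) * (u * y) * y * z\<^sup>2 + (A + C) * (v * z) * z * y\<^sup>2 - A * (y * z)\<^sup>2" by algebra
  also have "\<dots> = conic_poly A B C x t"
    unfolding conic_poly_def ux vx unfolding y_z_def by algebra
  finally show ?thesis unfolding conic using yz by simp
qed

text \<open>
For fixed \<open>s = u - v\<close> the equation of the conic is linear in \<open>v\<close>, because the lines \<open>u - v = s\<close> meet the conic
in one point at infinity. So \<open>s\<close> is a rational parameter.
\<close>
lemma conic_parameter:
  fixes x t A B C :: complex
  assumes reg: "x \<noteq> 1" "x \<noteq> t" and A: "A = 1 + B - C" and conic: "conic_poly A B C x t = 0"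
  defines "s \<equiv> x / (x - 1) - x / (x - t)"
  shows "x * ((s - 1) * (1 + C * s)) = (1 + s) * (A + C * s)"
    and "t * ((1 - s)\<^sup>2 * (A + B * s) * (1 + C * s)) = (1 + s)\<^sup>2 * (A + C * s) * (1 + B * s)"
proof -
  define u v where "u = x / (x - 1)" "v = x / (x - t)"
  have ux: "u * (x - 1) = x" and vx: "v * (x - t) = x" using reg by (simp_all add: u_v_def)
  have q: "(u - v) * (B * u + C * v) + (A - B) * u + (A + C) * v - A = 0"
    using conic_equation[OF reg conic] unfolding u_v_def .
  have s: "s = u - v" by (simp add: s_def u_v_def)
  define d where "d = 1 + A + (B + C) * s"
  have vd: "v * d = (1 - s) * (A + B * s)"
    using q unfolding d_def s A by algebra
  have us: "u = v + s" by (simp add: s)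
  have ud: "u * d = (1 + s) * (A + C * s)" "(u - 1) * d = (s - 1) * (1 + C * s)"
      "(v - 1) * d = - (1 + s) * (1 + B * s)"
    using vd unfolding us d_def A by algebra+
  have "x * ((u - 1) * d) = u * d + (u * (x - 1) - x) * d" by algebra
  then show "x * ((s - 1) * (1 + C * s)) = (1 + s) * (A + C * s)" unfolding ux ud by simp
  have "t * (v * d) * ((u - 1) * d) = (u * d) * ((v - 1) * d)
      + d\<^sup>2 * (x - v * (x - t)) * (u - 1) + d\<^sup>2 * (v - 1) * (u * (x - 1) - x)" by algebra
  then have "t * ((1 - s) * (A + B * s)) * ((s - 1) * (1 + C * s))
      = ((1 + s) * (A + C * s)) * (- (1 + s) * (1 + B * s))"
    unfolding ux vx vd ud by simp
  moreover have "t * ((1 - s)\<^sup>2 * (A + B * s) * (1 + C * s))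
      = - (t * ((1 - s) * (A + B * s)) * ((s - 1) * (1 + C * s)))"
    "(1 + s)\<^sup>2 * (A + C * s) * (1 + B * s) = - (((1 + s) * (A + C * s)) * (- (1 + s) * (1 + B * s)))"
    by algebra+
  ultimately show "t * ((1 - s)\<^sup>2 * (A + B * s) * (1 + C * s)) = (1 + s)\<^sup>2 * (A + C * s) * (1 + B * s)"
    by simp
qed

text \<open>
If \<open>A = 1\<close>, \<open>C = 1\<close> or \<open>B
    = - 1\<close>, the conic is a pair of lines, and on each line \<open>f\<close> satisfies a quadratic relation, to which
\<open>quadratic_branch\<close> applies. Otherwise \<open>no_critical_parameter\<close> is applied to the zeros of the cubic in
\<open>conic_critical_values\<close>, which divides the numerator of the derivative of \<open>t\<close> with respect to \<open>s\<close>.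
\<close>
lemma conic_branch:
  assumes f: "germ f U" "solves \<alpha> f U" and nc: "\<nexists>c. \<forall>t\<in>U. f t = c"
    and A: "A = 1 + B - C" and nz: "A \<noteq> 0" "B \<noteq> 0" "C \<noteq> 0"
    and rel: "\<And>t. t \<in> U \<Longrightarrow> conic_poly A B C (f t) t = 0"
  shows "(\<forall>t\<in>U. (f t)\<^sup>2 - t = 0) \<or> (\<forall>t\<in>U. (f t)\<^sup>2 - 2 * f t + t = 0) \<or> (\<forall>t\<in>U. (f t)\<^sup>2 - 2 * f t * t + t = 0) \<or>
    (A, B, C) \<in> {(- 1, 1, 3), (- 1, - 3, - 1), (3, 1, - 1), (1 / 3, - 1 / 3, 1 / 3)}"
proof -
  have reg: "t \<noteq> 0" "t - 1 \<noteq> 0" "f t \<noteq> 0" "f t - 1 \<noteq> 0" "f t - t \<noteq> 0" if "t \<in> U" for t using f that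
      by (auto simp: germ_def)
  have holf: "f holomorphic_on U" using f by (simp add: germ_def)
  define u v s where "u t = f t / (f t - 1)" "v t = f t / (f t - t)" "s t = u t - v t" for t
  have hol: "u holomorphic_on U" "v holomorphic_on U" "s holomorphic_on U"
    unfolding u_v_s_def by (intro holomorphic_intros holf; use reg in simp)+
  have uf: "u t * (f t - 1) = f t" "v t * (f t - t) = f t" "u t \<noteq> 0" "v t \<noteq> 0" if "t \<in> U" for t
    using reg[OF that] by (auto simp: u_v_s_def)
  have q: "(u t - v t) * (B * u t + C * v t) + (A - B) * u t + (A + C) * v t - A = 0" if "t \<in> U" for t
    using conic_equation[OF _ _ rel[OF that]] reg[OF that] by (simp add: u_v_s_def)
  have mul: "(a * u t + b * v t + c) * ((f t - 1) * (f t - t)) =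
      a * f t * (f t - t) + b * f t * (f t - 1) + c * ((f t - 1) * (f t - t))" if "t \<in> U" for a b c t
  proof -
    have "(a * u t + b * v t + c) * ((f t - 1) * (f t - t)) =
      a * (u t * (f t - 1)) * (f t - t) + b * (v t * (f t - t)) * (f t - 1) + c * ((f t - 1) * (f t - t))" by algebra
    then show ?thesis unfolding uf(1,2)[OF that] .
  qed
  have quad: ?thesis if "A' \<noteq> 0" "B' \<noteq> 0" "1 - A' + B' \<noteq> 0"
    "\<And>t. t \<in> U \<Longrightarrow> (f t)\<^sup>2 - ((A' - B') * t + 1 + B') * f t + A' * t = 0" for A' B'
    using quadratic_branch[OF f nc that] by blast
  have sconst: ?thesis if c: "\<And>t. t \<in> U \<Longrightarrow> s t = c" for c
  proof -
    have e: "c * (f t - 1) * (f t - t) = f t * (1 - t)" if "t \<in> U" for t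
    proof -
      have "s t * (f t - 1) * (f t - t) = (u t * (f t - 1)) * (f t - t) - (v t * (f t - t)) * (f t - 1)"
        unfolding u_v_s_def(3) by algebra
      also have "\<dots> = f t * (1 - t)" unfolding uf(1,2)[OF that] by algebra
      finally show ?thesis unfolding c[OF that] .
    qed
    obtain t where "t \<in> U" using f by (auto simp: germ_def)
    then have "c \<noteq> 0" using e[of t] reg[of t] by auto
    show ?thesis
    proof (rule quad[of 1 "1 / c"])
      fix t assume "t \<in> U"
      have "c * ((f t)\<^sup>2 - ((1 - 1 / c) * t + 1 + 1 / c) * f t + 1 * t) = c * (f t - 1) * (f t - t) - f t * (1 - t)"
        using \<open>c \<noteq> 0\<close> by (simp add: field_simps) algebra
      then show "(f t)\<^sup>2 - ((1 - 1 / c) * t + 1 + 1 / c) * f t + 1 * t = 0"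
        using e[OF \<open>t \<in> U\<close>] \<open>c \<noteq> 0\<close> by simp
    qed (use \<open>c \<noteq> 0\<close> in auto)
  qed
  show ?thesis
  proof (cases "\<exists>c. \<forall>t\<in>U. s t = c")
    case True
    then show ?thesis using sconst by blast
  next
    case snc: False
    consider "A = 1" | "C = 1" | "B = - 1" | "A \<noteq> 1" "C \<noteq> 1" "B \<noteq> - 1" by blast
    then show ?thesis
    proof cases
      case 1
      then have CB: "C = B" using A by simp
      have "(u t + v t - 1) * (B * s t + 1) = 0" if "t \<in> U" for t
        using q[OF that] unfolding 1 CB u_v_s_def(3) by algebra
      then have "(\<forall>t\<in>U. u t + v t - 1 = 0) \<or> (\<forall>t\<in>U. B * s t + 1 = 0)"
        by (intro germ_product_zero[OF f(1)] holomorphic_intros hol)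
      then show ?thesis
      proof
        assume h: "\<forall>t\<in>U. u t + v t - 1 = 0"
        have "(f t)\<^sup>2 - t = 0" if "t \<in> U" for t
        proof -
          have z: "1 * u t + 1 * v t + - 1 = 0" using bspec[OF h that] by simp
          show ?thesis using mul[OF that, of 1 1 "- 1"] unfolding z by algebra
        qed
        then show ?thesis by blast
      next
        assume "\<forall>t\<in>U. B * s t + 1 = 0"
        then have "B * s t = - 1" if "t \<in> U" for t using that unfolding eq_neg_iff_add_eq_0 by blast
        then have "s t = - 1 / B" if "t \<in> U" for t using that nz(2) by (metis nonzero_mult_div_cancel_left)
        then show ?thesis using snc by blast
      qed
    next
      case 2
      then have AB: "B = A" using A by simp
      have "(s t + 1) * (A * u t + v t - A) = 0" if "t \<in> U" for t
        using q[OF that] unfolding 2 AB u_v_s_def(3) by algebra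
      then have "(\<forall>t\<in>U. s t + 1 = 0) \<or> (\<forall>t\<in>U. A * u t + v t - A = 0)"
        by (intro germ_product_zero[OF f(1)] holomorphic_intros hol)
      then show ?thesis
      proof
        assume "\<forall>t\<in>U. s t + 1 = 0"
        then have "s t = - 1" if "t \<in> U" for t using that unfolding eq_neg_iff_add_eq_0 by blast
        then show ?thesis using snc by blast
      next
        assume h: "\<forall>t\<in>U. A * u t + v t - A = 0"
        show ?thesis
        proof (rule quad[of "- A" "- A"])
          fix t assume t: "t \<in> U"
          show "(f t)\<^sup>2 - ((- A - - A) * t + 1 + - A) * f t + - A * t = 0"
          proof -
            have z: "A * u t + 1 * v t + - A = 0" using bspec[OF h t] by simp
            show ?thesis using mul[OF t, of A 1 "- A"] unfolding z by algebra
          qed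
        qed (use nz in auto)
      qed
    next
      case 3
      then have CA: "C = - A" using A by simp
      have "(s t - 1) * (u t + A * v t - A) = 0" if "t \<in> U" for t
        using q[OF that] unfolding 3 CA u_v_s_def(3) by algebra
      then have "(\<forall>t\<in>U. s t - 1 = 0) \<or> (\<forall>t\<in>U. u t + A * v t - A = 0)"
        by (intro germ_product_zero[OF f(1)] holomorphic_intros hol)
      then show ?thesis
      proof
        assume "\<forall>t\<in>U. s t - 1 = 0"
        then have "s t = 1" if "t \<in> U" for t using that by auto
        then show ?thesis using snc by blast
      next
        assume h: "\<forall>t\<in>U. u t + A * v t - A = 0"
        show ?thesis
        proof (rule quad[of "- A" "- 1"])
          fix t assume t: "t \<in> U"
          show "(f t)\<^sup>2 - ((- A - - 1) * t + 1 + - 1) * f t + - A * t = 0"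
          proof -
            have z: "1 * u t + A * v t + - A = 0" using bspec[OF h t] by simp
            show ?thesis using mul[OF t, of 1 A "- A"] unfolding z by algebra
          qed
        qed (use nz in auto)
      qed
    next
      case irr: 4
      define den where "den r = 1 + A + (B + C) * r" for r
      define M N P Q where "M = [:1, -1:]\<^sup>2 * [:A, B:] * [:1, C:]" "N = [:1, 1:]\<^sup>2 * [:A, C:] * [:1, B:]"
        "P = [:-1, 1:] * [:1, C:]" "Q = [:1, 1:] * [:A, C:]"
      have ev: "poly M r = (1 - r)\<^sup>2 * (A + B * r) * (1 + C * r)" "poly N r = (1 + r)\<^sup>2 * (A + C * r) * (1 + B * r)"
        "poly P r = (r - 1) * (1 + C * r)" "poly Q r = (1 + r) * (A + C * r)" for r
        by (simp_all add: M_N_P_Q_def algebra_simps)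
      have ev': "poly (pderiv M) r
          = - 2 * (1 - r) * (A + B * r) * (1 + C * r) + (1 - r)\<^sup>2 * (B * (1 + C * r) + C * (A + B * r))"
        "poly (pderiv N) r = 2 * (1 + r) * (A + C * r) * (1 + B * r) + (1 + r)\<^sup>2 * (C * (1 + B * r) + B * (A
            + C * r))"
        "poly (pderiv P) r = 1 + C * r + C * (r - 1)" "poly (pderiv Q) r = A + C * r + C * (1 + r)" for r
        by (simp_all add: M_N_P_Q_def pderiv_mult pderiv_power_Suc power2_eq_square pderiv_pCons, algebra+)
      have param: "f t * ((s t - 1) * (1 + C * s t)) = (1 + s t) * (A + C * s t)"
        "t * ((1 - s t)\<^sup>2 * (A + B * s t) * (1 + C * s t)) = (1 + s t)\<^sup>2 * (A + C * s t) * (1 + B * s t)"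
            if "t \<in> U" for t
        using conic_parameter[OF _ _ A rel[OF that]] reg[OF that] unfolding u_v_s_def by auto
      have parQ: "f t * poly P (s t) = poly Q (s t)" and parN: "t * poly M (s t) = poly N (s t)" if "t \<in> U" for t
        unfolding ev using param[OF that] by blast+
      have "(A, B, C) \<in> {(- 1, 1, 3), (- 1, - 3, - 1), (3, 1, - 1), (1 / 3, - 1 / 3, 1 / 3)}"
      proof (rule conic_critical_values[OF A nz irr], rule ccontr)
        fix r
        assume E: "B * C * (B + C) * r ^ 3 + 3 * B * C * (1 + A) * r\<^sup>2 + 3 * A * (B + C) * r + A * (1 + A) = 0"
          and "\<not> (r = 1 \<or> r = - 1 \<or> 1 + A + (B + C) * r = 0)"
        then have r: "1 - r \<noteq> 0" "r - 1 \<noteq> 0" "1 + r \<noteq> 0" "den r \<noteq> 0" by (auto simp: den_def add_eq_0_iff)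
        have \<delta>: "B - C \<noteq> 0" "C - 1 \<noteq> 0" "B + 1 \<noteq> 0" using irr A by (auto simp: add_eq_0_iff2)
        have r0: "r \<noteq> 0" using E r(4) nz unfolding den_def by auto
        (* Up to the factor 1 - r^2, the numerator of the derivative of t. *)
        have W: "4 * ((A + C * r) * (1 + C * r) * (1 + B * r) * (A + B * r)) + (B - C)\<^sup>2 * (A
            - B * C * r\<^sup>2) * (1 - r\<^sup>2) = 0"
        proof -
          have "4 * ((A + C * r) * (1 + C * r) * (1 + B * r) * (A + B * r)) + (B - C)\<^sup>2 * (A - B * C * r\<^sup>2) * (1
              - r\<^sup>2) =
             den r * (B * C * (B + C) * r ^ 3 + 3 * B * C * (1 + A) * r\<^sup>2 + 3 * A * (B + C) * r + A * (1 + A))"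
            unfolding den_def A by algebra
          then show ?thesis unfolding E by simp
        qed
        have W': "A - B * C * r\<^sup>2 = 0" if "(A + C * r) * (1 + C * r) * (1 + B * r) * (A + B * r) = 0"
        proof -
          have "(B - C)\<^sup>2 * (A - B * C * r\<^sup>2) * ((1 - r) * (1 + r)) = (B - C)\<^sup>2 * (A - B * C * r\<^sup>2) * (1 - r\<^sup>2)"
              by algebra
          also have "\<dots> = 0" using W unfolding that by simp
          finally show ?thesis using \<delta> r by simp
        qed
        have d1: "(B - C) * (r - 1) = (1 + B * r) - (A + C * r)"
            and d2: "(B - C) * (1 + r) = (A + B * r) - (1 + C * r)"
          unfolding A by algebra+
        have i1: "C * r * (1 + B * r) = (A + C * r) - (A - B * C * r\<^sup>2)"
            and i2: "B * r * (1 + C * r) = (A + B * r) - (A - B * C * r\<^sup>2)"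
          by algebra+
        have fac: "A + C * r \<noteq> 0" "1 + C * r \<noteq> 0" "1 + B * r \<noteq> 0" "A + B * r \<noteq> 0"
        proof -
          show "A + C * r \<noteq> 0"
          proof
            assume h: "A + C * r = 0"
            then have "A - B * C * r\<^sup>2 = 0" by (intro W') simp
            then have "1 + B * r = 0" using i1 h nz r0 by simp
            then show False using d1 h \<delta> r by simp
          qed
          show "1 + C * r \<noteq> 0"
          proof
            assume h: "1 + C * r = 0"
            then have "A - B * C * r\<^sup>2 = 0" by (intro W') simp
            then have "A + B * r = 0" using i2 h by simp
            then show False using d2 h \<delta> r by simp
          qed
          show "1 + B * r \<noteq> 0"
          proof
            assume h: "1 + B * r = 0"
            then have "A - B * C * r\<^sup>2 = 0" by (intro W') simp
            then have "A + C * r = 0" using i1 h by simp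
            then show False using d1 h \<delta> r by simp
          qed
          show "A + B * r \<noteq> 0"
          proof
            assume h: "A + B * r = 0"
            then have "A - B * C * r\<^sup>2 = 0" by (intro W') simp
            then have "1 + C * r = 0" using i2 h nz r0 by simp
            then show False using d2 h \<delta> r by simp
          qed
        qed
        have "poly (pderiv N) r * poly M r \<noteq> poly N r * poly (pderiv M) r"
        proof (rule no_critical_parameter[OF f hol(3) snc parN parQ])
          show "poly M r \<noteq> 0" "poly P r \<noteq> 0" "poly N r \<noteq> 0" "poly Q r \<noteq> 0" unfolding ev using fac r by simp_all
          have "poly N r - poly M r = r * (den r)\<^sup>2" unfolding ev den_def A by algebra
          then show "poly N r \<noteq> poly M r" using r r0 by auto
          have "poly Q r - poly P r = den r" unfolding ev den_def A by algebra
          then show "poly Q r \<noteq> poly P r" using r by auto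
          have "poly Q r * poly M r - poly N r * poly P r = (1 + r) * (A + C * r) * (1 - r) * (1 + C * r) * den r"
            unfolding ev den_def A by algebra
          then show "poly Q r * poly M r \<noteq> poly N r * poly P r" using r fac by auto
          show "poly (pderiv Q) r * poly P r \<noteq> poly Q r * poly (pderiv P) r"
          proof
            assume "poly (pderiv Q) r * poly P r = poly Q r * poly (pderiv P) r"
            moreover have "poly (pderiv Q) r * poly P r - poly Q r * poly (pderiv P) r =
                C * (B - C) * (1 - r\<^sup>2) - 2 * (A + C * r) * (1 + C * r)" unfolding ev ev' A by algebra
            ultimately have h1: "C * (B - C) * (1 - r\<^sup>2) - 2 * (A + C * r) * (1 + C * r) = 0" by simp
            have "(1 - r) * (1 + r) * (B - C) * (2 * C * (1 + B * r) * (A + B * r) + (B - C) * (A - B * C * r\<^sup>2)) =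
              (4 * ((A + C * r) * (1 + C * r) * (1 + B * r) * (A + B * r)) + (B - C)\<^sup>2 * (A - B * C * r\<^sup>2) * (1
                  - r\<^sup>2))
              + 2 * (1 + B * r) * (A + B * r) * (C * (B - C) * (1 - r\<^sup>2) - 2 * (A + C * r) * (1 + C * r))"
              by algebra
            then have h2: "2 * C * (1 + B * r) * (A + B * r) + (B - C) * (A - B * C * r\<^sup>2) = 0"
              unfolding W h1 using r \<delta> by simp
            have "(B - C) * ((B + 1) * (C - 1)) = B * (C * (B - C) * (1 - r\<^sup>2) - 2 * (A + C * r) * (1 + C * r))
               + (2 * C * (1 + B * r) * (A + B * r) + (B - C) * (A - B * C * r\<^sup>2))" unfolding A by algebra
            then show False unfolding h1 h2 using \<delta> by simp
          qed
        qed
        moreover have "poly (pderiv N) r * poly M r - poly N r * poly (pderiv M) r = (1 - r\<^sup>2) *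
            (4 * ((A + C * r) * (1 + C * r) * (1 + B * r) * (A + B * r)) + (B - C)\<^sup>2 * (A - B * C * r\<^sup>2) * (1 - r\<^sup>2))"
          unfolding ev ev' A by algebra
        then have "poly (pderiv N) r * poly M r = poly N r * poly (pderiv M) r" unfolding W by simp
        ultimately show False by simp
      qed
      then show ?thesis by blast
    qed
  qed
qed

section \<open>Classification of the common solutions\<close>

text \<open>
The four rational families that solve lines of Painleve VI equations without belonging to the list.
\<close>
definition degenerate_germ :: "(complex \<Rightarrow> complex) \<Rightarrow> complex set \<Rightarrow> bool" where
  "degenerate_germ f U \<longleftrightarrow> (\<exists>c. (\<forall>t\<in>U. f t = c) \<or> (\<forall>t\<in>U. f t = c * t) \<or> (\<forall>t\<in>U. f t - 1 = c * (t - 1)) \<or>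
     (\<forall>t\<in>U. (f t - 1) * t = c * f t * (t - 1)))"

lemma ball_dom:
  "(\<forall>t\<in>dom_inverse U. P t) \<longleftrightarrow> (\<forall>t\<in>U. P (1 / t))" "(\<forall>t\<in>dom_reflect U. P t) \<longleftrightarrow> (\<forall>t\<in>U. P (1 - t))"
  by (auto simp: dom_inverse_def dom_reflect_def)

lemma degenerate_flip:
  assumes f: "germ f U"
  shows "degenerate_germ (flip01 f) (dom_inverse U) \<Longrightarrow> degenerate_germ f U"
    "degenerate_germ (flip12 f) (dom_reflect U) \<Longrightarrow> degenerate_germ f U"
    "degenerate_germ (flip23 f) (dom_inverse U) \<Longrightarrow> degenerate_germ f U"
proof -
  have reg: "t \<noteq> 0" "t \<noteq> 1" "f t \<noteq> 0" "f t \<noteq> 1" "f t \<noteq> t" if "t \<in> U" for t using f that by (auto simp: germ_def)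
  obtain t0 where t0: "t0 \<in> U" using f by (auto simp: germ_def)
  have fl: "flip01 f (1 / t) = 1 / f t" "flip12 f (1 - t) = 1 - f t" "flip23 f (1 / t) = f t / t" for t
    by (simp_all add: flip01_def flip12_def flip23_def)
  have D: "degenerate_germ f U" if "(\<forall>t\<in>U. f t = c) \<or> (\<forall>t\<in>U. f t = c * t) \<or> (\<forall>t\<in>U. f t - 1 = c * (t - 1)) \<or>
     (\<forall>t\<in>U. (f t - 1) * t = c * f t * (t - 1))" for c using that unfolding degenerate_germ_def by blast
  show "degenerate_germ f U" if "degenerate_germ (flip01 f) (dom_inverse U)"
  proof -
    from that[unfolded degenerate_germ_def ball_dom fl]
    obtain c where c: "(\<forall>t\<in>U. 1 / f t = c) \<or> (\<forall>t\<in>U. 1 / f t = c * (1 / t)) \<or> (\<forall>t\<in>U. 1 / f t - 1 = c * (1 / t - 1)) \<or>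
       (\<forall>t\<in>U. (1 / f t - 1) * (1 / t) = c * (1 / f t) * (1 / t - 1))" ..
    from c show ?thesis
    proof (elim disjE)
      assume h: "\<forall>t\<in>U. 1 / f t = c"
      have "f t = 1 / c" if "t \<in> U" for t using h that by auto
      then show ?thesis using D[of "1 / c"] by blast
    next
      assume h: "\<forall>t\<in>U. 1 / f t = c * (1 / t)"
      have "f t = (1 / c) * t" if "t \<in> U" for t
      proof -
        have e: "t = c * f t" using bspec[OF h that] reg[OF that] by (simp add: field_simps)
        then have "c \<noteq> 0" using reg[OF that] by auto
        then show ?thesis using e by (simp add: field_simps)
      qed
      then show ?thesis using D[of "1 / c"] by blast
    next
      assume h: "\<forall>t\<in>U. 1 / f t - 1 = c * (1 / t - 1)"
      have "(f t - 1) * t = c * f t * (t - 1)" if "t \<in> U" for t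
      proof -
        have "(1 / f t - 1) * (f t * t) = c * (1 / t - 1) * (f t * t)" by (simp only: bspec[OF h that])
        then have "(1 - f t) * t = c * (1 - t) * f t" using reg[OF that] by (simp add: algebra_simps)
        then show ?thesis by algebra
      qed
      then show ?thesis using D[of c] by blast
    next
      assume h: "\<forall>t\<in>U. (1 / f t - 1) * (1 / t) = c * (1 / f t) * (1 / t - 1)"
      have "f t - 1 = c * (t - 1)" if "t \<in> U" for t
      proof -
        have "(1 / f t - 1) * (1 / t) * (f t * t) = c * (1 / f t) * (1 / t - 1) * (f t * t)"
            by (simp only: bspec[OF h that])
        then have "1 - f t = c * (1 - t)" using reg[OF that] by (simp add: algebra_simps)
        then show ?thesis by algebra
      qed
      then show ?thesis using D[of c] by blast
    qed
  qed
  show "degenerate_germ f U" if "degenerate_germ (flip12 f) (dom_reflect U)"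
  proof -
    from that[unfolded degenerate_germ_def ball_dom fl]
    obtain c where c: "(\<forall>t\<in>U. 1 - f t = c) \<or> (\<forall>t\<in>U. 1 - f t = c * (1 - t)) \<or> (\<forall>t\<in>U. 1 - f t - 1 = c * (1 - t - 1)) \<or>
       (\<forall>t\<in>U. (1 - f t - 1) * (1 - t) = c * (1 - f t) * (1 - t - 1))" ..
    from c show ?thesis
    proof (elim disjE)
      assume h: "\<forall>t\<in>U. 1 - f t = c"
      have "f t = 1 - c" if "t \<in> U" for t using bspec[OF h that] by auto
      then show ?thesis using D[of "1 - c"] by blast
    next
      assume h: "\<forall>t\<in>U. 1 - f t = c * (1 - t)"
      have "f t - 1 = c * (t - 1)" if "t \<in> U" for t using bspec[OF h that] by algebra
      then show ?thesis using D[of c] by blast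
    next
      assume h: "\<forall>t\<in>U. 1 - f t - 1 = c * (1 - t - 1)"
      have "f t = c * t" if "t \<in> U" for t using bspec[OF h that] by simp
      then show ?thesis using D[of c] by blast
    next
      assume h: "\<forall>t\<in>U. (1 - f t - 1) * (1 - t) = c * (1 - f t) * (1 - t - 1)"
      then have h': "f t * (t - 1) = c * ((f t - 1) * t)" if "t \<in> U" for t
        using bspec[OF h that] by (simp add: algebra_simps)
      then have "c \<noteq> 0" using h'[OF t0] reg[OF t0] by auto
      then have "(f t - 1) * t = (1 / c) * f t * (t - 1)" if "t \<in> U" for t using h'[OF that]
          by (simp add: field_simps)
      then show ?thesis using D[of "1 / c"] by blast
    qed
  qed
  show "degenerate_germ f U" if "degenerate_germ (flip23 f) (dom_inverse U)"
  proof -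
    from that[unfolded degenerate_germ_def ball_dom fl]
    obtain c where c: "(\<forall>t\<in>U. f t / t = c) \<or> (\<forall>t\<in>U. f t / t = c * (1 / t)) \<or> (\<forall>t\<in>U. f t / t - 1 = c * (1 / t - 1)) \<or>
       (\<forall>t\<in>U. (f t / t - 1) * (1 / t) = c * (f t / t) * (1 / t - 1))" ..
    from c show ?thesis
    proof (elim disjE)
      assume h: "\<forall>t\<in>U. f t / t = c"
      have "f t = c * t" if "t \<in> U" for t using bspec[OF h that] reg[OF that] by (auto simp: field_simps)
      then show ?thesis using D[of c] by blast
    next
      assume h: "\<forall>t\<in>U. f t / t = c * (1 / t)"
      have "f t = c" if "t \<in> U" for t using bspec[OF h that] reg[OF that] by (auto simp: field_simps)
      then show ?thesis using D[of c] by blast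
    next
      assume h: "\<forall>t\<in>U. f t / t - 1 = c * (1 / t - 1)"
      have "f t - 1 = (1 - c) * (t - 1)" if "t \<in> U" for t
      proof -
        have "(f t / t - 1) * t = c * (1 / t - 1) * t" by (simp only: bspec[OF h that])
        then have "f t - t = c * (1 - t)" using reg[OF that] by (simp add: algebra_simps)
        then show ?thesis by algebra
      qed
      then show ?thesis using D[of "1 - c"] by blast
    next
      assume h: "\<forall>t\<in>U. (f t / t - 1) * (1 / t) = c * (f t / t) * (1 / t - 1)"
      have "(f t - 1) * t = (1 - c) * f t * (t - 1)" if "t \<in> U" for t
      proof -
        have "(f t / t - 1) * (1 / t) * (t * t) = f t - t" "c * (f t / t) * (1 / t - 1) * (t * t) = c * f t * (1 - t)"
          using reg[OF that] by (simp_all add: field_simps)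
        moreover have "(f t / t - 1) * (1 / t) * (t * t) = c * (f t / t) * (1 / t - 1) * (t * t)"
            by (simp only: bspec[OF h that])
        ultimately have "f t - t = c * f t * (1 - t)" by simp
        then show ?thesis by algebra
      qed
      then show ?thesis using D[of "1 - c"] by blast
    qed
  qed
qed

lemma difference_flip:
  assumes f: "germ f U" and d: "\<And>t. t \<in> U \<Longrightarrow> PVI_difference g (f t) t = 0"
  shows "t \<in> dom_inverse U \<Longrightarrow> PVI_difference (swap01 g) (flip01 f t) t = 0"
    "t \<in> dom_reflect U \<Longrightarrow> PVI_difference (swap12 g) (flip12 f t) t = 0"
    "t \<in> dom_inverse U \<Longrightarrow> PVI_difference (swap23 g) (flip23 f t) t = 0"
proof -
  have reg: "t \<noteq> 0" "t \<noteq> 1" "f t \<noteq> 0" "f t \<noteq> 1" "f t \<noteq> t" if "t \<in> U" for t using f that by (auto simp: germ_def)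
  show "PVI_difference (swap01 g) (flip01 f t) t = 0" if u0: "t \<in> dom_inverse U"
  proof -
    obtain u where u: "u \<in> U" "t = 1 / u" using u0 unfolding dom_inverse_def by blast
    show ?thesis using PVI_difference_invert[of u "f u" g] reg[OF u(1)] d[OF u(1)] u(2) by (simp add: flip01_def)
  qed
  show "PVI_difference (swap12 g) (flip12 f t) t = 0" if u0: "t \<in> dom_reflect U"
  proof -
    obtain u where u: "u \<in> U" "t = 1 - u" using u0 unfolding dom_reflect_def by blast
    show ?thesis using PVI_difference_reflect(1)[of g "f u" u] d[OF u(1)] u(2) by (simp add: flip12_def)
  qed
  show "PVI_difference (swap23 g) (flip23 f t) t = 0" if u0: "t \<in> dom_inverse U"
  proof -
    obtain u where u: "u \<in> U" "t = 1 / u" using u0 unfolding dom_inverse_def by blast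
    show ?thesis using PVI_difference_scale(1)[of u g "f u"] reg[OF u(1)] d[OF u(1)] u(2) by (simp add: flip23_def)
  qed
qed

definition family_relation :: "(complex \<Rightarrow> complex) \<Rightarrow> complex set \<Rightarrow> bool" where
  "family_relation f U \<longleftrightarrow> (\<exists>P S. PVI_family P S \<and> (\<forall>t\<in>U. P (f t) t = 0))"

lemma family_relationI:
  "PVI_family P S \<Longrightarrow> (\<And>t. t \<in> U \<Longrightarrow> P (f t) t = 0) \<Longrightarrow> family_relation f U"
  unfolding family_relation_def by blast

lemma family_relationI_ball:
  "PVI_family P S \<Longrightarrow> \<forall>t\<in>U. P (f t) t = 0 \<Longrightarrow> family_relation f U"
  unfolding family_relation_def by blast

lemma difference_polynomial:
  assumes f: "germ f U" "t \<in> U" and d: "PVI_difference (g0, g1, g2, g3) (f t) t = 0"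
  shows "g0 * ((f t)\<^sup>2 * (f t - 1)\<^sup>2 * (f t - t)\<^sup>2) - g1 * t * ((f t - 1)\<^sup>2 * (f t - t)\<^sup>2)
    + g2 * (t - 1) * ((f t)\<^sup>2 * (f t - t)\<^sup>2) - g3 * (t * (t - 1)) * ((f t)\<^sup>2 * (f t - 1)\<^sup>2) = 0"
proof -
  define x y z where "x = f t" "y = f t - 1" "z = f t - t"
  have "x \<noteq> 0" "y \<noteq> 0" "z \<noteq> 0" using f by (auto simp: germ_def x_y_z_def)
  moreover have "g0 - g1 * (t / x\<^sup>2) + g2 * ((t - 1) / y\<^sup>2) - g3 * (t * (t - 1) / z\<^sup>2) = 0"
    using d by (simp add: x_y_z_def)
  ultimately have "g0 * (x\<^sup>2 * y\<^sup>2 * z\<^sup>2) - g1 * t * (y\<^sup>2 * z\<^sup>2) + g2 * (t - 1) * (x\<^sup>2 * z\<^sup>2) - g3 * (t * (t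
      - 1)) * (x\<^sup>2 * y\<^sup>2) = 0"
    by (simp add: field_simps)
  then show ?thesis unfolding x_y_z_def .
qed

text \<open>
With square roots of the ratios at hand, the equation of the curve factors, and on a germ one of the two
factors vanishes identically.
\<close>
lemma square_relation_family:
  assumes f: "germ f U" "solves \<alpha> f U" and nc: "\<nexists>c. \<forall>t\<in>U. f t = c"
    and nz: "g0 \<noteq> 0" "A \<noteq> 0" "B \<noteq> 0" "C \<noteq> 0" and A: "A = 1 + B - C"
    and d: "\<And>t. t \<in> U \<Longrightarrow> PVI_difference (g0, g0 * A\<^sup>2, g0 * B\<^sup>2, g0 * C\<^sup>2) (f t) t = 0"
  shows "family_relation f U"
proof -
  have holf: "f holomorphic_on U" using f by (simp add: germ_def)
  have prod: "((f t)\<^sup>2 - ((A - B) * t + 1 + B) * f t + A * t) * conic_poly A B C (f t) t = 0" if "t \<in> U" for t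
  proof -
    have "g0 * (((f t)\<^sup>2 - ((A - B) * t + 1 + B) * f t + A * t) * conic_poly A B C (f t) t) = 
      g0 * ((f t)\<^sup>2 * (f t - 1)\<^sup>2 * (f t - t)\<^sup>2) - g0 * A\<^sup>2 * t * ((f t - 1)\<^sup>2 * (f t - t)\<^sup>2)
      + g0 * B\<^sup>2 * (t - 1) * ((f t)\<^sup>2 * (f t - t)\<^sup>2) - g0 * C\<^sup>2 * (t * (t - 1)) * ((f t)\<^sup>2 * (f t - 1)\<^sup>2)"
      unfolding conic_poly_def A by algebra
    then show ?thesis using difference_polynomial[OF f(1) that d[OF that]] nz(1) by simp
  qed
  have "(\<forall>t\<in>U. (f t)\<^sup>2 - ((A - B) * t + 1 + B) * f t + A * t = 0) \<or> (\<forall>t\<in>U. conic_poly A B C (f t) t = 0)"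
    by (rule germ_product_zero[OF f(1) _ _ prod])
       (unfold conic_poly_def, (intro holomorphic_intros holf)+)
  then have "(\<forall>t\<in>U. (f t)\<^sup>2 - t = 0) \<or> (\<forall>t\<in>U. (f t)\<^sup>2 - 2 * f t + t = 0) \<or> (\<forall>t\<in>U. (f t)\<^sup>2 - 2 * f t * t + t = 0) \<or>
    ((A, B, C) \<in> {(- 1, 1, 3), (- 1, - 3, - 1), (3, 1, - 1), (1 / 3, - 1 / 3, 1 / 3)}
        \<and> (\<forall>t\<in>U. conic_poly A B C (f t) t = 0))"
  proof
    assume h: "\<forall>t\<in>U. (f t)\<^sup>2 - ((A - B) * t + 1 + B) * f t + A * t = 0"
    have "1 - A + B \<noteq> 0" using nz A by simp
    from quadratic_branch[OF f nc nz(2,3) this] h show ?thesis by blast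
  next
    assume "\<forall>t\<in>U. conic_poly A B C (f t) t = 0"
    then show ?thesis using conic_branch[OF f nc A nz(2-4)] by blast
  qed
  then show ?thesis
  proof (elim disjE conjE)
    assume h: "\<forall>t\<in>U. (f t)\<^sup>2 - t = 0"
    show ?thesis by (rule family_relationI[OF f2A]) (use h in blast)
  next
    assume h: "\<forall>t\<in>U. (f t)\<^sup>2 - 2 * f t + t = 0"
    show ?thesis by (rule family_relationI[OF f2B]) (use h in blast)
  next
    assume h: "\<forall>t\<in>U. (f t)\<^sup>2 - 2 * f t * t + t = 0"
    show ?thesis by (rule family_relationI[OF f2C]) (use h in blast)
  next
    assume k: "\<forall>t\<in>U. conic_poly A B C (f t) t = 0"
      and "(A, B, C) \<in> {(- 1, 1, 3), (- 1, - 3, - 1), (3, 1, - 1), (1 / 3, - 1 / 3, 1 / 3)}"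
    then consider "A = - 1 \<and> B = 1 \<and> C = 3" | "A = - 1 \<and> B = - 3 \<and> C = - 1" | "A = 3 \<and> B = 1 \<and> C = - 1"
      | "A = 1 / 3 \<and> B = - 1 / 3 \<and> C = 1 / 3" by auto
    then show ?thesis
    proof cases
      case 1
      show ?thesis
      proof (rule family_relationI[OF f3D])
        fix t assume "t \<in> U"
        have "conic_poly (- 1) 1 3 x t = x^4 - 4 * t * x^3 + 6 * t * x^2 - 4 * t * x + t^2" for x
          unfolding conic_poly_def by algebra
        with bspec[OF k \<open>t \<in> U\<close>] 1 show "f t ^ 4 - 4 * t * f t ^ 3 + 6 * t * (f t)\<^sup>2 - 4 * t * f t + t\<^sup>2 = 0" by simp
      qed
    next
      case 2
      show ?thesis
      proof (rule family_relationI[OF f3C])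
        fix t assume "t \<in> U"
        have "conic_poly (- 1) (- 3) (- 1) x t = x^4 - 4 * x^3 + 6 * t * x^2 - 4 * t^2 * x + t^2" for x
          unfolding conic_poly_def by algebra
        with bspec[OF k \<open>t \<in> U\<close>] 2 show "f t ^ 4 - 4 * f t ^ 3 + 6 * t * (f t)\<^sup>2 - 4 * t\<^sup>2 * f t + t\<^sup>2 = 0" by simp
      qed
    next
      case 3
      show ?thesis
      proof (rule family_relationI[OF f3A])
        fix t assume "t \<in> U"
        have "conic_poly 3 1 (- 1) x t = x^4 - 6 * x^2 * t + 4 * x * t + 4 * x * t^2 - 3 * t^2" for x
          unfolding conic_poly_def by algebra
        with bspec[OF k \<open>t \<in> U\<close>] 3 show "f t ^ 4 - 6 * (f t)\<^sup>2 * t + 4 * f t * t + 4 * f t * t\<^sup>2 - 3 * t\<^sup>2 = 0"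
            by simp
      qed
    next
      case 4
      show ?thesis
      proof (rule family_relationI[OF f3B])
        fix t assume "t \<in> U"
        have "A = 1 / 3" "B = - 1 / 3" "C = 1 / 3" using 4 by blast+
        then have three: "3 * A = 1" "3 * B = - 1" "3 * C = 1" by (simp_all only:) simp_all
        have "3 * conic_poly A B C x t
            = (3 * A - 3 * B) * x * (x - 1) * (x - t)\<^sup>2 + (3 * A + 3 * C) * x * (x - 1)\<^sup>2 * (x - t)
            - 3 * A * (x - 1)\<^sup>2 * (x - t)\<^sup>2 + x\<^sup>2 * (1 - t) * (3 * B * (x - t) + 3 * C * (x - 1))" for x
          unfolding conic_poly_def by algebra
        also have "\<dots> x = 3 * x^4 - 4 * x^3 - 4 * x^3 * t + 6 * x^2 * t - t^2" for x
          unfolding three by algebra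
        finally have "3 * conic_poly A B C x t = 3 * x^4 - 4 * x^3 - 4 * x^3 * t + 6 * x^2 * t - t^2" for x .
        from this[of "f t"] bspec[OF k \<open>t \<in> U\<close>] show
            "3 * f t ^ 4 - 4 * f t ^ 3 - 4 * f t ^ 3 * t + 6 * (f t)\<^sup>2 * t - t\<^sup>2 = 0" by simp
      qed
    qed
  qed
qed

text \<open>
The symmetric form of the condition for a singular point: a choice of square roots with sum zero.
\<close>
fun square_relation :: "parameters \<Rightarrow> bool" where
  "square_relation (g0, g1, g2, g3) \<longleftrightarrow>
    (\<exists>h0 h1 h2 h3. h0\<^sup>2 = g0 \<and> h1\<^sup>2 = g1 \<and> h2\<^sup>2 = g2 \<and> h3\<^sup>2 = g3 \<and> h0 + h1 + h2 + h3 = 0)"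

lemma square_relation_iff:
  assumes "g0 \<noteq> 0"
  shows "square_relation (g0, g1, g2, g3) \<longleftrightarrow>
    (\<exists>A B C. A - B + C = 1 \<and> g1 = g0 * A\<^sup>2 \<and> g2 = g0 * B\<^sup>2 \<and> g3 = g0 * C\<^sup>2)"
proof
  assume "square_relation (g0, g1, g2, g3)"
  then obtain h0 h1 h2 h3 where h: "h0\<^sup>2 = g0" "h1\<^sup>2 = g1" "h2\<^sup>2 = g2" "h3\<^sup>2 = g3" "h0 + h1 + h2 + h3 = 0" by auto
  have h0: "h0 \<noteq> 0" using h assms by auto
  have "- h1 - h2 - h3 = h0" using h(5) by algebra
  then have "(- h1 / h0) - (h2 / h0) + (- h3 / h0) = 1" using h0 by (simp add: divide_simps)
  moreover have "g1 = g0 * (- h1 / h0)\<^sup>2" "g2 = g0 * (h2 / h0)\<^sup>2" "g3 = g0 * (- h3 / h0)\<^sup>2"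
    using h0 unfolding h(1-4)[symmetric] by (simp_all add: power_divide)
  ultimately show "\<exists>A B C. A - B + C = 1 \<and> g1 = g0 * A\<^sup>2 \<and> g2 = g0 * B\<^sup>2 \<and> g3 = g0 * C\<^sup>2" by blast
next
  assume "\<exists>A B C. A - B + C = 1 \<and> g1 = g0 * A\<^sup>2 \<and> g2 = g0 * B\<^sup>2 \<and> g3 = g0 * C\<^sup>2"
  then obtain A B C where ABC: "A - B + C = 1" "g1 = g0 * A\<^sup>2" "g2 = g0 * B\<^sup>2" "g3 = g0 * C\<^sup>2" by blast
  define h where "h = csqrt g0"
  have h: "h\<^sup>2 = g0" by (simp add: h_def)
  have "h + (- A * h) + B * h + (- C * h) = h * (1 - (A - B + C))" by algebra
  then have "h + (- A * h) + B * h + (- C * h) = 0" using ABC(1) by simp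
  then show "square_relation (g0, g1, g2, g3)"
    unfolding square_relation.simps using h ABC(2-4)
    by (intro exI[of _ h] exI[of _ "- A * h"] exI[of _ "B * h"] exI[of _
        "- C * h"]) (simp add: power_mult_distrib mult.commute)
qed

lemma square_relation_swap:
  "square_relation (swap01 g) \<longleftrightarrow> square_relation g" "square_relation (swap12 g) \<longleftrightarrow> square_relation g"
  "square_relation (swap23 g) \<longleftrightarrow> square_relation g"
proof -
  obtain g0 g1 g2 g3 where g: "g = (g0, g1, g2, g3)" by (metis prod_cases4)
  have s: "square_relation (b, a, c, d)" "square_relation (a, c, b, d)" "square_relation (a, b, d, c)"
    if "square_relation (a, b, c, d)" for a b c d
  proof -
    from that obtain h0 h1 h2 h3 where h: "h0\<^sup>2 = a" "h1\<^sup>2 = b" "h2\<^sup>2 = c" "h3\<^sup>2 = d" "h0 + h1 + h2 + h3 = 0" by auto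
    have "h1 + h0 + h2 + h3 = 0" "h0 + h2 + h1 + h3 = 0" "h0 + h1 + h3 + h2 = 0" using h(5)
        by (simp_all add: ac_simps)
    then show "square_relation (b, a, c, d)" "square_relation (a, c, b, d)" "square_relation (a, b, d, c)"
      unfolding square_relation.simps using h(1-4) by blast+
  qed
  show "square_relation (swap01 g) \<longleftrightarrow> square_relation g" "square_relation (swap12 g) \<longleftrightarrow> square_relation g"
    "square_relation (swap23 g) \<longleftrightarrow> square_relation g"
    unfolding g swap01.simps swap12.simps swap23.simps using s by blast+
qed

lemma smooth_degenerate0:
  assumes "all_nonzero (g0, g1, g2, g3)" "\<not> square_relation (g0, g1, g2, g3)" "g0 \<notin> {g1, g2, g3}"
    and "germ f U" "solves \<alpha> f U" "\<And>t. t \<in> U \<Longrightarrow> PVI_difference (g0, g1, g2, g3) (f t) t = 0"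
  shows "degenerate_germ f U"
proof -
  have nz: "g0 \<noteq> 0" "g1 \<noteq> 0" "g2 \<noteq> 0" "g3 \<noteq> 0" and dist: "g0 \<noteq> g1" "g0 \<noteq> g2" "g0 \<noteq> g3"
    using assms(1,3) by auto
  have "\<nexists>A B C. A - B + C = 1 \<and> g1 = g0 * A\<^sup>2 \<and> g2 = g0 * B\<^sup>2 \<and> g3 = g0 * C\<^sup>2"
    using assms(2) unfolding square_relation_iff[OF nz(1)] .
  then have "\<exists>c. \<forall>t\<in>U. f t = c"
    by (rule smooth_curve_constant[OF nz dist _ assms(4,5,6)])
  then show ?thesis unfolding degenerate_germ_def by blast
qed

lemma smooth_degenerate1:
  assumes nz: "all_nonzero (g0, g1, g2, g3)" and sq: "\<not> square_relation (g0, g1, g2, g3)" and i: "g1 \<notin> {g0, g2, g3}"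
    and f: "germ f U" "solves \<alpha> f U" "\<And>t. t \<in> U \<Longrightarrow> PVI_difference (g0, g1, g2, g3) (f t) t = 0"
  shows "degenerate_germ f U"
  by (rule degenerate_flip(1)[OF f(1)], rule smooth_degenerate0[OF _ _ i germ_flip(1)[OF f(1)] solves_flip(1)[OF
      f(1,2)]])
     (use nz sq square_relation_swap(1)[of "(g0, g1, g2, g3)"] difference_flip(1)[OF f(1,3)] in auto)

lemma smooth_degenerate2:
  assumes nz: "all_nonzero (g0, g1, g2, g3)" and sq: "\<not> square_relation (g0, g1, g2, g3)" and i: "g2 \<notin> {g0, g1, g3}"
    and f: "germ f U" "solves \<alpha> f U" "\<And>t. t \<in> U \<Longrightarrow> PVI_difference (g0, g1, g2, g3) (f t) t = 0"
  shows "degenerate_germ f U"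
  by (rule degenerate_flip(2)[OF f(1)], rule smooth_degenerate1[OF _ _ i germ_flip(2)[OF f(1)] solves_flip(2)[OF
      f(1,2)]])
     (use nz sq square_relation_swap(2)[of "(g0, g1, g2, g3)"] difference_flip(2)[OF f(1,3)] in auto)

lemma smooth_degenerate3:
  assumes nz: "all_nonzero (g0, g1, g2, g3)" and sq: "\<not> square_relation (g0, g1, g2, g3)" and i: "g3 \<notin> {g0, g1, g2}"
    and f: "germ f U" "solves \<alpha> f U" "\<And>t. t \<in> U \<Longrightarrow> PVI_difference (g0, g1, g2, g3) (f t) t = 0"
  shows "degenerate_germ f U"
  by (rule degenerate_flip(3)[OF f(1)], rule smooth_degenerate2[OF _ _ i germ_flip(3)[OF f(1)] solves_flip(3)[OF
      f(1,2)]])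
     (use nz sq square_relation_swap(3)[of "(g0, g1, g2, g3)"] difference_flip(3)[OF f(1,3)] in auto)

text \<open>
Square roots \<open>h, - h, k, - k\<close> have sum zero. So if the \<open>g\<close> formed two pairs of equal values, the square
relation would hold. Hence some \<open>g\<close> differs from the three others, and a symmetry moves it to the first position.
\<close>
lemma smooth_degenerate:
  assumes nz: "all_nonzero (g0, g1, g2, g3)" and sq: "\<not> square_relation (g0, g1, g2, g3)"
    and f: "germ f U" "solves \<alpha> f U" "\<And>t. t \<in> U \<Longrightarrow> PVI_difference (g0, g1, g2, g3) (f t) t = 0"
  shows "degenerate_germ f U"
proof -
  have pairs: "\<not> (g0 = g1 \<and> g2 = g3)" "\<not> (g0 = g2 \<and> g1 = g3)" "\<not> (g0 = g3 \<and> g1 = g2)"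
  proof -
    have c: "\<exists>h k. h\<^sup>2 = p \<and> k\<^sup>2 = q" for p q :: complex
      by (intro exI[of _ "csqrt p"] exI[of _ "csqrt q"]) simp
    show "\<not> (g0 = g1 \<and> g2 = g3)" "\<not> (g0 = g2 \<and> g1 = g3)" "\<not> (g0 = g3 \<and> g1 = g2)"
    proof (safe)
      assume "g0 = g1" "g2 = g3"
      obtain h k where "h\<^sup>2 = g0" "k\<^sup>2 = g2" using c by blast
      then have "square_relation (g0, g1, g2, g3)" using \<open>g0 = g1\<close> \<open>g2 = g3\<close> unfolding square_relation.simps
        by (intro exI[of _ h] exI[of _ "- h"] exI[of _ k] exI[of _ "- k"]) auto
      then show False using sq by simp
    next
      assume "g0 = g2" "g1 = g3"
      obtain h k where "h\<^sup>2 = g0" "k\<^sup>2 = g1" using c by blast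
      then have "square_relation (g0, g1, g2, g3)" using \<open>g0 = g2\<close> \<open>g1 = g3\<close> unfolding square_relation.simps
        by (intro exI[of _ h] exI[of _ k] exI[of _ "- h"] exI[of _ "- k"]) auto
      then show False using sq by simp
    next
      assume "g0 = g3" "g1 = g2"
      obtain h k where "h\<^sup>2 = g0" "k\<^sup>2 = g1" using c by blast
      then have "square_relation (g0, g1, g2, g3)" using \<open>g0 = g3\<close> \<open>g1 = g2\<close> unfolding square_relation.simps
        by (intro exI[of _ h] exI[of _ k] exI[of _ "- k"] exI[of _ "- h"]) auto
      then show False using sq by simp
    qed
  qed
  then have "g0 \<notin> {g1, g2, g3} \<or> g1 \<notin> {g0, g2, g3} \<or> g2 \<notin> {g0, g1, g3} \<or> g3 \<notin> {g0, g1, g2}" by auto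
  then show ?thesis
    using smooth_degenerate0[OF nz sq _ f] smooth_degenerate1[OF nz sq _ f] smooth_degenerate2[OF nz sq _ f]
      smooth_degenerate3[OF nz sq _ f] by blast
qed

text \<open>
The flips carry the quartic and the cubics of \<open>one_zero_branch\<close> to the relations \<open>f4A\<close> to \<open>f4C\<close> and \<open>f5A\<close> to \<open>f5I\<close>.
\<close>
lemma flip_quartic:
  "t \<noteq> 0 \<Longrightarrow> (x / t)^4 - 2 * (x / t)^3 + 2 * (1 / t) * (x / t) - 1 / t
      = (x^4 - 2 * t * x^3 + 2 * t^2 * x - t^3) / t ^ 4"
  "(1 - x)^4 - 2 * (1 - t) * (1 - x)^3 + 2 * (1 - t)^2 * (1 - x) - (1 - t)^3 =
    x^4 - 2 * t * x^3 - 2 * x^3 + 6 * t * x^2 - 2 * t^2 * x - 2 * t * x + t^3 - t^2 + t"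
  "t \<noteq> 0 \<Longrightarrow> x \<noteq> 0 \<Longrightarrow> (1 / x)^4 - 2 * (1 / t) * (1 / x)^3 - 2 * (1 / x)^3 + 6 * (1 / t) * (1 / x)^2
      - 2 * (1 / t)^2 * (1 / x)
      - 2 * (1 / t) * (1 / x) + (1 / t)^3 - (1 / t)^2 + 1 / t =
    (x^4 * (t^2 - t + 1) - 2 * x^3 * t * (t + 1) + 6 * t^2 * x^2 - 2 * x * t^2 * (t + 1) + t^3) / (x ^ 4 * t ^ 3)"
  for x t :: complex
    apply (simp add: divide_simps, algebra)
   apply algebra
  apply (simp add: divide_simps, algebra)
  done

lemma flip_cubics23:
  fixes x t :: complex
  assumes "t \<noteq> 0"
  shows "(x / t)^3 - 3 * (x / t)^2 + 3 * (1 / t) * (x / t) - 1 / t = (x^3 - 3 * t * x^2 + 3 * t * x - t^2) / t ^ 3"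
    "(x / t)^3 - 3 * (1 / t) * (x / t) + 2 * (1 / t) = (x^3 - 3 * t * x + 2 * t^2) / t ^ 3"
    "2 * (x / t)^3 - 3 * (x / t)^2 + 1 / t = (2 * x^3 - 3 * t * x^2 + t^2) / t ^ 3"
  using assms by (simp add: divide_simps, algebra)+

lemma flip_cubics12:
  "(1 - x)^3 - 3 * (1 - t) * (1 - x)^2 + 3 * (1 - t) * (1 - x) - (1 - t)^2
      = - (x^3 - 3 * t * x^2 + 3 * t * x + t^2 - 2 * t)"
  "(1 - x)^3 - 3 * (1 - t) * (1 - x) + 2 * (1 - t)^2 = - (x^3 - 3 * x^2 + 3 * t * x - 2 * t^2 + t)"
  "2 * (1 - x)^3 - 3 * (1 - t) * (1 - x)^2 + (1 - t)^2 = - 2 * x^3 + 3 * t * x^2 + 3 * x^2 - 6 * t * x + t^2 + t"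
  for x t :: complex
  by algebra+

lemma flip_cubics01:
  fixes x t :: complex
  assumes "t \<noteq> 0" "x \<noteq> 0"
  shows "(1 / x)^3 - 3 * (1 / t) * (1 / x)^2 + 3 * (1 / t) * (1 / x) + (1 / t)^2 - 2 * (1 / t) =
      ((1 - 2 * t) * x^3 + 3 * t * x^2 - 3 * t * x + t^2) / (x ^ 3 * t ^ 2)"
    "(1 / x)^3 - 3 * (1 / x)^2 + 3 * (1 / t) * (1 / x) - 2 * (1 / t)^2 + 1 / t =
      (x^3 * (2 - t) - 3 * t * x^2 + 3 * t^2 * x - t^2) / (- (x ^ 3 * t ^ 2))"
    "- 2 * (1 / x)^3 + 3 * (1 / t) * (1 / x)^2 + 3 * (1 / x)^2 - 6 * (1 / t) * (1 / x) + (1 / t)^2 + 1 / t =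
      (x^3 * (t + 1) - 6 * t * x^2 + 3 * t * (t + 1) * x - 2 * t^2) / (x ^ 3 * t ^ 2)"
  using assms by (simp add: divide_simps, algebra)+

lemma ball_zero_quotient:
  fixes a b d :: "complex \<Rightarrow> complex"
  assumes "\<forall>t\<in>U. a t = 0" "\<And>t. t \<in> U \<Longrightarrow> a t = b t / d t" "\<And>t. t \<in> U \<Longrightarrow> d t \<noteq> 0"
  shows "\<forall>t\<in>U. b t = 0"
  using assms by simp

lemma one_zero_branch2:
  assumes f: "germ f U" "solves \<alpha> f U" and nd: "\<not> degenerate_germ f U"
    and nz: "g0 \<noteq> 0" "g1 \<noteq> 0" "g3 \<noteq> 0"
    and rel: "\<And>t. t \<in> U \<Longrightarrow> PVI_difference (g0, g1, 0, g3) (f t) t = 0"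
  shows "(\<forall>t\<in>U. f t ^ 4 - 2 * t * f t ^ 3 + 2 * t\<^sup>2 * f t - t ^ 3 = 0) \<or>
    (\<forall>t\<in>U. f t ^ 3 - 3 * t * (f t)\<^sup>2 + 3 * t * f t - t\<^sup>2 = 0) \<or>
    (\<forall>t\<in>U. f t ^ 3 - 3 * t * f t + 2 * t\<^sup>2 = 0) \<or>
    (\<forall>t\<in>U. 2 * f t ^ 3 - 3 * t * (f t)\<^sup>2 + t\<^sup>2 = 0)"
proof -
  have t0: "t \<noteq> 0" if "t \<in> U" for t using f that by (auto simp: germ_def)
  have nc: "\<nexists>c. \<forall>t\<in>dom_inverse U. flip23 f t = c"
    using nd degenerate_flip(3)[OF f(1)] unfolding degenerate_germ_def by blast
  have d: "PVI_difference (g0, g1, g3, 0) (flip23 f t) t = 0" if "t \<in> dom_inverse U" for t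
    using difference_flip(3)[OF f(1) rel that] by simp
  have fl: "flip23 f (1 / t) = f t / t" for t by (simp add: flip23_def)
  have c1: "\<forall>t\<in>U. f t ^ 4 - 2 * t * f t ^ 3 + 2 * t\<^sup>2 * f t - t ^ 3 = 0"
      if "\<forall>t\<in>U. (f t / t) ^ 4 - 2 * (f t / t) ^ 3 + 2 * (1 / t) * (f t / t) - 1 / t = 0"
    by (rule ball_zero_quotient[OF that flip_quartic(1)]) (simp_all add: t0)
  have c2: "\<forall>t\<in>U. f t ^ 3 - 3 * t * (f t)\<^sup>2 + 3 * t * f t - t\<^sup>2 = 0"
      if "\<forall>t\<in>U. (f t / t) ^ 3 - 3 * (f t / t)\<^sup>2 + 3 * (1 / t) * (f t / t) - 1 / t = 0"
    by (rule ball_zero_quotient[OF that flip_cubics23(1)]) (simp_all add: t0)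
  have c3: "\<forall>t\<in>U. f t ^ 3 - 3 * t * f t + 2 * t\<^sup>2 = 0"
      if "\<forall>t\<in>U. (f t / t) ^ 3 - 3 * (1 / t) * (f t / t) + 2 * (1 / t) = 0"
    by (rule ball_zero_quotient[OF that flip_cubics23(2)]) (simp_all add: t0)
  have c4: "\<forall>t\<in>U. 2 * f t ^ 3 - 3 * t * (f t)\<^sup>2 + t\<^sup>2 = 0" if "\<forall>t\<in>U. 2 * (f t / t) ^ 3 - 3 * (f t / t)\<^sup>2 + 1 / t = 0"
    by (rule ball_zero_quotient[OF that flip_cubics23(3)]) (simp_all add: t0)
  from one_zero_branch[OF germ_flip(3)[OF f(1)] solves_flip(3)[OF f] nc nz(1,2,3) d]
  show ?thesis unfolding ball_dom fl using c1 c2 c3 c4 by blast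
qed

lemma one_zero_branch1:
  assumes f: "germ f U" "solves \<alpha> f U" and nd: "\<not> degenerate_germ f U"
    and nz: "g0 \<noteq> 0" "g2 \<noteq> 0" "g3 \<noteq> 0"
    and rel: "\<And>t. t \<in> U \<Longrightarrow> PVI_difference (g0, 0, g2, g3) (f t) t = 0"
  shows "(\<forall>t\<in>U. f t ^ 4 - 2 * t * f t ^ 3 - 2 * f t ^ 3 + 6 * t * (f t)\<^sup>2 - 2 * t\<^sup>2 * f t - 2 * t * f t + t ^ 3
      - t\<^sup>2 + t = 0) \<or>
    (\<forall>t\<in>U. f t ^ 3 - 3 * t * (f t)\<^sup>2 + 3 * t * f t + t\<^sup>2 - 2 * t = 0) \<or>
    (\<forall>t\<in>U. f t ^ 3 - 3 * (f t)\<^sup>2 + 3 * t * f t - 2 * t\<^sup>2 + t = 0) \<or>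
    (\<forall>t\<in>U. - 2 * f t ^ 3 + 3 * t * (f t)\<^sup>2 + 3 * (f t)\<^sup>2 - 6 * t * f t + t\<^sup>2 + t = 0)"
proof -
  have nd': "\<not> degenerate_germ (flip12 f) (dom_reflect U)" using nd degenerate_flip(2)[OF f(1)] by blast
  have d: "PVI_difference (g0, g2, 0, g3) (flip12 f t) t = 0" if "t \<in> dom_reflect U" for t
    using difference_flip(2)[OF f(1) rel that] by simp
  have fl: "flip12 f (1 - t) = 1 - f t" for t by (simp add: flip12_def)
  from one_zero_branch2[OF germ_flip(2)[OF f(1)] solves_flip(2)[OF f] nd' nz d]
  show ?thesis
    unfolding ball_dom fl flip_quartic(2) flip_cubics12 neg_equal_0_iff_equal .
qed

lemma one_zero_branch0:
  assumes f: "germ f U" "solves \<alpha> f U" and nd: "\<not> degenerate_germ f U"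
    and nz: "g1 \<noteq> 0" "g2 \<noteq> 0" "g3 \<noteq> 0"
    and rel: "\<And>t. t \<in> U \<Longrightarrow> PVI_difference (0, g1, g2, g3) (f t) t = 0"
  shows "(\<forall>t\<in>U. f t ^ 4 * (t\<^sup>2 - t + 1) - 2 * f t ^ 3 * t * (t + 1) + 6 * t\<^sup>2 * (f t)\<^sup>2 - 2 * f t * t\<^sup>2 * (t
      + 1) + t ^ 3 = 0) \<or>
    (\<forall>t\<in>U. (1 - 2 * t) * f t ^ 3 + 3 * t * (f t)\<^sup>2 - 3 * t * f t + t\<^sup>2 = 0) \<or>
    (\<forall>t\<in>U. f t ^ 3 * (2 - t) - 3 * t * (f t)\<^sup>2 + 3 * t\<^sup>2 * f t - t\<^sup>2 = 0) \<or>
    (\<forall>t\<in>U. f t ^ 3 * (t + 1) - 6 * t * (f t)\<^sup>2 + 3 * t * (t + 1) * f t - 2 * t\<^sup>2 = 0)"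
proof -
  have t0: "t \<noteq> 0" "f t \<noteq> 0" if "t \<in> U" for t using f that by (auto simp: germ_def)
  have nd': "\<not> degenerate_germ (flip01 f) (dom_inverse U)" using nd degenerate_flip(1)[OF f(1)] by blast
  have d: "PVI_difference (g1, 0, g2, g3) (flip01 f t) t = 0" if "t \<in> dom_inverse U" for t
    using difference_flip(1)[OF f(1) rel that] by simp
  have fl: "flip01 f (1 / t) = 1 / f t" for t by (simp add: flip01_def)
  have c1: "\<forall>t\<in>U. f t ^ 4 * (t\<^sup>2 - t + 1) - 2 * f t ^ 3 * t * (t + 1) + 6 * t\<^sup>2 * (f t)\<^sup>2 - 2 * f t * t\<^sup>2 * (t
      + 1) + t ^ 3 = 0" if "\<forall>t\<in>U. (1 / f t) ^ 4 - 2 * (1 / t) * (1 / f t) ^ 3 - 2 * (1 / f t) ^ 3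
          + 6 * (1 / t) * (1 / f t)\<^sup>2 - 2 * (1 / t)\<^sup>2 * (1 / f t) - 2 * (1 / t) * (1 / f t) + (1 / t) ^ 3
              - (1 / t)\<^sup>2 + 1 / t = 0"
    by (rule ball_zero_quotient[OF that flip_quartic(3)]) (simp_all add: t0)
  have c2: "\<forall>t\<in>U. (1 - 2 * t) * f t ^ 3 + 3 * t * (f t)\<^sup>2 - 3 * t * f t + t\<^sup>2 = 0"
      if "\<forall>t\<in>U. (1 / f t) ^ 3 - 3 * (1 / t) * (1 / f t)\<^sup>2 + 3 * (1 / t) * (1 / f t) + (1 / t)\<^sup>2 - 2 * (1 / t) = 0"
    by (rule ball_zero_quotient[OF that flip_cubics01(1)]) (simp_all add: t0)
  have c3: "\<forall>t\<in>U. f t ^ 3 * (2 - t) - 3 * t * (f t)\<^sup>2 + 3 * t\<^sup>2 * f t - t\<^sup>2 = 0"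
      if "\<forall>t\<in>U. (1 / f t) ^ 3 - 3 * (1 / f t)\<^sup>2 + 3 * (1 / t) * (1 / f t) - 2 * (1 / t)\<^sup>2 + 1 / t = 0"
    by (rule ball_zero_quotient[OF that flip_cubics01(2)]) (simp_all add: t0)
  have c4: "\<forall>t\<in>U. f t ^ 3 * (t + 1) - 6 * t * (f t)\<^sup>2 + 3 * t * (t + 1) * f t - 2 * t\<^sup>2 = 0"
      if "\<forall>t\<in>U. - 2 * (1 / f t) ^ 3 + 3 * (1 / t) * (1 / f t)\<^sup>2 + 3 * (1 / f t)\<^sup>2 - 6 * (1 / t) * (1 / f t)
          + (1 / t)\<^sup>2 + 1 / t = 0"
    by (rule ball_zero_quotient[OF that flip_cubics01(3)]) (simp_all add: t0)
  from one_zero_branch1[OF germ_flip(1)[OF f(1)] solves_flip(1)[OF f] nd' nz d]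
  show ?thesis unfolding ball_dom fl using c1 c2 c3 c4 by blast
qed

text \<open>
The classification for germs, by the number and position of the vanishing components of \<open>g = \<beta> - \<alpha>\<close>.
If two components vanish, the equation of the curve is itself one of the relations.
\<close>
lemma two_solutions_family:
  assumes f: "germ f U" and nd: "\<not> degenerate_germ f U" and sol: "solves \<alpha> f U" "solves \<beta> f U" "\<alpha> \<noteq> \<beta>"
  shows "family_relation f U"
proof -
  obtain g0 g1 g2 g3 where g: "\<beta> - \<alpha> = (g0, g1, g2, g3)" by (metis prod_cases4)
  have d: "PVI_difference (g0, g1, g2, g3) (f t) t = 0" if "t \<in> U" for t
    using solves_difference[OF f sol(1), of \<beta>] sol(2) that unfolding g by blast
  have "\<beta> - \<alpha> \<noteq> 0" using sol(3) by simp
  then have g0: "\<not> (g0 = 0 \<and> g1 = 0 \<and> g2 = 0 \<and> g3 = 0)" unfolding g zero_prod_def by auto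
  have nc: "\<nexists>c. \<forall>t\<in>U. f t = c" using nd unfolding degenerate_germ_def by blast
  have reg: "t \<noteq> 0" "t - 1 \<noteq> 0" "f t \<noteq> 0" "f t - 1 \<noteq> 0" "f t - t \<noteq> 0" "1 - t \<noteq> 0" if "t \<in> U" for t using f that
      by (auto simp: germ_def)
  obtain t1 where t1: "t1 \<in> U" using f by (auto simp: germ_def)
  note p = difference_polynomial[OF f _ d]
  have p1: "g0 * ((f t1)\<^sup>2 * (f t1 - 1)\<^sup>2 * (f t1 - t1)\<^sup>2) - g1 * t1 * ((f t1 - 1)\<^sup>2 * (f t1 - t1)\<^sup>2)
    + g2 * (t1 - 1) * ((f t1)\<^sup>2 * (f t1 - t1)\<^sup>2) - g3 * (t1 * (t1 - 1)) * ((f t1)\<^sup>2 * (f t1 - 1)\<^sup>2) = 0"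
    by (rule p[OF t1 t1])
  have canc: "b = 0" if "a * b = 0" "a \<noteq> 0" for a b :: complex using that by simp
  consider (all) "g0 \<noteq> 0" "g1 \<noteq> 0" "g2 \<noteq> 0" "g3 \<noteq> 0"
    | (z0) "g0 = 0" "g1 \<noteq> 0" "g2 \<noteq> 0" "g3 \<noteq> 0" | (z1) "g1 = 0" "g0 \<noteq> 0" "g2 \<noteq> 0" "g3 \<noteq> 0"
    | (z2) "g2 = 0" "g0 \<noteq> 0" "g1 \<noteq> 0" "g3 \<noteq> 0" | (z3) "g3 = 0" "g0 \<noteq> 0" "g1 \<noteq> 0" "g2 \<noteq> 0"
    | (n01) "g2 = 0" "g3 = 0" | (n02) "g1 = 0" "g3 = 0" | (n03) "g1 = 0" "g2 = 0"
    | (n12) "g0 = 0" "g3 = 0" | (n13) "g0 = 0" "g2 = 0" | (n23) "g0 = 0" "g1 = 0" by blast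
  then show ?thesis
  proof cases
    case all
    have "square_relation (g0, g1, g2, g3)"
      using smooth_degenerate[of g0 g1 g2 g3 f U \<alpha>] all f sol(1) d nd by (meson all_nonzero.simps)
    then obtain A B C where ABC: "A - B + C = 1" "g1 = g0 * A\<^sup>2" "g2 = g0 * B\<^sup>2" "g3 = g0 * C\<^sup>2"
      using square_relation_iff[OF all(1)] by blast
    have "A = 1 + B - C" using ABC(1) by algebra
    moreover have "A \<noteq> 0" "B \<noteq> 0" "C \<noteq> 0" using all ABC by auto
    ultimately show ?thesis using square_relation_family[OF f sol(1) nc all(1)] d unfolding ABC by blast
  next
    case z3
    show ?thesis
      by (rule one_zero_branch[OF f sol(1) nc z3(2-4), THEN disjE])
        ((rule d[unfolded z3(1)], assumption) | (rule family_relationI_ball[OF f4D], assumption)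
            | (rule family_relationI_ball[OF f5J], assumption)
                | (rule family_relationI_ball[OF f5K], assumption)
                    | (rule family_relationI_ball[OF f5L], assumption) | elim disjE)+
  next
    case z2
    show ?thesis
      by (rule one_zero_branch2[OF f sol(1) nd z2(2-4), THEN disjE])
        ((rule d[unfolded z2(1)], assumption) | (rule family_relationI_ball[OF f4B], assumption)
            | (rule family_relationI_ball[OF f5F], assumption)
                | (rule family_relationI_ball[OF f5E], assumption)
                    | (rule family_relationI_ball[OF f5D], assumption) | elim disjE)+
  next
    case z1
    show ?thesis
      by (rule one_zero_branch1[OF f sol(1) nd z1(2-4), THEN disjE])
        ((rule d[unfolded z1(1)], assumption) | (rule family_relationI_ball[OF f4A], assumption)
            | (rule family_relationI_ball[OF f5C], assumption)
                | (rule family_relationI_ball[OF f5B], assumption)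
                    | (rule family_relationI_ball[OF f5A], assumption) | elim disjE)+
  next
    case z0
    show ?thesis
      by (rule one_zero_branch0[OF f sol(1) nd z0(2-4), THEN disjE])
        ((rule d[unfolded z0(1)], assumption) | (rule family_relationI_ball[OF f4C], assumption)
            | (rule family_relationI_ball[OF f5I], assumption)
                | (rule family_relationI_ball[OF f5G], assumption)
                    | (rule family_relationI_ball[OF f5H], assumption) | elim disjE)+
  next
    case n01
    have e: "g0 * (f t)\<^sup>2 - g1 * t = 0" if "t \<in> U" for t
      by (rule canc[of "(f t - 1)\<^sup>2 * (f t
          - t)\<^sup>2"]) (use p[OF that that] reg[OF that] n01 in \<open>simp_all add: algebra_simps\<close>)
    have nz: "g0 \<noteq> 0" "g1 \<noteq> 0" using e[OF t1] reg[OF t1] g0 n01 by auto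
    show ?thesis
    proof (cases "g0 = g1")
      case True
      have "(f t)\<^sup>2 - t = 0" if "t \<in> U" for t
        by (rule canc[of g0]) (use e[OF that] True nz in \<open>simp_all add: algebra_simps\<close>)
      then show ?thesis by (rule family_relationI[OF f2A])
    next
      case False
      show ?thesis by (rule family_relationI[OF f1A[OF nz False] e])
    qed
  next
    case n02
    have e: "g0 * (f t - 1)\<^sup>2 + g2 * (t - 1) = 0" if "t \<in> U" for t
      by (rule canc[of "(f t)\<^sup>2 * (f t
          - t)\<^sup>2"]) (use p[OF that that] reg[OF that] n02 in \<open>simp_all add: algebra_simps\<close>)
    have nz: "g0 \<noteq> 0" "g2 \<noteq> 0" using e[OF t1] reg[OF t1] g0 n02 by auto
    show ?thesis
    proof (cases "g0 = g2")
      case True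
      have "(f t)\<^sup>2 - 2 * f t + t = 0" if "t \<in> U" for t
      proof (rule canc[of g0])
        show "g0 * ((f t)\<^sup>2 - 2 * f t + t) = 0" using e[OF that] True by algebra
      qed (rule nz)
      then show ?thesis by (rule family_relationI[OF f2B])
    next
      case False
      show ?thesis by (rule family_relationI[OF f1B[OF nz False] e])
    qed
  next
    case n03
    have e: "g0 * (f t - t)\<^sup>2 - g3 * t * (t - 1) = 0" if "t \<in> U" for t
      by (rule canc[of "(f t)\<^sup>2 * (f t
          - 1)\<^sup>2"]) (use p[OF that that] reg[OF that] n03 in \<open>simp_all add: algebra_simps\<close>)
    have nz: "g0 \<noteq> 0" "g3 \<noteq> 0" using e[OF t1] reg[OF t1] g0 n03 by auto
    show ?thesis
    proof (cases "g0 = g3")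
      case True
      have "(f t)\<^sup>2 - 2 * f t * t + t = 0" if "t \<in> U" for t
      proof (rule canc[of g0])
        show "g0 * ((f t)\<^sup>2 - 2 * f t * t + t) = 0" using e[OF that] True by algebra
      qed (rule nz)
      then show ?thesis by (rule family_relationI[OF f2C])
    next
      case False
      show ?thesis by (rule family_relationI[OF f1C[OF nz False] e])
    qed
  next
    case n12
    have e: "- g1 * t * (f t - 1)\<^sup>2 + g2 * (t - 1) * (f t)\<^sup>2 = 0" if "t \<in> U" for t
      by (rule canc[of "(f t - t)\<^sup>2"]) (use p[OF that that] reg[OF that] n12 in \<open>simp_all add: algebra_simps\<close>)
    have nz: "g1 \<noteq> 0" "g2 \<noteq> 0" using e[OF t1] reg[OF t1] g0 n12 by auto
    show ?thesis
    proof (cases "g1 = g2")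
      case True
      have "(f t)\<^sup>2 - 2 * f t * t + t = 0" if "t \<in> U" for t
      proof (rule canc[of g1])
        show "g1 * ((f t)\<^sup>2 - 2 * f t * t + t) = 0" using e[OF that] True by algebra
      qed (rule nz)
      then show ?thesis by (rule family_relationI[OF f2C])
    next
      case False
      show ?thesis by (rule family_relationI[OF f1D[OF nz False] e])
    qed
  next
    case n13
    have e: "g1 * (f t - t)\<^sup>2 + g3 * (t - 1) * (f t)\<^sup>2 = 0" if "t \<in> U" for t
    proof (rule canc[of "- t * (f t - 1)\<^sup>2"])
      have "- t * (f t - 1)\<^sup>2 * (g1 * (f t - t)\<^sup>2 + g3 * (t - 1) * (f t)\<^sup>2) =
          g0 * ((f t)\<^sup>2 * (f t - 1)\<^sup>2 * (f t - t)\<^sup>2) - g1 * t * ((f t - 1)\<^sup>2 * (f t - t)\<^sup>2)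
          + g2 * (t - 1) * ((f t)\<^sup>2 * (f t - t)\<^sup>2) - g3 * (t * (t - 1)) * ((f t)\<^sup>2 * (f t - 1)\<^sup>2)"
        unfolding n13 by algebra
      then show "- t * (f t - 1)\<^sup>2 * (g1 * (f t - t)\<^sup>2 + g3 * (t - 1) * (f t)\<^sup>2) = 0"
        using p[OF that that] by (rule trans)
    qed (use reg[OF that] in simp)
    have nz: "g1 \<noteq> 0" "g3 \<noteq> 0" using e[OF t1] reg[OF t1] g0 n13 by auto
    show ?thesis
    proof (cases "g1 = g3")
      case True
      have "(f t)\<^sup>2 - 2 * f t + t = 0" if "t \<in> U" for t
      proof (rule canc[of "g1 * t"])
        show "g1 * t * ((f t)\<^sup>2 - 2 * f t + t) = 0" using e[OF that] True by algebra
      qed (use nz reg[OF that] in simp)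
      then show ?thesis by (rule family_relationI[OF f2B])
    next
      case False
      show ?thesis by (rule family_relationI[OF f1E[OF nz False] e])
    qed
  next
    case n23
    have e: "g2 * (f t - t)\<^sup>2 - g3 * t * (f t - 1)\<^sup>2 = 0" if "t \<in> U" for t
      by (rule canc[of "(t - 1) * (f t)\<^sup>2"]) (use p[OF that that] reg[OF that] n23 in \<open>simp_all add: algebra_simps\<close>)
    have nz: "g2 \<noteq> 0" "g3 \<noteq> 0" using e[OF t1] reg[OF t1] g0 n23 by auto
    show ?thesis
    proof (cases "g2 = g3")
      case True
      have "(f t)\<^sup>2 - t = 0" if "t \<in> U" for t
      proof (rule canc[of "g2 * (1 - t)"])
        show "g2 * (1 - t) * ((f t)\<^sup>2 - t) = 0" using e[OF that] True by algebra
      qed (use nz reg[OF that] in simp)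
      then show ?thesis by (rule family_relationI[OF f2A])
    next
      case False
      show ?thesis by (rule family_relationI[OF f1F[OF nz False] e])
    qed
  qed
qed

section \<open>The parameters of one family from each orbit\<close>

definition family_correct :: "(complex \<Rightarrow> complex \<Rightarrow> complex) \<Rightarrow> parameters set \<Rightarrow> bool" where
  "family_correct P S \<longleftrightarrow> (\<forall>f U. germ f U \<longrightarrow> (\<forall>t\<in>U. P (f t) t = 0) \<longrightarrow> {\<alpha>. solves \<alpha> f U} = S)"

lemma parameter_nonconstant:
  assumes "germ f U" "\<And>t. t \<in> U \<Longrightarrow> \<tau> (\<sigma> t) = t"
  shows "\<nexists>c. \<forall>t\<in>U. \<sigma> t = c"
proof
  assume "\<exists>c. \<forall>t\<in>U. \<sigma> t = c"
  then obtain c where "\<forall>t\<in>U. \<sigma> t = c" ..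
  then have "t = \<tau> c" if "t \<in> U" for t using assms(2)[OF that] that by simp
  then have "U = {\<tau> c}" using assms(1) by (auto simp: germ_def)
  then show False using assms(1) not_open_singleton[of "\<tau> c"] by (simp add: germ_def)
qed

text \<open>
One solution \<open>\<alpha>0\<close> is verified by substitution. A parameter \<open>\<alpha>\<close> is then another solution if and only if the
difference for \<open>\<alpha> - \<alpha>0\<close> vanishes along the germ, that is, if and only if its numerator \<open>p\<close> is the zero
polynomial in the parameter \<open>\<sigma>\<close>.
\<close>
lemma solution_parameters:
  assumes f: "germ f U" and \<sigma>: "\<sigma> holomorphic_on U"
    and par: "\<And>t. t \<in> U \<Longrightarrow> \<tau> (\<sigma> t) = t" "\<And>t. t \<in> U \<Longrightarrow> \<xi> (\<sigma> t) = f t"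
    and d\<tau>: "\<And>t. t \<in> U \<Longrightarrow> (\<tau> has_field_derivative t1 (\<sigma> t)) (at (\<sigma> t))"
      "\<And>t. t \<in> U \<Longrightarrow> (t1 has_field_derivative t2 (\<sigma> t)) (at (\<sigma> t))"
    and d\<xi>: "\<And>t. t \<in> U \<Longrightarrow> (\<xi> has_field_derivative x1 (\<sigma> t)) (at (\<sigma> t))"
      "\<And>t. t \<in> U \<Longrightarrow> (x1 has_field_derivative x2 (\<sigma> t)) (at (\<sigma> t))"
    and eqn: "\<And>t. t \<in> U \<Longrightarrow> x2 (\<sigma> t) * t1 (\<sigma> t) - x1 (\<sigma> t) * t2 (\<sigma> t) = PVI_a t (f t) * (x1 (\<sigma> t))\<^sup>2 * t1 (\<sigma> t)
        + PVI_b t (f t) * x1 (\<sigma> t) * (t1 (\<sigma> t))\<^sup>2 + PVI_rhs \<alpha>0 t (f t) 0 * t1 (\<sigma> t) ^ 3"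
    and diff: "\<And>t \<delta>. t \<in> U \<Longrightarrow> PVI_difference \<delta> (f t) t = 0 \<longleftrightarrow> poly (p \<delta>) (\<sigma> t) = 0"
  shows "{\<alpha>. solves \<alpha> f U} = {\<alpha>. p (\<alpha> - \<alpha>0) = 0}"
proof -
  have U: "open U" using f by (simp add: germ_def)
  have "solves \<alpha>0 f U"
    unfolding solves_def using parametrized_equation(2)[OF U _ \<sigma> par d\<tau> d\<xi>, of _ \<alpha>0] eqn by blast
  note sd = solves_difference[OF f this]
  have nc: "\<nexists>c. \<forall>t\<in>U. \<sigma> t = c"
    by (rule parameter_nonconstant[OF f]) (rule par(1))
  have "solves \<alpha> f U \<longleftrightarrow> p (\<alpha> - \<alpha>0) = 0" for \<alpha>
  proof
    assume "solves \<alpha> f U"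
    then have "poly (p (\<alpha> - \<alpha>0)) (\<sigma> t) = 0" if "t \<in> U" for t using sd diff that by blast
    then show "p (\<alpha> - \<alpha>0) = 0"
      by (rule poly_vanishing_on_image[OF f \<sigma> nc])
  next
    assume "p (\<alpha> - \<alpha>0) = 0"
    then have "poly (p (\<alpha> - \<alpha>0)) (\<sigma> t) = 0" for t by simp
    then show "solves \<alpha> f U" using sd diff by blast
  qed
  then show ?thesis by blast
qed

lemma family_1A:
  assumes nz: "a0 \<noteq> 0" "b0 \<noteq> 0" "a0 \<noteq> b0"
  shows "family_correct (\<lambda>x t. a0 * x\<^sup>2 - b0 * t) {(s * a0, s * b0, 1/8, 1/8) | s. True}"
  unfolding family_correct_def
proof (intro allI impI)
  fix f U assume f: "germ f U" and rel: "\<forall>t\<in>U. a0 * (f t)\<^sup>2 - b0 * t = 0"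
  define k where "k = a0 / b0"
  have k: "k \<noteq> 0" "k \<noteq> 1" "b0 * k = a0" using nz by (auto simp: k_def)
  have t: "k * (f t)\<^sup>2 = t" if "t \<in> U" for t
  proof -
    have "b0 * (k * (f t)\<^sup>2) = b0 * t" using bspec[OF rel that] k(3) by algebra
    then show ?thesis using nz by simp
  qed
  have reg: "t \<noteq> 0" "t \<noteq> 1" "f t \<noteq> 0" "f t \<noteq> 1" "f t \<noteq> t" if "t \<in> U" for t using f that by (auto simp: germ_def)
  define p where "p \<delta> = (case \<delta> of (d0, d1, d2, d3) \<Rightarrow>
    smult (d0 - k * d1) ([:-1, 1:]\<^sup>2 * [:1, -k:]\<^sup>2) + smult d2 ([:-1, 0, k:] * [:1, -k:]\<^sup>2)
        - smult (d3 * k) ([:-1, 0, k:] * [:-1, 1:]\<^sup>2))" for \<delta> :: parameters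
  have ev: "poly (p (d0, d1, d2, d3)) x
      = (d0 - k * d1) * ((x - 1)\<^sup>2 * (1 - k * x)\<^sup>2) + d2 * ((k * x\<^sup>2 - 1) * (1 - k * x)\<^sup>2)
      - d3 * k * ((k * x\<^sup>2 - 1) * (x - 1)\<^sup>2)" for d0 d1 d2 d3 x
    by (simp add: p_def) algebra
  have "{\<alpha>. solves \<alpha> f U} = {\<alpha>. p (\<alpha> - (0, 0, 1/8, 1/8)) = 0}"
  proof (rule solution_parameters[where \<tau> = "\<lambda>x. k * x\<^sup>2" and \<xi> = "\<lambda>x. x" and ?t1.0 =
      "\<lambda>x. 2 * k * x" and ?t2.0 = "\<lambda>x. 2 * k"
        and ?x1.0 = "\<lambda>x. 1" and ?x2.0 = "\<lambda>x. 0" and \<sigma> = f, OF f])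
    fix t assume tU: "t \<in> U"
    define x y z w where "x = f t" "y = x - 1" "z = 1 - k * x" "w = k * x\<^sup>2 - 1"
    have tx: "t = k * x\<^sup>2" using t[OF tU] by (simp add: x_y_z_w_def)
    have e0: "f t = x" by (simp add: x_y_z_w_def)
    have "x - 1 = y" "x - t = x * z" "t - 1 = w" unfolding tx
        by (simp_all add: x_y_z_w_def(2-) power2_eq_square algebra_simps)
    note e = e0 this
    have n: "x \<noteq> 0" "y \<noteq> 0" "z \<noteq> 0" "w \<noteq> 0" using reg[OF tU] e by auto
    show "0 * (2 * k * f t) - 1 * (2 * k) = PVI_a t (f t) * 1\<^sup>2 * (2 * k * f t)
        + PVI_b t (f t) * 1 * (2 * k * f t)\<^sup>2 + PVI_rhs (0, 0, 1/8, 1/8) t (f t) 0 * (2 * k * f t) ^ 3"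
      unfolding PVI_a_def PVI_b_def PVI_rhs_def prod.case e unfolding tx
      using n k(1) by (simp add: divide_simps) (simp add: x_y_z_w_def(2-), algebra)
    fix \<delta> :: parameters
    obtain d0 d1 d2 d3 where d: "\<delta> = (d0, d1, d2, d3)" by (metis prod_cases4)
    have "PVI_difference \<delta> (f t) t * (y\<^sup>2 * z\<^sup>2) = poly (p \<delta>) (f t)"
      unfolding d ev PVI_difference.simps e unfolding tx x_y_z_w_def(2-)[symmetric]
      using n k(1) by (simp add: divide_simps) algebra
    then show "PVI_difference \<delta> (f t) t = 0 \<longleftrightarrow> poly (p \<delta>) (f t) = 0" using n by (metis mult_eq_0_iff power_not_zero)
  qed (use f t in \<open>auto simp: germ_def intro!: derivative_eq_intros\<close>)
  also have "\<dots> = {(s * a0, s * b0, 1/8, 1/8) | s. True}"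
  proof (intro equalityI subsetI)
    fix \<alpha> :: parameters assume "\<alpha> \<in> {\<alpha>. p (\<alpha> - (0, 0, 1/8, 1/8)) = 0}"
    moreover obtain c0 c1 c2 c3 where c: "\<alpha> = (c0, c1, c2, c3)" by (metis prod_cases4)
    ultimately have p: "p (c0, c1, c2 - 1/8, c3 - 1/8) = 0" by simp
    have "c2 - 1/8 = 0" using ev[of c0 c1 "c2 - 1/8" "c3 - 1/8" 1] k unfolding p by simp
    moreover have "c3 - 1/8 = 0"
    proof -
      define r where "r = 1 / k"
      have r: "k * r = 1" "r \<noteq> 1" using k by (auto simp: r_def)
      then have "k * r\<^sup>2 = r" by (simp add: power2_eq_square flip: mult.assoc)
      then have "(c3 - 1/8) * k * ((r - 1) * (r - 1)\<^sup>2) = 0"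
        using ev[of c0 c1 "c2 - 1/8" "c3 - 1/8" r] r unfolding p by simp
      then show ?thesis using r k unfolding mult_eq_0_iff
          by (metis mult_zero_left power_not_zero right_minus_eq zero_neq_one)
    qed
    moreover have "c0 = k * c1" using ev[of c0 c1 "c2 - 1/8" "c3 - 1/8" 0] calculation unfolding p by simp
    ultimately have "\<alpha> = ((c1 / b0) * a0, (c1 / b0) * b0, 1/8, 1/8)" using nz c by (simp add: k_def)
    then show "\<alpha> \<in> {(s * a0, s * b0, 1/8, 1/8) | s. True}" by blast
  next
    fix \<alpha> :: parameters assume "\<alpha> \<in> {(s * a0, s * b0, 1/8, 1/8) | s. True}"
    then obtain s where s: "\<alpha> = (s * a0, s * b0, 1/8, 1/8)" by blast
    have "poly (p (s * a0, s * b0, 0, 0)) x = 0" for x unfolding ev using k(3)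
        by (simp add: mult.commute mult.left_commute)
    then have "p (s * a0, s * b0, 0, 0) = 0" using poly_all_0_iff_0 by blast
    then show "\<alpha> \<in> {\<alpha>. p (\<alpha> - (0, 0, 1/8, 1/8)) = 0}" by (simp add: s zero_prod_def)
  qed
  finally show "{\<alpha>. solves \<alpha> f U} = {(s * a0, s * b0, 1/8, 1/8) | s. True}" .
qed

lemma family_2A: "family_correct (\<lambda>x t. x\<^sup>2 - t) {(a, a, b, b) | a b. True}"
  unfolding family_correct_def
proof (intro allI impI)
  fix f U assume f: "germ f U" and rel: "\<forall>t\<in>U. (f t)\<^sup>2 - t = 0"
  have t: "(f t)\<^sup>2 = t" if "t \<in> U" for t using bspec[OF rel that] by simp
  have reg: "t \<noteq> 0" "t \<noteq> 1" "f t \<noteq> 0" "f t \<noteq> 1" "f t \<noteq> t" if "t \<in> U" for t using f that by (auto simp: germ_def)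
  define p where "p \<delta> = (case \<delta> of (d0, d1, d2, d3) \<Rightarrow> smult (d0 - d1) [:-1, 1:] + smult (d2 - d3) [:1, 1:])"
      for \<delta> :: parameters
  have ev: "poly (p (d0, d1, d2, d3)) x = (d0 - d1) * (x - 1) + (d2 - d3) * (x + 1)" for d0 d1 d2 d3 x
    by (simp add: p_def algebra_simps)
  have "{\<alpha>. solves \<alpha> f U} = {\<alpha>. p (\<alpha> - (0, 0, 0, 0)) = 0}"
  proof (rule solution_parameters[where \<tau> = "\<lambda>x. x\<^sup>2" and \<xi> = "\<lambda>x. x" and ?t1.0 = "\<lambda>x. 2 * x" and ?t2.0 = "\<lambda>x. 2"
        and ?x1.0 = "\<lambda>x. 1" and ?x2.0 = "\<lambda>x. 0" and \<sigma> = f, OF f])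
    fix t assume tU: "t \<in> U"
    define x y z where "x = f t" "y = x - 1" "z = x + 1"
    have tx: "t = x\<^sup>2" using t[OF tU] by (simp add: x_y_z_def)
    have e0: "f t = x" by (simp add: x_y_z_def)
    have "x - 1 = y" "x - t = - (x * y)" "t - 1 = y * z" unfolding tx
        by (simp_all add: x_y_z_def(2-) power2_eq_square algebra_simps)
    note e = e0 this
    have n: "x \<noteq> 0" "y \<noteq> 0" "z \<noteq> 0" using reg[OF tU] e by auto
    show "0 * (2 * f t) - 1 * 2 = PVI_a t (f t) * 1\<^sup>2 * (2 * f t)
        + PVI_b t (f t) * 1 * (2 * f t)\<^sup>2 + PVI_rhs (0, 0, 0, 0) t (f t) 0 * (2 * f t) ^ 3"
      unfolding PVI_a_def PVI_b_def PVI_rhs_def prod.case e unfolding tx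
      using n by (simp add: divide_simps) (simp add: x_y_z_def(2-), algebra)
    fix \<delta> :: parameters
    obtain d0 d1 d2 d3 where d: "\<delta> = (d0, d1, d2, d3)" by (metis prod_cases4)
    have "PVI_difference \<delta> (f t) t * y = poly (p \<delta>) (f t)"
      unfolding d ev PVI_difference.simps e unfolding tx x_y_z_def(2-)[symmetric]
      using n by (simp add: divide_simps) algebra
    then show "PVI_difference \<delta> (f t) t = 0 \<longleftrightarrow> poly (p \<delta>) (f t) = 0" using n by (metis mult_eq_0_iff)
  qed (use f t in \<open>auto simp: germ_def intro!: derivative_eq_intros\<close>)
  also have "\<dots> = {(a :: complex, a, b :: complex, b) | a b. True}"
  proof (intro equalityI subsetI)
    fix \<alpha> :: parameters assume "\<alpha> \<in> {\<alpha>. p (\<alpha> - (0, 0, 0, 0)) = 0}"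
    moreover obtain c0 c1 c2 c3 where c: "\<alpha> = (c0, c1, c2, c3)" by (metis prod_cases4)
    ultimately have p: "p (c0, c1, c2, c3) = 0" by simp
    show "\<alpha> \<in> {(a :: complex, a, b :: complex, b) | a b. True}"
      using ev[of c0 c1 c2 c3 1] ev[of c0 c1 c2 c3 "- 1"] unfolding p c by simp
  next
    fix \<alpha> :: parameters assume "\<alpha> \<in> {(a :: complex, a, b :: complex, b) | a b. True}"
    then obtain a b where s: "\<alpha> = (a, a, b, b)" by blast
    show "\<alpha> \<in> {\<alpha>. p (\<alpha> - (0, 0, 0, 0)) = 0}" by (simp add: s p_def)
  qed
  finally show "{\<alpha>. solves \<alpha> f U} = {(a :: complex, a, b :: complex, b) | a b. True}" .
qed

lemma quartic_parameter_derivatives: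
  fixes x :: complex
  assumes nz: "1 - 2 * x \<noteq> 0"
  shows "((\<lambda>x. x ^ 3 * (x - 2) / (1 - 2 * x)) has_field_derivative - 6 * x\<^sup>2 * (x - 1)\<^sup>2 / (1 - 2 * x)\<^sup>2) (at x)"
    and "((\<lambda>x. - 6 * x\<^sup>2 * (x - 1)\<^sup>2 / (1 - 2 * x)\<^sup>2) has_field_derivative
        12 * x * (x - 1) * (2 * x\<^sup>2 - 2 * x + 1) / (1 - 2 * x) ^ 3) (at x)"
proof -
  define m where "m = 1 - 2 * x"
  have m: "m \<noteq> 0" using nz by (simp add: m_def)
  have "((\<lambda>x. x ^ 3 * (x - 2)) has_field_derivative 4 * x ^ 3 - 6 * x\<^sup>2) (at x)"
    by (auto intro!: derivative_eq_intros; algebra)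
  moreover have "((\<lambda>x. 1 - 2 * x) has_field_derivative - 2) (at x)"
    by (auto intro!: derivative_eq_intros)
  ultimately have "((\<lambda>x. x ^ 3 * (x - 2) / (1 - 2 * x)) has_field_derivative
      ((4 * x ^ 3 - 6 * x\<^sup>2) * m - x ^ 3 * (x - 2) * - 2) / (m * m)) (at x)"
    using DERIV_divide nz unfolding m_def by blast
  moreover have "((4 * x ^ 3 - 6 * x\<^sup>2) * m - x ^ 3 * (x - 2) * - 2) / (m * m) = - 6 * x\<^sup>2 * (x - 1)\<^sup>2 / m\<^sup>2"
    using m by (simp add: divide_simps) (simp add: m_def, algebra)
  ultimately show "((\<lambda>x. x ^ 3 * (x - 2) / (1 - 2 * x)) has_field_derivative - 6 * x\<^sup>2 * (x - 1)\<^sup>2 / (1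
      - 2 * x)\<^sup>2) (at x)"
    by (simp only: m_def)
  have "((\<lambda>x. - 6 * x\<^sup>2 * (x - 1)\<^sup>2) has_field_derivative - 12 * x * (x - 1) * (2 * x - 1)) (at x)"
    by (auto intro!: derivative_eq_intros; algebra)
  moreover have "((\<lambda>x. (1 - 2 * x)\<^sup>2) has_field_derivative - 4 * (1 - 2 * x)) (at x)"
    by (auto intro!: derivative_eq_intros; algebra)
  ultimately have "((\<lambda>x. - 6 * x\<^sup>2 * (x - 1)\<^sup>2 / (1 - 2 * x)\<^sup>2) has_field_derivative
      (- 12 * x * (x - 1) * (2 * x - 1) * m\<^sup>2 - (- 6 * x\<^sup>2 * (x - 1)\<^sup>2) * (- 4 * m)) / (m\<^sup>2 * m\<^sup>2)) (at x)"
    using DERIV_divide nz power_not_zero unfolding m_def by blast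
  moreover have "(- 12 * x * (x - 1) * (2 * x - 1) * m\<^sup>2 - (- 6 * x\<^sup>2 * (x - 1)\<^sup>2) * (- 4 * m)) / (m\<^sup>2 * m\<^sup>2)
      = 12 * x * (x - 1) * (2 * x\<^sup>2 - 2 * x + 1) / m ^ 3"
    using m by (simp add: divide_simps) (simp add: m_def, algebra)
  ultimately show "((\<lambda>x. - 6 * x\<^sup>2 * (x - 1)\<^sup>2 / (1 - 2 * x)\<^sup>2) has_field_derivative
        12 * x * (x - 1) * (2 * x\<^sup>2 - 2 * x + 1) / (1 - 2 * x) ^ 3) (at x)"
    by (simp only: m_def)
qed

lemma family_4D: "family_correct (\<lambda>x t. x^4 - 2 * x^3 + 2 * t * x - t) {(a, a, a, 1/8) | a. True}"
  unfolding family_correct_def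
proof (intro allI impI)
  fix f U assume f: "germ f U" and rel: "\<forall>t\<in>U. f t ^ 4 - 2 * f t ^ 3 + 2 * t * f t - t = 0"
  have reg: "t \<noteq> 0" "t \<noteq> 1" "f t \<noteq> 0" "f t \<noteq> 1" "f t \<noteq> t" if "t \<in> U" for t using f that by (auto simp: germ_def)
  have m: "t * (1 - 2 * f t) = f t ^ 3 * (f t - 2)" if "t \<in> U" for t using bspec[OF rel that] by algebra
  have m0: "1 - 2 * f t \<noteq> 0" if "t \<in> U" for t
  proof
    assume h: "1 - 2 * f t = 0"
    then have "f t - 2 = 0" using m[OF that] reg[OF that] by simp
    then have "f t = 2" by simp
    then show False using h by simp
  qed
  have t: "f t ^ 3 * (f t - 2) / (1 - 2 * f t) = t" if "t \<in> U" for t using m[OF that] m0[OF that]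
      by (simp add: field_simps)
  define p where "p \<delta> = (case \<delta> of (d0, d1, d2, d3) \<Rightarrow>
    (smult d0 [:1, -2:] - smult d1 [:0, -2, 1:] + smult d2 [:-1, 0, 1:]) * [:1, -1, 1:]\<^sup>2
     - smult d3 ([:0, -2, 1:] * [:-1, 0, 1:] * [:1, -2:]))" for \<delta> :: parameters
  have ev: "poly (p (d0, d1, d2, d3)) x
      = (d0 * (1 - 2 * x) - d1 * (x * (x - 2)) + d2 * ((x - 1) * (x + 1))) * (x\<^sup>2 - x + 1)\<^sup>2
      - d3 * (x * (x - 2) * ((x - 1) * (x + 1)) * (1 - 2 * x))" for d0 d1 d2 d3 x
    by (simp add: p_def) algebra
  have "{\<alpha>. solves \<alpha> f U} = {\<alpha>. p (\<alpha> - (0, 0, 0, 1/8)) = 0}"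
  proof (rule solution_parameters[where \<tau> = "\<lambda>x. x ^ 3 * (x - 2) / (1 - 2 * x)" and \<xi> = "\<lambda>x. x"
        and ?t1.0 = "\<lambda>x. - 6 * x\<^sup>2 * (x - 1)\<^sup>2 / (1 - 2 * x)\<^sup>2" and ?t2.0 =
            "\<lambda>x. 12 * x * (x - 1) * (2 * x\<^sup>2 - 2 * x + 1) / (1 - 2 * x) ^ 3"
        and ?x1.0 = "\<lambda>x. 1" and ?x2.0 = "\<lambda>x. 0" and \<sigma> = f, OF f])
    fix t assume tU: "t \<in> U"
    define x y z w m v where "x = f t" "y = x - 1" "z = x\<^sup>2 - x + 1" "w = x + 1" "m = 1 - 2 * x" "v = x - 2"
    note ds = x_y_z_w_m_v_def(2-)
    have m: "m \<noteq> 0" using m0[OF tU] by (simp add: x_y_z_w_m_v_def)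
    have tx: "t = x ^ 3 * v / m" using t[OF tU] by (simp add: x_y_z_w_m_v_def)
    have e0: "f t = x" "x - 1 = y" "1 - 2 * x = m" by (simp_all add: x_y_z_w_m_v_def)
    have e1: "x - t = - x * y * z / m" unfolding tx using m by (simp add: divide_simps) (simp add: ds, algebra)
    have e2: "t - 1 = y ^ 3 * w / m" unfolding tx using m by (simp add: divide_simps) (simp add: ds, algebra)
    note e = e0 e1 e2
    have n: "x \<noteq> 0" "y \<noteq> 0" "z \<noteq> 0" "w \<noteq> 0" "v \<noteq> 0" using reg[OF tU] e tx by auto
    show "((\<lambda>x. x ^ 3 * (x - 2) / (1 - 2 * x)) has_field_derivative - 6 * (f t)\<^sup>2 * (f t - 1)\<^sup>2 / (1
        - 2 * f t)\<^sup>2) (at (f t))"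
      "((\<lambda>x. - 6 * x\<^sup>2 * (x - 1)\<^sup>2 / (1 - 2 * x)\<^sup>2) has_field_derivative
        12 * f t * (f t - 1) * (2 * (f t)\<^sup>2 - 2 * f t + 1) / (1 - 2 * f t) ^ 3) (at (f t))"
      by (rule quartic_parameter_derivatives[OF m0[OF tU]])+
    show "0 * (- 6 * (f t)\<^sup>2 * (f t - 1)\<^sup>2 / (1 - 2 * f t)\<^sup>2) - 1 * (12 * f t * (f t - 1) * (2 * (f t)\<^sup>2
        - 2 * f t + 1) / (1 - 2 * f t) ^ 3)
      = PVI_a t (f t) * 1\<^sup>2 * (- 6 * (f t)\<^sup>2 * (f t - 1)\<^sup>2 / (1 - 2 * f t)\<^sup>2)
        + PVI_b t (f t) * 1 * (- 6 * (f t)\<^sup>2 * (f t - 1)\<^sup>2 / (1 - 2 * f t)\<^sup>2)\<^sup>2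
        + PVI_rhs (0, 0, 0, 1/8) t (f t) 0 * (- 6 * (f t)\<^sup>2 * (f t - 1)\<^sup>2 / (1 - 2 * f t)\<^sup>2) ^ 3"
    proof -
      define t1 B q where "t1 = - 6 * x\<^sup>2 * y\<^sup>2 / m\<^sup>2" "B = y ^ 3 * w * z + x ^ 3 * v * z - x\<^sup>2 * y\<^sup>2 * v * w"
          "q = 2 * x\<^sup>2 - 2 * x + 1"
      have "1 / x + 1 / y + 1 / (- x * y * z / m) = - (m * (z + 1)) / (x * y * z)"
        using n m by (simp add: divide_simps) (simp add: ds, algebra)
      then have a: "PVI_a t x = - (m * (z + 1)) / (2 * x * y * z)" unfolding PVI_a_def e by simp
      have b: "PVI_b t x = - (m * B) / (x ^ 3 * y ^ 3 * v * w * z)"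
        unfolding PVI_b_def e unfolding tx t1_B_q_def(2) using n m by (simp add: divide_simps) algebra
      have r: "PVI_rhs (0, 0, 0, 1/8) t x 0 = - (3 * m ^ 3) / (8 * x ^ 3 * y ^ 3 * v * w * z)"
        unfolding PVI_rhs_def prod.case e unfolding tx using n m by (simp add: divide_simps) algebra
      have key: "3 * (z + 1) * m\<^sup>2 * v * w - 36 * B + 81 * x\<^sup>2 * y\<^sup>2 = - 12 * q * v * w * z"
        unfolding t1_B_q_def(2-) ds by algebra
      have "PVI_a t x * 1\<^sup>2 * t1 = 3 * x * y * (z + 1) / (z * m)"
        unfolding a t1_B_q_def(1) using n m by (simp add: divide_simps) algebra
      moreover have "PVI_b t x * 1 * t1\<^sup>2 = - (36 * x * y * B) / (v * w * z * m ^ 3)"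
        unfolding b t1_B_q_def(1) using n m by (simp add: divide_simps) algebra
      moreover have "PVI_rhs (0, 0, 0, 1/8) t x 0 * t1 ^ 3 = 81 * x ^ 3 * y ^ 3 / (v * w * z * m ^ 3)"
        unfolding r t1_B_q_def(1) using n m by (simp add: divide_simps) algebra
      moreover have "3 * x * y * (z + 1) / (z * m) + - (36 * x * y * B) / (v * w * z * m ^ 3)
          + 81 * x ^ 3 * y ^ 3 / (v * w * z * m ^ 3)
          = (3 * (z + 1) * m\<^sup>2 * v * w - 36 * B + 81 * x\<^sup>2 * y\<^sup>2) * (x * y) / (v * w * z * m ^ 3)"
        using n m by (simp add: divide_simps) algebra
      moreover have "\<dots> = - (12 * x * y * q / m ^ 3)" unfolding key using n m by (simp add: divide_simps)
      ultimately show ?thesis unfolding e t1_B_q_def(1,3)[symmetric] by simp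
    qed
    fix \<delta> :: parameters
    obtain d0 d1 d2 d3 where d: "\<delta> = (d0, d1, d2, d3)" by (metis prod_cases4)
    have "PVI_difference \<delta> (f t) t * (m * z\<^sup>2) = poly (p \<delta>) (f t)"
      unfolding d ev PVI_difference.simps e unfolding tx x_y_z_w_m_v_def(2-)[symmetric]
      using n m by (simp add: divide_simps) algebra
    then show "PVI_difference \<delta> (f t) t = 0 \<longleftrightarrow> poly (p \<delta>) (f t) = 0" using n m by (metis mult_eq_0_iff power_not_zero)
  qed (use f t in \<open>auto simp: germ_def intro!: derivative_eq_intros\<close>)
  also have "\<dots> = {(a, a, a, 1/8) | a. True}"
  proof (intro equalityI subsetI)
    fix \<alpha> :: parameters assume "\<alpha> \<in> {\<alpha>. p (\<alpha> - (0, 0, 0, 1/8)) = 0}"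
    moreover obtain c0 c1 c2 c3 where c: "\<alpha> = (c0, c1, c2, c3)" by (metis prod_cases4)
    ultimately have p: "p (c0, c1, c2, c3 - 1/8) = 0" by simp
    have c01: "c1 = c2" "c0 = c2" using ev[of c0 c1 c2 "c3 - 1/8" 0] ev[of c0 c1 c2 "c3 - 1/8" 1] unfolding p
        by simp_all
    then have "c3 - 1/8 = 0" using ev[of c0 c1 c2 "c3 - 1/8" 3] unfolding p by (simp add: mult.commute)
    then have "c3 = 1/8" by simp
    then show "\<alpha> \<in> {(a, a, a, 1/8) | a. True}" unfolding c c01 by blast
  next
    fix \<alpha> :: parameters assume "\<alpha> \<in> {(a, a, a, 1/8) | a. True}"
    then obtain a where s: "\<alpha> = (a, a, a, 1/8)" by blast
    have "poly (p (a, a, a, 0)) x = 0" for x unfolding ev by algebra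
    then have "p (a, a, a, 0) = 0" using poly_all_0_iff_0 by blast
    then show "\<alpha> \<in> {\<alpha>. p (\<alpha> - (0, 0, 0, 1/8)) = 0}" by (simp add: s)
  qed
  finally show "{\<alpha>. solves \<alpha> f U} = {(a, a, a, 1/8) | a. True}" .
qed

lemma family_5L: "family_correct (\<lambda>x t. 2 * x^3 - 3 * x\<^sup>2 + t) {(4 * a, a, a, 1/18) | a. True}"
  unfolding family_correct_def
proof (intro allI impI)
  fix f U assume f: "germ f U" and rel: "\<forall>t\<in>U. 2 * f t ^ 3 - 3 * (f t)\<^sup>2 + t = 0"
  have reg: "t \<noteq> 0" "t \<noteq> 1" "f t \<noteq> 0" "f t \<noteq> 1" "f t \<noteq> t" if "t \<in> U" for t using f that by (auto simp: germ_def)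
  have t: "3 * (f t)\<^sup>2 - 2 * f t ^ 3 = t" if "t \<in> U" for t using bspec[OF rel that] by algebra
  define p where "p \<delta> = (case \<delta> of (d0, d1, d2, d3) \<Rightarrow>
    ([:d0:] - smult d1 [:3, -2:] - smult d2 [:1, 2:]) * [:-1, 2:]\<^sup>2 + smult d3 ([:3, -2:] * [:1, 2:]))"
        for \<delta> :: parameters
  have ev: "poly (p (d0, d1, d2, d3)) x = (d0 - d1 * (3 - 2 * x) - d2 * (2 * x + 1)) * (2 * x - 1)\<^sup>2
      + d3 * ((3 - 2 * x) * (2 * x + 1))" for d0 d1 d2 d3 x
    by (simp add: p_def) algebra
  have "{\<alpha>. solves \<alpha> f U} = {\<alpha>. p (\<alpha> - (0, 0, 0, 1/18)) = 0}"
  proof (rule solution_parameters[where \<tau> = "\<lambda>x. 3 * x\<^sup>2 - 2 * x ^ 3" and \<xi> = "\<lambda>x. x"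
        and ?t1.0 = "\<lambda>x. 6 * x - 6 * x\<^sup>2" and ?t2.0 = "\<lambda>x. 6 - 12 * x"
        and ?x1.0 = "\<lambda>x. 1" and ?x2.0 = "\<lambda>x. 0" and \<sigma> = f, OF f])
    fix t assume tU: "t \<in> U"
    define x y z w v where "x = f t" "y = x - 1" "z = 2 * x - 1" "w = 2 * x + 1" "v = 3 - 2 * x"
    note ds = x_y_z_w_v_def(2-)
    have "3 * x\<^sup>2 - 2 * x ^ 3 = x\<^sup>2 * v" unfolding ds by algebra
    then have tx: "t = x\<^sup>2 * v" using t[OF tU] by (simp add: x_y_z_w_v_def(1))
    have e0: "f t = x" "x - 1 = y" by (simp_all add: x_y_z_w_v_def)
    have e1: "x - t = x * y * z" unfolding tx ds by algebra
    have e2: "t - 1 = - (y\<^sup>2 * w)" unfolding tx ds by algebra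
    have e3: "6 * x - 6 * x\<^sup>2 = - (6 * x * y)" unfolding ds by algebra
    note e = e0 e1 e2 e3
    have n: "x \<noteq> 0" "y \<noteq> 0" "z \<noteq> 0" "w \<noteq> 0" "v \<noteq> 0" using reg[OF tU] e tx by auto
    show "0 * (6 * f t - 6 * (f t)\<^sup>2) - 1 * (6 - 12 * f t)
      = PVI_a t (f t) * 1\<^sup>2 * (6 * f t - 6 * (f t)\<^sup>2) + PVI_b t (f t) * 1 * (6 * f t - 6 * (f t)\<^sup>2)\<^sup>2
        + PVI_rhs (0, 0, 0, 1/18) t (f t) 0 * (6 * f t - 6 * (f t)\<^sup>2) ^ 3"
      unfolding PVI_a_def PVI_b_def PVI_rhs_def prod.case e unfolding tx
      using n by (simp add: divide_simps) (simp add: ds, algebra)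
    fix \<delta> :: parameters
    obtain d0 d1 d2 d3 where d: "\<delta> = (d0, d1, d2, d3)" by (metis prod_cases4)
    have "PVI_difference \<delta> (f t) t * z\<^sup>2 = poly (p \<delta>) (f t)"
      unfolding d ev PVI_difference.simps e unfolding tx ds[symmetric]
      using n by (simp add: divide_simps)
    then show "PVI_difference \<delta> (f t) t = 0 \<longleftrightarrow> poly (p \<delta>) (f t) = 0" using n by (metis mult_eq_0_iff power_not_zero)
  qed (use f t in \<open>auto simp: germ_def power2_eq_square intro!: derivative_eq_intros\<close>)
  also have "\<dots> = {(4 * a, a, a, 1/18) | a. True}"
  proof (intro equalityI subsetI)
    fix \<alpha> :: parameters assume "\<alpha> \<in> {\<alpha>. p (\<alpha> - (0, 0, 0, 1/18)) = 0}"
    moreover obtain c0 c1 c2 c3 where c: "\<alpha> = (c0, c1, c2, c3)" by (metis prod_cases4)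
    ultimately have p: "p (c0, c1, c2, c3 - 1/18) = 0" by simp
    have "c3 - 1/18 = 0" using ev[of c0 c1 c2 "c3 - 1/18" "1 / 2"] unfolding p by (simp add: mult.commute)
    then have c3: "c3 = 1/18" by simp
    have p0: "p (c0, c1, c2, 0) = 0" using p c3 by simp
    have e: "c0 - 3 * c1 - c2 = 0" "c0 - c1 - 3 * c2 = 0"
      using ev[of c0 c1 c2 0 0] ev[of c0 c1 c2 0 1] unfolding p0 by (simp_all add: algebra_simps)
    have "2 * (c1 - c2) = 0" using e by algebra
    then have "c1 = c2" by simp
    moreover have "c0 - 4 * c2 = (c0 - 3 * c1 - c2) + 3 * (c1 - c2)" by algebra
    ultimately have "c0 = 4 * c2" using e by simp
    then show "\<alpha> \<in> {(4 * a, a, a, 1/18) | a. True}" using c3 \<open>c1 = c2\<close> by (simp add: c)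
  next
    fix \<alpha> :: parameters assume "\<alpha> \<in> {(4 * a, a, a, 1/18) | a. True}"
    then obtain a where s: "\<alpha> = (4 * a, a, a, 1/18)" by blast
    have "poly (p (4 * a, a, a, 0)) x = 0" for x unfolding ev by algebra
    then have "p (4 * a, a, a, 0) = 0" using poly_all_0_iff_0 by blast
    then show "\<alpha> \<in> {\<alpha>. p (\<alpha> - (0, 0, 0, 1/18)) = 0}" by (simp add: s)
  qed
  finally show "{\<alpha>. solves \<alpha> f U} = {(4 * a, a, a, 1/18) | a. True}" .
qed

text \<open>
The parametrization of \<open>conic_parameter\<close> for \<open>(A, B, C) = (- 1, 1, 3)\<close>, the curve \<open>f3D\<close>.
\<close>
lemma conic_parameter_derivatives:
  fixes s :: complex
  assumes nz: "1 - s \<noteq> 0" "1 + 3 * s \<noteq> 0"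
  shows "((\<lambda>s. (1 + s) ^ 3 * (1 - 3 * s) / ((1 - s) ^ 3 * (1 + 3 * s))) has_field_derivative
      - 48 * s\<^sup>2 * (1 + s)\<^sup>2 / ((1 - s) ^ 4 * (1 + 3 * s)\<^sup>2)) (at s)"
    and "((\<lambda>s. - 48 * s\<^sup>2 * (1 + s)\<^sup>2 / ((1 - s) ^ 4 * (1 + 3 * s)\<^sup>2)) has_field_derivative
      - 96 * s * (1 + s) * (3 * s ^ 3 + 9 * s\<^sup>2 + 3 * s + 1) / ((1 - s) ^ 5 * (1 + 3 * s) ^ 3)) (at s)"
    and "((\<lambda>s. (1 + s) * (1 - 3 * s) / ((1 - s) * (1 + 3 * s))) has_field_derivative
      - 4 * (1 + 3 * s\<^sup>2) / ((1 - s)\<^sup>2 * (1 + 3 * s)\<^sup>2)) (at s)"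
    and "((\<lambda>s. - 4 * (1 + 3 * s\<^sup>2) / ((1 - s)\<^sup>2 * (1 + 3 * s)\<^sup>2)) has_field_derivative
      - 8 * (9 * s ^ 3 + 9 * s - 2) / ((1 - s) ^ 3 * (1 + 3 * s) ^ 3)) (at s)"
proof -
  define y z where "y = 1 - s" "z = 1 + 3 * s"
  have yz: "y \<noteq> 0" "z \<noteq> 0" using nz by (simp_all add: y_z_def)
  have q: "((\<lambda>s. N s / (D s :: complex)) has_field_derivative E) (at s)"
    if "(N has_field_derivative N') (at s)" "(D has_field_derivative D') (at s)" "D s \<noteq> 0"
      "(N' * D s - N s * D') / (D s * D s) = E" for N D N' D' E
    using DERIV_divide[OF that(1-3)] that(4) by simp
  show "((\<lambda>s. (1 + s) ^ 3 * (1 - 3 * s) / ((1 - s) ^ 3 * (1 + 3 * s))) has_field_derivative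
      - 48 * s\<^sup>2 * (1 + s)\<^sup>2 / ((1 - s) ^ 4 * (1 + 3 * s)\<^sup>2)) (at s)"
  proof (rule q)
    show "((\<lambda>s. (1 + s) ^ 3 * (1 - 3 * s)) has_field_derivative - 12 * s * (1 + s)\<^sup>2) (at s)"
      by (auto intro!: derivative_eq_intros; algebra)
    show "((\<lambda>s. (1 - s) ^ 3 * (1 + 3 * s)) has_field_derivative - 12 * s * (1 - s)\<^sup>2) (at s)"
      by (auto intro!: derivative_eq_intros; algebra)
    show "(- 12 * s * (1 + s)\<^sup>2 * ((1 - s) ^ 3 * (1 + 3 * s)) - (1 + s) ^ 3 * (1 - 3 * s) * (- 12 * s * (1 - s)\<^sup>2)) /
        ((1 - s) ^ 3 * (1 + 3 * s) * ((1 - s) ^ 3 * (1 + 3 * s)))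
            = - 48 * s\<^sup>2 * (1 + s)\<^sup>2 / ((1 - s) ^ 4 * (1 + 3 * s)\<^sup>2)"
      unfolding y_z_def[symmetric] using yz by (simp add: divide_simps) (simp add: y_z_def, algebra)
  qed (use nz in simp)
  show "((\<lambda>s. - 48 * s\<^sup>2 * (1 + s)\<^sup>2 / ((1 - s) ^ 4 * (1 + 3 * s)\<^sup>2)) has_field_derivative
      - 96 * s * (1 + s) * (3 * s ^ 3 + 9 * s\<^sup>2 + 3 * s + 1) / ((1 - s) ^ 5 * (1 + 3 * s) ^ 3)) (at s)"
  proof (rule q)
    show "((\<lambda>s. - 48 * s\<^sup>2 * (1 + s)\<^sup>2) has_field_derivative - 96 * s * (1 + s) * (1 + 2 * s)) (at s)"
      by (auto intro!: derivative_eq_intros; algebra)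
    show "((\<lambda>s. (1 - s) ^ 4 * (1 + 3 * s)\<^sup>2) has_field_derivative (1 - s) ^ 3 * (1 + 3 * s) * (2 - 18 * s)) (at s)"
      by (auto intro!: derivative_eq_intros; algebra)
    show "(- 96 * s * (1 + s) * (1 + 2 * s) * ((1 - s) ^ 4 * (1 + 3 * s)\<^sup>2) -
          - 48 * s\<^sup>2 * (1 + s)\<^sup>2 * ((1 - s) ^ 3 * (1 + 3 * s) * (2 - 18 * s))) /
        ((1 - s) ^ 4 * (1 + 3 * s)\<^sup>2 * ((1 - s) ^ 4 * (1 + 3 * s)\<^sup>2)) =
        - 96 * s * (1 + s) * (3 * s ^ 3 + 9 * s\<^sup>2 + 3 * s + 1) / ((1 - s) ^ 5 * (1 + 3 * s) ^ 3)"
      unfolding y_z_def[symmetric] using yz by (simp add: divide_simps) (simp add: y_z_def, algebra)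
  qed (use nz in simp)
  show "((\<lambda>s. (1 + s) * (1 - 3 * s) / ((1 - s) * (1 + 3 * s))) has_field_derivative
      - 4 * (1 + 3 * s\<^sup>2) / ((1 - s)\<^sup>2 * (1 + 3 * s)\<^sup>2)) (at s)"
  proof (rule q)
    show "((\<lambda>s. (1 + s) * (1 - 3 * s)) has_field_derivative - 2 - 6 * s) (at s)"
      by (auto intro!: derivative_eq_intros; algebra)
    show "((\<lambda>s. (1 - s) * (1 + 3 * s)) has_field_derivative 2 - 6 * s) (at s)"
      by (auto intro!: derivative_eq_intros; algebra)
    show "((- 2 - 6 * s) * ((1 - s) * (1 + 3 * s)) - (1 + s) * (1 - 3 * s) * (2 - 6 * s)) /
        ((1 - s) * (1 + 3 * s) * ((1 - s) * (1 + 3 * s))) = - 4 * (1 + 3 * s\<^sup>2) / ((1 - s)\<^sup>2 * (1 + 3 * s)\<^sup>2)"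
      unfolding y_z_def[symmetric] using yz by (simp add: divide_simps) (simp add: y_z_def, algebra)
  qed (use nz in simp)
  show "((\<lambda>s. - 4 * (1 + 3 * s\<^sup>2) / ((1 - s)\<^sup>2 * (1 + 3 * s)\<^sup>2)) has_field_derivative
      - 8 * (9 * s ^ 3 + 9 * s - 2) / ((1 - s) ^ 3 * (1 + 3 * s) ^ 3)) (at s)"
  proof (rule q)
    show "((\<lambda>s. - 4 * (1 + 3 * s\<^sup>2)) has_field_derivative - 24 * s) (at s)"
      by (auto intro!: derivative_eq_intros; algebra)
    show "((\<lambda>s. (1 - s)\<^sup>2 * (1 + 3 * s)\<^sup>2) has_field_derivative (1 - s) * (1 + 3 * s) * (4 - 12 * s)) (at s)"
      by (auto intro!: derivative_eq_intros; algebra)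
    show "(- 24 * s * ((1 - s)\<^sup>2 * (1 + 3 * s)\<^sup>2) - - 4 * (1 + 3 * s\<^sup>2) * ((1 - s) * (1 + 3 * s) * (4 - 12 * s))) /
        ((1 - s)\<^sup>2 * (1 + 3 * s)\<^sup>2 * ((1 - s)\<^sup>2 * (1 + 3 * s)\<^sup>2))
            = - 8 * (9 * s ^ 3 + 9 * s - 2) / ((1 - s) ^ 3 * (1 + 3 * s) ^ 3)"
      unfolding y_z_def[symmetric] using yz by (simp add: divide_simps) (simp add: y_z_def, algebra)
  qed (use nz in simp)
qed

text \<open>
The only representative that cannot be parametrized by \<open>x\<close> itself.
\<close>
lemma family_3D: "family_correct (\<lambda>x t. x^4 - 4 * t * x^3 + 6 * t * x\<^sup>2 - 4 * t * x
    + t\<^sup>2) {(a, a, a, 9 * a) | a. True}"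
  unfolding family_correct_def
proof (intro allI impI)
  fix f U assume f: "germ f U" and rel: "\<forall>t\<in>U. f t ^ 4 - 4 * t * f t ^ 3 + 6 * t * (f t)\<^sup>2 - 4 * t * f t + t\<^sup>2 = 0"
  have reg: "t \<noteq> 0" "t \<noteq> 1" "f t \<noteq> 0" "f t \<noteq> 1" "f t \<noteq> t" if "t \<in> U" for t using f that by (auto simp: germ_def)
  have hol: "f holomorphic_on U" using f by (simp add: germ_def)
  define \<sigma> where "\<sigma> t = f t / (f t - 1) - f t / (f t - t)" for t
  have conic: "conic_poly (- 1) 1 3 (f t) t = 0" if "t \<in> U" for t
    using bspec[OF rel that] unfolding conic_poly_def by algebra
  have par: "f t * ((\<sigma> t - 1) * (1 + 3 * \<sigma> t)) = (1 + \<sigma> t) * (- 1 + 3 * \<sigma> t)"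
      "t * ((1 - \<sigma> t)\<^sup>2 * (- 1 + 1 * \<sigma> t) * (1 + 3 * \<sigma> t)) = (1 + \<sigma> t)\<^sup>2 * (- 1 + 3 * \<sigma> t) * (1 + 1 * \<sigma> t)"
          if "t \<in> U" for t
    unfolding \<sigma>_def using reg[OF that] by (intro conic_parameter conic[OF that]; simp)+
  have nz: "1 - \<sigma> t \<noteq> 0" "1 + 3 * \<sigma> t \<noteq> 0" if "t \<in> U" for t
  proof -
    show "1 - \<sigma> t \<noteq> 0"
    proof
      assume "1 - \<sigma> t = 0"
      then have "\<sigma> t = 1" by simp
      then show False using par(1)[OF that] by simp
    qed
    show "1 + 3 * \<sigma> t \<noteq> 0"
    proof
      assume h: "1 + 3 * \<sigma> t = 0"
      have "(1 + \<sigma> t) * (- 1 + 3 * \<sigma> t) = 0" using par(1)[OF that] unfolding h by simp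
      then have "1 + \<sigma> t = 0 \<or> - 1 + 3 * \<sigma> t = 0" by simp
      then show False
      proof
        assume "1 + \<sigma> t = 0"
        then have "\<sigma> t = - 1" by algebra
        then show False using h by simp
      next
        assume "- 1 + 3 * \<sigma> t = 0"
        then have "3 * \<sigma> t = 1" by algebra
        then show False using h by simp
      qed
    qed
  qed
  define p where "p \<delta> = (case \<delta> of (d0, d1, d2, d3) \<Rightarrow>
    smult d0 ([:1, -1:] * [:1, -3:]) - smult d1 ([:1, 1:] * [:1, 3:]) - smult d2 ([:0, 1:] * [:1, 3:] * [:1, -3:])
      + smult d3 ([:0, 1:] * [:1, 1:] * [:1, -1:]))" for \<delta> :: parameters
  have ev: "poly (p (d0, d1, d2, d3)) s = d0 * ((1 - s) * (1 - 3 * s)) - d1 * ((1 + s) * (1 + 3 * s))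
      - d2 * (s * (1 + 3 * s) * (1 - 3 * s)) + d3 * (s * (1 + s) * (1 - s))" for d0 d1 d2 d3 s
    by (simp add: p_def) algebra
  have "{\<alpha>. solves \<alpha> f U} = {\<alpha>. p (\<alpha> - (0, 0, 0, 0)) = 0}"
  proof (rule solution_parameters[where \<tau> = "\<lambda>s. (1 + s) ^ 3 * (1 - 3 * s) / ((1 - s) ^ 3 * (1 + 3 * s))"
        and \<xi> = "\<lambda>s. (1 + s) * (1 - 3 * s) / ((1 - s) * (1 + 3 * s))"
        and ?t1.0 = "\<lambda>s. - 48 * s\<^sup>2 * (1 + s)\<^sup>2 / ((1 - s) ^ 4 * (1 + 3 * s)\<^sup>2)"
        and ?t2.0 = "\<lambda>s. - 96 * s * (1 + s) * (3 * s ^ 3 + 9 * s\<^sup>2 + 3 * s + 1) / ((1 - s) ^ 5 * (1 + 3 * s) ^ 3)"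
        and ?x1.0 = "\<lambda>s. - 4 * (1 + 3 * s\<^sup>2) / ((1 - s)\<^sup>2 * (1 + 3 * s)\<^sup>2)"
        and ?x2.0 = "\<lambda>s. - 8 * (9 * s ^ 3 + 9 * s - 2) / ((1 - s) ^ 3 * (1 + 3 * s) ^ 3)" and \<sigma> = \<sigma>, OF f])
    show "\<sigma> holomorphic_on U" unfolding \<sigma>_def using reg hol by (intro holomorphic_intros) auto
  next
    fix t assume tU: "t \<in> U"
    define s x y z w v where "s = \<sigma> t" "x = f t" "y = 1 - s" "z = 1 + 3 * s" "w = 1 + s" "v = 1 - 3 * s"
    note ds = s_x_y_z_w_v_def(3-)
    have yz: "y \<noteq> 0" "z \<noteq> 0" using nz[OF tU] by (simp_all add: s_x_y_z_w_v_def)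
    have "x * (y * z) = w * v" "t * (y ^ 3 * z) = w ^ 3 * v"
      using par[OF tU] unfolding s_x_y_z_w_v_def(1,2)[symmetric] ds by algebra+
    then have xt: "x = w * v / (y * z)" "t = w ^ 3 * v / (y ^ 3 * z)" using yz by (simp_all add: eq_divide_eq)
    have e0: "f t = x" "\<sigma> t = s" "1 - s = y" "1 + 3 * s = z" "1 + s = w" "1 - 3 * s = v"
        by (simp_all add: s_x_y_z_w_v_def)
    have e1: "x - 1 = - 4 * s / (y * z)" unfolding xt using yz by (simp add: divide_simps) (simp add: ds, algebra)
    have e2: "t - 1 = - 16 * s ^ 3 / (y ^ 3 * z)" unfolding xt using yz
        by (simp add: divide_simps) (simp add: ds, algebra)
    have e3: "x - t = - 4 * s * w * v / (y ^ 3 * z)" unfolding xt using yz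
        by (simp add: divide_simps) (simp add: ds, algebra)
    note e = e0 e1 e2 e3
    have n: "s \<noteq> 0" "w \<noteq> 0" "v \<noteq> 0" using reg[OF tU] e1 xt e0(1) by auto
    show "(1 + \<sigma> t) ^ 3 * (1 - 3 * \<sigma> t) / ((1 - \<sigma> t) ^ 3 * (1 + 3 * \<sigma> t)) = t" unfolding e0 using xt by simp
    show "(1 + \<sigma> t) * (1 - 3 * \<sigma> t) / ((1 - \<sigma> t) * (1 + 3 * \<sigma> t)) = f t" unfolding e0 using xt by simp
    note conic_parameter_derivatives[OF nz[OF tU]]
    then show "((\<lambda>s. (1 + s) ^ 3 * (1 - 3 * s) / ((1 - s) ^ 3 * (1 + 3 * s))) has_field_derivative
      - 48 * (\<sigma> t)\<^sup>2 * (1 + \<sigma> t)\<^sup>2 / ((1 - \<sigma> t) ^ 4 * (1 + 3 * \<sigma> t)\<^sup>2)) (at (\<sigma> t))"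
      "((\<lambda>s. - 48 * s\<^sup>2 * (1 + s)\<^sup>2 / ((1 - s) ^ 4 * (1 + 3 * s)\<^sup>2)) has_field_derivative
      - 96 * \<sigma> t * (1 + \<sigma> t) * (3 * \<sigma> t ^ 3 + 9 * (\<sigma> t)\<^sup>2 + 3 * \<sigma> t + 1) / ((1 - \<sigma> t) ^ 5 * (1
          + 3 * \<sigma> t) ^ 3)) (at (\<sigma> t))"
      "((\<lambda>s. (1 + s) * (1 - 3 * s) / ((1 - s) * (1 + 3 * s))) has_field_derivative
      - 4 * (1 + 3 * (\<sigma> t)\<^sup>2) / ((1 - \<sigma> t)\<^sup>2 * (1 + 3 * \<sigma> t)\<^sup>2)) (at (\<sigma> t))"
      "((\<lambda>s. - 4 * (1 + 3 * s\<^sup>2) / ((1 - s)\<^sup>2 * (1 + 3 * s)\<^sup>2)) has_field_derivative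
      - 8 * (9 * \<sigma> t ^ 3 + 9 * \<sigma> t - 2) / ((1 - \<sigma> t) ^ 3 * (1 + 3 * \<sigma> t) ^ 3)) (at (\<sigma> t))" .
    show "- 8 * (9 * \<sigma> t ^ 3 + 9 * \<sigma> t - 2) / ((1 - \<sigma> t) ^ 3 * (1 + 3 * \<sigma> t) ^ 3) *
        (- 48 * (\<sigma> t)\<^sup>2 * (1 + \<sigma> t)\<^sup>2 / ((1 - \<sigma> t) ^ 4 * (1 + 3 * \<sigma> t)\<^sup>2)) -
        - 4 * (1 + 3 * (\<sigma> t)\<^sup>2) / ((1 - \<sigma> t)\<^sup>2 * (1 + 3 * \<sigma> t)\<^sup>2) *
        (- 96 * \<sigma> t * (1 + \<sigma> t) * (3 * \<sigma> t ^ 3 + 9 * (\<sigma> t)\<^sup>2 + 3 * \<sigma> t + 1) / ((1 - \<sigma> t) ^ 5 * (1 + 3 * \<sigma> t) ^ 3)) =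
        PVI_a t (f t) * (- 4 * (1 + 3 * (\<sigma> t)\<^sup>2) / ((1 - \<sigma> t)\<^sup>2 * (1 + 3 * \<sigma> t)\<^sup>2))\<^sup>2 *
          (- 48 * (\<sigma> t)\<^sup>2 * (1 + \<sigma> t)\<^sup>2 / ((1 - \<sigma> t) ^ 4 * (1 + 3 * \<sigma> t)\<^sup>2)) +
        PVI_b t (f t) * (- 4 * (1 + 3 * (\<sigma> t)\<^sup>2) / ((1 - \<sigma> t)\<^sup>2 * (1 + 3 * \<sigma> t)\<^sup>2)) *
          (- 48 * (\<sigma> t)\<^sup>2 * (1 + \<sigma> t)\<^sup>2 / ((1 - \<sigma> t) ^ 4 * (1 + 3 * \<sigma> t)\<^sup>2))\<^sup>2 +
        PVI_rhs (0, 0, 0, 0) t (f t) 0 * (- 48 * (\<sigma> t)\<^sup>2 * (1 + \<sigma> t)\<^sup>2 / ((1 - \<sigma> t) ^ 4 * (1 + 3 * \<sigma> t)\<^sup>2)) ^ 3"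
    proof -
      define t1 x1 B c g h k where "t1 = - 48 * s\<^sup>2 * w\<^sup>2 / (y ^ 4 * z\<^sup>2)" "x1 = - 4 * (1 + 3 * s\<^sup>2) / (y\<^sup>2 * z\<^sup>2)"
        "B = 16 * s ^ 3 - w ^ 3 * v - 4 * s\<^sup>2 * w\<^sup>2" "c = 3 * s ^ 3 + 9 * s\<^sup>2 + 3 * s + 1" "g = 1 + 3 * s\<^sup>2"
        "h = 9 * s ^ 3 + 9 * s - 2" "k = s\<^sup>2 + 4 * s - 1"
      note dt = t1_x1_B_c_g_h_k_def
      have x1: "x1 = - 4 * g / (y\<^sup>2 * z\<^sup>2)" by (simp add: dt(2,5))
      have a: "PVI_a t x = y * z * k / (4 * s * w * v)"
        unfolding PVI_a_def e unfolding xt using n yz by (simp add: divide_simps) (simp add: dt(7) ds, algebra)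
      have b: "PVI_b t x = - (y ^ 3 * z * B) / (16 * s ^ 3 * w ^ 3 * v)"
        unfolding PVI_b_def e unfolding xt dt(3) using n yz by (simp add: divide_simps) algebra
      have r: "PVI_rhs (0, 0, 0, 0) t x 0 = - (y ^ 7 * z) / (32 * s ^ 3 * w ^ 3 * v)"
        unfolding PVI_rhs_def prod.case e unfolding xt using n yz by (simp add: divide_simps) algebra
      have key: "- 192 * k * g\<^sup>2 + 576 * B * g + 3456 * s\<^sup>2 * w\<^sup>2 * y\<^sup>2 = 384 * v * (h * s * w - g * c)"
        unfolding dt(3-) ds by algebra
      have "PVI_a t x * x1\<^sup>2 * t1 = - (192 * k * g\<^sup>2 * s * w) / (v * y ^ 7 * z ^ 5)"
        unfolding a x1 dt(1) using n yz by (simp add: divide_simps) algebra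
      moreover have "PVI_b t x * x1 * t1\<^sup>2 = 576 * B * g * s * w / (v * y ^ 7 * z ^ 5)"
        unfolding b x1 dt(1) using n yz by (simp add: divide_simps) algebra
      moreover have "PVI_rhs (0, 0, 0, 0) t x 0 * t1 ^ 3 = 3456 * s ^ 3 * w ^ 3 / (v * y ^ 5 * z ^ 5)"
        unfolding r dt(1) using n yz by (simp add: divide_simps) algebra
      moreover have "- (192 * k * g\<^sup>2 * s * w) / (v * y ^ 7 * z ^ 5) + 576 * B * g * s * w / (v * y ^ 7 * z ^ 5)
          + 3456 * s ^ 3 * w ^ 3 / (v * y ^ 5 * z ^ 5)
          = (- 192 * k * g\<^sup>2 + 576 * B * g + 3456 * s\<^sup>2 * w\<^sup>2 * y\<^sup>2) * (s * w) / (v * y ^ 7 * z ^ 5)"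
        using n yz by (simp add: divide_simps) algebra
      moreover have "\<dots> = - 8 * h / (y ^ 3 * z ^ 3) * t1 - x1 * (- 96 * s * w * c / (y ^ 5 * z ^ 3))"
        unfolding key x1 dt(1) using n yz by (simp add: divide_simps) algebra
      ultimately show ?thesis unfolding e dt(1,2,4,6)[symmetric] by simp
    qed
    fix \<delta> :: parameters
    obtain d0 d1 d2 d3 where d: "\<delta> = (d0, d1, d2, d3)" by (metis prod_cases4)
    have "PVI_difference \<delta> (f t) t * (y * v) = poly (p \<delta>) (\<sigma> t)"
      unfolding d ev PVI_difference.simps e unfolding xt
      using n yz by (simp add: divide_simps) (simp add: ds, algebra)
    then show "PVI_difference \<delta> (f t) t = 0 \<longleftrightarrow> poly (p \<delta>) (\<sigma> t) = 0" using n yz by (metis mult_eq_0_iff)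
  qed
  also have "\<dots> = {(a, a, a, 9 * a) | a. True}"
  proof (intro equalityI subsetI)
    fix \<alpha> :: parameters assume "\<alpha> \<in> {\<alpha>. p (\<alpha> - (0, 0, 0, 0)) = 0}"
    moreover obtain c0 c1 c2 c3 where c: "\<alpha> = (c0, c1, c2, c3)" by (metis prod_cases4)
    ultimately have p: "p (c0, c1, c2, c3) = 0" by simp
    have "c0 = c1" using ev[of c0 c1 c2 c3 0] unfolding p by simp
    moreover have "c2 = c1" using ev[of c0 c1 c2 c3 1] unfolding p by simp
    moreover have "c3 = 9 * c1" using ev[of c0 c1 c2 c3 "1 / 3"] unfolding p by (simp add: field_simps)
    ultimately show "\<alpha> \<in> {(a, a, a, 9 * a) | a. True}" by (simp add: c)
  next
    fix \<alpha> :: parameters assume "\<alpha> \<in> {(a, a, a, 9 * a) | a. True}"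
    then obtain a where s: "\<alpha> = (a, a, a, 9 * a)" by blast
    have "poly (p (a, a, a, 9 * a)) x = 0" for x unfolding ev by algebra
    then have "p (a, a, a, 9 * a) = 0" using poly_all_0_iff_0 by blast
    then show "\<alpha> \<in> {\<alpha>. p (\<alpha> - (0, 0, 0, 0)) = 0}" by (simp add: s)
  qed
  finally show "{\<alpha>. solves \<alpha> f U} = {(a, a, a, 9 * a) | a. True}" .
qed

section \<open>The remaining families by symmetry\<close>

text \<open>
A relation \<open>P' = 0\<close> that is the flip of \<open>P = 0\<close>, up to the factor \<open>K\<close> from clearing denominators,
has the permuted parameters.
\<close>
lemma family_correct_flip:
  assumes P: "family_correct P S"
  shows "(\<And>x t. x \<noteq> 0 \<Longrightarrow> t \<noteq> 0 \<Longrightarrow> P (1 / x) (1 / t) = K x t * P' x t) \<Longrightarrow>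
      (\<And>a b c d. (a, b, c, d) \<in> S' \<longleftrightarrow> (b, a, c, d) \<in> S) \<Longrightarrow> family_correct P' S'"
    and "(\<And>x t. P (1 - x) (1 - t) = K x t * P' x t) \<Longrightarrow>
      (\<And>a b c d. (a, b, c, d) \<in> S' \<longleftrightarrow> (a, c, b, d) \<in> S) \<Longrightarrow> family_correct P' S'"
    and "(\<And>x t. t \<noteq> 0 \<Longrightarrow> P (x / t) (1 / t) = K x t * P' x t) \<Longrightarrow>
      (\<And>a b c d. (a, b, c, d) \<in> S' \<longleftrightarrow> (a, b, d, c) \<in> S) \<Longrightarrow> family_correct P' S'"
proof -
  have eq: "{\<alpha>. solves \<alpha> g V} = S" if "germ g V" "\<forall>t\<in>V. P (g t) t = 0" for g V
    using P that unfolding family_correct_def by blast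
  show "family_correct P' S'" if rel: "\<And>x t. x \<noteq> 0 \<Longrightarrow> t \<noteq> 0 \<Longrightarrow> P (1 / x) (1 / t) = K x t * P' x t"
      and S': "\<And>a b c d. (a, b, c, d) \<in> S' \<longleftrightarrow> (b, a, c, d) \<in> S"
    unfolding family_correct_def
  proof (intro allI impI)
    fix f U assume f: "germ f U" and P': "\<forall>t\<in>U. P' (f t) t = 0"
    have "\<forall>t\<in>dom_inverse U. P (flip01 f t) t = 0"
      using rel P' f unfolding ball_dom by (auto simp: flip01_def germ_def)
    then have e: "{\<alpha>. solves \<alpha> (flip01 f) (dom_inverse U)} = S" by (rule eq[OF germ_flip(1)[OF f]])
    have "\<alpha> \<in> S' \<longleftrightarrow> swap01 \<alpha> \<in> S" for \<alpha> using S' by (cases \<alpha>) simp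
    then show "{\<alpha>. solves \<alpha> f U} = S'" using e solves_flip_iff(1)[OF f] by blast
  qed
  show "family_correct P' S'" if rel: "\<And>x t. P (1 - x) (1 - t) = K x t * P' x t"
      and S': "\<And>a b c d. (a, b, c, d) \<in> S' \<longleftrightarrow> (a, c, b, d) \<in> S"
    unfolding family_correct_def
  proof (intro allI impI)
    fix f U assume f: "germ f U" and P': "\<forall>t\<in>U. P' (f t) t = 0"
    have "\<forall>t\<in>dom_reflect U. P (flip12 f t) t = 0"
      using rel P' f unfolding ball_dom by (auto simp: flip12_def germ_def)
    then have e: "{\<alpha>. solves \<alpha> (flip12 f) (dom_reflect U)} = S" by (rule eq[OF germ_flip(2)[OF f]])
    have "\<alpha> \<in> S' \<longleftrightarrow> swap12 \<alpha> \<in> S" for \<alpha> using S' by (cases \<alpha>) simp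
    then show "{\<alpha>. solves \<alpha> f U} = S'" using e solves_flip_iff(2)[OF f] by blast
  qed
  show "family_correct P' S'" if rel: "\<And>x t. t \<noteq> 0 \<Longrightarrow> P (x / t) (1 / t) = K x t * P' x t"
      and S': "\<And>a b c d. (a, b, c, d) \<in> S' \<longleftrightarrow> (a, b, d, c) \<in> S"
    unfolding family_correct_def
  proof (intro allI impI)
    fix f U assume f: "germ f U" and P': "\<forall>t\<in>U. P' (f t) t = 0"
    have "\<forall>t\<in>dom_inverse U. P (flip23 f t) t = 0"
      using rel P' f unfolding ball_dom by (auto simp: flip23_def germ_def)
    then have e: "{\<alpha>. solves \<alpha> (flip23 f) (dom_inverse U)} = S" by (rule eq[OF germ_flip(3)[OF f]])
    have "\<alpha> \<in> S' \<longleftrightarrow> swap23 \<alpha> \<in> S" for \<alpha> using S' by (cases \<alpha>) simp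
    then show "{\<alpha>. solves \<alpha> f U} = S'" using e solves_flip_iff(3)[OF f] by blast
  qed
qed

lemma family_1B:
  assumes nz: "a0 \<noteq> 0" "b0 \<noteq> 0" "a0 \<noteq> b0"
  shows "family_correct (\<lambda>x t. a0 * (x - 1)^2 + b0 * (t - 1))
    {(s * a0, 1/8, s * b0, 1/8) | s. True}"
  by (rule family_correct_flip(2)[OF family_1A[OF nz], where K = "\<lambda>x t. 1"]) (algebra, auto)

lemma family_1C:
  assumes nz: "a0 \<noteq> 0" "b0 \<noteq> 0" "a0 \<noteq> b0"
  shows "family_correct (\<lambda>x t. a0 * (x - t)^2 - b0 * t * (t - 1))
    {(s * a0, 1/8, 1/8, s * b0) | s. True}"
  by (rule family_correct_flip(3)[OF family_1B[OF nz], where K =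
      "\<lambda>x t. 1 / t ^ 2"]) (simp add: divide_simps, algebra?, auto)

lemma family_1D:
  assumes nz: "a0 \<noteq> 0" "b0 \<noteq> 0" "a0 \<noteq> b0"
  shows "family_correct (\<lambda>x t. - a0 * t * (x - 1)^2 + b0 * (t - 1) * x^2)
    {(1/8, s * a0, s * b0, 1/8) | s. True}"
  by (rule family_correct_flip(1)[OF family_1B[OF nz], where K =
      "\<lambda>x t. - 1 / (x ^ 2 * t)"]) (simp add: divide_simps, algebra?, auto)

lemma family_1E:
  assumes nz: "a0 \<noteq> 0" "b0 \<noteq> 0" "a0 \<noteq> b0"
  shows "family_correct (\<lambda>x t. a0 * (x - t)^2 + b0 * (t - 1) * x^2)
    {(1/8, s * a0, 1/8, s * b0) | s. True}"
  by (rule family_correct_flip(1)[OF family_1C[OF nz], where K =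
      "\<lambda>x t. 1 / (x ^ 2 * t ^ 2)"]) (simp add: divide_simps, algebra?, auto)

lemma family_1F:
  assumes nz: "a0 \<noteq> 0" "b0 \<noteq> 0" "a0 \<noteq> b0"
  shows "family_correct (\<lambda>x t. a0 * (x - t)^2 - b0 * t * (x - 1)^2)
    {(1/8, 1/8, s * a0, s * b0) | s. True}"
  by (rule family_correct_flip(2)[OF family_1E[OF nz], where K = "\<lambda>x t. 1"]) (algebra, auto)

lemma family_2B: "family_correct (\<lambda>x t. x^2 - 2 * x + t)
    {(a, b, a, b) | a b. True}"
  by (rule family_correct_flip(2)[OF family_2A, where K = "\<lambda>x t. 1"]) (algebra, auto)

lemma family_2C: "family_correct (\<lambda>x t. x^2 - 2 * x * t + t)
    {(b, a, a, b) | a b. True}"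
  by (rule family_correct_flip(1)[OF family_2B, where K =
      "\<lambda>x t. 1 / (x ^ 2 * t)"]) (simp add: divide_simps, algebra?, auto)

lemma family_3C: "family_correct (\<lambda>x t. x^4 - 4 * x^3 + 6 * t * x^2 - 4 * t^2 * x + t^2)
    {(a, a, 9 * a, a) | a. True}"
  by (rule family_correct_flip(3)[OF family_3D, where K = "\<lambda>x t. 1 / t ^ 4"]) (simp add: divide_simps, algebra?, auto)

lemma family_3A: "family_correct (\<lambda>x t. x^4 - 6 * x^2 * t + 4 * x * t + 4 * x * t^2 - 3 * t^2)
    {(a, 9 * a, a, a) | a. True}"
  by (rule family_correct_flip(2)[OF family_3C, where K = "\<lambda>x t. 1"]) (algebra, auto)

lemma family_3B: "family_correct (\<lambda>x t. 3 * x^4 - 4 * x^3 - 4 * x^3 * t + 6 * x^2 * t - t^2)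
    {(9 * a, a, a, a) | a. True}"
  by (rule family_correct_flip(1)[OF family_3A, where K =
      "\<lambda>x t. - 1 / (x ^ 4 * t ^ 2)"]) (simp add: divide_simps, algebra?, auto)

lemma family_4B: "family_correct (\<lambda>x t. x^4 - 2 * t * x^3 + 2 * t^2 * x - t^3)
    {(a, a, 1/8, a) | a. True}"
  by (rule family_correct_flip(3)[OF family_4D, where K = "\<lambda>x t. 1 / t ^ 4"]) (simp add: divide_simps, algebra?, auto)

lemma family_4A: "family_correct (\<lambda>x t. x^4 - 2 * t * x^3 - 2 * x^3 + 6 * t * x^2 - 2 * t^2 * x - 2 * t * x
    + t^3 - t^2 + t)
    {(a, 1/8, a, a) | a. True}"
  by (rule family_correct_flip(2)[OF family_4B, where K = "\<lambda>x t. 1"]) (algebra, auto)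

lemma family_4C: "family_correct (\<lambda>x t. x^4 * (t^2 - t + 1) - 2 * x^3 * t * (t + 1) + 6 * t^2 * x^2
    - 2 * x * t^2 * (t + 1) + t^3)
    {(1/8, a, a, a) | a. True}"
  by (rule family_correct_flip(1)[OF family_4A, where K =
      "\<lambda>x t. 1 / (x ^ 4 * t ^ 3)"]) (simp add: divide_simps, algebra?, auto)

lemma family_5K: "family_correct (\<lambda>x t. x^3 - 3 * t * x + 2 * t)
    {(a, 4 * a, a, 1/18) | a. True}"
  by (rule family_correct_flip(1)[OF family_5L, where K =
      "\<lambda>x t. 1 / (x ^ 3 * t)"]) (simp add: divide_simps, algebra?, auto)

lemma family_5J: "family_correct (\<lambda>x t. x^3 - 3 * x^2 + 3 * t * x - t)
    {(a, a, 4 * a, 1/18) | a. True}"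
  by (rule family_correct_flip(2)[OF family_5K, where K = "\<lambda>x t. - 1"]) (algebra, auto)

lemma family_5F: "family_correct (\<lambda>x t. x^3 - 3 * t * x^2 + 3 * t * x - t^2)
    {(a, a, 1/18, 4 * a) | a. True}"
  by (rule family_correct_flip(3)[OF family_5J, where K = "\<lambda>x t. 1 / t ^ 3"]) (simp add: divide_simps, algebra?, auto)

lemma family_5C: "family_correct (\<lambda>x t. x^3 - 3 * t * x^2 + 3 * t * x + t^2 - 2 * t)
    {(a, 1/18, a, 4 * a) | a. True}"
  by (rule family_correct_flip(2)[OF family_5F, where K = "\<lambda>x t. - 1"]) (algebra, auto)

lemma family_5I: "family_correct (\<lambda>x t. (1 - 2 * t) * x^3 + 3 * t * x^2 - 3 * t * x + t^2)
    {(1/18, a, a, 4 * a) | a. True}"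
  by (rule family_correct_flip(1)[OF family_5C, where K =
      "\<lambda>x t. 1 / (x ^ 3 * t ^ 2)"]) (simp add: divide_simps, algebra?, auto)

lemma family_5E: "family_correct (\<lambda>x t. x^3 - 3 * t * x + 2 * t^2)
    {(a, 4 * a, 1/18, a) | a. True}"
  by (rule family_correct_flip(3)[OF family_5K, where K = "\<lambda>x t. 1 / t ^ 3"]) (simp add: divide_simps, algebra?, auto)

lemma family_5B: "family_correct (\<lambda>x t. x^3 - 3 * x^2 + 3 * t * x - 2 * t^2 + t)
    {(a, 1/18, 4 * a, a) | a. True}"
  by (rule family_correct_flip(2)[OF family_5E, where K = "\<lambda>x t. - 1"]) (algebra, auto)

lemma family_5G: "family_correct (\<lambda>x t. x^3 * (2 - t) - 3 * t * x^2 + 3 * t^2 * x - t^2)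
    {(1/18, a, 4 * a, a) | a. True}"
  by (rule family_correct_flip(1)[OF family_5B, where K =
      "\<lambda>x t. - 1 / (x ^ 3 * t ^ 2)"]) (simp add: divide_simps, algebra?, auto)

lemma family_5D: "family_correct (\<lambda>x t. 2 * x^3 - 3 * t * x^2 + t^2)
    {(4 * a, a, 1/18, a) | a. True}"
  by (rule family_correct_flip(3)[OF family_5L, where K = "\<lambda>x t. 1 / t ^ 3"]) (simp add: divide_simps, algebra?, auto)

lemma family_5A: "family_correct (\<lambda>x t. - 2 * x^3 + 3 * t * x^2 + 3 * x^2 - 6 * t * x + t^2 + t)
    {(4 * a, 1/18, a, a) | a. True}"
  by (rule family_correct_flip(2)[OF family_5D, where K = "\<lambda>x t. 1"]) (algebra, auto)

lemma family_5H: "family_correct (\<lambda>x t. x^3 * (t + 1) - 6 * t * x^2 + 3 * t * (t + 1) * x - 2 * t^2)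
    {(1/18, 4 * a, a, a) | a. True}"
  by (rule family_correct_flip(1)[OF family_5A, where K =
      "\<lambda>x t. 1 / (x ^ 3 * t ^ 2)"]) (simp add: divide_simps, algebra?, auto)

lemma PVI_family_correct: "PVI_family P S \<Longrightarrow> family_correct P S"
  by (induction rule: PVI_family.induct)
    (rule family_1A family_1B family_1C family_1D family_1E family_1F family_2A family_2B family_2C family_3A
        family_3B family_3C family_3D family_4A family_4B family_4C family_4D family_5A family_5B family_5C
            family_5D family_5E family_5F family_5G family_5H family_5I family_5J family_5K family_5L; assumption)+

section \<open>From germs to multivalued functions\<close>

lemma PVI_family_two_parameters:
  assumes "PVI_family P S"
  shows "\<exists>\<alpha>\<in>S. \<exists>\<beta>\<in>S. \<alpha> \<noteq> \<beta>"
proof -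
  have one: "\<exists>\<alpha>\<in>{F s | s. True}. \<exists>\<beta>\<in>{F s | s. True}. \<alpha> \<noteq> \<beta>" if "F 0 \<noteq> F 1" for F :: "complex \<Rightarrow> parameters"
    using that by blast
  have two: "\<exists>\<alpha>\<in>{F a b | a b. True}. \<exists>\<beta>\<in>{F a b | a b. True}. \<alpha> \<noteq> \<beta>" if "F 0 0 \<noteq> F 1 0"
    for F :: "complex \<Rightarrow> complex \<Rightarrow> parameters"
    using that by blast
  show ?thesis using assms
    by (induction rule: PVI_family.induct) (rule one, simp; fail | rule two, simp; fail)+
qed

lemma PVI_family_holomorphic:
  assumes "PVI_family P S" "f holomorphic_on U"
  shows "(\<lambda>t. P (f t) t) holomorphic_on U"
  using assms by (induction rule: PVI_family.induct) (intro holomorphic_intros; assumption)+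

lemma element_relation:
  assumes el: "is_function_element (f, U)"
    and q: "q holomorphic_on U" and V: "open V" "V \<noteq> {}" "V \<subseteq> U" "\<And>t. t \<in> V \<Longrightarrow> q t = 0"
    and t: "t \<in> U"
  shows "q t = (0 :: complex)"
proof -
  have "open U" "connected U" using el by (simp_all add: is_function_element_def)
  then show ?thesis
    using analytic_continuation_open[of V U q "\<lambda>_. 0" t] V q t by simp
qed

text \<open>
A direct continuation agrees with the previous element on a nonempty open set, so the identity theorem carries the
relation along every chain of continuations.
\<close>
lemma relation_propagates:
  assumes F: "analytic_function F" and el: "(f, U) \<in> F"
    and hol: "\<And>g W. g holomorphic_on W \<Longrightarrow> (\<lambda>t. R (g t) t) holomorphic_on W"
    and V: "open V" "V \<noteq> {}" "V \<subseteq> U" "\<And>t. t \<in> V \<Longrightarrow> R (f t) t = 0"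
  shows "satisfies_relation R F"
proof -
  have ele: "is_function_element d" if "d \<in> F" for d using F that by (simp add: analytic_function_def)
  define Q where "Q d \<longleftrightarrow> (\<forall>t\<in>snd d. R (fst d t) t = 0)" for d :: function_element
  have holR: "(\<lambda>t. R (g t) t) holomorphic_on W" if "(g, W) \<in> F" for g W
    using hol ele[OF that] by (simp add: is_function_element_def)
  have "Q d" if "d \<in> F" for d
  proof -
    have "((f, U), d) \<in> {(x, y). x \<in> F \<and> y \<in> F \<and> direct_continuation x y}\<^sup>*"
      using F el that unfolding analytic_function_def by blast
    then show ?thesis
    proof (induction rule: rtrancl_induct)
      case base
      show ?case
        unfolding Q_def using element_relation[OF ele[OF el] holR[OF el] V] by simp
    next
      case (step y z)
      obtain g W h X where yz: "y = (g, W)" "z = (h, X)" by fastforce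
      have s: "(g, W) \<in> F" "(h, X) \<in> F" "W \<inter> X \<noteq> {}" "\<And>t. t \<in> W \<inter> X \<Longrightarrow> g t = h t"
        using step.hyps(2) by (auto simp: yz direct_continuation_def)
      have o: "open (W \<inter> X)" using ele[OF s(1)] ele[OF s(2)] by (auto simp: is_function_element_def)
      have "R (h t) t = 0" if "t \<in> W \<inter> X" for t
        using step.IH s(4)[OF that] that by (metis Q_def yz(1) fst_conv snd_conv IntD1)
      then show ?case
        unfolding Q_def yz using element_relation[OF ele[OF s(2)] holR[OF s(2)] o s(3)] by simp
    qed
  qed
  then show ?thesis by (auto simp: satisfies_relation_def Q_def)
qed

text \<open>
Nonvanishing on a dense set. In contrast to the condition that a function is not identically zero, it is
inherited by smaller open sets and by products without any connectedness.
\<close>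
definition densely_nonzero :: "(complex \<Rightarrow> complex) \<Rightarrow> complex set \<Rightarrow> bool" where
  "densely_nonzero q U \<longleftrightarrow> (\<forall>V. open V \<longrightarrow> V \<noteq> {} \<longrightarrow> V \<subseteq> U \<longrightarrow> (\<exists>t\<in>V. q t \<noteq> 0))"

lemma densely_nonzero_mult:
  assumes U: "open U" and p: "continuous_on U p" and nz: "densely_nonzero p U" "densely_nonzero q U"
  shows "densely_nonzero (\<lambda>t. p t * q t) U"
  unfolding densely_nonzero_def
proof (intro allI impI)
  fix V assume V: "open V" "V \<noteq> {}" "V \<subseteq> U"
  define W where "W = V \<inter> p -` (- {0})"
  have "open W" unfolding W_def
    by (rule continuous_open_preimage[OF continuous_on_subset[OF p V(3)] V(1)]) auto
  moreover have "W \<noteq> {}" using nz(1) V unfolding densely_nonzero_def W_def by blast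
  moreover have "W \<subseteq> U" using V by (auto simp: W_def)
  ultimately obtain t where "t \<in> W" "q t \<noteq> 0" using nz(2) unfolding densely_nonzero_def by meson
  then show "\<exists>t\<in>V. p t * q t \<noteq> 0" by (auto simp: W_def)
qed

definition denominators :: "(complex \<Rightarrow> complex) \<Rightarrow> complex \<Rightarrow> complex" where
  "denominators f t = t * ((t - 1) * (f t * ((f t - 1) * (f t - t))))"

lemma continuous_denominators:
  assumes "f holomorphic_on U"
  shows "continuous_on U (denominators f)"
  unfolding denominators_def by (intro continuous_intros holomorphic_on_imp_continuous_on assms)

lemma germ_in_element:
  assumes el: "is_function_element (f, U)" and t: "t \<in> U" "denominators f t \<noteq> 0" and W: "open W" "t \<in> W"
  obtains V where "germ f V" "t \<in> V" "V \<subseteq> U" "V \<subseteq> W"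
proof -
  have U: "open U" "f holomorphic_on U" using el by (simp_all add: is_function_element_def)
  define X where "X = (U \<inter> denominators f -` (- {0})) \<inter> W"
  have "open X" unfolding X_def
    by (intro open_Int W(1) continuous_open_preimage[OF continuous_denominators[OF U(2)] U(1)]) auto
  moreover have "t \<in> X" using t W by (simp add: X_def)
  ultimately obtain e where e: "e > 0" "ball t e \<subseteq> X" unfolding open_contains_ball by blast
  have "germ f (ball t e)"
    unfolding germ_def
  proof (intro conjI ballI)
    show "f holomorphic_on ball t e" by (rule holomorphic_on_subset[OF U(2)]) (use e in \<open>auto simp: X_def\<close>)
    fix u assume "u \<in> ball t e"
    then have "denominators f u \<noteq> 0" using e by (auto simp: X_def)
    then show "u \<noteq> 0" "u \<noteq> 1" "f u \<noteq> 0" "f u \<noteq> 1" "f u \<noteq> u" by (auto simp: denominators_def)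
  qed (use e in auto)
  then show ?thesis using that[of "ball t e"] e by (auto simp: X_def)
qed

theorem theorem1:
  fixes \<Lambda> :: "function_element set"
  assumes "analytic_function \<Lambda>"
    and "\<not> identically \<Lambda> (\<lambda>t. 0)"
    and "\<not> identically \<Lambda> (\<lambda>t. 1)"
    and "\<not> identically \<Lambda> (\<lambda>t. t)"
    and "\<not> degenerate \<Lambda>"
  shows "((\<exists>\<alpha> \<in> PVI_parameters \<Lambda>. \<exists>\<beta> \<in> PVI_parameters \<Lambda>. \<alpha> \<noteq> \<beta>) \<longleftrightarrow>
            (\<exists>P S. PVI_family P S \<and> satisfies_relation P \<Lambda>)) \<and>
         (\<forall>P S. PVI_family P S \<and> satisfies_relation P \<Lambda> \<longrightarrow> PVI_parameters \<Lambda> = S)"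
proof -
  note F = assms(1)
  have ele: "is_function_element d" if "d \<in> \<Lambda>" for d using F that by (simp add: analytic_function_def)
  have nz: "densely_nonzero (\<lambda>t. f t - g t) U"
    if "(f, U) \<in> \<Lambda>" "\<not> identically \<Lambda> g" "g holomorphic_on UNIV" for f U g
    unfolding densely_nonzero_def
  proof (intro allI impI, rule ccontr)
    fix V assume V: "open V" "V \<noteq> {}" "V \<subseteq> U" "\<not> (\<exists>t\<in>V. f t - g t \<noteq> 0)"
    have "satisfies_relation (\<lambda>x t. x - g t) \<Lambda>"
    proof (rule relation_propagates[OF F that(1) _ V(1-3)])
      show "(\<lambda>t. h t - g t) holomorphic_on W" if "h holomorphic_on W" for h :: "complex \<Rightarrow> complex" and W
        using that \<open>g holomorphic_on UNIV\<close> by (intro holomorphic_intros) (auto intro: holomorphic_on_subset)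
    qed (use V(4) in auto)
    then show False using that(2) by (simp add: satisfies_relation_def identically_def)
  qed
  have regular: "densely_nonzero (denominators f) U" if el: "(f, U) \<in> \<Lambda>" for f U
  proof -
    have U: "open U" "f holomorphic_on U" using ele[OF el] by (simp_all add: is_function_element_def)
    have c: "continuous_on U f" by (rule holomorphic_on_imp_continuous_on[OF U(2)])
    have pt: "densely_nonzero (\<lambda>t. t - a) U" for a
      unfolding densely_nonzero_def
    proof (intro allI impI, rule ccontr)
      fix V assume V: "open V" "V \<noteq> {}" "\<not> (\<exists>t\<in>V. t - a \<noteq> 0)"
      then have "V = {a}" by auto
      then show False using V(1) not_open_singleton[of a] by simp
    qed
    show ?thesis
      unfolding denominators_def[abs_def]
      using pt[of 0] pt[of 1] nz[OF el assms(2)] nz[OF el assms(3)] nz[OF el assms(4)]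
      by (intro densely_nonzero_mult U continuous_intros c) simp_all
  qed
  have germs: "\<exists>V. germ f V \<and> V \<subseteq> U" if el: "(f, U) \<in> \<Lambda>" for f U
  proof -
    have "open U" "U \<noteq> {}" using ele[OF el] by (simp_all add: is_function_element_def)
    then obtain t where "t \<in> U" "denominators f t \<noteq> 0" using regular[OF el] unfolding densely_nonzero_def by blast
    then show ?thesis by (metis germ_in_element[OF ele[OF el] _ _ \<open>open U\<close>])
  qed
  have nd: "\<not> degenerate_germ f V" if el: "(f, U) \<in> \<Lambda>" and V: "germ f V" "V \<subseteq> U" for f U V
  proof
    have Vo: "open V" "V \<noteq> {}" using V(1) by (simp_all add: germ_def)
    note extend = relation_propagates[OF F el _ Vo V(2)]
    assume "degenerate_germ f V"
    then obtain c where "(\<forall>t\<in>V. f t = c) \<or> (\<forall>t\<in>V. f t = c * t) \<or> (\<forall>t\<in>V. f t - 1 = c * (t - 1)) \<or>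
        (\<forall>t\<in>V. (f t - 1) * t = c * f t * (t - 1))"
      unfolding degenerate_germ_def ..
    then have "satisfies_relation (\<lambda>x t. x - c) \<Lambda> \<or> satisfies_relation (\<lambda>x t. x - c * t) \<Lambda> \<or>
        satisfies_relation (\<lambda>x t. (x - 1) - c * (t - 1)) \<Lambda>
            \<or> satisfies_relation (\<lambda>x t. (x - 1) * t - c * x * (t - 1)) \<Lambda>"
    proof (elim disjE)
      assume "\<forall>t\<in>V. f t = c"
      then have "satisfies_relation (\<lambda>x t. x - c) \<Lambda>" by (intro extend holomorphic_intros) auto
      then show ?thesis by blast
    next
      assume "\<forall>t\<in>V. f t = c * t"
      then have "satisfies_relation (\<lambda>x t. x - c * t) \<Lambda>" by (intro extend holomorphic_intros) auto
      then show ?thesis by blast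
    next
      assume "\<forall>t\<in>V. f t - 1 = c * (t - 1)"
      then have "satisfies_relation (\<lambda>x t. (x - 1) - c * (t - 1)) \<Lambda>" by (intro extend holomorphic_intros) auto
      then show ?thesis by blast
    next
      assume "\<forall>t\<in>V. (f t - 1) * t = c * f t * (t - 1)"
      then have "satisfies_relation (\<lambda>x t. (x - 1) * t - c * x * (t - 1)) \<Lambda>" by (intro extend holomorphic_intros) auto
      then show ?thesis by blast
    qed
    then show False using assms(5) unfolding degenerate_def by blast
  qed
  have sol: "solves \<alpha> f V" if "\<alpha> \<in> PVI_parameters \<Lambda>" "(f, U) \<in> \<Lambda>" "germ f V" "V \<subseteq> U" for \<alpha> f U V
    using that unfolding solves_def PVI_parameters_def PVI_solution_def germ_def by blast
  have fwd: "\<exists>P S. PVI_family P S \<and> satisfies_relation P \<Lambda>"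
    if \<alpha>\<beta>: "\<alpha> \<in> PVI_parameters \<Lambda>" "\<beta> \<in> PVI_parameters \<Lambda>" "\<alpha> \<noteq> \<beta>" for \<alpha> \<beta>
  proof -
    obtain f U where el: "(f, U) \<in> \<Lambda>" using F by (auto simp: analytic_function_def)
    obtain V where V: "germ f V" "V \<subseteq> U" using germs[OF el] by blast
    have "family_relation f V"
      by (rule two_solutions_family[OF V(1) nd[OF el V] sol[OF \<alpha>\<beta>(1) el V] sol[OF \<alpha>\<beta>(2) el V] \<alpha>\<beta>(3)])
    then obtain P S where P: "PVI_family P S" "\<forall>t\<in>V. P (f t) t = 0" unfolding family_relation_def by blast
    have Vo: "open V" "V \<noteq> {}" using V by (auto simp: germ_def)
    have "satisfies_relation P \<Lambda>"
    proof (rule relation_propagates[OF F el _ Vo V(2)])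
      show "(\<lambda>t. P (g t) t) holomorphic_on W" if "g holomorphic_on W" for g W
        by (rule PVI_family_holomorphic[OF P(1) that])
    qed (use P(2) in blast)
    then show ?thesis using P(1) by blast
  qed
  have params: "PVI_parameters \<Lambda> = S" if P: "PVI_family P S" "satisfies_relation P \<Lambda>" for P S
  proof
    have fc: "{\<alpha>. solves \<alpha> f V} = S" if "(f, U) \<in> \<Lambda>" "germ f V" "V \<subseteq> U" for f U V
    proof -
      have "\<forall>t\<in>V. P (f t) t = 0" using P(2) that unfolding satisfies_relation_def by blast
      then show ?thesis using PVI_family_correct[OF P(1)] that(2) unfolding family_correct_def by blast
    qed
    show "PVI_parameters \<Lambda> \<subseteq> S"
    proof
      fix \<alpha> assume \<alpha>: "\<alpha> \<in> PVI_parameters \<Lambda>"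
      obtain f U where el: "(f, U) \<in> \<Lambda>" using F by (auto simp: analytic_function_def)
      obtain V where V: "germ f V" "V \<subseteq> U" using germs[OF el] by blast
      show "\<alpha> \<in> S" using fc[OF el V] sol[OF \<alpha> el V] by blast
    qed
    show "S \<subseteq> PVI_parameters \<Lambda>"
    proof
      fix \<alpha> assume \<alpha>: "\<alpha> \<in> S"
      have "deriv (deriv f) t = PVI_rhs \<alpha> t (f t) (deriv f t)"
        if el: "(f, U) \<in> \<Lambda>" and t: "t \<in> U" "t \<noteq> 0" "t \<noteq> 1" "f t \<noteq> 0" "f t \<noteq> 1" "f t \<noteq> t" for f U t
      proof -
        have "denominators f t \<noteq> 0" using t by (simp add: denominators_def)
        then obtain V where V: "germ f V" "t \<in> V" "V \<subseteq> U"
          using germ_in_element[OF ele[OF el] t(1) _ open_UNIV] by blast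
        have "solves \<alpha> f V" using fc[OF el V(1,3)] \<alpha> by blast
        then show ?thesis using V(2) unfolding solves_def by blast
      qed
      then show "\<alpha> \<in> PVI_parameters \<Lambda>"
        using assms(2-4) by (auto simp: PVI_parameters_def PVI_solution_def)
    qed
  qed
  show ?thesis
  proof (intro conjI iffI allI impI)
    assume "\<exists>\<alpha>\<in>PVI_parameters \<Lambda>. \<exists>\<beta>\<in>PVI_parameters \<Lambda>. \<alpha> \<noteq> \<beta>"
    then show "\<exists>P S. PVI_family P S \<and> satisfies_relation P \<Lambda>" using fwd by blast
  next
    assume "\<exists>P S. PVI_family P S \<and> satisfies_relation P \<Lambda>"
    then obtain P S where P: "PVI_family P S" "satisfies_relation P \<Lambda>" by blast
    show "\<exists>\<alpha>\<in>PVI_parameters \<Lambda>. \<exists>\<beta>\<in>PVI_parameters \<Lambda>. \<alpha> \<noteq> \<beta>"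
      using PVI_family_two_parameters[OF P(1)] unfolding params[OF P] .
  next
    fix P S assume "PVI_family P S \<and> satisfies_relation P \<Lambda>"
    then show "PVI_parameters \<Lambda> = S" using params by blast
  qed
qed

end
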